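(* Let $\mu,\nu\ge 0$ and $\alpha>0$ be real, let $\vartheta=\alpha-\mu-\nu$ be non-integer, and let $a>b>0$. Then, for $0<a+b\le 2\pi$, one has the convergent expansion $$S_{\mu,\nu}(a,b)=\hat F(1)+\frac{1}{\Gamma(1+\nu)}\sum_{m=0}^\infty B_m\left(\tfrac12 a\right)^{2m},$$ where $$\hat F(1)=\frac{(\frac12 a)^{\vartheta-1}\,\Gamma(\frac12\mu+\frac12\nu+\frac12-\frac12\alpha)}{2\,\Gamma(1+\nu)\,\Gamma(\frac12\mu-\frac12\nu+\frac12\alpha+\frac12)}\;{}_2F_1\left(\frac{\mu+\nu+1-\alpha}{2},\frac{\nu-\mu+1-\alpha}{2};1+\nu;\frac{b^2}{a^2}\right)$$ and $$B_m=\frac{(-1)^m\,\zeta(\vartheta-2m)}{m!\,\Gamma(1+\mu+m)}\;{}_2F_1\left(-m,-m-\mu;1+\nu;\frac{b^2}{a^2}\right).$$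
   Context: $J_\nu$ is the Bessel function of the first kind, $\zeta$ is the (analytically continued) Riemann zeta function, ${}_2F_1(A,B;C;z)$ is the Gauss hypergeometric function, and $1/\Gamma$ is understood to be $0$ at the poles of $\Gamma$. For $a,b>0$, $$S_{\mu,\nu}(a,b)=\frac{2^{\mu+\nu}}{a^\mu b^\nu}\sum_{n=1}^\infty\frac{J_\mu(na)\,J_\nu(nb)}{n^{\alpha}}.$$ *)

theory Defs
  imports "HOL-Complex_Analysis.Complex_Analysis"
begin

text \<open>
  The reciprocal of the Gamma function is \<^const>\<open>rGamma\<close> throughout: unlike
  \<^const>\<open>Gamma\<close> it has no poles, and it vanishes at the non-positive integers.
\<close>

text \<open>
  Bessel function of the first kind, of real order and for argument \<open>x > 0\<close>. (At \<open>x = 0\<close> and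
  \<open>\<nu> = 0\<close> the formula gives \<open>0\<close> instead of \<open>1\<close>, since \<open>0 powr 0 = 0\<close>.)
\<close>

definition bessel_J :: "real \<Rightarrow> real \<Rightarrow> real" where
  "bessel_J \<nu> x = (x / 2) powr \<nu> *
     (\<Sum>k. (-1) ^ k * rGamma (\<nu> + real k + 1) / fact k * (x / 2) ^ (2 * k))"

text \<open>
  Gauss hypergeometric function as a power series; it represents \<open>\<^sub>2F\<^sub>1(A, B; C; z)\<close> for
  \<open>\<bar>z\<bar> < 1\<close>, provided that \<open>C\<close> is not a non-positive integer. If \<open>A\<close> or \<open>B\<close> is a
  non-positive integer, the series terminates.
\<close>

definition hyp2F1 :: "real \<Rightarrow> real \<Rightarrow> real \<Rightarrow> real \<Rightarrow> real" where
  "hyp2F1 A B C z = eval_fps (fps_hypergeo [A, B] [C] 1) z"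

lemma hyp2F1_altdef:
  "hyp2F1 A B C z =
     (\<Sum>n. pochhammer A n * pochhammer B n / (pochhammer C n * fact n) * z ^ n)"
  by (simp add: hyp2F1_def eval_fps_def)

text \<open>
  The analytic continuation to \<open>\<complex> - {1}\<close> of the Dirichlet series, unique by the identity theorem.
  The value at the pole is fixed as \<open>0\<close>, only to make the description definite.
\<close>

definition riemann_zeta :: "complex \<Rightarrow> complex" where
  "riemann_zeta = (THE f. f holomorphic_on (- {1}) \<and>
     (\<forall>s. Re s > 1 \<longrightarrow> (\<lambda>n. of_nat (Suc n) powr (- s)) sums f s) \<and> f 1 = 0)"

text \<open>In the summand below, the index \<open>n\<close> corresponds to the term \<open>n + 1\<close> of the series.\<close>

definition schloemilch_term :: "real \<Rightarrow> real \<Rightarrow> real \<Rightarrow> real \<Rightarrow> real \<Rightarrow> nat \<Rightarrow> real" where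
  "schloemilch_term \<alpha> \<mu> \<nu> a b n =
     bessel_J \<mu> (real (Suc n) * a) * bessel_J \<nu> (real (Suc n) * b) / real (Suc n) powr \<alpha>"

definition schloemilch_sum :: "real \<Rightarrow> real \<Rightarrow> real \<Rightarrow> real \<Rightarrow> real \<Rightarrow> real" where
  "schloemilch_sum \<alpha> \<mu> \<nu> a b =
     2 powr (\<mu> + \<nu>) / (a powr \<mu> * b powr \<nu>) * (\<Sum>n. schloemilch_term \<alpha> \<mu> \<nu> a b n)"

definition F_hat_1 :: "real \<Rightarrow> real \<Rightarrow> real \<Rightarrow> real \<Rightarrow> real \<Rightarrow> real" where
  "F_hat_1 \<alpha> \<mu> \<nu> a b =
     (a / 2) powr ((\<alpha> - \<mu> - \<nu>) - 1) * Gamma (\<mu> / 2 + \<nu> / 2 + 1 / 2 - \<alpha> / 2) / 2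
       * rGamma (1 + \<nu>) * rGamma (\<mu> / 2 - \<nu> / 2 + \<alpha> / 2 + 1 / 2)
       * hyp2F1 ((\<mu> + \<nu> + 1 - \<alpha>) / 2) ((\<nu> - \<mu> + 1 - \<alpha>) / 2) (1 + \<nu>) (b\<^sup>2 / a\<^sup>2)"

definition B_coeff :: "real \<Rightarrow> real \<Rightarrow> real \<Rightarrow> real \<Rightarrow> real \<Rightarrow> nat \<Rightarrow> complex" where
  "B_coeff \<alpha> \<mu> \<nu> a b m =
     (-1) ^ m * riemann_zeta (of_real ((\<alpha> - \<mu> - \<nu>) - 2 * real m)) / fact m
       * of_real (rGamma (1 + \<mu> + real m))
       * of_real (hyp2F1 (- real m) (- real m - \<mu>) (1 + \<nu>) (b\<^sup>2 / a\<^sup>2))"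

end

theory Submission
  imports Defs
begin

text \<open>
  Dividing \<open>J\<^sub>\<mu> (n a) J\<^sub>\<nu> (n b)\<close> by the powers of \<open>n a / 2\<close> and \<open>n b / 2\<close> leaves an even entire function
  \<open>G (n)\<close>, so that the series is \<open>\<Sum> n\<^sup>-\<^sup>\<theta> G (n)\<close> with \<open>\<theta> = \<alpha> - \<mu> - \<nu>\<close>. Let \<open>G (x) = \<Sum> c m x^(2 m)\<close>.
  Inserting this power series and interchanging the sums formally gives \<open>\<Sum> c m \<zeta> (\<theta> - 2 m)\<close>, which is the
  zeta series of the theorem, since \<open>c m\<close> is a terminating hypergeometric sum
  (\<open>product_coeff_hyp2F1\<close>). The interchange is not legitimate, and the term \<open>F_hat_1\<close> is what it misses.

  To make it legitimate, consider \<open>F (p) = \<Sum> n\<^sup>-\<^sup>\<theta> G (n) exp (- n p)\<close>, which tends to the original sum as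
  \<open>p\<close> decreases to 0. For real \<open>p > a + b\<close> everything converges absolutely, because \<open>G\<close> has exponential
  type \<open>a + b\<close>, and \<open>F (p) = \<Sum> c m E (\<theta> - 2 m, p)\<close> with \<open>E (s, p) = \<Sum> n\<^sup>-\<^sup>s exp (- n p)\<close>. Now
  \<open>E (s, p) = \<Gamma> (1 - s) p^(s - 1) + R (s, p)\<close>, where \<open>R (s, p)\<close> is holomorphic in the strip
  \<open>\<bar>Im p\<bar> < 2 \<pi>\<close> with \<open>R (s, 0) = \<zeta> (s)\<close> and \<open>R (s - k, p) = (-1)^k (d/dp)^k R (s, p)\<close>
  (\<open>polylog_extension_exists\<close>). Accordingly \<open>F = A + B\<close>, with two parts continued to \<open>p = 0\<close> separately:

  \<^item> \<open>B = \<Sum> c m (d/dp)^(2 m) R (\<theta>, p)\<close>. The coefficients \<open>c m\<close> are of the size \<open>(a + b)^(2 m) / (2 m)!\<close>, and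
    the singularities of \<open>R\<close> nearest to \<open>0\<close> lie at distance \<open>2 \<pi>\<close>. By Cauchy's inequality the series converges
    near \<open>0\<close> if \<open>a + b < 2 \<pi>\<close>. Its value there is the zeta series.

  \<^item> \<open>A = \<Sum> c m \<Gamma> (1 - \<theta> + 2 m) p^(\<theta> - 1 - 2 m)\<close>, formally the Laplace transform of \<open>x\<^sup>-\<^sup>\<theta> G (x)\<close>. Expanding
    only the factor of \<open>G\<close> that belongs to \<open>J\<^sub>\<nu>\<close> turns it into a series of derivatives of the Laplace
    transform belonging to \<open>J\<^sub>\<mu>\<close> alone. Those coefficients are of the size \<open>b^(2 k) / (2 k)!\<close>, the
    singularities of the transform are \<open>\<plusminus> \<i> a\<close> (\<open>laplace_extension_exists\<close>), and \<open>b < a\<close> yields convergence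
    near \<open>0\<close>. The derivatives at \<open>0\<close> are Mellin transforms of \<open>J\<^sub>\<mu>\<close>, and the sum is the hypergeometric
    series \<open>F_hat_1\<close> (\<open>bessel_mellin_sum\<close>).

  The identity \<open>F = A + B\<close> persists down to \<open>p = 0\<close> by the identity theorem (\<open>interior_identity\<close>).

  For \<open>a + b = 2 \<pi>\<close>, replace \<open>(a, b)\<close> by \<open>(t a, t b)\<close> and let \<open>t\<close> increase to 1. All three
  parts are continuous in \<open>t\<close>: the summands on the left are \<open>O (n\<^sup>-\<^sup>\<alpha>\<^sup>-\<^sup>1)\<close> because \<open>J\<^sub>\<mu> (x) = O (x^(- 1 / 2))\<close>,
  and those of the zeta series are \<open>O (m\<^sup>-\<^sup>\<alpha>\<^sup>-\<^sup>1)\<close> by sharp bounds on \<open>c m\<close> and \<open>\<zeta> (\<theta> - 2 m)\<close>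
  (\<open>product_coeff_bound\<close>, \<open>riemann_zeta_bound\<close>).
\<close>

section \<open>Parameter integrals and differential operators of infinite order\<close>

lemma power_series_higher_deriv:
  fixes a :: "nat \<Rightarrow> complex"
  assumes "r > 0" and sums: "\<And>w. w \<in> ball z r \<Longrightarrow> (\<lambda>n. a n * (w - z) ^ n) sums f w"
  shows "f holomorphic_on ball z r" and "(deriv ^^ n) f z = fact n * a n"
proof -
  show "f holomorphic_on ball z r"
    using sums by (rule power_series_holomorphic)
  have rad: "fps_conv_radius (Abs_fps a) \<ge> r"
    unfolding fps_conv_radius_def
  proof (rule conv_radius_geI_ex')
    fix r' assume "0 < r'" "ereal r' < r"
    then have "z + of_real r' \<in> ball z r" by (simp add: dist_norm)
    from sums[OF this] show "summable (\<lambda>n. fps_nth (Abs_fps a) n * of_real r' ^ n)"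
      by (simp add: sums_iff)
  qed
  have "eventually (\<lambda>x. f (z + x) = eval_fps (Abs_fps a) x) (nhds 0)"
  proof (rule eventually_mono)
    show "\<forall>\<^sub>F x in nhds 0. x \<in> ball (0::complex) r"
      using \<open>r > 0\<close> by (intro eventually_nhds_in_open) auto
    show "f (z + x) = eval_fps (Abs_fps a) x" if "x \<in> ball 0 r" for x
      using sums[of "z + x"] that by (simp add: eval_fps_def sums_iff dist_norm)
  qed
  then have "(deriv ^^ n) (f \<circ> (\<lambda>x. z + x)) 0 = (deriv ^^ n) (eval_fps (Abs_fps a)) 0"
    by (intro higher_deriv_cong_ev) (auto simp: o_def)
  moreover have "0 < fps_conv_radius (Abs_fps a)"
    using rad \<open>r > 0\<close> by (auto intro: less_le_trans[of 0 "ereal r"])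
  then have "fps_nth (Abs_fps a) n = (deriv ^^ n) (eval_fps (Abs_fps a)) 0 / fact n"
    by (rule fps_nth_conv_deriv)
  ultimately show "(deriv ^^ n) f z = fact n * a n"
    by (simp add: higher_deriv_shift_0[of n f z] field_simps)
qed

text \<open>
  A derivative in the parameter is a limit of difference quotients along a fixed sequence of increments, and
  measurability passes to sequential limits. Induction gives all orders.
\<close>

lemma borel_measurable_higher_deriv_param:
  fixes f :: "'a \<Rightarrow> complex \<Rightarrow> complex"
  assumes "open S" and hol: "\<And>x. x \<in> space M \<Longrightarrow> f x holomorphic_on S"
    and meas: "\<And>p. p \<in> S \<Longrightarrow> (\<lambda>x. f x p) \<in> borel_measurable M"
    and "p \<in> S"
  shows "(\<lambda>x. (deriv ^^ n) (f x) p) \<in> borel_measurable M"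
  using \<open>p \<in> S\<close>
proof (induction n arbitrary: p)
  case (Suc n)
  obtain e where e: "e > 0" "ball p e \<subseteq> S"
    using \<open>open S\<close> Suc.prems open_contains_ball by blast
  define h where "h = (\<lambda>k::nat. complex_of_real (e / (2 + real k)))"
  have h: "p + h k \<in> S" "h k \<noteq> 0" for k
  proof -
    have "e / (2 + real k) < e" using \<open>e > 0\<close> by (simp add: field_simps add_pos_nonneg)
    moreover have nh: "norm (h k) = e / (2 + real k)"
      unfolding h_def norm_of_real using \<open>e > 0\<close> by simp
    ultimately have "p + h k \<in> ball p e" by (simp add: dist_norm)
    then show "p + h k \<in> S" using e by blast
    have "norm (h k) > 0" unfolding nh using \<open>e > 0\<close> by simp
    then show "h k \<noteq> 0" by simp
  qed
  have h0: "h \<longlonglongrightarrow> 0"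
  proof -
    have "(\<lambda>k. e / (2 + real k)) \<longlonglongrightarrow> 0" by real_asymp
    then have "(\<lambda>k. complex_of_real (e / (2 + real k))) \<longlonglongrightarrow> of_real 0"
      by (rule tendsto_of_real)
    then show ?thesis by (simp add: h_def)
  qed
  show ?case
  proof (rule borel_measurable_LIMSEQ_metric)
    show "(\<lambda>x. ((deriv ^^ n) (f x) (p + h k) - (deriv ^^ n) (f x) p) / h k) \<in> borel_measurable M" for k
      using Suc.IH[OF h(1), of k] Suc.IH[OF Suc.prems] by measurable
    fix x assume "x \<in> space M"
    have "((deriv ^^ n) (f x)) holomorphic_on S"
      using hol[OF \<open>x \<in> space M\<close>] \<open>open S\<close> by (rule holomorphic_higher_deriv)
    then have "((deriv ^^ n) (f x) has_field_derivative deriv ((deriv ^^ n) (f x)) p) (at p)"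
      using \<open>open S\<close> Suc.prems by (rule holomorphic_derivI)
    then have "((\<lambda>d. ((deriv ^^ n) (f x) (p + d) - (deriv ^^ n) (f x) p) / d) \<longlongrightarrow>
        deriv ((deriv ^^ n) (f x)) p) (at 0)"
      by (simp add: DERIV_def)
    moreover have "filterlim h (at 0) sequentially"
      using h0 h(2) by (simp add: filterlim_at eventually_sequentially)
    ultimately show "(\<lambda>k. ((deriv ^^ n) (f x) (p + h k) - (deriv ^^ n) (f x) p) / h k)
        \<longlonglongrightarrow> (deriv ^^ Suc n) (f x) p"
      by (auto intro: filterlim_compose)
  qed
qed (use meas in simp)

lemma Cauchy_bound_ball:
  assumes hol: "f holomorphic_on ball z r" and "0 < r'" "r' < r"
    and B: "\<And>w. w \<in> ball z r \<Longrightarrow> norm (f w) \<le> B"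
  shows "norm ((deriv ^^ n) f z) \<le> fact n * B / r' ^ n"
proof (rule Cauchy_inequality)
  show "f holomorphic_on ball z r'"
    using hol by (rule holomorphic_on_subset) (use assms in auto)
  show "continuous_on (cball z r') f"
    using holomorphic_on_imp_continuous_on[OF hol] by (rule continuous_on_subset) (use assms in auto)
  show "norm (f w) \<le> B" if "norm (z - w) = r'" for w
    using that assms by (intro B) (auto simp: dist_norm)
qed fact

text \<open>
  Cauchy's estimate bounds the \<open>n\<close>-th Taylor coefficient of the integrand at \<open>p0\<close> by \<open>g x\<close> times a
  geometric sequence independent of \<open>x\<close>. Hence the Taylor series may be integrated term by term,
  and the integral is given by a power series in \<open>p\<close>.
\<close>

theorem holomorphic_param_integral:
  fixes f :: "'a \<Rightarrow> complex \<Rightarrow> complex"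
  assumes r: "r > 0"
    and meas: "\<And>p. p \<in> ball p0 r \<Longrightarrow> (\<lambda>x. f x p) \<in> borel_measurable M"
    and hol: "\<And>x. x \<in> space M \<Longrightarrow> f x holomorphic_on ball p0 r"
    and bound: "\<And>x p. x \<in> space M \<Longrightarrow> p \<in> ball p0 r \<Longrightarrow> norm (f x p) \<le> g x"
    and g: "integrable M g"
  shows "(\<lambda>p. \<integral>x. f x p \<partial>M) holomorphic_on ball p0 r" (is ?th1)
    and "(deriv ^^ n) (\<lambda>p. \<integral>x. f x p \<partial>M) p0 = (\<integral>x. (deriv ^^ n) (f x) p0 \<partial>M)" (is ?th2)
    and "integrable M (\<lambda>x. (deriv ^^ n) (f x) p0)" (is ?th3)
proof -
  have int: "integrable M (\<lambda>x. (deriv ^^ n) (f x) p0)" for n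
  proof (rule Bochner_Integration.integrable_bound)
    show "integrable M (\<lambda>x. fact n / (r / 2) ^ n * g x)"
      using g by simp
    show "(\<lambda>x. (deriv ^^ n) (f x) p0) \<in> borel_measurable M"
      by (rule borel_measurable_higher_deriv_param[OF open_ball hol meas]) (use r in auto)
    show "AE x in M. norm ((deriv ^^ n) (f x) p0) \<le> norm (fact n / (r / 2) ^ n * g x)"
    proof (rule AE_I2)
      fix x assume x: "x \<in> space M"
      have "norm ((deriv ^^ n) (f x) p0) \<le> fact n * g x / (r / 2) ^ n"
        by (rule Cauchy_bound_ball[OF hol[OF x]]) (use r bound[OF x] in auto)
      also have "\<dots> \<le> norm (fact n / (r / 2) ^ n * g x)"
        using r by (simp add: abs_mult divide_right_mono)
      finally show "norm ((deriv ^^ n) (f x) p0) \<le> norm (fact n / (r / 2) ^ n * g x)" .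
    qed
  qed
  have sums: "(\<lambda>n. (\<integral>x. (deriv ^^ n) (f x) p0 \<partial>M) / fact n * (p - p0) ^ n) sums (\<integral>x. f x p \<partial>M)"
    if p: "p \<in> ball p0 r" for p
  proof -
    define r' where "r' = (norm (p - p0) + r) / 2"
    have r': "0 < r'" "r' < r" "norm (p - p0) < r'"
      using p r by (auto simp: r'_def dist_norm norm_minus_commute add_nonneg_pos)
    define q where "q = norm (p - p0) / r'"
    have q: "0 \<le> q" "q < 1" using r' by (auto simp: q_def)
    have le: "norm ((deriv ^^ n) (f x) p0 / fact n * (p - p0) ^ n) \<le> g x * q ^ n"
      if x: "x \<in> space M" for x n
    proof -
      have "norm ((deriv ^^ n) (f x) p0) \<le> fact n * g x / r' ^ n"
        by (rule Cauchy_bound_ball[OF hol[OF x]]) (use r' bound[OF x] in auto)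
      then have "norm ((deriv ^^ n) (f x) p0) / fact n * norm (p - p0) ^ n \<le> g x / r' ^ n * norm (p - p0) ^ n"
        by (intro mult_right_mono) (auto simp: field_simps)
      then show ?thesis by (simp add: q_def norm_mult norm_divide norm_power power_divide)
    qed
    have g0: "g x \<ge> 0" if "x \<in> space M" for x
      using bound[OF that, of p0] r by (meson centre_in_ball norm_ge_zero order_trans)
    have "(\<lambda>n. \<integral>x. (deriv ^^ n) (f x) p0 / fact n * (p - p0) ^ n \<partial>M) sums
        (\<integral>x. (\<Sum>n. (deriv ^^ n) (f x) p0 / fact n * (p - p0) ^ n) \<partial>M)"
    proof (rule sums_integral)
      show "integrable M (\<lambda>x. (deriv ^^ n) (f x) p0 / fact n * (p - p0) ^ n)" for n
        using int by simp
      show "AE x in M. summable (\<lambda>n. norm ((deriv ^^ n) (f x) p0 / fact n * (p - p0) ^ n))"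
      proof (rule AE_I2)
        fix x assume "x \<in> space M"
        show "summable (\<lambda>n. norm ((deriv ^^ n) (f x) p0 / fact n * (p - p0) ^ n))"
          by (rule summable_comparison_test'[where g = "\<lambda>n. g x * q ^ n" and N = 0])
            (use le[OF \<open>x \<in> space M\<close>] q in \<open>auto intro!: summable_mult summable_geometric\<close>)
      qed
      show "summable (\<lambda>n. \<integral>x. norm ((deriv ^^ n) (f x) p0 / fact n * (p - p0) ^ n) \<partial>M)"
      proof (rule summable_comparison_test'[where N = 0])
        show "summable (\<lambda>n. (\<integral>x. g x \<partial>M) * q ^ n)"
          using q by (auto intro!: summable_mult summable_geometric)
        fix n
        have "(\<integral>x. norm ((deriv ^^ n) (f x) p0 / fact n * (p - p0) ^ n) \<partial>M) \<le> (\<integral>x. g x * q ^ n \<partial>M)"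
          using int g le by (intro integral_mono) auto
        then show "norm (\<integral>x. norm ((deriv ^^ n) (f x) p0 / fact n * (p - p0) ^ n) \<partial>M)
            \<le> (\<integral>x. g x \<partial>M) * q ^ n"
          by simp
      qed
    qed
    also have "(\<integral>x. (\<Sum>n. (deriv ^^ n) (f x) p0 / fact n * (p - p0) ^ n) \<partial>M) = (\<integral>x. f x p \<partial>M)"
    proof (rule Bochner_Integration.integral_cong[OF refl])
      fix x assume "x \<in> space M"
      from holomorphic_power_series[OF hol[OF this] p]
      show "(\<Sum>n. (deriv ^^ n) (f x) p0 / fact n * (p - p0) ^ n) = f x p"
        by (simp add: sums_iff)
    qed
    finally show ?thesis by simp
  qed
  show ?th1 using power_series_higher_deriv(1)[OF r sums] by simp
  show ?th2 using power_series_higher_deriv(2)[OF r sums] by simp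
  show ?th3 by (rule int)
qed

text \<open>
  The series is a differential operator of infinite order, with coefficients of exponential type \<open>\<rho>\<close>,
  applied to \<open>g\<close>. Cauchy's inequality on circles with a radius \<open>\<sigma>\<close> between \<open>\<rho>\<close> and \<open>\<rho>'\<close> bounds the \<open>m\<close>-th term
  by a constant times \<open>(\<rho> / \<sigma>)^(2 m)\<close>. So the operator acts at every point whose distance to the
  singularities of \<open>g\<close> exceeds the type. It is through this lemma that \<open>b < a\<close> and \<open>a + b < 2 \<pi>\<close> enter.
\<close>

theorem holomorphic_sum_derivs:
  fixes c :: "nat \<Rightarrow> complex"
  assumes hol: "g holomorphic_on D" and "open D" and "open U"
    and "0 \<le> \<rho>" "\<rho> < \<rho>'" and sub: "\<And>p. p \<in> U \<Longrightarrow> cball p \<rho>' \<subseteq> D"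
    and c: "\<And>m. norm (c m) \<le> C * \<rho> ^ (2 * m) / fact (2 * m)"
  shows "(\<lambda>p. \<Sum>m. c m * (deriv ^^ (2 * m)) g p) holomorphic_on U"
    and "p \<in> U \<Longrightarrow> summable (\<lambda>m. c m * (deriv ^^ (2 * m)) g p)"
proof -
  define \<sigma> where "\<sigma> = (\<rho> + \<rho>') / 2"
  define \<epsilon> where "\<epsilon> = (\<rho>' - \<rho>) / 2"
  have \<epsilon>: "\<epsilon> > 0" "\<rho> < \<sigma>" "0 < \<sigma>" using assms by (auto simp: \<sigma>_def \<epsilon>_def)
  have C: "C \<ge> 0" using order_trans[OF norm_ge_zero c[of 0]] by simp
  have holU: "(deriv ^^ n) g holomorphic_on U" for n
  proof (rule holomorphic_on_subset[OF holomorphic_higher_deriv[OF hol \<open>open D\<close>]])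
    show "U \<subseteq> D" using sub assms by force
  qed
  have ex: "\<exists>q M. (0::real) \<le> q \<and> q < 1 \<and>
      (\<forall>p\<in>cball p0 \<epsilon>. \<forall>m. norm (c m * (deriv ^^ (2 * m)) g p) \<le> M * q ^ m)" if "p0 \<in> U" for p0
  proof -
    have "continuous_on (cball p0 \<rho>') g"
      using holomorphic_on_imp_continuous_on[OF hol] sub[OF that] by (rule continuous_on_subset)
    then have "bounded (g ` cball p0 \<rho>')"
      by (intro compact_imp_bounded compact_continuous_image) auto
    then obtain B where B: "\<And>w. w \<in> cball p0 \<rho>' \<Longrightarrow> norm (g w) \<le> B"
      unfolding bounded_iff by (metis imageI)
    define q where "q = (\<rho> / \<sigma>) ^ 2"
    have q: "0 \<le> q" "q < 1" using \<epsilon> assms by (auto simp: q_def power_less_one_iff)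
    have "norm (c m * (deriv ^^ (2 * m)) g p) \<le> (C * B) * q ^ m" if p: "p \<in> cball p0 \<epsilon>" for p m
    proof -
      have s: "cball p \<sigma> \<subseteq> cball p0 \<rho>'"
        using p unfolding \<sigma>_def \<epsilon>_def by (intro cball_subset_cball_iff[THEN iffD2]) (auto simp: dist_commute field_simps)
      have "norm ((deriv ^^ (2 * m)) g p) \<le> fact (2 * m) * B / \<sigma> ^ (2 * m)"
      proof (rule Cauchy_inequality)
        show "g holomorphic_on ball p \<sigma>"
          using hol by (rule holomorphic_on_subset) (use s sub[OF \<open>p0 \<in> U\<close>] in force)
        show "continuous_on (cball p \<sigma>) g"
          using \<open>continuous_on (cball p0 \<rho>') g\<close> s by (rule continuous_on_subset)
        show "norm (g w) \<le> B" if "norm (p - w) = \<sigma>" for w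
        proof (rule B)
          have "w \<in> cball p \<sigma>" using that by (simp add: dist_norm)
          then show "w \<in> cball p0 \<rho>'" using s by blast
        qed
      qed (use \<epsilon> in auto)
      then have "norm (c m) * norm ((deriv ^^ (2 * m)) g p) \<le>
          (C * \<rho> ^ (2 * m) / fact (2 * m)) * (fact (2 * m) * B / \<sigma> ^ (2 * m))"
        using C assms by (intro mult_mono c) auto
      also have "\<dots> = (C * B) * q ^ m"
        by (simp add: q_def power_mult[symmetric] power_divide)
      finally show ?thesis by (simp add: norm_mult)
    qed
    then show ?thesis using q by blast
  qed
  show "(\<lambda>p. \<Sum>m. c m * (deriv ^^ (2 * m)) g p) holomorphic_on U"
  proof (rule holomorphic_uniform_sequence[OF \<open>open U\<close>])
    show "(\<lambda>p. \<Sum>m<n. c m * (deriv ^^ (2 * m)) g p) holomorphic_on U" for n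
      by (intro holomorphic_intros holU)
    fix p0 assume p0: "p0 \<in> U"
    obtain q M where q: "(0::real) \<le> q" "q < 1"
      and le: "\<And>p m. p \<in> cball p0 \<epsilon> \<Longrightarrow> norm (c m * (deriv ^^ (2 * m)) g p) \<le> M * q ^ m"
      using ex[OF p0] by blast
    obtain d where d: "d > 0" "cball p0 d \<subseteq> U"
      using \<open>open U\<close> p0 open_contains_cball by blast
    have "uniform_limit (cball p0 \<epsilon>) (\<lambda>n p. \<Sum>m<n. c m * (deriv ^^ (2 * m)) g p)
        (\<lambda>p. \<Sum>m. c m * (deriv ^^ (2 * m)) g p) sequentially"
      by (rule Weierstrass_m_test[where M = "\<lambda>m. M * q ^ m"])
        (use le q in \<open>auto intro!: summable_mult summable_geometric\<close>)
    then have "uniform_limit (cball p0 (min d \<epsilon>)) (\<lambda>n p. \<Sum>m<n. c m * (deriv ^^ (2 * m)) g p)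
        (\<lambda>p. \<Sum>m. c m * (deriv ^^ (2 * m)) g p) sequentially"
      by (rule uniform_limit_on_subset) auto
    moreover have "cball p0 (min d \<epsilon>) \<subseteq> U" using d by (force)
    ultimately show "\<exists>d>0. cball p0 d \<subseteq> U \<and> uniform_limit (cball p0 d)
        (\<lambda>n p. \<Sum>m<n. c m * (deriv ^^ (2 * m)) g p) (\<lambda>p. \<Sum>m. c m * (deriv ^^ (2 * m)) g p) sequentially"
      using d \<epsilon> by (intro exI[of _ "min d \<epsilon>"]) auto
  qed
  assume "p \<in> U"
  then obtain q M where q: "(0::real) \<le> q" "q < 1"
    and le: "\<And>m. norm (c m * (deriv ^^ (2 * m)) g p) \<le> M * q ^ m"
    using ex[of p] \<epsilon> by fastforce
  show "summable (\<lambda>m. c m * (deriv ^^ (2 * m)) g p)"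
    by (rule summable_comparison_test'[where g = "\<lambda>m. M * q ^ m" and N = 0])
      (use le q in \<open>auto intro!: summable_mult summable_geometric\<close>)
qed

section \<open>Integrals over the positive half-line\<close>

abbreviation pos_measure :: "real measure" where
  "pos_measure \<equiv> restrict_space lborel {0<..}"

text \<open>
  Integrations by parts over the half-line go through this version of the fundamental theorem, which involves only
  the limits of the antiderivative at the two ends.
\<close>

lemma integral_pos_FTC:
  fixes F f :: "real \<Rightarrow> complex"
  assumes der: "\<And>x. x > 0 \<Longrightarrow> (F has_vector_derivative f x) (at x)"
    and cont: "continuous_on {0<..} f" and int: "integrable pos_measure f"
    and A: "(F \<longlongrightarrow> A) (at_right 0)" and B: "(F \<longlongrightarrow> B) at_top"
  shows "(\<integral>x. f x \<partial>pos_measure) = B - A"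
proof -
  have ein: "einterval 0 \<infinity> = {0<..}"
    by (auto simp: einterval_def)
  have "(LBINT x=0..\<infinity>. f x) = B - A"
  proof (rule interval_integral_FTC_integrable)
    show "isCont f x" if "(0::ereal) < ereal x" for x
      using cont that by (simp add: continuous_on_eq_continuous_at)
    show "set_integrable lborel (einterval 0 \<infinity>) f"
      using int by (simp add: ein set_integrable_def integrable_restrict_space)
    show "((F \<circ> real_of_ereal) \<longlongrightarrow> A) (at_right 0)"
      using A by (simp add: ereal_tendsto_simps zero_ereal_def)
    show "((F \<circ> real_of_ereal) \<longlongrightarrow> B) (at_left \<infinity>)"
      using B by (simp add: ereal_tendsto_simps)
  qed (use der in auto)
  then show ?thesis
    by (simp add: interval_lebesgue_integral_def ein set_lebesgue_integral_def integral_restrict_space)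
qed

lemma pos_integrable_iff:
  fixes f :: "real \<Rightarrow> 'b::euclidean_space"
  assumes "continuous_on {0<..} f"
  shows "integrable pos_measure f \<longleftrightarrow> f absolutely_integrable_on {0<..}"
    and "integrable pos_measure f \<Longrightarrow> integral\<^sup>L pos_measure f = integral {0<..} f"
proof -
  have m: "(\<lambda>x. indicator {0<..} x *\<^sub>R f x) \<in> borel_measurable lborel"
    using assms by (simp add: borel_measurable_continuous_on_indicator)
  show *: "integrable pos_measure f \<longleftrightarrow> f absolutely_integrable_on {0<..}"
    using m by (simp add: integrable_restrict_space set_integrable_def integrable_completion)
  assume "integrable pos_measure f"
  then have "f absolutely_integrable_on {0<..}" by (simp only: *)
  then have "integral {0<..} f = (LINT x:{0<..}|lebesgue. f x)"
    by (simp add: set_lebesgue_integral_eq_integral)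
  then show "integral\<^sup>L pos_measure f = integral {0<..} f"
    using m by (simp add: integral_restrict_space set_lebesgue_integral_def integral_completion)
qed

lemma pos_measurable: "continuous_on {0<..} f \<Longrightarrow> f \<in> borel_measurable pos_measure"
  for f :: "real \<Rightarrow> 'b::topological_space"
  using borel_measurable_continuous_on_restrict[of "{0<..}" f]
  by (simp cong: measurable_cong_sets add: sets_restrict_space)

lemma pos_integrable_bound:
  fixes f :: "real \<Rightarrow> complex"
  assumes "integrable pos_measure g" "continuous_on {0<..} f"
    and "\<And>x. x > 0 \<Longrightarrow> norm (f x) \<le> g x"
  shows "integrable pos_measure f"
proof (rule Bochner_Integration.integrable_bound[OF assms(1) pos_measurable[OF assms(2)]])
  have "norm (f x) \<le> norm (g x)" if "x > 0" for x
    using assms(3)[OF that] by simp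
  then show "AE x in pos_measure. norm (f x) \<le> norm (g x)"
    by (intro AE_I2) (auto simp: space_restrict_space)
qed

lemma pos_integrable_powr_weight:
  fixes \<sigma> k :: real
  assumes "0 < \<sigma>" "\<sigma> < k"
  shows "integrable pos_measure (\<lambda>x. x powr (\<sigma> - 1) / (1 + x) powr k)"
proof -
  let ?f = "\<lambda>x::real. x powr (\<sigma> - 1) / (1 + x) powr k"
  have cont: "continuous_on {0<..} ?f"
    by (intro continuous_intros) auto
  have "(\<lambda>x. x powr (\<sigma> - 1)) absolutely_integrable_on {0<..1}"
    using integrable_on_powr_from_0'[of "\<sigma> - 1" 1] assms
    by (subst absolutely_integrable_on_iff_nonneg) auto
  moreover have "(\<lambda>x. x powr (\<sigma> - 1 - k)) absolutely_integrable_on {1..}"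
    using has_integral_powr_to_inf[of "\<sigma> - 1 - k" 1] assms
    by (subst absolutely_integrable_on_iff_nonneg) (auto simp: integrable_on_def)
  ultimately have
    "(\<lambda>x. indicator {0<..1} x *\<^sub>R x powr (\<sigma> - 1) + indicator {1..} x *\<^sub>R x powr (\<sigma> - 1 - k))
      absolutely_integrable_on UNIV" (is "?g absolutely_integrable_on _")
    unfolding set_integrable_def by auto
  then have g: "?g absolutely_integrable_on {0<..}"
    by (rule set_integrable_subset) auto
  have "?f absolutely_integrable_on {0<..}"
  proof (rule set_integrable_bound[OF g])
    show "set_borel_measurable lebesgue {0<..} ?f"
      using borel_measurable_continuous_on_indicator[OF _ cont]
      unfolding set_borel_measurable_def by (intro measurable_completion) auto
    have "norm (?f x) \<le> norm (?g x)" if x: "x > 0" for x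
    proof (cases "x \<le> 1")
      case True
      have "?f x \<le> x powr (\<sigma> - 1) / 1"
        using x assms by (intro divide_left_mono ge_one_powr_ge_zero) auto
      also have "\<dots> \<le> ?g x" using True x by (auto simp: indicator_def)
      finally show ?thesis using x by simp
    next
      case False
      have "?f x \<le> x powr (\<sigma> - 1) / x powr k"
        using x assms by (intro divide_left_mono powr_mono2) auto
      also have "\<dots> = ?g x" using False x by (auto simp: indicator_def powr_diff)
      finally show ?thesis using x by simp
    qed
    then show "AE x in lebesgue. x \<in> {0<..} \<longrightarrow> norm (?f x) \<le> norm (?g x)"
      by (intro AE_I2) auto
  qed
  then show ?thesis using pos_integrable_iff(1)[OF cont] by simp
qed

lemma powr_complex_of_real: "x > 0 \<Longrightarrow> norm (complex_of_real x powr w) = x powr Re w"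
  by (simp add: norm_powr_real_powr)

lemma Gamma_integral_scaled:
  fixes z :: complex and a :: real
  assumes z: "Re z > 0" and a: "a > 0"
  shows "integrable pos_measure (\<lambda>x. of_real x powr (z - 1) * of_real (exp (- (a * x))))"
    and "(\<integral>x. of_real x powr (z - 1) * of_real (exp (- (a * x))) \<partial>pos_measure) = Gamma z * of_real a powr (- z)"
proof -
  have cont: "continuous_on {0<..} (\<lambda>x. complex_of_real x powr (z - 1) * of_real (exp (- (a * x))))" for a
    by (intro continuous_intros) auto
  have eq: "complex_of_real x powr (z - 1) * of_real (exp (- (a * x))) =
      of_real x powr (z - 1) / of_real (exp (a * x))" for x a :: real
    by (simp add: exp_minus field_simps)
  show int: "integrable pos_measure (\<lambda>x. of_real x powr (z - 1) * of_real (exp (- (a * x))))"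
    by (rule pos_integrable_iff(1)[OF cont, THEN iffD2])
      (use absolutely_integrable_Gamma_integral[OF z a] in \<open>simp only: eq\<close>)
  have I: "integral {0<..} (\<lambda>x. complex_of_real x powr (z - 1) * of_real (exp (- x))) = Gamma z"
    using Gamma_integral_complex'[OF z] eq[of _ 1] by (simp add: integral_unique)
  have AI: "(\<lambda>x. complex_of_real x powr (z - 1) * of_real (exp (- x))) absolutely_integrable_on {0<..}"
    using absolutely_integrable_Gamma_integral'[OF z] eq[of _ 1] by simp
  have im: "(\<lambda>x. a * x) ` {0<..} = {0<..}"
  proof (rule set_eqI)
    fix y show "y \<in> (\<lambda>x. a * x) ` {0<..} \<longleftrightarrow> y \<in> {0<..}"
      using a by (auto intro!: image_eqI[of _ _ "y / a"])
  qed
  have "(\<lambda>x. \<bar>a\<bar> *\<^sub>R (complex_of_real (a * x) powr (z - 1) * of_real (exp (- (a * x))))) absolutely_integrable_on {0<..} \<and>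
      integral {0<..} (\<lambda>x. \<bar>a\<bar> *\<^sub>R (complex_of_real (a * x) powr (z - 1) * of_real (exp (- (a * x))))) = Gamma z"
    by (subst has_absolute_integral_change_of_variables_real)
      (use a I AI in \<open>auto simp: im inj_on_def intro!: derivative_eq_intros\<close>)
  then have *: "integral {0<..} (\<lambda>x. \<bar>a\<bar> *\<^sub>R (complex_of_real (a * x) powr (z - 1) * of_real (exp (- (a * x))))) = Gamma z"
    by blast
  have "integral {0<..} (\<lambda>x. \<bar>a\<bar> *\<^sub>R (complex_of_real (a * x) powr (z - 1) * of_real (exp (- (a * x)))))
      = integral {0<..} (\<lambda>x. of_real a powr z * (of_real x powr (z - 1) * of_real (exp (- (a * x)))))"
  proof (rule Henstock_Kurzweil_Integration.integral_cong)
    fix x :: real assume "x \<in> {0<..}"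
    then have "complex_of_real (a * x) powr (z - 1) = of_real a powr (z - 1) * of_real x powr (z - 1)"
      using a by (simp add: powr_times_real)
    moreover have "complex_of_real a powr z = of_real a * of_real a powr (z - 1)"
      using a by (simp add: powr_diff)
    ultimately show "\<bar>a\<bar> *\<^sub>R (complex_of_real (a * x) powr (z - 1) * of_real (exp (- (a * x)))) =
      of_real a powr z * (of_real x powr (z - 1) * of_real (exp (- (a * x))))"
      using a by (simp add: scaleR_conv_of_real)
  qed
  also have "\<dots> = of_real a powr z * (\<integral>x. of_real x powr (z - 1) * of_real (exp (- (a * x))) \<partial>pos_measure)"
    using int by (simp add: pos_integrable_iff(2)[OF cont])
  finally show "(\<integral>x. of_real x powr (z - 1) * of_real (exp (- (a * x))) \<partial>pos_measure) = Gamma z * of_real a powr (- z)"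
    using * a by (simp add: powr_minus field_simps)
qed

text \<open>
  The substitution \<open>x = p t / (1 - t)\<close> produces a Beta integral. Integrating the pole of the Bose kernel in
  this way accounts for the singular part \<open>\<Gamma> (1 - s) p^(s - 1)\<close> of the polylogarithm.
\<close>

lemma Beta_integral_pos:
  fixes s p :: real
  assumes s: "0 < s" "s < 1" and p: "p > 0"
  shows "integrable pos_measure (\<lambda>x. x powr (s - 1) / (x + p))"
    and "(\<integral>x. x powr (s - 1) / (x + p) \<partial>pos_measure) = p powr (s - 1) * (Gamma s * Gamma (1 - s))"
proof -
  let ?f = "\<lambda>x. x powr (s - 1) / (x + p)"
  have cont: "continuous_on {0<..} ?f"
    using p by (intro continuous_intros) auto
  define g where "g = (\<lambda>t::real. p * t / (1 - t))"
  define g' where "g' = (\<lambda>t::real. p / (1 - t)\<^sup>2)"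
  have im: "g ` {0<..<1} = {0<..}"
  proof (rule set_eqI)
    fix y :: real
    show "y \<in> g ` {0<..<1} \<longleftrightarrow> y \<in> {0<..}"
    proof
      assume "y \<in> {0<..}"
      then have y: "1 - y / (y + p) = p / (y + p)" "y / (y + p) \<in> {0<..<1}"
        using p by (auto simp: field_simps)
      moreover have "y = g (y / (y + p))"
        unfolding g_def y(1) using p \<open>y \<in> {0<..}\<close> by simp
      ultimately have "y = g (y / (y + p))" "y / (y + p) \<in> {0<..<1}" by auto
      then show "y \<in> g ` {0<..<1}" by blast
    qed (use p in \<open>auto simp: g_def\<close>)
  qed
  have inj: "inj_on g {0<..<1}"
    using p by (auto simp: inj_on_def g_def field_simps)
  have der: "(g has_field_derivative g' x) (at x within {0<..<1})" if "x \<in> {0<..<1}" for x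
    unfolding g_def g'_def using that
    by (auto intro!: derivative_eq_intros simp: field_simps power2_eq_square)
  define B where "B = (\<lambda>t::real. t powr (s - 1) * (1 - t) powr (1 - s - 1))"
  have B_int: "B absolutely_integrable_on {0<..<1}" "integral {0<..<1} B = Beta s (1 - s)"
  proof -
    have "(B has_integral Beta s (1 - s)) {0..1}"
      unfolding B_def using has_integral_Beta_real[of s "1 - s"] s by simp
    then have h: "(B has_integral Beta s (1 - s)) {0<..<1}"
      using has_integral_open_interval[of B _ 0 1] by simp
    then show "integral {0<..<1} B = Beta s (1 - s)" by (rule integral_unique)
    show "B absolutely_integrable_on {0<..<1}"
      using h by (subst absolutely_integrable_on_iff_nonneg) (auto simp: B_def integrable_on_def)
  qed
  have eq: "\<bar>g' t\<bar> * ?f (g t) = p powr (s - 1) * B t" if t: "t \<in> {0<..<1}" for t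
  proof -
    have 1: "g t powr (s - 1) = p powr (s - 1) * t powr (s - 1) * (1 - t) powr (1 - s)"
    proof -
      have "g t = p * t * (1 - t) powr (-1)" using t by (simp add: g_def powr_minus field_simps)
      then have "g t powr (s - 1) = p powr (s - 1) * t powr (s - 1) * ((1 - t) powr (-1)) powr (s - 1)"
        unfolding \<open>g t = _\<close> using t p by (simp only: powr_mult)
      then show ?thesis by (simp only: powr_powr) simp
    qed
    have 2: "g t + p = p / (1 - t)" using t by (simp add: g_def field_simps)
    have 3: "(1 - t) powr (1 - s - 1) = (1 - t) powr (1 - s) / (1 - t)"
      by (subst powr_diff) (use t in simp)
    show ?thesis unfolding 1 2 B_def 3 g'_def using t p
      by (simp add: power2_eq_square)
  qed
  have "(\<lambda>t. \<bar>g' t\<bar> * ?f (g t)) absolutely_integrable_on {0<..<1} \<and>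
    integral {0<..<1} (\<lambda>t. \<bar>g' t\<bar> * ?f (g t)) = p powr (s - 1) * Beta s (1 - s)"
  proof -
    have "(\<lambda>t. p powr (s - 1) * B t) absolutely_integrable_on {0<..<1}"
      using B_int by simp
    then have "(\<lambda>t. \<bar>g' t\<bar> * ?f (g t)) absolutely_integrable_on {0<..<1}"
      using eq by (subst set_integrable_cong[OF refl refl, of _ _ "\<lambda>t. p powr (s - 1) * B t"]) auto
    moreover have "integral {0<..<1} (\<lambda>t. \<bar>g' t\<bar> * ?f (g t)) = integral {0<..<1} (\<lambda>t. p powr (s - 1) * B t)"
      by (rule Henstock_Kurzweil_Integration.integral_cong) (rule eq)
    ultimately show ?thesis using B_int by simp
  qed
  then have res: "?f absolutely_integrable_on {0<..} \<and> integral {0<..} ?f = p powr (s - 1) * Beta s (1 - s)"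
    using has_absolute_integral_change_of_variables_1'[of "{0<..<1}" g g' ?f] der inj im by auto
  then show int: "integrable pos_measure ?f" using pos_integrable_iff(1)[OF cont] by simp
  show "integral\<^sup>L pos_measure ?f = p powr (s - 1) * (Gamma s * Gamma (1 - s))"
    using pos_integrable_iff(2)[OF cont int] res by (simp add: Beta_def Gamma_eq_zero_iff)
qed

section \<open>The kernel of the Bose integral\<close>

lemma exp_minus_1_limit:
  assumes "exp c = (1::complex)"
  shows "((\<lambda>z. (z - c) * (1 / (exp z - 1) - 1 / (z - c))) \<longlongrightarrow> 0) (at c)"
proof -
  have "(exp has_field_derivative 1) (at c)"
    using assms by (auto intro!: derivative_eq_intros)
  then have "((\<lambda>z. (exp z - 1) / (z - c)) \<longlongrightarrow> 1) (at c)"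
    using assms by (simp add: has_field_derivative_iff)
  then have "((\<lambda>z. inverse ((exp z - 1) / (z - c)) - 1) \<longlongrightarrow> inverse 1 - 1) (at c)"
    by (intro tendsto_intros) auto
  then have "((\<lambda>z. inverse ((exp z - 1) / (z - c)) - 1) \<longlongrightarrow> 0) (at c)" by simp
  moreover have "eventually (\<lambda>z. inverse ((exp z - 1) / (z - c)) - 1 =
      (z - c) * (1 / (exp z - 1) - 1 / (z - c))) (at c)"
    by (auto simp: eventually_at field_simps intro!: exI[of _ 1])
  ultimately show ?thesis by (rule Lim_transform_eventually)
qed

lemma exp_eq_1_strip:
  assumes "\<bar>Im u\<bar> < 4 * pi"
  shows "exp u = 1 \<longleftrightarrow> u \<in> {0, 2 * pi * \<i>, - (2 * pi * \<i>)}"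
proof
  assume "exp u = 1"
  then obtain n :: int where n: "Re u = 0" "Im u = of_int (2 * n) * pi"
    by (auto simp: exp_eq_1)
  have "\<bar>of_int (2 * n)\<bar> * pi < 4 * pi" using assms n by (simp add: abs_mult)
  then have "\<bar>n\<bar> < 2" by simp
  then have "n = 0 \<or> n = 1 \<or> n = -1" by linarith
  then show "u \<in> {0, 2 * pi * \<i>, - (2 * pi * \<i>)}"
    using n by (auto simp: complex_eq_iff)
next
  assume "u \<in> {0, 2 * pi * \<i>, - (2 * pi * \<i>)}"
  then show "exp u = 1"
    by (auto simp: exp_eq_1 intro: exI[of _ "1::int"] exI[of _ "-1::int"])
qed

lemma pole_remainder_bounded:
  assumes "exp c = (1::complex)"
  shows "(\<lambda>z. 1 / (exp z - 1) - 1 / (z - c)) \<in> O[at c](\<lambda>_. 1)"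
proof -
  let ?f = "\<lambda>z. 1 / (exp z - 1) - 1 / (z - c)"
  have ne: "exp z \<noteq> 1" if "z \<in> ball c 1 - {c}" for z
  proof
    assume "exp z = 1"
    then have "exp (z - c) = 1" using assms by (simp add: exp_diff)
    moreover have "norm (z - c) < 1" using that by (simp add: dist_norm norm_minus_commute)
    then have "\<bar>Im (z - c)\<bar> < 4 * pi" "\<bar>Im (z - c)\<bar> < 2 * pi"
      using abs_Im_le_cmod[of "z - c"] pi_gt3 by linarith+
    ultimately have "z - c \<in> {0, 2 * pi * \<i>, - (2 * pi * \<i>)}"
      using exp_eq_1_strip by blast
    then show False using that \<open>\<bar>Im (z - c)\<bar> < 2 * pi\<close> by (auto simp: complex_eq_iff)
  qed
  have "?f holomorphic_on ball c 1 - {c}"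
    using ne by (intro holomorphic_intros) auto
  then have "\<exists>g. g holomorphic_on ball c 1 \<and> (\<forall>z\<in>ball c 1 - {c}. g z = ?f z)"
    using exp_minus_1_limit[OF assms] by (subst holomorphic_on_extend_lim) auto
  then obtain g where g: "g holomorphic_on ball c 1" "\<And>z. z \<in> ball c 1 - {c} \<Longrightarrow> g z = ?f z"
    by blast
  have "isCont g c"
    using g(1) by (intro continuous_on_interior[OF holomorphic_on_imp_continuous_on]) auto
  then have "(g \<longlongrightarrow> g c) (at c)" by (simp add: isCont_def)
  moreover have "eventually (\<lambda>z. g z = ?f z) (at c)"
    using g(2) by (auto simp: eventually_at dist_commute intro!: exI[of _ 1])
  ultimately have "(?f \<longlongrightarrow> g c) (at c)" by (rule Lim_transform_eventually)
  then show ?thesis by (intro bigoI_tendsto[of _ _ "g c"]) auto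
qed

text \<open>
  The function \<open>1 / (exp u - 1) - 1 / u\<close>, with its removable singularity at \<open>0\<close> filled in; the remaining poles
  are the nonzero multiples of \<open>2 \<pi> \<i>\<close>.
\<close>

definition phi :: "complex \<Rightarrow> complex" where
  "phi u = (if u = 0 then Lim (at 0) (\<lambda>u. 1 / (exp u - 1) - 1 / u) else 1 / (exp u - 1) - 1 / u)"

text \<open>
  Without its poles at \<open>\<plusminus> 2 \<pi> \<i>\<close> the kernel is holomorphic in a strip twice as wide. Its
  derivatives then grow at a smaller exponential rate than those of the two poles, which therefore determine
  the growth of the zeta function on the negative axis.
\<close>

lemma phi_regular_part:
  obtains \<psi> where "\<psi> holomorphic_on {u. \<bar>Im u\<bar> < 4 * pi}"
    and "\<And>u. \<bar>Im u\<bar> < 4 * pi \<Longrightarrow> u \<notin> {0, 2 * pi * \<i>, - (2 * pi * \<i>)} \<Longrightarrow>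
      \<psi> u = 1 / (exp u - 1) - 1 / u - 1 / (u - 2 * pi * \<i>) - 1 / (u + 2 * pi * \<i>)"
    and "\<And>u. \<bar>Im u\<bar> < 2 * pi \<Longrightarrow> phi u = \<psi> u + 1 / (u - 2 * pi * \<i>) + 1 / (u + 2 * pi * \<i>)"
proof -
  define S where "S = {u. \<bar>Im u\<bar> < 4 * pi}"
  define X where "X = {0, 2 * pi * \<i>, - (2 * pi * \<i>)}"
  define F where "F = (\<lambda>u. 1 / (exp u - 1) - 1 / u - 1 / (u - 2 * pi * \<i>) - 1 / (u + 2 * pi * \<i>))"
  have "open S" unfolding S_def by (intro open_Collect_less continuous_intros)
  have XS: "X \<subseteq> S" by (auto simp: X_def S_def)
  have distinct: "0 \<noteq> 2 * pi * \<i>" "2 * pi * \<i> \<noteq> - (2 * pi * \<i>)"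
    by (auto simp: complex_eq_iff)
  have "\<exists>g. g holomorphic_on S \<and> (\<forall>z\<in>S - X. g z = F z)"
  proof (rule removable_singularities)
    show "finite X" by (simp add: X_def)
    show "X \<subseteq> interior S" using XS \<open>open S\<close> by (simp add: interior_open)
    have "exp u \<noteq> 1" if "u \<in> S - X" for u
      using exp_eq_1_strip[of u] that by (auto simp: S_def X_def)
    moreover have "u - 2 * pi * \<i> \<noteq> 0" "u + 2 * pi * \<i> \<noteq> 0" if "u \<in> S - X" for u
      using that by (auto simp: X_def add_eq_0_iff)
    ultimately show "F holomorphic_on S - X"
      unfolding F_def by (intro holomorphic_intros) (auto simp: X_def)
    have cont: "(\<lambda>u. 1 / (u - d)) \<in> O[at c](\<lambda>_. 1)" if "c \<noteq> d" for c d :: complex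
      by (rule bigoI_tendsto[of _ _ "1 / (c - d)"]) (use that in \<open>auto intro!: tendsto_eq_intros\<close>)
    fix c assume c: "c \<in> X"
    then have main: "(\<lambda>z. 1 / (exp z - 1) - 1 / (z - c)) \<in> O[at c](\<lambda>_. 1)"
      using XS by (intro pole_remainder_bounded) (auto simp: exp_eq_1_strip S_def X_def)
    have F: "F = (\<lambda>z. (1 / (exp z - 1) - 1 / (z - c)) - (\<Sum>d\<in>X-{c}. 1 / (z - d)))"
      using c distinct unfolding X_def F_def
      by (auto simp: fun_eq_iff insert_Diff_if)
    have "(\<lambda>z. \<Sum>d\<in>X-{c}. 1 / (z - d)) \<in> O[at c](\<lambda>_. 1)"
      by (rule big_sum_in_bigo) (use cont in auto)
    with main show "F \<in> O[at c](\<lambda>_. 1)"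
      unfolding F by (rule sum_in_bigo)
  qed
  then obtain g where g: "g holomorphic_on S" "\<And>z. z \<in> S - X \<Longrightarrow> g z = F z" by blast
  show thesis
  proof (rule that[of g])
    show "g holomorphic_on {u. \<bar>Im u\<bar> < 4 * pi}" using g(1) by (simp add: S_def)
    show "g u = 1 / (exp u - 1) - 1 / u - 1 / (u - 2 * pi * \<i>) - 1 / (u + 2 * pi * \<i>)"
      if "\<bar>Im u\<bar> < 4 * pi" "u \<notin> {0, 2 * pi * \<i>, - (2 * pi * \<i>)}" for u
      using g(2)[of u] that by (auto simp: S_def X_def F_def)
    fix u assume u: "\<bar>Im u\<bar> < 2 * pi"
    show "phi u = g u + 1 / (u - 2 * pi * \<i>) + 1 / (u + 2 * pi * \<i>)"
    proof (cases "u = 0")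
      case False
      then have "u \<in> S - X" using u pi_gt_zero by (auto simp: S_def X_def)
      then show ?thesis using g(2)[of u] False by (simp add: phi_def F_def)
    next
      case True
      let ?h = "\<lambda>u. g u + 1 / (u - 2 * pi * \<i>) + 1 / (u + 2 * pi * \<i>)"
      have "isCont g 0"
        using g(1) \<open>open S\<close> by (intro continuous_on_interior[OF holomorphic_on_imp_continuous_on[OF g(1)]])
          (auto simp: interior_open S_def)
      then have "isCont ?h 0" using distinct by (intro continuous_intros) auto
      then have "(?h \<longlongrightarrow> ?h 0) (at 0)" by (simp add: isCont_def)
      moreover have "eventually (\<lambda>u. ?h u = 1 / (exp u - 1) - 1 / u) (at 0)"
      proof -
        have "eventually (\<lambda>u. u \<in> {u. \<bar>Im u\<bar> < 2 * pi}) (at (0::complex))"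
          by (intro eventually_at_in_open' open_Collect_less continuous_intros) auto
        then show ?thesis
        proof (rule eventually_elim2[OF _ eventually_neq_at_within])
          fix u :: complex assume "u \<in> {u. \<bar>Im u\<bar> < 2 * pi}" "u \<noteq> 0"
          then have "u \<in> S - X" using pi_gt_zero by (auto simp: S_def X_def)
          then show "?h u = 1 / (exp u - 1) - 1 / u" using g(2)[of u] by (simp add: F_def)
        qed
      qed
      ultimately have "((\<lambda>u. 1 / (exp u - 1) - 1 / u) \<longlongrightarrow> ?h 0) (at 0)"
        by (rule Lim_transform_eventually)
      then have "Lim (at 0) (\<lambda>u. 1 / (exp u - 1) - 1 / u) = ?h 0"
        by (intro tendsto_Lim) auto
      then show ?thesis by (simp add: phi_def True)
    qed
  qed
qed

definition phi_domain :: "complex set" where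
  "phi_domain = {u. Re u > 0} \<union> {u. \<bar>Im u\<bar> < 2 * pi}"

lemma open_phi_domain: "open phi_domain"
  unfolding phi_domain_def by (intro open_Un open_Collect_less continuous_intros)

lemma phi_holomorphic: "phi holomorphic_on phi_domain"
  unfolding phi_domain_def
proof (rule holomorphic_on_Un)
  show "open {u. 0 < Re u}" "open {u. \<bar>Im u\<bar> < 2 * pi}"
    by (intro open_Collect_less continuous_intros)+
  have ne: "exp u \<noteq> 1" if "Re u > 0" for u
    using that by (auto simp: exp_eq_1)
  have "(\<lambda>u. 1 / (exp u - 1) - 1 / u) holomorphic_on {u. 0 < Re u}"
    using ne by (intro holomorphic_intros) auto
  then show "phi holomorphic_on {u. 0 < Re u}"
    by (rule holomorphic_transform) (auto simp: phi_def)
  obtain \<psi> where \<psi>: "\<psi> holomorphic_on {u. \<bar>Im u\<bar> < 4 * pi}"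
    "\<And>u. \<bar>Im u\<bar> < 2 * pi \<Longrightarrow> phi u = \<psi> u + 1 / (u - 2 * pi * \<i>) + 1 / (u + 2 * pi * \<i>)"
    using phi_regular_part by metis
  have ne': "u - 2 * pi * \<i> \<noteq> 0" "u + 2 * pi * \<i> \<noteq> 0" if "\<bar>Im u\<bar> < 2 * pi" for u
    using that by (auto simp: complex_eq_iff)
  have "(\<lambda>u. \<psi> u + 1 / (u - 2 * pi * \<i>) + 1 / (u + 2 * pi * \<i>)) holomorphic_on {u. \<bar>Im u\<bar> < 2 * pi}"
    using ne' by (intro holomorphic_intros holomorphic_on_subset[OF \<psi>(1)]) auto
  then show "phi holomorphic_on {u. \<bar>Im u\<bar> < 2 * pi}"
    by (rule holomorphic_transform) (use \<psi>(2) in auto)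
qed

lemma norm_Re_inverse_le: "a > 0 \<Longrightarrow> a \<le> Re w \<Longrightarrow> norm (1 / w) \<le> 1 / a"
  using complex_Re_le_cmod[of w] by (auto simp: norm_divide intro!: divide_left_mono mult_pos_pos)

lemma norm_inverse_exp_minus_1:
  assumes "Re u > 0"
  shows "norm (1 / (exp u - 1)) \<le> 1 / (exp (Re u) - 1)"
proof -
  have "exp (Re u) - 1 \<le> norm (exp u - 1)"
    using norm_triangle_ineq2[of "exp u" 1] by simp
  moreover have "exp (Re u) - 1 > 0" using assms by simp
  ultimately show ?thesis by (auto simp: norm_divide intro!: divide_left_mono mult_pos_pos)
qed

lemma norm_inverse_exp_minus_1':
  assumes "Re u > 0"
  shows "norm (1 / (exp u - 1)) \<le> 1 / Re u"
proof -
  have "1 / (exp (Re u) - 1) \<le> 1 / Re u"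
  proof (intro divide_left_mono mult_pos_pos)
    show "Re u \<le> exp (Re u) - 1" using exp_ge_add_one_self[of "Re u"] by linarith
  qed (use assms in auto)
  then show ?thesis using norm_inverse_exp_minus_1[OF assms] by linarith
qed

lemma norm_phi_le: "Re u > 0 \<Longrightarrow> norm (phi u) \<le> 2 / Re u"
proof -
  assume u: "Re u > 0"
  then have "u \<noteq> 0" by auto
  have "norm (phi u) \<le> norm (1 / (exp u - 1)) + norm (1 / u)"
    using \<open>u \<noteq> 0\<close> by (simp add: phi_def norm_triangle_ineq4)
  also have "\<dots> \<le> 1 / Re u + 1 / Re u"
    using norm_inverse_exp_minus_1'[OF u] norm_Re_inverse_le[OF u order_refl] by (rule add_mono)
  finally show ?thesis by simp
qed

text \<open>
  The bounds \<open>-10\<close> and \<open>20\<close> only have to leave room for the real shifts used later: discs of radius \<open>3 \<pi>\<close> about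
  positive points and translations by points of \<open>polylog_strip\<close> stay in \<open>Re u \<ge> -10\<close>, where \<open>20 + Re u\<close>
  is at least \<open>10\<close>.
\<close>

lemma strip_decay:
  fixes f :: "complex \<Rightarrow> complex"
  assumes hol: "f holomorphic_on S" and sub: "\<And>u. \<bar>Im u\<bar> \<le> \<rho> \<Longrightarrow> u \<in> S"
    and decay: "\<And>u. \<bar>Im u\<bar> \<le> \<rho> \<Longrightarrow> Re u \<ge> 1 \<Longrightarrow> norm (f u) \<le> K / Re u"
  obtains C where "C \<ge> 0" and "\<And>u. \<bar>Im u\<bar> \<le> \<rho> \<Longrightarrow> Re u \<ge> -10 \<Longrightarrow> norm (f u) \<le> C / (20 + Re u)"
proof -
  let ?R = "cbox (Complex (-10) (-\<rho>)) (Complex 1 \<rho>)"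
  have "?R \<subseteq> S" using sub by (auto simp: in_cbox_complex_iff)
  then have "continuous_on ?R f"
    by (rule continuous_on_subset[OF holomorphic_on_imp_continuous_on[OF hol]])
  then have "bounded (f ` ?R)"
    by (intro compact_imp_bounded compact_continuous_image) auto
  then obtain B where "\<And>u. u \<in> ?R \<Longrightarrow> norm (f u) \<le> B" unfolding bounded_iff by (metis imageI)
  then have B: "\<And>u. u \<in> ?R \<Longrightarrow> norm (f u) \<le> \<bar>B\<bar>" by force
  \<comment> \<open>\<open>21\<close> bounds \<open>20 + Re u\<close> where \<open>Re u \<le> 1\<close>, and \<open>(20 + Re u) / Re u\<close> beyond.\<close>
  define C where "C = 21 * \<bar>B\<bar> + 21 * \<bar>K\<bar>"
  show thesis
  proof (rule that[of C])
    show "C \<ge> 0" by (simp add: C_def)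
    fix u assume u: "\<bar>Im u\<bar> \<le> \<rho>" "Re u \<ge> -10"
    show "norm (f u) \<le> C / (20 + Re u)"
    proof (cases "Re u \<le> 1")
      case True
      then have "norm (f u) \<le> \<bar>B\<bar>" using u by (intro B) (auto simp: in_cbox_complex_iff)
      moreover have "\<bar>B\<bar> * (20 + Re u) \<le> \<bar>B\<bar> * 21" using True by (intro mult_left_mono) auto
      ultimately have "norm (f u) * (20 + Re u) \<le> C"
      proof -
        assume 1: "norm (f u) \<le> \<bar>B\<bar>" and 2: "\<bar>B\<bar> * (20 + Re u) \<le> \<bar>B\<bar> * 21"
        have "norm (f u) * (20 + Re u) \<le> \<bar>B\<bar> * (20 + Re u)"
          using 1 u by (intro mult_right_mono) auto
        also note 2
        also have "\<bar>B\<bar> * 21 \<le> C" by (simp add: C_def)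
        finally show ?thesis .
      qed
      then show ?thesis using u by (simp add: pos_le_divide_eq)
    next
      case False
      then have "norm (f u) \<le> K / Re u" using u decay by simp
      also have "\<dots> \<le> \<bar>K\<bar> / Re u" using False by (intro divide_right_mono) auto
      also have "\<dots> \<le> (21 * \<bar>K\<bar>) / (20 + Re u)"
      proof -
        have "\<bar>K\<bar> * (20 + Re u) \<le> \<bar>K\<bar> * (21 * Re u)" using False by (intro mult_left_mono) auto
        then show ?thesis using False by (simp add: field_simps)
      qed
      also have "\<dots> \<le> C / (20 + Re u)" using u by (intro divide_right_mono) (auto simp: C_def)
      finally show ?thesis .
    qed
  qed
qed

lemma phi_decay:
  assumes "\<rho> < 2 * pi"
  obtains C where "C \<ge> 0" and "\<And>u. \<bar>Im u\<bar> \<le> \<rho> \<Longrightarrow> Re u \<ge> -10 \<Longrightarrow> norm (phi u) \<le> C / (20 + Re u)"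
proof (rule strip_decay[OF phi_holomorphic, of \<rho> 2])
  show "u \<in> phi_domain" if "\<bar>Im u\<bar> \<le> \<rho>" for u
    using that assms by (auto simp: phi_domain_def)
qed (use norm_phi_le that in auto)

text \<open>
  Since \<open>phi u = O (1 / Re u)\<close> in the right half-plane, Cauchy's inequality on the disc of radius \<open>x / 2\<close> about \<open>x\<close>
  gains a factor \<open>1 / x\<close> for each derivative.
\<close>

lemma higher_deriv_phi_decay:
  obtains C where "C \<ge> 0"
    and "\<And>x. x > 0 \<Longrightarrow> norm ((deriv ^^ N) phi (of_real x)) \<le> C / (1 + x) powr (real N + 1)"
proof -
  have hol: "(deriv ^^ N) phi holomorphic_on phi_domain"
    by (rule holomorphic_higher_deriv[OF phi_holomorphic open_phi_domain])
  have "continuous_on {0..1} (\<lambda>x. (deriv ^^ N) phi (complex_of_real x))"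
    by (rule continuous_on_compose2[OF holomorphic_on_imp_continuous_on[OF hol]])
      (auto simp: phi_domain_def intro!: continuous_intros)
  then have "bounded ((\<lambda>x. (deriv ^^ N) phi (complex_of_real x)) ` {0..1})"
    by (intro compact_imp_bounded compact_continuous_image) auto
  then obtain B where "\<And>x. x \<in> {0..1} \<Longrightarrow> norm ((deriv ^^ N) phi (complex_of_real x)) \<le> B"
    unfolding bounded_iff by (metis imageI)
  then have B: "\<And>x. x \<in> {0..1} \<Longrightarrow> norm ((deriv ^^ N) phi (complex_of_real x)) \<le> \<bar>B\<bar>" by force
  define C where "C = \<bar>B\<bar> * 2 ^ (N + 1) + fact N * 4 * 2 ^ N * 2 ^ (N + 1)"
  show thesis
  proof (rule that[of C])
    show "C \<ge> 0" by (simp add: C_def)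
    fix x :: real assume x: "x > 0"
    have pw: "(1 + x) powr (real N + 1) = (1 + x) ^ (N + 1)"
      using x powr_realpow[of "1 + x" "N + 1"] by (simp add: add.commute)
    show "norm ((deriv ^^ N) phi (of_real x)) \<le> C / (1 + x) powr (real N + 1)"
    proof (cases "x \<le> 1")
      case True
      have "\<bar>B\<bar> * (1 + x) ^ (N + 1) \<le> \<bar>B\<bar> * 2 ^ (N + 1)"
        using True x by (intro mult_left_mono power_mono) auto
      then have "\<bar>B\<bar> * (1 + x) ^ (N + 1) \<le> C" by (simp add: C_def add_increasing2)
      then have "\<bar>B\<bar> \<le> C / (1 + x) ^ (N + 1)" using x by (simp add: pos_le_divide_eq)
      then show ?thesis using B[of x] True x by (simp add: pw)
    next
      case False
      have sub: "cball (of_real x) (x / 2) \<subseteq> phi_domain"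
      proof
        fix u assume u: "u \<in> cball (complex_of_real x) (x / 2)"
        then have "\<bar>Re (complex_of_real x - u)\<bar> \<le> x / 2"
          using abs_Re_le_cmod[of "complex_of_real x - u"] by (simp add: dist_norm)
        then show "u \<in> phi_domain" using x by (auto simp: phi_domain_def abs_if split: if_splits)
      qed
      have "norm ((deriv ^^ N) phi (of_real x)) \<le> fact N * (4 / x) / (x / 2) ^ N"
      proof (rule Cauchy_inequality)
        show "phi holomorphic_on ball (of_real x) (x / 2)"
          using sub by (intro holomorphic_on_subset[OF phi_holomorphic]) auto
        show "continuous_on (cball (of_real x) (x / 2)) phi"
          using sub by (intro continuous_on_subset[OF holomorphic_on_imp_continuous_on[OF phi_holomorphic]]) auto
        fix u assume "norm (complex_of_real x - u) = x / 2"
        then have "\<bar>Re (complex_of_real x - u)\<bar> \<le> x / 2"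
          using abs_Re_le_cmod[of "complex_of_real x - u"] by simp
        then have u: "Re u \<ge> x / 2" by (auto simp: abs_if split: if_splits)
        then have "norm (phi u) \<le> 2 / Re u" using x by (intro norm_phi_le) auto
        also have "\<dots> \<le> 2 / (x / 2)" using u x by (intro divide_left_mono mult_pos_pos) auto
        finally show "norm (phi u) \<le> 4 / x" by simp
      qed (use x in auto)
      also have "\<dots> = fact N * 4 * 2 ^ N / x ^ (N + 1)" using x by (simp add: field_simps)
      also have "\<dots> \<le> (fact N * 4 * 2 ^ N * 2 ^ (N + 1)) / (1 + x) ^ (N + 1)"
      proof -
        have "(1 + x) ^ (N + 1) \<le> (2 * x) ^ (N + 1)" using False by (intro power_mono) auto
        then have "fact N * 4 * 2 ^ N * (1 + x) ^ (N + 1) \<le> fact N * 4 * 2 ^ N * (2 ^ (N + 1) * x ^ (N + 1))"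
          by (intro mult_left_mono) (auto simp: power_mult_distrib mult_ac)
        then show ?thesis using x by (simp add: divide_simps mult_ac)
      qed
      also have "\<dots> \<le> C / (1 + x) ^ (N + 1)"
        using x by (intro divide_right_mono) (auto simp: C_def)
      finally show ?thesis by (simp add: pw)
    qed
  qed
qed

section \<open>Mellin integrals for the zeta function\<close>

lemma mellin_integrable:
  fixes c :: "real \<Rightarrow> complex"
  assumes cont: "continuous_on {0<..} c"
    and c: "\<And>x. x > 0 \<Longrightarrow> norm (c x) \<le> C / (1 + x) powr k"
    and w: "0 < Re w" "Re w < k"
  shows "integrable pos_measure (\<lambda>x. of_real x powr (w - 1) * c x)"
proof (rule pos_integrable_bound)
  show "integrable pos_measure (\<lambda>x. C * (x powr (Re w - 1) / (1 + x) powr k))"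
    by (intro integrable_mult_right pos_integrable_powr_weight w)
  show "continuous_on {0<..} (\<lambda>x. of_real x powr (w - 1) * c x)"
    by (intro continuous_intros cont) auto
  fix x :: real assume x: "x > 0"
  have "norm (of_real x powr (w - 1) * c x) = x powr (Re w - 1) * norm (c x)"
    using x by (simp add: norm_mult powr_complex_of_real)
  also have "\<dots> \<le> x powr (Re w - 1) * (C / (1 + x) powr k)"
    using c[OF x] by (intro mult_left_mono) auto
  finally show "norm (of_real x powr (w - 1) * c x) \<le> C * (x powr (Re w - 1) / (1 + x) powr k)"
    by (simp add: mult_ac)
qed

lemma powr_between:
  fixes x :: real
  assumes "x > 0" "a \<le> t" "t \<le> b"
  shows "x powr t \<le> x powr a + x powr b"
proof (cases "x \<le> 1")
  case True
  then have "x powr t \<le> x powr a" using assms by (intro powr_mono') auto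
  then show ?thesis by (simp add: add_increasing2)
next
  case False
  then have "x powr t \<le> x powr b" using assms by (intro powr_mono) auto
  then show ?thesis by (simp add: add_increasing)
qed

lemma mellin_holomorphic:
  fixes c :: "real \<Rightarrow> complex"
  assumes cont: "continuous_on {0<..} c"
    and c: "\<And>x. x > 0 \<Longrightarrow> norm (c x) \<le> C / (1 + x) powr k"
  shows "(\<lambda>w. \<integral>x. of_real x powr (w - 1) * c x \<partial>pos_measure) holomorphic_on {w. 0 < Re w \<and> Re w < k}"
proof (rule holomorphic_on_open[THEN iffD2])
  show "open {w. 0 < Re w \<and> Re w < k}"
    by (intro open_Collect_conj open_Collect_less continuous_intros)
  have C: "C \<ge> 0" using order_trans[OF norm_ge_zero c[of 1]] by (simp add: zero_le_divide_iff)
  show "\<forall>p0\<in>{w. 0 < Re w \<and> Re w < k}. \<exists>f'. ((\<lambda>w. \<integral>x. of_real x powr (w - 1) * c x \<partial>pos_measure) has_field_derivative f') (at p0)"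
  proof
    fix p0 assume p0: "p0 \<in> {w. 0 < Re w \<and> Re w < k}"
    define r where "r = min (Re p0) (k - Re p0) / 2"
    have r: "r > 0" "Re p0 - r > 0" "Re p0 + r < k" using p0 by (auto simp: r_def min_def field_simps)
    have "(\<lambda>w. \<integral>x. of_real x powr (w - 1) * c x \<partial>pos_measure) holomorphic_on ball p0 r"
    proof (rule holomorphic_param_integral(1)[OF \<open>r > 0\<close>])
      show "(\<lambda>x. of_real x powr (w - 1) * c x) \<in> borel_measurable pos_measure" for w
        by (intro pos_measurable continuous_intros cont) auto
      show "(\<lambda>w. of_real x powr (w - 1) * c x) holomorphic_on ball p0 r" if "x \<in> space pos_measure" for x
        using that by (intro holomorphic_intros) (auto simp: space_restrict_space)
      show "integrable pos_measure (\<lambda>x. C * (x powr ((Re p0 - r) - 1) / (1 + x) powr k) +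
          C * (x powr ((Re p0 + r) - 1) / (1 + x) powr k))"
        using r by (intro Bochner_Integration.integrable_add integrable_mult_right pos_integrable_powr_weight) auto
      fix x w assume "x \<in> space pos_measure" "w \<in> ball p0 r"
      then have x: "x > 0" and w: "\<bar>Re (p0 - w)\<bar> < r"
        using abs_Re_le_cmod[of "p0 - w"] by (auto simp: space_restrict_space dist_norm)
      have "norm (of_real x powr (w - 1) * c x) = x powr (Re w - 1) * norm (c x)"
        using x by (simp add: norm_mult powr_complex_of_real)
      also have "\<dots> \<le> (x powr ((Re p0 - r) - 1) + x powr ((Re p0 + r) - 1)) * (C / (1 + x) powr k)"
        using w by (intro mult_mono powr_between x c) auto
      finally show "norm (of_real x powr (w - 1) * c x) \<le> C * (x powr ((Re p0 - r) - 1) / (1 + x) powr k) +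
          C * (x powr ((Re p0 + r) - 1) / (1 + x) powr k)"
        by (simp add: algebra_simps add_divide_distrib)
    qed
    then show "\<exists>f'. ((\<lambda>w. \<integral>x. of_real x powr (w - 1) * c x \<partial>pos_measure) has_field_derivative f') (at p0)"
      using r by (auto simp: holomorphic_on_open)
  qed
qed

lemma continuous_higher_deriv_phi: "continuous_on {0<..} (\<lambda>x. (deriv ^^ N) phi (complex_of_real x))"
  by (rule continuous_on_compose2[OF holomorphic_on_imp_continuous_on[OF
      holomorphic_higher_deriv[OF phi_holomorphic open_phi_domain]]])
    (auto simp: phi_domain_def intro!: continuous_intros)

text \<open>
  The classical formula \<open>\<Gamma> (s) \<zeta> (s) = \<integral> x^(s - 1) phi x dx\<close>, valid for \<open>0 < Re s < 1\<close>, after \<open>N\<close> integrations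
  by parts. Every step extends the strip of convergence by one to the left.
\<close>

definition zeta_left :: "nat \<Rightarrow> complex \<Rightarrow> complex" where
  "zeta_left N s = rGamma (s + of_nat N) * (-1) ^ N *
     (\<integral>x. of_real x powr (s + of_nat N - 1) * (deriv ^^ N) phi (of_real x) \<partial>pos_measure)"

lemma zeta_left_holomorphic: "zeta_left N holomorphic_on {s. - real N < Re s \<and> Re s < 1}"
proof -
  obtain C where C: "\<And>x. x > 0 \<Longrightarrow> norm ((deriv ^^ N) phi (of_real x)) \<le> C / (1 + x) powr (real N + 1)"
    using higher_deriv_phi_decay[of N] by metis
  have "((\<lambda>w. \<integral>x. of_real x powr (w - 1) * (deriv ^^ N) phi (of_real x) \<partial>pos_measure) \<circ> (\<lambda>s. s + of_nat N))
      holomorphic_on {s. - real N < Re s \<and> Re s < 1}"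
    by (rule holomorphic_on_compose_gen[OF _ mellin_holomorphic[OF continuous_higher_deriv_phi C]])
      (auto intro!: holomorphic_intros)
  then show ?thesis
    unfolding zeta_left_def o_def by (intro holomorphic_intros)
qed

lemma tendsto_at_right_0_powr:
  fixes g :: "real \<Rightarrow> complex"
  assumes "\<sigma> > 0" and "\<And>x. x > 0 \<Longrightarrow> norm (g x) \<le> C * x powr \<sigma>"
  shows "(g \<longlongrightarrow> 0) (at_right 0)"
proof (rule Lim_null_comparison)
  show "\<forall>\<^sub>F x in at_right 0. norm (g x) \<le> C * x powr \<sigma>"
    using eventually_at_right_less by eventually_elim (rule assms(2))
  have "((\<lambda>x. x powr \<sigma>) \<longlongrightarrow> 0) (at_right 0)"
    using \<open>\<sigma> > 0\<close> by real_asymp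
  then show "((\<lambda>x. C * x powr \<sigma>) \<longlongrightarrow> 0) (at_right 0)"
    using tendsto_mult_right_zero by blast
qed

lemma tendsto_at_top_powr:
  fixes g :: "real \<Rightarrow> complex"
  assumes "\<sigma> > 0" and "\<And>x. x > 0 \<Longrightarrow> norm (g x) \<le> C * x powr (- \<sigma>)"
  shows "(g \<longlongrightarrow> 0) at_top"
proof (rule Lim_null_comparison)
  show "\<forall>\<^sub>F x in at_top. norm (g x) \<le> C * x powr (- \<sigma>)"
    using eventually_gt_at_top[of 0] by eventually_elim (rule assms(2))
  have "((\<lambda>x. x powr (- \<sigma>)) \<longlongrightarrow> 0) at_top"
    using \<open>\<sigma> > 0\<close> by (intro tendsto_neg_powr filterlim_ident) auto
  then show "((\<lambda>x. C * x powr (- \<sigma>)) \<longlongrightarrow> 0) at_top"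
    using tendsto_mult_right_zero by blast
qed

lemma has_vector_derivative_powr_complex:
  assumes "x > 0"
  shows "((\<lambda>x. complex_of_real x powr w) has_vector_derivative w * of_real x powr (w - 1)) (at x)"
  using has_vector_derivative_real_field[of "\<lambda>z. z powr w" "w * of_real x powr (w - 1)" x]
    has_field_derivative_powr[of "of_real x" w] assms
  by (simp add: field_simps has_field_derivative_at_within)

text \<open>
  Integration by parts; the boundary terms vanish because \<open>x^(s + N) (d/dx)^N phi x\<close> is of order \<open>x^(Re s + N)\<close> at \<open>0\<close>
  and \<open>x^(Re s - 1)\<close> at infinity.
\<close>

lemma zeta_left_Suc:
  assumes s: "- real N < Re s" "Re s < 1"
  shows "zeta_left (Suc N) s = zeta_left N s"
proof -
  let ?w = "s + of_nat N"
  let ?d = "\<lambda>n x. (deriv ^^ n) phi (complex_of_real x)"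
  have w: "0 < Re ?w" "Re ?w < real N + 1" using s by auto
  obtain C where C: "C \<ge> 0" "\<And>x. x > 0 \<Longrightarrow> norm (?d N x) \<le> C / (1 + x) powr (real N + 1)"
    using higher_deriv_phi_decay[of N] by metis
  obtain C' where C': "\<And>x. x > 0 \<Longrightarrow> norm (?d (Suc N) x) \<le> C' / (1 + x) powr (real (Suc N) + 1)"
    using higher_deriv_phi_decay[of "Suc N"] by metis
  have i1: "integrable pos_measure (\<lambda>x. of_real x powr (?w - 1) * ?d N x)"
    by (rule mellin_integrable[OF continuous_higher_deriv_phi C(2)]) (use w in auto)
  have i2: "integrable pos_measure (\<lambda>x. of_real x powr ((?w + 1) - 1) * ?d (Suc N) x)"
    by (rule mellin_integrable[OF continuous_higher_deriv_phi C']) (use w in auto)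
  then have i2: "integrable pos_measure (\<lambda>x. of_real x powr ?w * ?d (Suc N) x)" by simp
  have "(\<integral>x. ?w * (of_real x powr (?w - 1) * ?d N x) + of_real x powr ?w * ?d (Suc N) x \<partial>pos_measure) = 0 - 0"
  proof (rule integral_pos_FTC[where F = "\<lambda>x. of_real x powr ?w * ?d N x"])
    fix x :: real assume x: "x > 0"
    have d: "(?d N has_vector_derivative ?d (Suc N) x) (at x)"
      using has_vector_derivative_real_field[of "(deriv ^^ N) phi" "?d (Suc N) x" x]
        has_field_derivative_higher_deriv[OF phi_holomorphic open_phi_domain, of "of_real x" N] x
      by (auto simp: phi_domain_def has_field_derivative_at_within)
    show "((\<lambda>x. of_real x powr ?w * ?d N x) has_vector_derivative
        ?w * (of_real x powr (?w - 1) * ?d N x) + of_real x powr ?w * ?d (Suc N) x) (at x)"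
      using has_vector_derivative_mult[OF has_vector_derivative_powr_complex[OF x, of ?w] d]
      by (simp add: algebra_simps)
  next
    show "continuous_on {0<..} (\<lambda>x. ?w * (of_real x powr (?w - 1) * ?d N x) + of_real x powr ?w * ?d (Suc N) x)"
      by (intro continuous_intros continuous_higher_deriv_phi) auto
    show "integrable pos_measure (\<lambda>x. ?w * (of_real x powr (?w - 1) * ?d N x) + of_real x powr ?w * ?d (Suc N) x)"
      using i1 i2 by simp
    have n: "norm (of_real x powr ?w * ?d N x) \<le> x powr Re ?w * (C / (1 + x) powr (real N + 1))" if "x > 0" for x
      unfolding norm_mult powr_complex_of_real[OF that] by (intro mult_left_mono C(2) that) auto
    show "((\<lambda>x. of_real x powr ?w * ?d N x) \<longlongrightarrow> 0) (at_right 0)"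
    proof (rule tendsto_at_right_0_powr[OF w(1)])
      fix x :: real assume x: "x > 0"
      have "x powr Re ?w * (C / (1 + x) powr (real N + 1)) \<le> x powr Re ?w * (C / 1)"
        using x C(1) by (intro mult_left_mono divide_left_mono ge_one_powr_ge_zero) auto
      then show "norm (of_real x powr ?w * ?d N x) \<le> C * x powr Re ?w" using n[OF x] by (simp add: mult.commute)
    qed
    show "((\<lambda>x. of_real x powr ?w * ?d N x) \<longlongrightarrow> 0) at_top"
    proof (rule tendsto_at_top_powr[of "real N + 1 - Re ?w"])
      fix x :: real assume x: "x > 0"
      have "x powr Re ?w * (C / (1 + x) powr (real N + 1)) \<le> x powr Re ?w * (C / x powr (real N + 1))"
        using x C(1) by (intro mult_left_mono divide_left_mono powr_mono2) auto
      also have "\<dots> = C * x powr (- (real N + 1 - Re ?w))" using x by (simp add: powr_diff powr_add)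
      finally show "norm (of_real x powr ?w * ?d N x) \<le> C * x powr (- (real N + 1 - Re ?w))"
        using n[OF x] by linarith
    qed (use w in auto)
  qed
  then have *: "(\<integral>x. of_real x powr ?w * ?d (Suc N) x \<partial>pos_measure) =
      - (?w * (\<integral>x. of_real x powr (?w - 1) * ?d N x \<partial>pos_measure))"
    using i1 i2 by (simp add: add_eq_0_iff)
  have g: "rGamma (?w + 1) * ?w = rGamma ?w" using rGamma_plus1[of ?w] by (simp add: mult.commute)
  have e: "s + of_nat (Suc N) = ?w + 1" "?w + 1 - 1 = ?w" by simp_all
  show ?thesis
    unfolding zeta_left_def e * g[symmetric] by (simp only: power_Suc mult_ac mult_minus_left mult_minus_right mult_1 minus_minus)
qed

definition bose_remainder :: "real \<Rightarrow> real" where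
  "bose_remainder x = 1 / (exp x - 1) - exp (- x) / x"

text \<open>
  Subtracting \<open>exp (- x) / x\<close>, rather than \<open>1 / x\<close>, from \<open>1 / (exp x - 1)\<close> removes the pole at \<open>0\<close> and keeps the
  exponential decay, so the integral converges for all \<open>Re s > 0\<close>. The Mellin transform of the
  subtracted term is \<open>\<Gamma> (s - 1)\<close>, which contributes \<open>1 / (s - 1)\<close>.
\<close>

definition zeta_right :: "complex \<Rightarrow> complex" where
  "zeta_right s = 1 / (s - 1) + rGamma s *
     (\<integral>x. of_real x powr (s - 1) * of_real (bose_remainder x) \<partial>pos_measure)"

lemma continuous_bose_remainder: "continuous_on {0<..} (\<lambda>x. complex_of_real (bose_remainder x))"
  unfolding bose_remainder_def by (intro continuous_intros) auto

lemma phi_minus_bose_remainder: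
  "x > 0 \<Longrightarrow> phi (of_real x) = of_real (bose_remainder x) - of_real ((1 - exp (- x)) / x)"
  by (simp add: phi_def bose_remainder_def exp_of_real[symmetric] diff_divide_distrib)

lemma bose_remainder_decay:
  obtains C where "\<And>x. x > 0 \<Longrightarrow> norm (complex_of_real (bose_remainder x)) \<le> C / (1 + x) powr real k"
proof -
  obtain B where B: "B \<ge> 0" "\<And>x. x > 0 \<Longrightarrow> norm ((deriv ^^ 0) phi (of_real x)) \<le> B / (1 + x) powr (real 0 + 1)"
    using higher_deriv_phi_decay[of 0] by metis
  have e: "exp (- x) \<le> fact k * exp 1 / (1 + x) ^ k" if "x > 0" for x :: real
  proof -
    have "(\<Sum>n\<in>{k}. (1 + x) ^ n / fact n) \<le> (\<Sum>n. (1 + x) ^ n / fact n)"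
      using exp_converges[of "1 + x"] that
      by (intro sum_le_suminf) (auto simp: sums_iff divide_inverse mult.commute)
    then have "(1 + x) ^ k / fact k \<le> exp (1 + x)"
      by (simp add: exp_def divide_inverse mult.commute)
    then show ?thesis using that by (simp add: exp_minus exp_add field_simps)
  qed
  define C where "C = 3 * (fact k * exp 1) + (B + 1) * 2 ^ k"
  show thesis
  proof (rule that[of C])
    fix x :: real assume x: "x > 0"
    have pw: "(1 + x) powr real k = (1 + x) ^ k" using x by (simp add: powr_realpow)
    show "norm (complex_of_real (bose_remainder x)) \<le> C / (1 + x) powr real k"
    proof (cases "x \<le> 1")
      case True
      have "1 - exp (- x) \<le> x" using exp_ge_add_one_self[of "- x"] by simp
      then have "\<bar>(1 - exp (- x)) / x\<bar> \<le> 1" using x by (simp add: field_simps)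
      moreover have "norm (phi (of_real x)) \<le> B"
      proof -
        have "norm (phi (of_real x)) \<le> B / (1 + x)" using B(2)[OF x] x by simp
        also have "\<dots> \<le> B / 1" using B(1) x by (intro divide_left_mono) auto
        finally show ?thesis by simp
      qed
      moreover have "complex_of_real (bose_remainder x) = phi (of_real x) + of_real ((1 - exp (- x)) / x)"
        using phi_minus_bose_remainder[OF x] by simp
      ultimately have "norm (complex_of_real (bose_remainder x)) \<le> B + 1"
        using norm_triangle_ineq[of "phi (of_real x)" "of_real ((1 - exp (- x)) / x)"]
        by (simp only: norm_of_real)
      also have "B + 1 \<le> C / (1 + x) ^ k"
      proof -
        have "(B + 1) * (1 + x) ^ k \<le> (B + 1) * 2 ^ k"
          using True x B(1) by (intro mult_left_mono power_mono) auto
        also have "\<dots> \<le> C" by (simp add: C_def)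
        finally show ?thesis using x by (simp add: field_simps)
      qed
      finally show ?thesis by (simp add: pw)
    next
      case False
      have "exp x \<ge> 2" using exp_ge_add_one_self[of x] False by linarith
      then have 1: "1 / (exp x - 1) \<le> 2 * exp (- x)" using x by (simp add: exp_minus divide_simps)
      have 2: "exp (- x) / x \<le> exp (- x)" using False by (simp add: field_simps)
      have "0 \<le> 1 / (exp x - 1)" "0 \<le> exp (- x) / x" using x by auto
      then have "\<bar>bose_remainder x\<bar> \<le> 3 * exp (- x)"
        using 1 2 unfolding bose_remainder_def by linarith
      also have "\<dots> \<le> 3 * (fact k * exp 1 / (1 + x) ^ k)" using e[OF x] by simp
      also have "\<dots> \<le> C / (1 + x) ^ k" using x B(1) by (auto simp: C_def intro!: divide_right_mono)
      finally show ?thesis by (simp add: pw)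
    qed
  qed
qed

lemma zeta_right_holomorphic: "zeta_right holomorphic_on {s. Re s > 0} - {1}"
proof -
  have "(\<lambda>w. \<integral>x. of_real x powr (w - 1) * of_real (bose_remainder x) \<partial>pos_measure) holomorphic_on {s. Re s > 0}"
    (is "?I holomorphic_on _")
  proof (rule holomorphic_on_subset)
    show "{s. Re s > 0} \<subseteq> (\<Union>k. {w. 0 < Re w \<and> Re w < real k})"
      using reals_Archimedean2 by auto
    show "?I holomorphic_on (\<Union>k. {w. 0 < Re w \<and> Re w < real k})"
    proof (rule holomorphic_on_UN_open)
      show "open {w. 0 < Re w \<and> Re w < real k}" for k
        by (intro open_Collect_conj open_Collect_less continuous_intros)
      show "?I holomorphic_on {w. 0 < Re w \<and> Re w < real k}" for k
        by (rule bose_remainder_decay[of k], rule mellin_holomorphic[OF continuous_bose_remainder])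
    qed
  qed
  then show ?thesis unfolding zeta_right_def
    by (intro holomorphic_intros) (auto intro: holomorphic_on_subset)
qed

lemma bose_remainder_integrable:
  assumes "Re s > 0"
  shows "integrable pos_measure (\<lambda>x. of_real x powr (s - 1) * of_real (bose_remainder x))"
proof -
  obtain k :: nat where k: "Re s < real k" using reals_Archimedean2 by blast
  obtain C where "\<And>x. x > 0 \<Longrightarrow> norm (complex_of_real (bose_remainder x)) \<le> C / (1 + x) powr real k"
    using bose_remainder_decay[of k] by metis
  from mellin_integrable[OF continuous_bose_remainder this assms k] show ?thesis .
qed

text \<open>
  The two kernels differ by \<open>(1 - exp (- x)) / x\<close>, whose Mellin transform for \<open>0 < Re s < 1\<close> is \<open>- \<Gamma> (s) / (s - 1)\<close> by
  an integration by parts.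
\<close>

lemma zeta_left_0:
  assumes s: "0 < Re s" "Re s < 1"
  shows "zeta_left 0 s = zeta_right s"
proof -
  have s1: "s \<noteq> 1" using s by auto
  obtain C where C: "\<And>x. x > 0 \<Longrightarrow> norm ((deriv ^^ 0) phi (of_real x)) \<le> C / (1 + x) powr (real 0 + 1)"
    using higher_deriv_phi_decay[of 0] by metis
  have i1: "integrable pos_measure (\<lambda>x. of_real x powr (s - 1) * phi (of_real x))"
    using mellin_integrable[OF continuous_higher_deriv_phi C, of s] s by auto
  note i2 = bose_remainder_integrable[OF s(1)]
  let ?q = "\<lambda>x. of_real x powr (s - 2) * complex_of_real (1 - exp (- x))"
  let ?e = "\<lambda>x. of_real x powr (s - 1) * complex_of_real (exp (- x))"
  have q: "of_real x powr (s - 1) * complex_of_real (bose_remainder x) - of_real x powr (s - 1) * phi (of_real x) = ?q x"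
    if "x > 0" for x
  proof -
    have "complex_of_real x powr (s - 1) = of_real x * of_real x powr (s - 2)"
      using that powr_add[of "complex_of_real x" 1 "s - 2"] by simp
    then show ?thesis using that by (simp add: phi_minus_bose_remainder field_simps)
  qed
  have iq: "integrable pos_measure ?q"
    using Bochner_Integration.integrable_diff[OF i2 i1]
    by (subst Bochner_Integration.integrable_cong[OF refl q[symmetric]]) (auto simp: space_restrict_space)
  have Iq: "(\<integral>x. ?q x \<partial>pos_measure) =
      (\<integral>x. of_real x powr (s - 1) * complex_of_real (bose_remainder x) \<partial>pos_measure) -
      (\<integral>x. of_real x powr (s - 1) * phi (of_real x) \<partial>pos_measure)"
    unfolding Bochner_Integration.integral_diff[OF i2 i1, symmetric]
    by (rule Bochner_Integration.integral_cong[OF refl q[symmetric]]) (auto simp: space_restrict_space)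
  have ie: "integrable pos_measure ?e" and Ie: "(\<integral>x. ?e x \<partial>pos_measure) = Gamma s"
    using Gamma_integral_scaled[OF s(1), of 1] by auto
  have "(\<integral>x. (s - 1) * ?q x + ?e x \<partial>pos_measure) = 0 - 0"
  proof (rule integral_pos_FTC[where F = "\<lambda>x. of_real x powr (s - 1) * complex_of_real (1 - exp (- x))"])
    fix x :: real assume x: "x > 0"
    have d: "((\<lambda>x. complex_of_real (1 - exp (- x))) has_vector_derivative of_real (exp (- x))) (at x)"
      by (rule has_vector_derivative_of_real) (auto intro!: derivative_eq_intros simp: has_real_derivative_iff_has_vector_derivative[symmetric])
    show "((\<lambda>x. of_real x powr (s - 1) * complex_of_real (1 - exp (- x))) has_vector_derivative (s - 1) * ?q x + ?e x) (at x)"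
      using has_vector_derivative_mult[OF has_vector_derivative_powr_complex[OF x, of "s - 1"] d]
      by (simp add: algebra_simps)
  next
    show "continuous_on {0<..} (\<lambda>x. (s - 1) * ?q x + ?e x)"
      by (intro continuous_intros) auto
    show "integrable pos_measure (\<lambda>x. (s - 1) * ?q x + ?e x)" using iq ie by simp
    have n: "norm (of_real x powr (s - 1) * complex_of_real (1 - exp (- x))) = x powr (Re s - 1) * (1 - exp (- x))"
      if "x > 0" for x
      using that by (simp only: norm_mult powr_complex_of_real norm_of_real) simp
    show "((\<lambda>x. of_real x powr (s - 1) * complex_of_real (1 - exp (- x))) \<longlongrightarrow> 0) (at_right 0)"
    proof (rule tendsto_at_right_0_powr[OF s(1)])
      fix x :: real assume x: "x > 0"
      have "1 - exp (- x) \<le> x" using exp_ge_add_one_self[of "- x"] by simp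
      then have "x powr (Re s - 1) * (1 - exp (- x)) \<le> x powr (Re s - 1) * x" by (intro mult_left_mono) auto
      then show "norm (of_real x powr (s - 1) * complex_of_real (1 - exp (- x))) \<le> 1 * x powr Re s"
        unfolding n[OF x] using x by (simp add: powr_diff)
    qed
    show "((\<lambda>x. of_real x powr (s - 1) * complex_of_real (1 - exp (- x))) \<longlongrightarrow> 0) at_top"
    proof (rule tendsto_at_top_powr)
      fix x :: real assume x: "x > 0"
      show "norm (of_real x powr (s - 1) * complex_of_real (1 - exp (- x))) \<le> 1 * x powr (- (1 - Re s))"
        unfolding n[OF x] using mult_left_mono[of "1 - exp (- x)" 1 "x powr (Re s - 1)"] by simp
    qed (use s in auto)
  qed
  then have *: "(s - 1) * (\<integral>x. ?q x \<partial>pos_measure) = - Gamma s"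
    using iq ie Ie by (simp add: add_eq_0_iff)
  have "rGamma s * Gamma s = 1"
  proof -
    have "s \<notin> \<int>\<^sub>\<le>\<^sub>0" using s by (auto elim!: nonpos_Ints_cases)
    then show ?thesis by (simp add: rGamma_inverse_Gamma Gamma_eq_zero_iff)
  qed
  then have "(s - 1) * (rGamma s * (\<integral>x. ?q x \<partial>pos_measure)) = - 1"
  proof -
    assume g: "rGamma s * Gamma s = 1"
    have "(s - 1) * (rGamma s * (\<integral>x. ?q x \<partial>pos_measure)) = rGamma s * ((s - 1) * (\<integral>x. ?q x \<partial>pos_measure))"
      by (rule mult.left_commute)
    also have "\<dots> = - (rGamma s * Gamma s)" unfolding * by (rule mult_minus_right)
    finally show ?thesis by (simp only: g)
  qed
  then have "rGamma s * (\<integral>x. ?q x \<partial>pos_measure) = - 1 / (s - 1)"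
    using s1 by (simp add: field_simps)
  then show ?thesis unfolding zeta_left_def zeta_right_def Iq
    by (simp add: algebra_simps)
qed

text \<open>
  Expanding \<open>1 / (exp x - 1)\<close> into a geometric series gives Gamma integrals for the terms \<open>n\<^sup>-\<^sup>s\<close>.
\<close>

lemma zeta_right_dirichlet:
  assumes s: "Re s > 1"
  shows "(\<lambda>n. of_nat (Suc n) powr (- s)) sums zeta_right s"
proof -
  have s0: "Re s > 0" "s \<noteq> 1" using s by auto
  let ?f = "\<lambda>n x. complex_of_real x powr (s - 1) * of_real (exp (- (real (Suc n) * x)))"
  have int: "integrable pos_measure (?f n)" and I: "integral\<^sup>L pos_measure (?f n) = Gamma s * of_nat (Suc n) powr (- s)" for n
    using Gamma_integral_scaled[OF s0(1), of "real (Suc n)"] by simp_all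
  have norm_int: "(\<integral>x. norm (?f n x) \<partial>pos_measure) = Gamma (Re s) * real (Suc n) powr (- Re s)" for n
  proof -
    have "complex_of_real (\<integral>x. norm (?f n x) \<partial>pos_measure) = (\<integral>x. of_real (norm (?f n x)) \<partial>pos_measure)"
      by simp
    also have "\<dots> = (\<integral>x. of_real x powr (of_real (Re s) - 1) * of_real (exp (- (real (Suc n) * x))) \<partial>pos_measure)"
      by (intro Bochner_Integration.integral_cong)
        (auto simp: norm_mult powr_complex_of_real space_restrict_space powr_of_real[symmetric])
    also have "\<dots> = Gamma (of_real (Re s)) * of_real (real (Suc n)) powr (- of_real (Re s))"
      using s0 by (intro Gamma_integral_scaled) auto
    also have "\<dots> = of_real (Gamma (Re s) * real (Suc n) powr (- Re s))"
      by (simp add: Gamma_complex_of_real powr_of_real[symmetric] del: of_nat_Suc)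
    finally show ?thesis by (simp only: of_real_eq_iff)
  qed
  have "(\<lambda>n. integral\<^sup>L pos_measure (?f n)) sums (\<integral>x. (\<Sum>n. ?f n x) \<partial>pos_measure)"
  proof (rule sums_integral[OF int])
    have "summable (\<lambda>n. real (Suc n) powr (- Re s))"
      using s by (subst summable_Suc_iff) (simp add: summable_real_powr_iff)
    then show "summable (\<lambda>n. \<integral>x. norm (?f n x) \<partial>pos_measure)"
      unfolding norm_int by (rule summable_mult)
    show "AE x in pos_measure. summable (\<lambda>n. norm (?f n x))"
    proof (rule AE_I2)
      fix x assume "x \<in> space pos_measure"
      then have x: "x > 0" by (simp add: space_restrict_space)
      have "(\<lambda>n. norm (?f n x)) = (\<lambda>n. x powr (Re s - 1) * exp (- x) * exp (- x) ^ n)"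
        using x by (auto simp: norm_mult powr_complex_of_real fun_eq_iff exp_of_nat_mult[symmetric] exp_add[symmetric] algebra_simps)
      then show "summable (\<lambda>n. norm (?f n x))"
        using x by (auto intro!: summable_mult summable_geometric)
    qed
  qed
  also have "(\<integral>x. (\<Sum>n. ?f n x) \<partial>pos_measure) =
      (\<integral>x. of_real x powr (s - 1) * of_real (bose_remainder x) + of_real x powr (s - 2) * of_real (exp (- x)) \<partial>pos_measure)"
  proof (rule Bochner_Integration.integral_cong[OF refl])
    fix x assume "x \<in> space pos_measure"
    then have x: "x > 0" by (simp add: space_restrict_space)
    have "(\<lambda>n. exp (- x) ^ n) sums (1 / (1 - exp (- x)))"
      using x by (intro geometric_sums) simp
    then have "(\<lambda>n. exp (- x) * exp (- x) ^ n) sums (exp (- x) * (1 / (1 - exp (- x))))"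
      by (rule sums_mult)
    also have "exp (- x) * (1 / (1 - exp (- x))) = 1 / (exp x - 1)"
      using x by (simp add: exp_minus field_simps)
    finally have "(\<lambda>n. complex_of_real (exp (- (real (Suc n) * x)))) sums of_real (1 / (exp x - 1))"
      by (simp only: sums_of_real_iff) (simp add: exp_of_nat_mult[symmetric] exp_add[symmetric] algebra_simps)
    then have "(\<lambda>n. ?f n x) sums (of_real x powr (s - 1) * of_real (1 / (exp x - 1)))"
      by (rule sums_mult)
    then have "(\<Sum>n. ?f n x) = of_real x powr (s - 1) * of_real (1 / (exp x - 1))"
      by (simp add: sums_iff)
    moreover have "complex_of_real x powr (s - 1) = of_real x * of_real x powr (s - 2)"
      using x powr_add[of "complex_of_real x" 1 "s - 2"] by simp
    ultimately show "(\<Sum>n. ?f n x) = of_real x powr (s - 1) * of_real (bose_remainder x) + of_real x powr (s - 2) * of_real (exp (- x))"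
      using x by (simp add: bose_remainder_def algebra_simps)
  qed
  also have "\<dots> = (\<integral>x. of_real x powr (s - 1) * of_real (bose_remainder x) \<partial>pos_measure) + Gamma (s - 1)"
    using bose_remainder_integrable[OF s0(1)] Gamma_integral_scaled[of "s - 1" 1] s
    by (subst Bochner_Integration.integral_add) auto
  finally have "(\<lambda>n. rGamma s * (Gamma s * of_nat (Suc n) powr (- s))) sums
      (rGamma s * ((\<integral>x. of_real x powr (s - 1) * of_real (bose_remainder x) \<partial>pos_measure) + Gamma (s - 1)))"
    unfolding I by (rule sums_mult)
  moreover have np: "s \<notin> \<int>\<^sub>\<le>\<^sub>0" "s - 1 \<notin> \<int>\<^sub>\<le>\<^sub>0" using s by (auto elim!: nonpos_Ints_cases simp: complex_eq_iff)
  moreover have "rGamma s * Gamma s = 1" using np by (simp add: rGamma_inverse_Gamma Gamma_eq_zero_iff)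
  moreover have "rGamma s * Gamma (s - 1) = 1 / (s - 1)"
    using Gamma_plus1[OF np(2)] np s0 by (simp add: rGamma_inverse_Gamma Gamma_eq_zero_iff field_simps)
  ultimately show ?thesis
    by (simp add: zeta_right_def distrib_left mult.assoc[symmetric] add.commute)
qed

lemma zeta_left_consistent:
  assumes "- real N < Re s" "- real M < Re s" "Re s < 1"
  shows "zeta_left N s = zeta_left M s"
proof -
  have *: "zeta_left n s = zeta_left m s" if "n \<le> m" "- real n < Re s" for n m
    using that(1)
  proof (induction m rule: dec_induct)
    case (step k)
    have "zeta_left (Suc k) s = zeta_left k s"
      using step.hyps that(2) assms(3) by (intro zeta_left_Suc) auto
    then show ?case using step.IH by simp
  qed simp
  show ?thesis
  proof (cases "N \<le> M")
    case True
    then show ?thesis using assms(1) by (rule *)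
  next
    case False
    then have "M \<le> N" by simp
    from *[OF this assms(2)] show ?thesis by (rule sym)
  qed
qed

lemma connected_minus_one: "connected (- {1::complex})"
proof -
  have "connected (UNIV - {1::complex})"
    by (intro connected_open_delete) auto
  then show ?thesis by (simp add: Compl_eq_Diff_UNIV)
qed

text \<open>
  Gluing the two Mellin representations along \<open>0 < Re s < 1\<close> gives a function holomorphic off \<open>1\<close> which has the
  Dirichlet series to the right of \<open>1\<close>. The complement of \<open>{1}\<close> is connected, so the definite
  description has exactly this value.
\<close>

theorem riemann_zeta_characterisation:
  shows riemann_zeta_right: "\<And>s. Re s > 0 \<Longrightarrow> s \<noteq> 1 \<Longrightarrow> riemann_zeta s = zeta_right s"
    and riemann_zeta_left: "\<And>s N. - real N < Re s \<Longrightarrow> Re s < 1 \<Longrightarrow> riemann_zeta s = zeta_left N s"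
proof -
  define Z where "Z = (\<lambda>s. if s = 1 then 0 else if Re s > 0 then zeta_right s
    else zeta_left (Suc (nat \<lceil>- Re s\<rceil>)) s)"
  have Zr: "Z s = zeta_right s" if "Re s > 0" "s \<noteq> 1" for s
    using that by (simp add: Z_def)
  have Zl: "Z s = zeta_left N s" if s: "- real N < Re s" "Re s < 1" for s N
  proof (cases "Re s > 0")
    case True
    then have "zeta_left 0 s = zeta_right s" "zeta_left 0 s = zeta_left N s"
      using s by (intro zeta_left_0 zeta_left_consistent; simp)+
    then show ?thesis using s True by (auto simp: Z_def)
  next
    case False
    have "- real (Suc (nat \<lceil>- Re s\<rceil>)) < Re s" using False by linarith
    then have "zeta_left (Suc (nat \<lceil>- Re s\<rceil>)) s = zeta_left N s"
      using s by (intro zeta_left_consistent) auto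
    then show ?thesis using s False by (auto simp: Z_def)
  qed
  have Z: "Z holomorphic_on (- {1})"
  proof -
    let ?A = "{s. Re s > 0} - {1}" and ?B = "\<lambda>N. {s. - real N < Re s \<and> Re s < 1}"
    have oA: "open ?A" by (intro open_Diff open_Collect_less continuous_intros closed_insert closed_empty)
    have oB: "open (?B N)" for N
      by (intro open_Collect_conj open_Collect_less continuous_intros)
    have "Z holomorphic_on ?A"
      using zeta_right_holomorphic by (rule holomorphic_transform) (use Zr in auto)
    moreover have "Z holomorphic_on (\<Union>N. ?B N)"
    proof (rule holomorphic_on_UN_open[OF _ oB])
      show "Z holomorphic_on ?B N" for N
        using zeta_left_holomorphic[of N] by (rule holomorphic_transform) (use Zl in auto)
    qed
    ultimately have "Z holomorphic_on ?A \<union> (\<Union>N. ?B N)"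
      using oA oB by (intro holomorphic_on_Un) auto
    moreover have "- {1} \<subseteq> ?A \<union> (\<Union>N. ?B N)"
    proof
      fix s :: complex assume "s \<in> - {1}"
      moreover obtain N where "- Re s < real N" using reals_Archimedean2 by blast
      then have "- real N < Re s" by simp
      ultimately show "s \<in> ?A \<union> (\<Union>N. ?B N)" by (cases "Re s > 0") auto
    qed
    ultimately show ?thesis by (rule holomorphic_on_subset)
  qed
  have Zd: "(\<lambda>n. of_nat (Suc n) powr (- s)) sums Z s" if "Re s > 1" for s
    using zeta_right_dirichlet[OF that] Zr[of s] that by (cases "s = 1") auto
  have "riemann_zeta = Z"
    unfolding riemann_zeta_def
  proof (rule the_equality)
    show "Z holomorphic_on - {1} \<and> (\<forall>s. Re s > 1 \<longrightarrow> (\<lambda>n. of_nat (Suc n) powr (- s)) sums Z s) \<and> Z 1 = 0"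
      using Z Zd by (simp add: Z_def)
    fix f assume f: "f holomorphic_on - {1} \<and> (\<forall>s. Re s > 1 \<longrightarrow> (\<lambda>n. of_nat (Suc n) powr (- s)) sums f s) \<and> f 1 = 0"
    show "f = Z"
    proof
      fix s
      show "f s = Z s"
      proof (cases "s = 1")
        case False
        show ?thesis
        proof (rule analytic_continuation_open[of "{s. Re s > 1}" "- {1}" f Z])
          show "open {s. 1 < Re s}" by (intro open_Collect_less continuous_intros)
          show "{s. 1 < Re s} \<noteq> {}" by (auto intro: exI[of _ "2::complex"])
          show "f z = Z z" if "z \<in> {s. 1 < Re s}" for z
            using f Zd that by (auto intro: sums_unique2)
        qed (use f Z False connected_minus_one in auto)
      qed (use f in \<open>simp add: Z_def\<close>)
    qed
  qed
  then show "\<And>s. Re s > 0 \<Longrightarrow> s \<noteq> 1 \<Longrightarrow> riemann_zeta s = zeta_right s"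
    and "\<And>s N. - real N < Re s \<Longrightarrow> Re s < 1 \<Longrightarrow> riemann_zeta s = zeta_left N s"
    using Zr Zl by auto
qed

lemma riemann_zeta_dirichlet:
  "Re s > 1 \<Longrightarrow> (\<lambda>n. of_nat (Suc n) powr (- s)) sums riemann_zeta s"
  using zeta_right_dirichlet[of s] riemann_zeta_right[of s] by (cases "s = 1") auto

text \<open>
  All zeta values on a progression \<open>s - j\<close> are thus moments of derivatives of the single function
  \<open>phi\<close>. This is the form in which they meet the Taylor coefficients of the polylogarithm.
\<close>

lemma riemann_zeta_mellin:
  assumes s: "0 < s" "s < 1"
  shows "riemann_zeta (of_real (s - real j)) = of_real (rGamma s) * (-1) ^ j *
     (\<integral>x. of_real (x powr (s - 1)) * (deriv ^^ j) phi (of_real x) \<partial>pos_measure)"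
proof -
  have "(\<integral>x. complex_of_real x powr (of_real s - 1) * (deriv ^^ j) phi (of_real x) \<partial>pos_measure) =
      (\<integral>x. of_real (x powr (s - 1)) * (deriv ^^ j) phi (of_real x) \<partial>pos_measure)"
    by (intro Bochner_Integration.integral_cong) (auto simp: space_restrict_space powr_of_real[symmetric])
  then show ?thesis
    using riemann_zeta_left[of j "of_real (s - real j)"] s
    by (simp add: zeta_left_def rGamma_complex_of_real)
qed

section \<open>The polylogarithm near the origin\<close>

text \<open>
  This is the polylogarithm \<open>Li\<^sub>s (exp (- p))\<close>.
\<close>

definition exp_dirichlet :: "real \<Rightarrow> complex \<Rightarrow> complex" where
  "exp_dirichlet s p = (\<Sum>n. of_real (real (Suc n) powr (- s)) * exp (- (of_nat (Suc n) * p)))"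

lemma summable_powr_exp:
  fixes s q :: real
  assumes "q > 0"
  shows "summable (\<lambda>n. real n powr (- s) * exp (- (real n * q)))"
proof (rule summable_comparison_test_bigo)
  show "summable (\<lambda>n. norm (real n powr (-2)))"
    by (simp add: summable_real_powr_iff)
  show "(\<lambda>n. real n powr (- s) * exp (- (real n * q))) \<in> O(\<lambda>n. real n powr (-2))"
    using assms by real_asymp
qed

lemma summable_exp_dirichlet:
  assumes "Re p > 0"
  shows "summable (\<lambda>n. norm (complex_of_real (real (Suc n) powr (- s)) * exp (- (of_nat (Suc n) * p))))"
proof -
  have "(\<lambda>n. norm (complex_of_real (real (Suc n) powr (- s)) * exp (- (of_nat (Suc n) * p)))) =
      (\<lambda>n. real (Suc n) powr (- s) * exp (- (real (Suc n) * Re p)))"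
    by (auto simp: norm_mult algebra_simps)
  then show ?thesis
    using summable_powr_exp[OF assms, of s] by (subst (asm) summable_Suc_iff[symmetric]) simp
qed

text \<open>
  Termwise differentiation, as a power series in \<open>exp (- p)\<close>.
\<close>

lemma exp_dirichlet_has_derivative:
  assumes p: "Re p > 0"
  shows "(exp_dirichlet s has_field_derivative - exp_dirichlet (s - 1) p) (at p)"
proof -
  define c where "c = (\<lambda>n. complex_of_real (real n powr (- s)))"
  define G where "G = (\<lambda>w::complex. \<Sum>n. c n * w ^ n)"
  have summ: "summable (\<lambda>n. norm (c' n * w ^ n))"
    if "norm w < 1" and c': "c' = (\<lambda>n. complex_of_real (real n powr (- t)))" for w c' t
  proof (cases "w = 0")
    case False
    have "norm (c' n * w ^ n) = real n powr (- t) * exp (- (real n * (- ln (norm w))))" for n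
      using False by (simp add: c' norm_mult norm_power exp_of_nat_mult)
    moreover have "- ln (norm w) > 0" using that False by simp
    ultimately show ?thesis using summable_powr_exp[of "- ln (norm w)" t] by simp
  next
    case True
    then have "(\<lambda>n. norm (c' n * w ^ n)) = (\<lambda>_. 0)"
      by (auto simp: c' fun_eq_iff power_0_left)
    then show ?thesis by simp
  qed
  have exp_eq: "exp_dirichlet t q = (\<Sum>n. of_real (real n powr (- t)) * exp (- q) ^ n)" if "Re q > 0" for t q
  proof -
    have "summable (\<lambda>n. norm (complex_of_real (real n powr (- t)) * exp (- q) ^ n))"
      by (rule summ) (use that in auto)
    then have "summable (\<lambda>n. complex_of_real (real n powr (- t)) * exp (- q) ^ n)"
      by (rule summable_norm_cancel)
    then have "(\<Sum>n. complex_of_real (real n powr (- t)) * exp (- q) ^ n) =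
        (\<Sum>n. complex_of_real (real (Suc n) powr (- t)) * exp (- q) ^ Suc n)"
      by (subst suminf_split_head) simp_all
    then show ?thesis
      by (simp add: exp_dirichlet_def exp_of_nat_mult[symmetric] exp_add[symmetric] algebra_simps)
  qed
  let ?w = "exp (- p)"
  obtain K where K: "norm ?w < K" "K < 1" using dense[of "norm ?w" 1] p by auto
  then have "K > 0" using norm_ge_zero[of ?w] by linarith
  have "(G has_field_derivative (\<Sum>n. diffs c n * ?w ^ n)) (at ?w)"
    unfolding G_def
  proof (rule termdiffs_strong)
    show "summable (\<lambda>n. c n * of_real K ^ n)"
      by (rule summable_norm_cancel, rule summ) (use K \<open>K > 0\<close> in \<open>auto simp: c_def\<close>)
    show "norm ?w < norm (complex_of_real K)" using K \<open>K > 0\<close> by simp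
  qed
  then have "((\<lambda>q. G (exp (- q))) has_field_derivative (\<Sum>n. diffs c n * ?w ^ n) * - ?w) (at p)"
    by (rule DERIV_chain2) (auto intro!: derivative_eq_intros)
  moreover have "(\<Sum>n. diffs c n * ?w ^ n) * - ?w = - exp_dirichlet (s - 1) p"
  proof -
    have "summable (\<lambda>n. norm (complex_of_real (real n powr (- (s - 1))) * ?w ^ n))"
      by (rule summ[where t = "s - 1"]) (use p in auto)
    then have S: "summable (\<lambda>n. complex_of_real (real n powr (- (s - 1))) * ?w ^ n)"
      by (rule summable_norm_cancel)
    have eq: "complex_of_real (real (Suc n) powr (- (s - 1))) * ?w ^ Suc n = diffs c n * ?w ^ n * ?w" for n
    proof -
      have "real (Suc n) powr (- (s - 1)) = real (Suc n) * real (Suc n) powr (- s)"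
        using powr_add[of "real (Suc n)" 1 "- s"] by (simp del: of_nat_Suc)
      then show ?thesis by (simp add: diffs_def c_def del: of_nat_Suc)
    qed
    have "summable (\<lambda>n. diffs c n * ?w ^ n)"
    proof -
      have "summable (\<lambda>n. complex_of_real (real (Suc n) powr (- (s - 1))) * ?w ^ Suc n)"
        using S by (subst summable_Suc_iff)
      then have "summable (\<lambda>n. diffs c n * ?w ^ n * ?w)" by (simp only: eq)
      from summable_mult2[OF this, of "inverse ?w"] show ?thesis by (simp add: mult.assoc)
    qed
    then have "(\<Sum>n. diffs c n * ?w ^ n) * ?w = (\<Sum>n. diffs c n * ?w ^ n * ?w)"
      by (rule suminf_mult2)
    also have "\<dots> = exp_dirichlet (s - 1) p"
      unfolding exp_eq[OF p, of "s - 1"] eq[symmetric] suminf_split_head[OF S] by simp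
    finally show ?thesis by simp
  qed
  moreover have "eventually (\<lambda>q. exp_dirichlet s q = G (exp (- q))) (nhds p)"
  proof -
    have "eventually (\<lambda>q. q \<in> {q. Re q > 0}) (nhds p)"
      using p by (intro eventually_nhds_in_open open_Collect_less continuous_intros) auto
    then show ?thesis by eventually_elim (simp add: exp_eq G_def c_def)
  qed
  ultimately show ?thesis by (subst DERIV_cong_ev[OF refl _ refl]) simp_all
qed

text \<open>
  The polylogarithm without its branch at \<open>p = 0\<close>.
\<close>

definition polylog_regular :: "real \<Rightarrow> complex \<Rightarrow> complex" where
  "polylog_regular s p = exp_dirichlet s p - of_real (Gamma (1 - s)) * p powr (of_real (s - 1))"

lemma not_Ints_shift: "s \<notin> \<int> \<Longrightarrow> s - real k \<notin> \<int>" "s \<notin> \<int> \<Longrightarrow> s + real k \<notin> \<int>"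
  for s :: real
  using Ints_add[of "s - real k" "real k"] Ints_diff[of "s + real k" "real k"] by auto

lemma Gamma_plus1_real_notin_Ints: "(s::real) \<notin> \<int> \<Longrightarrow> Gamma (s + 1) = s * Gamma s"
  by (rule Gamma_plus1) (use nonpos_Ints_Int in blast)

lemma polylog_regular_has_derivative:
  assumes p: "Re p > 0" and s: "s \<notin> \<int>"
  shows "(polylog_regular s has_field_derivative - polylog_regular (s - 1) p) (at p)"
proof -
  have "1 - s \<notin> \<int>" using s Ints_diff[of 1 "1 - s"] by auto
  then have g: "Gamma (1 - (s - 1)) = (1 - s) * Gamma (1 - s)"
    using Gamma_plus1_real_notin_Ints[of "1 - s"] by (simp add: algebra_simps)
  have "p \<notin> \<real>\<^sub>\<le>\<^sub>0" using p by (auto elim!: nonpos_Reals_cases)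
  then show ?thesis
    unfolding polylog_regular_def g
    by (auto intro!: derivative_eq_intros exp_dirichlet_has_derivative[OF p] simp: algebra_simps)
qed

lemma polylog_regular_holomorphic: "s \<notin> \<int> \<Longrightarrow> polylog_regular s holomorphic_on {p. Re p > 0}"
  using polylog_regular_has_derivative
  by (subst holomorphic_on_open) (auto intro!: open_Collect_less continuous_intros)

text \<open>
  Here every family of functions is indexed so that differentiation lowers the exponent by one and
  changes the sign.
\<close>

lemma higher_deriv_ladder:
  assumes "open S" and der: "\<And>k p. p \<in> S \<Longrightarrow> (f k has_field_derivative - f (Suc k) p) (at p)"
    and "p \<in> S"
  shows "(deriv ^^ k) (f 0) p = (-1) ^ k * f k p"
  using \<open>p \<in> S\<close>
proof (induction k arbitrary: p)
  case (Suc k)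
  have "eventually (\<lambda>q. (deriv ^^ k) (f 0) q = (-1) ^ k * f k q) (nhds p)"
    using eventually_nhds_in_open[OF \<open>open S\<close> Suc.prems] by eventually_elim (rule Suc.IH)
  then have "deriv ((deriv ^^ k) (f 0)) p = deriv (\<lambda>q. (-1) ^ k * f k q) p"
    by (rule deriv_cong_ev) simp
  also have "\<dots> = (-1) ^ k * - f (Suc k) p"
    by (intro DERIV_imp_deriv DERIV_cmult der Suc.prems)
  finally show ?case by simp
qed simp

lemma higher_deriv_polylog_regular:
  assumes "Re p > 0" "s \<notin> \<int>"
  shows "(deriv ^^ k) (polylog_regular s) p = (-1) ^ k * polylog_regular (s - real k) p"
proof -
  have "(deriv ^^ k) (polylog_regular (s - real 0)) p = (-1) ^ k * polylog_regular (s - real k) p"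
  proof (rule higher_deriv_ladder)
    show "open {p. Re p > 0}" by (intro open_Collect_less continuous_intros)
    show "(polylog_regular (s - real k) has_field_derivative - polylog_regular (s - real (Suc k)) p) (at p)"
      if "p \<in> {p. Re p > 0}" for k p
      using polylog_regular_has_derivative[of p "s - real k"] not_Ints_shift(1)[OF assms(2), of k] that
      by (simp add: algebra_simps)
  qed (use assms in auto)
  then show ?thesis by simp
qed

lemma holomorphic_eq_from_real_ray:
  fixes a :: real
  assumes "f holomorphic_on S" "g holomorphic_on S" "open S" "connected S"
    and ray: "\<And>x. x > a \<Longrightarrow> of_real x \<in> S" "\<And>x. x > a \<Longrightarrow> f (of_real x) = g (of_real x)"
    and "p \<in> S"
  shows "f p = g p"
proof -
  have "f p - g p = 0"
  proof (rule analytic_continuation[of "\<lambda>p. f p - g p" S "of_real ` {a<..}" "of_real (a + 1)"])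
    show "complex_of_real (a + 1) islimpt of_real ` {a<..}"
    proof (rule islimptI)
      fix T assume T: "complex_of_real (a + 1) \<in> T" "open T"
      then obtain e where e: "e > 0" "ball (complex_of_real (a + 1)) e \<subseteq> T"
        using open_contains_ball by blast
      then have "complex_of_real (a + 1 + e / 2) \<in> T"
        by (auto simp: dist_norm subset_iff norm_of_real simp flip: of_real_diff)
      then show "\<exists>y\<in>of_real ` {a<..}. y \<in> T \<and> y \<noteq> complex_of_real (a + 1)"
        using e by (intro bexI[of _ "of_real (a + 1 + e / 2)"]) (auto simp del: of_real_add)
    qed
    show "complex_of_real (a + 1) \<in> S" by (rule ray(1)) simp
  qed (use assms in \<open>auto intro!: holomorphic_intros\<close>)
  then show ?thesis by simp
qed

text \<open>
  The bound \<open>-8\<close> is below \<open>- 2 \<pi>\<close>, so that the strip contains the disc of radius \<open>2 \<pi>\<close> about \<open>0\<close>.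
\<close>

definition polylog_strip :: "complex set" where
  "polylog_strip = {p. Re p > -8 \<and> \<bar>Im p\<bar> < 2 * pi}"

lemma polylog_strip: "open polylog_strip" "convex polylog_strip" "0 \<in> polylog_strip"
proof -
  have *: "polylog_strip = {p. Re p > -8} \<inter> {p. Im p < 2 * pi} \<inter> {p. Im p > - (2 * pi)}"
    by (auto simp: polylog_strip_def)
  show "open polylog_strip" unfolding polylog_strip_def
    by (intro open_Collect_conj open_Collect_less continuous_intros)
  show "convex polylog_strip" unfolding *
    by (intro convex_Int convex_halfspace_Re_gt convex_halfspace_Im_lt convex_halfspace_Im_gt)
  show "0 \<in> polylog_strip" by (simp add: polylog_strip_def)
qed

text \<open>
  Prescribing all derivatives at \<open>0\<close>, and not only the value, makes the predicate stable under differentiation and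
  integration, which move \<open>s\<close> by integers.
\<close>

definition polylog_extension :: "real \<Rightarrow> (complex \<Rightarrow> complex) \<Rightarrow> bool" where
  "polylog_extension s R \<longleftrightarrow> R holomorphic_on polylog_strip \<and>
     (\<forall>p>0. R (of_real p) = polylog_regular s (of_real p)) \<and>
     (\<forall>k. (deriv ^^ k) R 0 = (-1) ^ k * riemann_zeta (of_real (s - real k)))"

lemma polylog_extension_eq:
  assumes R: "polylog_extension s R" and s: "s \<notin> \<int>" and p: "p \<in> polylog_strip" "Re p > 0"
  shows "R p = polylog_regular s p"
    and "(deriv ^^ k) R p = (-1) ^ k * polylog_regular (s - real k) p"
proof -
  let ?S = "polylog_strip \<inter> {p. Re p > 0}"
  have S: "open ?S" "connected ?S"
    using polylog_strip by (auto intro!: open_Int open_Collect_less continuous_intros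
      convex_connected convex_Int convex_halfspace_Re_gt)
  have hol: "R holomorphic_on ?S" "polylog_regular s holomorphic_on ?S"
    using R polylog_regular_holomorphic[OF s] unfolding polylog_extension_def
    by (auto intro: holomorphic_on_subset)
  have eq: "R q = polylog_regular s q" if "q \<in> ?S" for q
    by (rule holomorphic_eq_from_real_ray[OF hol S, of 0])
      (use R that in \<open>auto simp: polylog_extension_def polylog_strip_def\<close>)
  then show "R p = polylog_regular s p" using p by auto
  have "(deriv ^^ k) R p = (deriv ^^ k) (polylog_regular s) p"
    by (rule higher_deriv_transform_within_open[OF hol S(1) _ eq]) (use p in auto)
  then show "(deriv ^^ k) R p = (-1) ^ k * polylog_regular (s - real k) p"
    using higher_deriv_polylog_regular[OF p(2) s] by simp
qed

text \<open>
  Expanding \<open>1 / (exp (x + p) - 1)\<close> geometrically gives the polylogarithm, and the term \<open>1 / (x + p)\<close> of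
  the kernel gives exactly the singular part.
\<close>

lemma polylog_regular_integral:
  assumes s: "0 < s" "s < 1" and p: "p > 0"
  shows "of_real (rGamma s) * (\<integral>x. of_real (x powr (s - 1)) * phi (of_real x + of_real p) \<partial>pos_measure)
    = polylog_regular s (of_real p)"
proof -
  let ?f = "\<lambda>n x. (complex_of_real x powr (of_real s - 1) * of_real (exp (- (real (Suc n) * x)))) * of_real (exp (- (real (Suc n) * p)))"
  have pw: "complex_of_real x powr (of_real s - 1) = of_real (x powr (s - 1))" if "x > 0" for x
    using that powr_of_real[of x "s - 1"] by simp
  have G: "Gamma (complex_of_real s) = of_real (Gamma s)" by (rule Gamma_complex_of_real)
  have rG: "rGamma s * Gamma s = 1"
    using Gamma_real_pos[OF s(1)] by (simp add: rGamma_inverse_Gamma)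
  have int: "integrable pos_measure (?f n)"
    and I: "integral\<^sup>L pos_measure (?f n) = of_real (Gamma s) * (of_real (real (Suc n) powr (- s)) * exp (- (of_nat (Suc n) * of_real p)))" for n
    using Gamma_integral_scaled[of "of_real s" "real (Suc n)"] s
    by (simp_all add: G powr_of_real[symmetric] exp_of_real[symmetric] del: of_nat_Suc)
  have norm_int: "(\<integral>x. norm (?f n x) \<partial>pos_measure) = norm (integral\<^sup>L pos_measure (?f n))" for n
  proof -
    have "(\<integral>x. complex_of_real (norm (?f n x)) \<partial>pos_measure) = integral\<^sup>L pos_measure (?f n)"
      by (intro Bochner_Integration.integral_cong) (auto simp: space_restrict_space pw norm_mult)
    then have 1: "complex_of_real (\<integral>x. norm (?f n x) \<partial>pos_measure) = integral\<^sup>L pos_measure (?f n)"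
      unfolding integral_complex_of_real .
    have 2: "(\<integral>x. norm (?f n x) \<partial>pos_measure) \<ge> 0"
      by (rule Bochner_Integration.integral_nonneg) (rule norm_ge_zero)
    show ?thesis unfolding 1[symmetric] norm_of_real using 2 by (rule abs_of_nonneg[symmetric])
  qed
  have "(\<lambda>n. integral\<^sup>L pos_measure (?f n)) sums (\<integral>x. (\<Sum>n. ?f n x) \<partial>pos_measure)"
  proof (rule sums_integral[OF int])
    show "summable (\<lambda>n. \<integral>x. norm (?f n x) \<partial>pos_measure)"
      unfolding norm_int I norm_mult[of "of_real (Gamma s)"]
      by (intro summable_mult summable_exp_dirichlet) (use p in simp)
    show "AE x in pos_measure. summable (\<lambda>n. norm (?f n x))"
    proof (rule AE_I2)
      fix x assume "x \<in> space pos_measure"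
      then have x: "x > 0" by (simp add: space_restrict_space)
      have "(\<lambda>n. norm (?f n x)) = (\<lambda>n. x powr (s - 1) * exp (- (x + p)) * exp (- (x + p)) ^ n)"
        using x by (auto simp: norm_mult powr_complex_of_real fun_eq_iff exp_of_nat_mult[symmetric] exp_add[symmetric] algebra_simps)
      then show "summable (\<lambda>n. norm (?f n x))"
        using x p by (auto intro!: summable_mult summable_geometric)
    qed
  qed
  then have e1: "(\<Sum>n. integral\<^sup>L pos_measure (?f n)) = (\<integral>x. (\<Sum>n. ?f n x) \<partial>pos_measure)"
    by (simp add: sums_iff)
  have e2: "(\<Sum>n. integral\<^sup>L pos_measure (?f n)) = of_real (Gamma s) * exp_dirichlet s (of_real p)"
    unfolding I exp_dirichlet_def
    by (rule suminf_mult[OF summable_norm_cancel[OF summable_exp_dirichlet]]) (use p in simp)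
  have e3: "(\<integral>x. (\<Sum>n. ?f n x) \<partial>pos_measure) =
      (\<integral>x. of_real (x powr (s - 1)) * phi (of_real x + of_real p) + of_real (x powr (s - 1) / (x + p)) \<partial>pos_measure)"
  proof (rule Bochner_Integration.integral_cong[OF refl])
    fix x assume "x \<in> space pos_measure"
    then have x: "x > 0" by (simp add: space_restrict_space)
    let ?u = "x + p"
    have u: "?u > 0" using x p by simp
    have "(\<lambda>n. exp (- ?u) ^ n) sums (1 / (1 - exp (- ?u)))"
      using u by (intro geometric_sums) simp
    then have "(\<lambda>n. exp (- ?u) * exp (- ?u) ^ n) sums (exp (- ?u) * (1 / (1 - exp (- ?u))))"
      by (rule sums_mult)
    also have "exp (- ?u) * (1 / (1 - exp (- ?u))) = 1 / (exp ?u - 1)"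
    proof -
      have "exp ?u \<noteq> 1" using u by simp
      then have "exp (- ?u) * (exp ?u - 1) = 1 - exp (- ?u)" "1 - exp (- ?u) \<noteq> 0"
        using u by (simp_all add: right_diff_distrib flip: exp_add)
      then show ?thesis using \<open>exp ?u \<noteq> 1\<close> by (simp add: field_simps)
    qed
    finally have "(\<lambda>n. x powr (s - 1) * (exp (- ?u) * exp (- ?u) ^ n)) sums (x powr (s - 1) * (1 / (exp ?u - 1)))"
      by (rule sums_mult)
    then have "(\<lambda>n. complex_of_real (x powr (s - 1) * (exp (- ?u) * exp (- ?u) ^ n))) sums of_real (x powr (s - 1) * (1 / (exp ?u - 1)))"
      by (simp only: sums_of_real_iff)
    moreover have "complex_of_real (x powr (s - 1) * (exp (- ?u) * exp (- ?u) ^ n)) = ?f n x" for n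
      unfolding pw[OF x] of_real_mult[symmetric]
      by (simp add: exp_of_nat_mult[symmetric] exp_add[symmetric] algebra_simps flip: of_real_mult)
    ultimately have f1: "(\<Sum>n. ?f n x) = of_real (x powr (s - 1) * (1 / (exp ?u - 1)))"
      by (simp add: sums_iff)
    have f2: "phi (of_real x + of_real p) = of_real (1 / (exp ?u - 1) - 1 / ?u)"
      using u by (simp add: phi_def exp_of_real[symmetric] flip: of_real_add)
    show "(\<Sum>n. ?f n x) = of_real (x powr (s - 1)) * phi (of_real x + of_real p) + of_real (x powr (s - 1) / (x + p))"
      unfolding f1 f2
      unfolding of_real_mult[symmetric] of_real_add[symmetric] by (simp add: right_diff_distrib)
  qed
  have i2: "integrable pos_measure (\<lambda>x. complex_of_real (x powr (s - 1) / (x + p)))"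
    using Beta_integral_pos(1)[OF s p] by (rule integrable_of_real)
  have i1: "integrable pos_measure (\<lambda>x. complex_of_real (x powr (s - 1)) * phi (of_real x + of_real p))"
  proof (rule pos_integrable_bound)
    show "integrable pos_measure (\<lambda>x. 2 * (x powr (s - 1) / (x + p)))"
      using Beta_integral_pos(1)[OF s p] by (rule integrable_mult_right)
    have "continuous_on {0<..} (\<lambda>x. phi (complex_of_real x + of_real p))"
      by (rule continuous_on_compose2[OF holomorphic_on_imp_continuous_on[OF phi_holomorphic]])
        (use p in \<open>auto simp: phi_domain_def intro!: continuous_intros\<close>)
    then show "continuous_on {0<..} (\<lambda>x. complex_of_real (x powr (s - 1)) * phi (of_real x + of_real p))"
      by (intro continuous_intros) auto
    fix x :: real assume x: "x > 0"
    have "norm (phi (of_real x + of_real p)) \<le> 2 / (x + p)"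
      using norm_phi_le[of "of_real x + of_real p"] x p by simp
    then have "x powr (s - 1) * norm (phi (of_real x + of_real p)) \<le> x powr (s - 1) * (2 / (x + p))"
      by (intro mult_left_mono) auto
    then show "norm (complex_of_real (x powr (s - 1)) * phi (of_real x + of_real p)) \<le> 2 * (x powr (s - 1) / (x + p))"
      by (simp add: norm_mult mult_ac)
  qed
  have "of_real (Gamma s) * exp_dirichlet s (of_real p) =
      (\<integral>x. of_real (x powr (s - 1)) * phi (of_real x + of_real p) \<partial>pos_measure) +
      of_real (\<integral>x. x powr (s - 1) / (x + p) \<partial>pos_measure)"
    unfolding e2[symmetric] e1 e3 Bochner_Integration.integral_add[OF i1 i2] integral_complex_of_real ..
  then have *: "(\<integral>x. of_real (x powr (s - 1)) * phi (of_real x + of_real p) \<partial>pos_measure) =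
      of_real (Gamma s) * (exp_dirichlet s (of_real p) - of_real (Gamma (1 - s) * p powr (s - 1)))"
    using Beta_integral_pos(2)[OF s p] by (simp add: algebra_simps)
  have "complex_of_real (rGamma s) * of_real (Gamma s) = 1"
    using rG by (metis of_real_1 of_real_mult)
  then show ?thesis
    unfolding * polylog_regular_def using p powr_of_real[of p "s - 1"]
    by (simp add: mult.assoc[symmetric])
qed

lemma higher_deriv_cmult_shift_phi:
  assumes "of_real x + p \<in> phi_domain"
  shows "(deriv ^^ n) (\<lambda>p. c * phi (of_real x + p)) p = c * (deriv ^^ n) phi (of_real x + p)"
proof -
  let ?S = "{p. of_real x + p \<in> phi_domain}"
  have S: "open ?S"
    using open_vimage[OF open_phi_domain, of "\<lambda>p. of_real x + p"] by (simp add: vimage_def continuous_intros)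
  have hol: "(\<lambda>p. phi (of_real x + p)) holomorphic_on ?S"
  proof -
    have "(phi \<circ> (\<lambda>p. of_real x + p)) holomorphic_on ?S"
      by (rule holomorphic_on_compose_gen[OF _ phi_holomorphic]) (auto intro!: holomorphic_intros)
    then show ?thesis by (simp add: o_def)
  qed
  have "(deriv ^^ n) (\<lambda>p. phi (1 * p + of_real x)) p = 1 ^ n * (deriv ^^ n) phi (1 * p + of_real x)"
    by (rule higher_deriv_compose_linear'[OF phi_holomorphic S open_phi_domain]) (use assms in \<open>auto simp: add.commute\<close>)
  then have "(deriv ^^ n) (\<lambda>p. phi (of_real x + p)) p = (deriv ^^ n) phi (of_real x + p)"
    by (simp add: add.commute)
  then show ?thesis using higher_deriv_cmult[OF hol _ S, of p n c] assms by simp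
qed

text \<open>
  The integral still converges for \<open>p\<close> in the strip, because \<open>phi\<close> is holomorphic there. Its derivatives at \<open>p = 0\<close>
  are the Mellin integrals of \<open>riemann_zeta_mellin\<close>.
\<close>

lemma polylog_extension_base:
  assumes s: "0 < s" "s < 1"
  shows "polylog_extension s (\<lambda>p. of_real (rGamma s) *
    (\<integral>x. of_real (x powr (s - 1)) * phi (of_real x + p) \<partial>pos_measure))"
proof -
  let ?f = "\<lambda>x p. complex_of_real (x powr (s - 1)) * phi (of_real x + p)"
  let ?I = "\<lambda>p. \<integral>x. ?f x p \<partial>pos_measure"
  have dom: "complex_of_real x + p \<in> phi_domain" if "p \<in> polylog_strip" for x p
    using that by (simp add: phi_domain_def polylog_strip_def)
  have loc: "\<exists>r>0. ball p0 r \<subseteq> polylog_strip \<and> ?I holomorphic_on ball p0 r \<and>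
      (\<forall>n. (deriv ^^ n) ?I p0 = (\<integral>x. (deriv ^^ n) (?f x) p0 \<partial>pos_measure))"
    if p0: "p0 \<in> polylog_strip" for p0
  proof -
    obtain r where r: "r > 0" "cball p0 r \<subseteq> polylog_strip"
      using polylog_strip(1) p0 open_contains_cball by blast
    have "\<bar>Im p0\<bar> + r < 2 * pi"
    proof -
      have "p0 + of_real r * \<i> \<in> cball p0 r" "p0 - of_real r * \<i> \<in> cball p0 r"
        using r by (auto simp: dist_norm norm_mult)
      then have "p0 + of_real r * \<i> \<in> polylog_strip" "p0 - of_real r * \<i> \<in> polylog_strip" using r by blast+
      then show ?thesis by (auto simp: polylog_strip_def)
    qed
    then obtain C where C: "C \<ge> 0" "\<And>u. \<bar>Im u\<bar> \<le> \<bar>Im p0\<bar> + r \<Longrightarrow> Re u \<ge> -10 \<Longrightarrow> norm (phi u) \<le> C / (20 + Re u)"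
      using phi_decay[of "\<bar>Im p0\<bar> + r"] by metis
    have meas: "(\<lambda>x. ?f x p) \<in> borel_measurable pos_measure" if "p \<in> ball p0 r" for p
    proof (rule pos_measurable)
      have "p \<in> polylog_strip" using that r by (auto simp: subset_iff)
      then have "continuous_on {0<..} (\<lambda>x. phi (complex_of_real x + p))"
        by (intro continuous_on_compose2[OF holomorphic_on_imp_continuous_on[OF phi_holomorphic]])
          (auto intro!: continuous_intros dom)
      then show "continuous_on {0<..} (\<lambda>x. ?f x p)" by (intro continuous_intros) auto
    qed
    have hol: "?f x holomorphic_on ball p0 r" for x
    proof -
      have "(phi \<circ> (\<lambda>p. of_real x + p)) holomorphic_on ball p0 r"
      proof (rule holomorphic_on_compose_gen[OF _ phi_holomorphic])
        show "(\<lambda>p. complex_of_real x + p) ` ball p0 r \<subseteq> phi_domain"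
          using r by (intro image_subsetI dom) auto
      qed (intro holomorphic_intros)
      then show ?thesis by (intro holomorphic_intros) (simp add: o_def)
    qed
    have bound: "norm (?f x p) \<le> C * (x powr (s - 1) / (1 + x) powr 1)"
      if "x \<in> space pos_measure" "p \<in> ball p0 r" for x p
    proof -
      have x: "x > 0" using that by (simp add: space_restrict_space)
      have "p \<in> polylog_strip" using that r by (auto simp: subset_iff)
      then have "Re p > -8" by (simp add: polylog_strip_def)
      have "\<bar>Im p\<bar> \<le> \<bar>Im p0\<bar> + r"
        using that abs_Im_le_cmod[of "p0 - p"] by (auto simp: dist_norm)
      then have "norm (phi (of_real x + p)) \<le> C / (20 + Re (of_real x + p))"
        using \<open>Re p > -8\<close> x by (intro C(2)) auto
      also have "\<dots> \<le> C / (1 + x)" using \<open>Re p > -8\<close> x C(1) by (intro divide_left_mono) auto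
      finally have "x powr (s - 1) * norm (phi (of_real x + p)) \<le> x powr (s - 1) * (C / (1 + x))"
        by (intro mult_left_mono) auto
      then show ?thesis using x by (simp add: norm_mult mult_ac)
    qed
    have int: "integrable pos_measure (\<lambda>x. C * (x powr (s - 1) / (1 + x) powr 1))"
      using s by (intro integrable_mult_right pos_integrable_powr_weight) auto
    show ?thesis
      using holomorphic_param_integral(1,2)[OF \<open>r > 0\<close> meas hol bound int] r
      by (intro exI[of _ r]) (auto simp: subset_iff)
  qed
  have hol: "?I holomorphic_on polylog_strip"
    unfolding holomorphic_on_open[OF polylog_strip(1)]
  proof
    fix p0 assume "p0 \<in> polylog_strip"
    then obtain r where "r > 0" "?I holomorphic_on ball p0 r" using loc by blast
    then show "\<exists>f'. (?I has_field_derivative f') (at p0)" by (auto simp: holomorphic_on_open)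
  qed
  have der: "(deriv ^^ n) (\<lambda>p. of_real (rGamma s) * ?I p) 0 = (-1) ^ n * riemann_zeta (of_real (s - real n))" for n
  proof -
    have "(deriv ^^ n) ?I 0 = (\<integral>x. (deriv ^^ n) (?f x) 0 \<partial>pos_measure)"
      using loc[OF polylog_strip(3)] by blast
    also have "\<dots> = (\<integral>x. of_real (x powr (s - 1)) * (deriv ^^ n) phi (of_real x) \<partial>pos_measure)"
    proof -
      have "(deriv ^^ n) (?f x) 0 = of_real (x powr (s - 1)) * (deriv ^^ n) phi (of_real x)" for x
        using higher_deriv_cmult_shift_phi[of x 0 n "of_real (x powr (s - 1))"] dom[OF polylog_strip(3), of x]
        by simp
      then show ?thesis by simp
    qed
    finally have *: "(deriv ^^ n) (\<lambda>p. of_real (rGamma s) * ?I p) 0 = of_real (rGamma s) *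
        (\<integral>x. of_real (x powr (s - 1)) * (deriv ^^ n) phi (of_real x) \<partial>pos_measure)"
      using higher_deriv_cmult[OF hol polylog_strip(3,1)] by simp
    have "(-1) ^ n * (r * (-1) ^ n * z) = r * z" for r z :: complex
    proof -
      have "(-1) ^ n * (r * (-1) ^ n * z) = ((-1) ^ n * (-1) ^ n) * (r * z)" by (simp only: mult_ac)
      then show ?thesis by (simp flip: power_mult_distrib)
    qed
    then show ?thesis unfolding * riemann_zeta_mellin[OF s] by (rule sym)
  qed
  show ?thesis unfolding polylog_extension_def
    using hol der polylog_regular_integral[OF s] by (auto intro!: holomorphic_intros)
qed

lemma polylog_extension_step_down:
  assumes R: "polylog_extension s R" and s: "s \<notin> \<int>"
  shows "polylog_extension (s - 1) (\<lambda>p. - deriv R p)"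
  unfolding polylog_extension_def
proof (intro conjI allI impI)
  have hol: "R holomorphic_on polylog_strip" using R by (simp add: polylog_extension_def)
  have hold: "deriv R holomorphic_on polylog_strip"
    using hol polylog_strip(1) by (rule holomorphic_deriv)
  then show "(\<lambda>p. - deriv R p) holomorphic_on polylog_strip" by (rule holomorphic_on_minus)
  show "- deriv R (of_real p) = polylog_regular (s - 1) (of_real p)" if "p > 0" for p
    using polylog_extension_eq(2)[OF R s, of "of_real p" 1] that by (simp add: polylog_strip_def)
  fix k
  have "(deriv ^^ k) (\<lambda>p. - deriv R p) 0 = - (deriv ^^ k) (deriv R) 0"
    by (rule higher_deriv_uminus[OF hold polylog_strip(1,3)])
  also have "(deriv ^^ k) (deriv R) 0 = (deriv ^^ Suc k) R 0"
    by (simp add: funpow_Suc_right del: funpow.simps)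
  also have "\<dots> = (-1) ^ Suc k * riemann_zeta (of_real (s - real (Suc k)))"
    using R unfolding polylog_extension_def by blast
  finally show "(deriv ^^ k) (\<lambda>p. - deriv R p) 0 = (-1) ^ k * riemann_zeta (of_real (s - 1 - real k))"
    by (simp add: algebra_simps)
qed

text \<open>
  Abel's theorem for the absolutely convergent Dirichlet series; the singular part \<open>p^(s - 1)\<close> vanishes as \<open>s > 1\<close>.
\<close>

lemma polylog_regular_limit:
  assumes "s > 1"
  shows "((\<lambda>p. polylog_regular s (of_real p)) \<longlongrightarrow> riemann_zeta (of_real s)) (at_right 0)"
proof -
  let ?t = "\<lambda>n p. complex_of_real (real (Suc n) powr (- s)) * exp (- (of_nat (Suc n) * complex_of_real p))"
  have summ: "summable (\<lambda>n. real (Suc n) powr (- s))"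
    using assms by (subst summable_Suc_iff) (simp add: summable_real_powr_iff)
  have "uniform_limit {0..} (\<lambda>N p. \<Sum>n<N. ?t n p) (\<lambda>p. \<Sum>n. ?t n p) sequentially"
  proof (rule Weierstrass_m_test[OF _ summ])
    fix n p assume "p \<in> {0::real..}"
    then have "real (Suc n) powr (- s) * exp (- (real (Suc n) * p)) \<le> real (Suc n) powr (- s) * 1"
      by (intro mult_left_mono) auto
    then show "norm (?t n p) \<le> real (Suc n) powr (- s)" by (simp add: norm_mult del: of_nat_Suc)
  qed
  then have "continuous_on {0..} (\<lambda>p. \<Sum>n. ?t n p)"
    by (rule uniform_limit_theorem[rotated]) (auto intro!: always_eventually continuous_intros)
  then have "continuous_on {0..} (\<lambda>p. exp_dirichlet s (complex_of_real p))"
    by (simp add: exp_dirichlet_def)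
  then have "((\<lambda>p. exp_dirichlet s (complex_of_real p)) \<longlongrightarrow> exp_dirichlet s (of_real 0)) (at 0 within {0..})"
    unfolding continuous_on_def by (rule bspec) simp
  then have "((\<lambda>p. exp_dirichlet s (complex_of_real p)) \<longlongrightarrow> exp_dirichlet s 0) (at_right 0)"
    by (rule tendsto_within_subset[THEN tendsto_eq_rhs]) auto
  moreover have "exp_dirichlet s 0 = riemann_zeta (of_real s)"
    using riemann_zeta_dirichlet[of "of_real s"] assms powr_of_real[of "real (Suc _)" "- s"]
    by (simp add: exp_dirichlet_def sums_iff)
  moreover have "((\<lambda>p. complex_of_real (Gamma (1 - s) * p powr (s - 1))) \<longlongrightarrow> of_real (Gamma (1 - s) * 0)) (at_right 0)"
    using assms by (intro tendsto_intros) real_asymp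
  ultimately have "((\<lambda>p. exp_dirichlet s (complex_of_real p) - of_real (Gamma (1 - s) * p powr (s - 1)))
      \<longlongrightarrow> riemann_zeta (of_real s) - 0) (at_right 0)"
    by (intro tendsto_diff) simp_all
  moreover have "eventually (\<lambda>p. exp_dirichlet s (complex_of_real p) - of_real (Gamma (1 - s) * p powr (s - 1))
      = polylog_regular s (of_real p)) (at_right 0)"
    using eventually_at_right_less
  proof eventually_elim
    fix p :: real assume "0 < p"
    then show "exp_dirichlet s (complex_of_real p) - of_real (Gamma (1 - s) * p powr (s - 1)) = polylog_regular s (of_real p)"
      using powr_of_real[of p "s - 1"] by (simp add: polylog_regular_def)
  qed
  ultimately show ?thesis by (simp add: Lim_transform_eventually)
qed

text \<open>
  A primitive of \<open>R\<close> is determined up to a constant, and the limit at \<open>0\<close> identifies the constant as \<open>\<zeta> (s + 1)\<close>.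
\<close>

lemma polylog_extension_step_up:
  assumes R: "polylog_extension s R" and s: "s \<notin> \<int>" "s > 0"
  shows "\<exists>R'. polylog_extension (s + 1) R'"
proof -
  let ?S = "polylog_strip \<inter> {p. Re p > 0}"
  have hol: "R holomorphic_on polylog_strip" using R by (simp add: polylog_extension_def)
  obtain G where G: "\<And>p. p \<in> polylog_strip \<Longrightarrow> (G has_field_derivative R p) (at p)"
    using holomorphic_convex_primitive'[OF polylog_strip(2,1) hol] polylog_strip(1)
    by (metis at_within_open)
  \<comment> \<open>Normalised to take the value \<open>\<zeta> (s + 1)\<close> at \<open>0\<close>; it remains to see that it extends the polylogarithm.\<close>
  define R' where "R' = (\<lambda>p. riemann_zeta (of_real (s + 1)) + G 0 - G p)"
  have R': "(R' has_field_derivative - R p) (at p)" if "p \<in> polylog_strip" for p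
    unfolding R'_def using G[OF that] by (auto intro!: derivative_eq_intros)
  have s1: "s + 1 \<notin> \<int>" using not_Ints_shift(2)[OF s(1), of 1] by simp
  have zero: "((\<lambda>p. R' p - polylog_regular (s + 1) p) has_field_derivative 0) (at p)" if "p \<in> ?S" for p
    using DERIV_diff[OF R' polylog_regular_has_derivative[OF _ s1], of p] that
      polylog_extension_eq(1)[OF R s(1), of p] by simp
  have S: "connected ?S" "open ?S"
    using polylog_strip by (auto intro!: open_Int open_Collect_less continuous_intros
      convex_connected convex_Int convex_halfspace_Re_gt)
  have "continuous_on ?S (\<lambda>p. R' p - polylog_regular (s + 1) p)"
    using zero by (meson DERIV_isCont continuous_at_imp_continuous_on)
  then have "(\<lambda>p. R' p - polylog_regular (s + 1) p) constant_on ?S"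
    using S zero by (intro DERIV_zero_connected_constant_on[of _ "{}"]) auto
  then have "\<exists>c. \<forall>p\<in>?S. R' p - polylog_regular (s + 1) p = c"
    by (simp add: constant_on_def)
  then obtain c where c: "\<And>p. p \<in> ?S \<Longrightarrow> R' p - polylog_regular (s + 1) p = c" by blast
  have "isCont R' 0" using R'[OF polylog_strip(3)] by (rule DERIV_isCont)
  then have "((\<lambda>p. R' (of_real p)) \<longlongrightarrow> R' (of_real 0)) (at_right (0::real))"
    by (intro isCont_tendsto_compose[of _ R'] tendsto_intros) auto
  moreover have "R' (of_real 0) = riemann_zeta (of_real (s + 1))" by (simp add: R'_def)
  ultimately have "((\<lambda>p. R' (of_real p) - polylog_regular (s + 1) (of_real p)) \<longlongrightarrow> 0) (at_right 0)"
    using tendsto_diff[OF _ polylog_regular_limit[of "s + 1"]] s by fastforce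
  moreover have ev: "eventually (\<lambda>p. R' (of_real p) - polylog_regular (s + 1) (of_real p) = c) (at_right (0::real))"
    using eventually_at_right_less by eventually_elim (intro c, auto simp: polylog_strip_def)
  ultimately have "((\<lambda>p::real. c) \<longlongrightarrow> 0) (at_right 0)"
    by (rule Lim_transform_eventually)
  then have "c = 0" by (simp add: tendsto_const_iff)
  have holR': "R' holomorphic_on polylog_strip"
    unfolding holomorphic_on_open[OF polylog_strip(1)] using R' by blast
  have "polylog_extension (s + 1) R'"
    unfolding polylog_extension_def
  proof (intro conjI allI impI holR')
    show "R' (of_real p) = polylog_regular (s + 1) (of_real p)" if "p > 0" for p
      using c[of "of_real p"] \<open>c = 0\<close> that by (simp add: polylog_strip_def)
    fix k
    show "(deriv ^^ k) R' 0 = (-1) ^ k * riemann_zeta (of_real (s + 1 - real k))"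
    proof (cases k)
      case 0
      then show ?thesis by (simp add: R'_def)
    next
      case (Suc j)
      have "(deriv ^^ k) R' 0 = (deriv ^^ j) (deriv R') 0"
        by (simp add: Suc funpow_Suc_right del: funpow.simps)
      also have "\<dots> = (deriv ^^ j) (\<lambda>p. - R p) 0"
        by (rule higher_deriv_transform_within_open[OF holomorphic_deriv[OF holR' polylog_strip(1)] _ polylog_strip(1,3)])
          (use R' in \<open>auto intro!: holomorphic_intros hol DERIV_imp_deriv\<close>)
      also have "\<dots> = - (deriv ^^ j) R 0"
        by (rule higher_deriv_uminus[OF hol polylog_strip(1,3)])
      also have "(deriv ^^ j) R 0 = (-1) ^ j * riemann_zeta (of_real (s - real j))"
        using R unfolding polylog_extension_def by blast
      finally show ?thesis by (simp add: Suc)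
    qed
  qed
  then show ?thesis by blast
qed

text \<open>
  The Mellin integral covers \<open>0 < s < 1\<close>; every other non-integer \<open>s\<close> is reached by differentiation or integration.
\<close>

theorem polylog_extension_exists:
  assumes "s \<notin> \<int>"
  shows "\<exists>R. polylog_extension s R"
proof -
  have frac: "0 < frac s" "frac s < 1" using assms by (simp_all add: frac_lt_1)
  have fr: "frac s \<notin> \<int>" using assms by simp
  have up: "\<exists>R. polylog_extension (frac s + real n) R" for n
  proof (induction n)
    case 0
    then show ?case using polylog_extension_base[OF frac] by auto
  next
    case (Suc n)
    then show ?case using polylog_extension_step_up[of "frac s + real n"] not_Ints_shift(2)[OF fr, of n] frac
      by (auto simp: add_ac add_pos_nonneg)
  qed
  have down: "\<exists>R. polylog_extension (frac s - real n) R" for n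
  proof (induction n)
    case 0
    then show ?case using polylog_extension_base[OF frac] by auto
  next
    case (Suc n)
    then obtain R where "polylog_extension (frac s - real n) R" by blast
    from polylog_extension_step_down[OF this] not_Ints_shift(1)[OF fr, of n]
    show ?case by (auto simp: algebra_simps)
  qed
  have "s = frac s + of_int \<lfloor>s\<rfloor>" by (simp add: frac_def)
  then show ?thesis
    using up[of "nat \<lfloor>s\<rfloor>"] down[of "nat (- \<lfloor>s\<rfloor>)"]
    by (cases "\<lfloor>s\<rfloor> \<ge> 0") (auto simp: frac_def)
qed

section \<open>Growth of the zeta function on the negative axis\<close>

text \<open>
  Euler's limit formula for \<open>1 / \<Gamma>\<close>.
\<close>

lemma pochhammer_asymptotics:
  fixes z :: real
  shows "(\<lambda>n. pochhammer z n / (fact n * real (n + 1) powr (z - 1))) \<longlonglongrightarrow> rGamma z"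
proof -
  have 1: "rGamma_series z \<longlonglongrightarrow> rGamma z" by (rule rGamma_series_LIMSEQ)
  have 2: "(\<lambda>n::nat. real n powr z / ((z + real n) * real (n + 1) powr (z - 1))) \<longlonglongrightarrow> 1"
    by real_asymp
  have "(\<lambda>n. rGamma_series z n * (real n powr z / ((z + real n) * real (n + 1) powr (z - 1)))) \<longlonglongrightarrow> rGamma z * 1"
    by (rule tendsto_mult[OF 1 2])
  moreover have "eventually (\<lambda>n. rGamma_series z n * (real n powr z / ((z + real n) * real (n + 1) powr (z - 1)))
      = pochhammer z n / (fact n * real (n + 1) powr (z - 1))) sequentially"
    using eventually_gt_at_top[of "nat \<lceil>\<bar>z\<bar>\<rceil>"]
  proof eventually_elim
    fix n assume n: "nat \<lceil>\<bar>z\<bar>\<rceil> < n"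
    then have "real n > \<bar>z\<bar>" by linarith
    then have "z + real n > 0" "real n > 0" by linarith+
    then show "rGamma_series z n * (real n powr z / ((z + real n) * real (n + 1) powr (z - 1)))
      = pochhammer z n / (fact n * real (n + 1) powr (z - 1))"
      by (simp add: rGamma_series_def pochhammer_Suc powr_def mult_ac)
  qed
  ultimately show ?thesis by (simp add: Lim_transform_eventually)
qed

lemma convergent_bound: "convergent (X :: nat \<Rightarrow> real) \<Longrightarrow> \<exists>C\<ge>0. \<forall>n. \<bar>X n\<bar> \<le> C"
  using convergent_imp_Bseq[of X] by (metis Bseq_def real_norm_def less_imp_le)

lemma pochhammer_upper_bound:
  fixes z :: real
  shows "\<exists>C\<ge>0. \<forall>n. \<bar>pochhammer z n\<bar> \<le> C * (fact n * real (n + 1) powr (z - 1))"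
proof -
  obtain C where "C \<ge> 0" "\<And>n. \<bar>pochhammer z n / (fact n * real (n + 1) powr (z - 1))\<bar> \<le> C"
    using convergent_bound[OF convergentI[OF pochhammer_asymptotics[of z]]] by blast
  then show ?thesis by (intro exI[of _ C]) (auto simp: abs_mult field_simps)
qed

lemma pochhammer_lower_bound:
  fixes z :: real
  assumes "z > 0"
  shows "\<exists>C\<ge>0. \<forall>n. fact n * real (n + 1) powr (z - 1) \<le> C * pochhammer z n"
proof -
  have "rGamma z \<noteq> 0" using Gamma_real_pos[OF assms] by (simp add: rGamma_inverse_Gamma)
  then have "(\<lambda>n. inverse (pochhammer z n / (fact n * real (n + 1) powr (z - 1)))) \<longlonglongrightarrow> inverse (rGamma z)"
    by (intro tendsto_inverse pochhammer_asymptotics)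
  from convergent_bound[OF convergentI[OF this]]
  obtain C where C: "C \<ge> 0" "\<And>n. \<bar>inverse (pochhammer z n / (fact n * real (n + 1) powr (z - 1)))\<bar> \<le> C"
    by blast
  have "fact n * real (n + 1) powr (z - 1) \<le> C * pochhammer z n" for n
  proof -
    have p: "pochhammer z n > 0" using assms by (rule pochhammer_pos)
    have "(fact n * real (n + 1) powr (z - 1)) / pochhammer z n \<le> C"
      using C(2)[of n] p by (simp add: abs_mult)
    then show ?thesis using p by (simp add: pos_divide_le_eq)
  qed
  then show ?thesis using C(1) by blast
qed

lemma has_field_derivative_inverse_power:
  fixes a c p :: complex
  assumes "p \<noteq> c"
  shows "((\<lambda>u. a / (u - c) ^ Suc k) has_field_derivative - (of_nat (Suc k) * a / (p - c) ^ Suc (Suc k))) (at p)"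
proof -
  define Y where "Y = p - c"
  have Y: "Y \<noteq> 0" using assms by (simp add: Y_def)
  have "((\<lambda>u. (u - c) ^ Suc k) has_field_derivative of_nat (Suc k) * Y ^ k) (at p)"
    by (rule DERIV_cong[OF DERIV_power[where n = "Suc k" and D = 1]])
      (auto intro!: derivative_eq_intros simp: Y_def)
  then have "((\<lambda>u. a / (u - c) ^ Suc k) has_field_derivative
      (0 * Y ^ Suc k - a * (of_nat (Suc k) * Y ^ k)) / (Y ^ Suc k * Y ^ Suc k)) (at p)"
    using Y by (intro DERIV_divide[OF DERIV_const, THEN DERIV_cong]) (auto simp: Y_def)
  also have "(0 * Y ^ Suc k - a * (of_nat (Suc k) * Y ^ k)) / (Y ^ Suc k * Y ^ Suc k) =
      - (of_nat (Suc k) * a / Y ^ Suc (Suc k))"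
    using Y by (simp add: field_simps)
  finally show ?thesis by (simp add: Y_def)
qed

text \<open>
  Up to sign, \<open>j!\<close> times this is the contribution of a pole \<open>- q\<close> of the kernel to the Mellin integral of its
  \<open>j\<close>-th derivative.
\<close>

definition stieltjes_kernel :: "real \<Rightarrow> nat \<Rightarrow> complex \<Rightarrow> complex" where
  "stieltjes_kernel s j q = (\<integral>x. of_real x powr (of_real s - 1) * (1 / (of_real x + q) ^ Suc j) \<partial>pos_measure)"

lemma stieltjes_kernel_bound:
  assumes q: "Re q = 0" "\<bar>Im q\<bar> \<ge> 1" and x: "x > 0"
  shows "norm (1 / (of_real x + q) ^ Suc j) \<le> 2 ^ Suc j / (1 + x) powr (real j + 1)" and "of_real x + q \<noteq> 0"
proof -
  have "\<bar>Re (of_real x + q)\<bar> \<le> norm (of_real x + q)" "\<bar>Im (of_real x + q)\<bar> \<le> norm (of_real x + q)"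
    by (rule abs_Re_le_cmod abs_Im_le_cmod)+
  then have n: "(1 + x) / 2 \<le> norm (of_real x + q)" using q x by simp
  then show "of_real x + q \<noteq> 0" using x by auto
  have "((1 + x) / 2) ^ Suc j \<le> norm (of_real x + q) ^ Suc j"
    using n x by (intro power_mono) auto
  moreover have "((1 + x) / 2) ^ Suc j > 0" using x by (intro zero_less_power) simp
  ultimately have "1 / norm (of_real x + q) ^ Suc j \<le> 1 / ((1 + x) / 2) ^ Suc j"
    by (intro divide_left_mono mult_pos_pos) auto
  moreover have "(1 + x) powr (real j + 1) = (1 + x) ^ Suc j"
    using x powr_realpow[of "1 + x" "Suc j"] by (simp add: add.commute)
  ultimately show "norm (1 / (of_real x + q) ^ Suc j) \<le> 2 ^ Suc j / (1 + x) powr (real j + 1)"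
    by (simp only: norm_divide norm_power norm_one power_divide divide_divide_eq_right mult_1)
qed

lemma stieltjes_kernel_continuous:
  assumes "Re q = 0" "\<bar>Im q\<bar> \<ge> 1"
  shows "continuous_on {0<..} (\<lambda>x. 1 / (of_real x + q) ^ Suc j)"
  using stieltjes_kernel_bound(2)[OF assms] by (intro continuous_intros) auto

lemma stieltjes_kernel_integrable:
  assumes "Re q = 0" "\<bar>Im q\<bar> \<ge> 1" "0 < s" "s < 1"
  shows "integrable pos_measure (\<lambda>x. of_real x powr (of_real s - 1) * (1 / (of_real x + q) ^ Suc j))"
  by (rule mellin_integrable[OF stieltjes_kernel_continuous[OF assms(1,2)] stieltjes_kernel_bound(1)[OF assms(1,2)]])
    (use assms in auto)

text \<open>
  Integrate the derivative of \<open>x^s / (x + q)^(j + 1)\<close> over the half-line, and write \<open>x = (x + q) - q\<close>.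
\<close>

lemma stieltjes_kernel_rec:
  assumes q: "Re q = 0" "\<bar>Im q\<bar> \<ge> 1" and s: "0 < s" "s < 1"
  shows "(of_nat (Suc j) * q) * stieltjes_kernel s (Suc j) q = of_real (real (Suc j) - s) * stieltjes_kernel s j q"
proof -
  let ?k = "\<lambda>j x. of_real x powr (of_real s - 1) * (1 / (of_real x + q) ^ Suc j)"
  have i: "integrable pos_measure (?k j)" for j by (rule stieltjes_kernel_integrable[OF q s])
  have "(\<integral>x. of_real (s - real (Suc j)) * ?k j x + (of_nat (Suc j) * q) * ?k (Suc j) x \<partial>pos_measure) = 0 - 0"
  proof (rule integral_pos_FTC[where F = "\<lambda>x. of_real x powr of_real s * (1 / (of_real x + q) ^ Suc j)"])
    show "integrable pos_measure (\<lambda>x. of_real (s - real (Suc j)) * ?k j x + (of_nat (Suc j) * q) * ?k (Suc j) x)"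
      by (intro Bochner_Integration.integrable_add integrable_mult_right i)
    show "continuous_on {0<..} (\<lambda>x. of_real (s - real (Suc j)) * ?k j x + (of_nat (Suc j) * q) * ?k (Suc j) x)"
      by (intro continuous_on_add continuous_on_mult continuous_on_const stieltjes_kernel_continuous[OF q] continuous_intros) auto
    fix x :: real assume x: "x > 0"
    let ?y = "of_real x + q"
    have y: "?y \<noteq> 0" using stieltjes_kernel_bound(2)[OF q x] .
    have d: "((\<lambda>u. 1 / (u + q) ^ Suc j) has_field_derivative - (of_nat (Suc j) / ?y ^ Suc (Suc j))) (at (of_real x))"
      using has_field_derivative_inverse_power[of "of_real x" "- q" 1 j] y
      by (simp add: add_eq_0_iff2)
    then have d: "((\<lambda>x. 1 / (of_real x + q) ^ Suc j) has_vector_derivative - (of_nat (Suc j) / ?y ^ Suc (Suc j))) (at x)"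
      by (intro has_vector_derivative_real_field) (rule has_field_derivative_at_within)
    have pw: "complex_of_real x powr of_real s = (?y - q) * of_real x powr (of_real s - 1)"
      using x powr_add[of "complex_of_real x" 1 "of_real s - 1"] by simp
    have "((\<lambda>x. of_real x powr of_real s * (1 / (of_real x + q) ^ Suc j)) has_vector_derivative
      (of_real x powr of_real s * (- (of_nat (Suc j) / ?y ^ Suc (Suc j))) +
       (of_real s * of_real x powr (of_real s - 1)) * (1 / ?y ^ Suc j))) (at x)"
      by (rule has_vector_derivative_mult[OF has_vector_derivative_powr_complex[OF x] d])
    moreover have "(of_real x powr of_real s * (- (of_nat (Suc j) / ?y ^ Suc (Suc j))) +
       (of_real s * of_real x powr (of_real s - 1)) * (1 / ?y ^ Suc j)) =
       of_real (s - real (Suc j)) * ?k j x + (of_nat (Suc j) * q) * ?k (Suc j) x"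
    proof -
      define Y where "Y = ?y"
      define P where "P = complex_of_real x powr (of_real s - 1)"
      have Y: "Y \<noteq> 0" using y by (simp add: Y_def)
      have "((Y - q) * P) * (- (of_nat (Suc j) / Y ^ Suc (Suc j))) + (of_real s * P) * (1 / Y ^ Suc j) =
        of_real (s - real (Suc j)) * (P * (1 / Y ^ Suc j)) + (of_nat (Suc j) * q) * (P * (1 / Y ^ Suc (Suc j)))"
        using Y by (simp add: field_simps)
      then show ?thesis unfolding pw Y_def P_def .
    qed
    ultimately show "((\<lambda>x. of_real x powr of_real s * (1 / (of_real x + q) ^ Suc j)) has_vector_derivative
      of_real (s - real (Suc j)) * ?k j x + (of_nat (Suc j) * q) * ?k (Suc j) x) (at x)" by simp
  next
    have n: "norm (of_real x powr of_real s * (1 / (of_real x + q) ^ Suc j)) \<le> x powr s * (2 ^ Suc j / (1 + x) powr (real j + 1))"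
      if "x > 0" for x
      unfolding norm_mult[of "of_real x powr of_real s"] powr_complex_of_real[OF that] Re_complex_of_real
      by (intro mult_left_mono stieltjes_kernel_bound(1) q that) auto
    show "((\<lambda>x. of_real x powr of_real s * (1 / (of_real x + q) ^ Suc j)) \<longlongrightarrow> 0) (at_right 0)"
    proof (rule tendsto_at_right_0_powr[OF s(1)])
      fix x :: real assume x: "x > 0"
      have "x powr s * (2 ^ Suc j / (1 + x) powr (real j + 1)) \<le> x powr s * (2 ^ Suc j / 1)"
        using x by (intro mult_left_mono divide_left_mono ge_one_powr_ge_zero) auto
      then show "norm (of_real x powr of_real s * (1 / (of_real x + q) ^ Suc j)) \<le> 2 ^ Suc j * x powr s"
        using n[OF x] by (simp add: mult.commute)
    qed
    show "((\<lambda>x. of_real x powr of_real s * (1 / (of_real x + q) ^ Suc j)) \<longlongrightarrow> 0) at_top"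
    proof (rule tendsto_at_top_powr[of "real j + 1 - s"])
      fix x :: real assume x: "x > 0"
      have "x powr s * (2 ^ Suc j / (1 + x) powr (real j + 1)) \<le> x powr s * (2 ^ Suc j / x powr (real j + 1))"
        using x by (intro mult_left_mono divide_left_mono powr_mono2) auto
      also have "\<dots> = 2 ^ Suc j * x powr (- (real j + 1 - s))" using x by (simp add: powr_diff powr_add)
      finally show "norm (of_real x powr of_real s * (1 / (of_real x + q) ^ Suc j)) \<le> 2 ^ Suc j * x powr (- (real j + 1 - s))"
        using n[OF x] by linarith
    qed (use s in auto)
  qed
  then have "of_real (s - real (Suc j)) * stieltjes_kernel s j q + (of_nat (Suc j) * q) * stieltjes_kernel s (Suc j) q = 0"
    using Bochner_Integration.integral_add[OF integrable_mult_right[OF i[of j], of "of_real (s - real (Suc j))"]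
        integrable_mult_right[OF i[of "Suc j"], of "of_nat (Suc j) * q"]]
    unfolding stieltjes_kernel_def integral_mult_right_zero by simp
  then show ?thesis by (simp add: algebra_simps)
qed

lemma norm_stieltjes_kernel:
  assumes q: "Re q = 0" "\<bar>Im q\<bar> \<ge> 1" and s: "0 < s" "s < 1"
  shows "fact j * norm q ^ j * norm (stieltjes_kernel s j q) = pochhammer (1 - s) j * norm (stieltjes_kernel s 0 q)"
proof (induction j)
  case (Suc j)
  have "norm ((of_nat (Suc j) * q) * stieltjes_kernel s (Suc j) q) = norm (complex_of_real (real (Suc j) - s) * stieltjes_kernel s j q)"
    by (simp only: stieltjes_kernel_rec[OF q s])
  then have *: "real (Suc j) * norm q * norm (stieltjes_kernel s (Suc j) q) = (1 - s + real j) * norm (stieltjes_kernel s j q)"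
    using s by (simp only: norm_mult norm_of_real norm_of_nat) simp
  have "fact (Suc j) * norm q ^ Suc j * norm (stieltjes_kernel s (Suc j) q) =
      fact j * norm q ^ j * (real (Suc j) * norm q * norm (stieltjes_kernel s (Suc j) q))"
    by (simp add: mult_ac)
  also have "\<dots> = (1 - s + real j) * (fact j * norm q ^ j * norm (stieltjes_kernel s j q))"
    unfolding * by (simp only: mult_ac)
  also have "\<dots> = pochhammer (1 - s) (Suc j) * norm (stieltjes_kernel s 0 q)"
    unfolding Suc.IH by (simp add: pochhammer_Suc)
  finally show ?case .
qed simp

lemma higher_deriv_inverse_shift:
  assumes "z \<noteq> (c::complex)"
  shows "(deriv ^^ j) (\<lambda>u. 1 / (u - c)) z = (-1) ^ j * (fact j / (z - c) ^ Suc j)"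
proof -
  have "(deriv ^^ j) (\<lambda>u. fact 0 / (u - c) ^ Suc 0) z = (-1) ^ j * (fact j / (z - c) ^ Suc j)"
  proof (rule higher_deriv_ladder[where S = "- {c}"])
    fix k p assume "p \<in> - {c}"
    then show "((\<lambda>u. fact k / (u - c) ^ Suc k) has_field_derivative - (fact (Suc k) / (p - c) ^ Suc (Suc k))) (at p)"
      using has_field_derivative_inverse_power[of p c "fact k" k] by simp
  qed (use assms in auto)
  then show ?thesis by simp
qed

text \<open>
  The loss of a factor \<open>j + 1\<close> is harmless, because this is applied to a remainder which is exponentially smaller
  than the main term.
\<close>

lemma fact_le_pochhammer:
  assumes s: "0 < s" "s < (1::real)"
  shows "fact j \<le> real (j + 1) * (pochhammer (1 - s) j / (1 - s))"
proof (cases j)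
  case 0
  then show ?thesis using s by (simp add: field_simps)
next
  case (Suc i)
  have "(1 - s) * fact (Suc i) \<le> real (Suc i) * pochhammer (1 - s) (Suc i)"
  proof (induction i)
    case (Suc i)
    have "(1 - s) * fact (Suc (Suc i)) = real (Suc (Suc i)) * ((1 - s) * fact (Suc i))" by simp
    also have "\<dots> \<le> real (Suc (Suc i)) * (real (Suc i) * pochhammer (1 - s) (Suc i))"
      by (intro mult_left_mono Suc.IH) auto
    also have "\<dots> \<le> real (Suc (Suc i)) * ((1 - s + real (Suc i)) * pochhammer (1 - s) (Suc i))"
      using s by (intro mult_left_mono mult_right_mono pochhammer_nonneg) auto
    finally show ?case by (simp only: pochhammer_Suc[of _ "Suc i"] mult_ac)
  qed (use s in simp)
  moreover have "real (Suc i) * pochhammer (1 - s) (Suc i) \<le> real (j + 1) * pochhammer (1 - s) (Suc i)"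
    using s Suc by (intro mult_right_mono pochhammer_nonneg) auto
  ultimately have "(1 - s) * fact j \<le> real (j + 1) * pochhammer (1 - s) j"
    unfolding Suc by linarith
  then show ?thesis using s by (simp add: field_simps)
qed

text \<open>
  The poles at \<open>\<plusminus> 2 \<pi> \<i>\<close> of the kernel contribute multiples of \<open>pochhammer (1 - s) j / (2 \<pi>)^j\<close>. What is left of
  the kernel is holomorphic in discs of radius \<open>3 \<pi>\<close>, so it contributes \<open>O (j! / (3 \<pi>)^j)\<close>, which is smaller.
  This replaces the functional equation.
\<close>

lemma riemann_zeta_bound_unit_shift:
  assumes s: "0 < s" "s < 1"
  shows "\<exists>C\<ge>0. \<forall>j. norm (riemann_zeta (of_real (s - real j))) \<le> C * pochhammer (1 - s) j / (2 * pi) ^ j"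
proof -
  obtain \<psi> where \<psi>: "\<psi> holomorphic_on {u. \<bar>Im u\<bar> < 4 * pi}"
    and \<psi>_eq: "\<And>u. \<bar>Im u\<bar> < 4 * pi \<Longrightarrow> u \<notin> {0, 2 * pi * \<i>, - (2 * pi * \<i>)} \<Longrightarrow>
      \<psi> u = 1 / (exp u - 1) - 1 / u - 1 / (u - 2 * pi * \<i>) - 1 / (u + 2 * pi * \<i>)"
    and \<psi>_phi: "\<And>u. \<bar>Im u\<bar> < 2 * pi \<Longrightarrow> phi u = \<psi> u + 1 / (u - 2 * pi * \<i>) + 1 / (u + 2 * pi * \<i>)"
    by (rule phi_regular_part[OF that])
  have openS: "open {u. \<bar>Im u\<bar> < r}" for r :: real
    by (intro open_Collect_less continuous_intros)
  have sub: "u \<in> {u. \<bar>Im u\<bar> < 4 * pi}" if "\<bar>Im u\<bar> \<le> 3 * pi" for u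
    using that pi_gt_zero by (simp, linarith)
  have decay: "norm (\<psi> u) \<le> 4 / Re u" if u: "\<bar>Im u\<bar> \<le> 3 * pi" "1 \<le> Re u" for u
  proof -
    have "norm (\<psi> u) = norm (1 / (exp u - 1) - 1 / u - 1 / (u - 2 * pi * \<i>) - 1 / (u + 2 * pi * \<i>))"
    proof (subst \<psi>_eq)
      show "\<bar>Im u\<bar> < 4 * pi" using u pi_gt_zero by linarith
    qed (use u in auto)
    also have "\<dots> \<le> norm (1 / (exp u - 1)) + norm (1 / u) + norm (1 / (u - 2 * pi * \<i>)) + norm (1 / (u + 2 * pi * \<i>))"
      by (intro order_trans[OF norm_triangle_ineq4] add_mono order_refl)
    also have "\<dots> \<le> 1 / Re u + 1 / Re u + 1 / Re u + 1 / Re u"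
      using u by (intro add_mono norm_inverse_exp_minus_1' norm_Re_inverse_le) auto
    finally show ?thesis by simp
  qed
  obtain C where C: "C \<ge> 0" "\<And>u. \<bar>Im u\<bar> \<le> 3 * pi \<Longrightarrow> Re u \<ge> -10 \<Longrightarrow> norm (\<psi> u) \<le> C / (20 + Re u)"
    by (rule strip_decay[OF \<psi> sub decay that])
  let ?c = "2 * pi * \<i>"
  have \<psi>_der: "norm ((deriv ^^ j) \<psi> (of_real x)) \<le> fact j * (C / (1 + x)) / (3 * pi) ^ j" if x: "x > 0" for x j
  proof (rule Cauchy_inequality)
    have pi4: "pi < 16/5" using pi_approx by simp
    have near: "\<bar>Im u\<bar> \<le> 3 * pi" "\<bar>x - Re u\<bar> \<le> 3 * pi" if "norm (of_real x - u) \<le> 3 * pi" for u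
      using that abs_Im_le_cmod[of "of_real x - u"] abs_Re_le_cmod[of "of_real x - u"] by auto
    have sub: "cball (of_real x) (3 * pi) \<subseteq> {u. \<bar>Im u\<bar> < 4 * pi}"
    proof
      fix u assume "u \<in> cball (complex_of_real x) (3 * pi)"
      then have "\<bar>Im u\<bar> \<le> 3 * pi" using near(1) by (simp add: dist_norm)
      then show "u \<in> {u. \<bar>Im u\<bar> < 4 * pi}" using pi_gt_zero by (simp, linarith)
    qed
    then show "continuous_on (cball (of_real x) (3 * pi)) \<psi>" "\<psi> holomorphic_on ball (of_real x) (3 * pi)"
      by (rule continuous_on_subset[OF holomorphic_on_imp_continuous_on[OF \<psi>]],
          intro holomorphic_on_subset[OF \<psi>] order_trans[OF ball_subset_cball])
    fix u assume u: "norm (complex_of_real x - u) = 3 * pi"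
    have "Re u \<ge> x - 10" using near(2)[of u] u pi4 by simp
    then have "norm (\<psi> u) \<le> C / (20 + Re u)" using near(1)[of u] u x by (intro C(2)) auto
    also have "\<dots> \<le> C / (1 + x)"
      using C(1) x \<open>Re u \<ge> x - 10\<close> by (intro divide_left_mono mult_pos_pos) auto
    finally show "norm (\<psi> u) \<le> C / (1 + x)" .
  qed simp
  have phi_der: "(deriv ^^ j) phi (of_real x) = (deriv ^^ j) \<psi> (of_real x) +
      (-1) ^ j * (fact j * (1 / (of_real x + (- ?c)) ^ Suc j)) + (-1) ^ j * (fact j * (1 / (of_real x + ?c) ^ Suc j))"
    if x: "x > 0" for x j
  proof -
    let ?S = "{u. \<bar>Im u\<bar> < 2 * pi}"
    have ne: "u - ?c \<noteq> 0" "u - (- ?c) \<noteq> 0" if "u \<in> ?S" for u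
      using that by (auto simp: complex_eq_iff)
    have h: "\<psi> holomorphic_on ?S" "(\<lambda>u. 1 / (u - ?c)) holomorphic_on ?S" "(\<lambda>u. 1 / (u - (- ?c))) holomorphic_on ?S"
      using ne by (auto intro!: holomorphic_intros intro: holomorphic_on_subset[OF \<psi>])
    have x': "of_real x \<in> ?S" by simp
    have "(deriv ^^ j) phi (of_real x) = (deriv ^^ j) (\<lambda>u. (\<psi> u + 1 / (u - ?c)) + 1 / (u - (- ?c))) (of_real x)"
    proof (rule higher_deriv_transform_within_open[OF _ _ openS x'])
      show "phi holomorphic_on ?S" by (rule holomorphic_on_subset[OF phi_holomorphic]) (auto simp: phi_domain_def)
      show "(\<lambda>u. (\<psi> u + 1 / (u - ?c)) + 1 / (u - (- ?c))) holomorphic_on ?S"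
        by (intro holomorphic_on_add h)
      show "phi u = (\<psi> u + 1 / (u - ?c)) + 1 / (u - (- ?c))" if "u \<in> ?S" for u
        using \<psi>_phi[of u] that by simp
    qed
    also have "\<dots> = (deriv ^^ j) (\<lambda>u. \<psi> u + 1 / (u - ?c)) (of_real x) + (deriv ^^ j) (\<lambda>u. 1 / (u - (- ?c))) (of_real x)"
      by (rule higher_deriv_add[OF _ h(3) openS x']) (intro holomorphic_on_add h)
    also have "(deriv ^^ j) (\<lambda>u. \<psi> u + 1 / (u - ?c)) (of_real x) = (deriv ^^ j) \<psi> (of_real x) + (deriv ^^ j) (\<lambda>u. 1 / (u - ?c)) (of_real x)"
      by (rule higher_deriv_add[OF h(1,2) openS x'])
    also have "(deriv ^^ j) (\<lambda>u. 1 / (u - ?c)) (of_real x) = (-1) ^ j * (fact j / (of_real x - ?c) ^ Suc j)"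
      using x by (intro higher_deriv_inverse_shift) (auto simp: complex_eq_iff)
    also have "(deriv ^^ j) (\<lambda>u. 1 / (u - (- ?c))) (of_real x) = (-1) ^ j * (fact j / (of_real x - (- ?c)) ^ Suc j)"
      using x by (intro higher_deriv_inverse_shift) (auto simp: complex_eq_iff)
    finally show ?thesis by simp
  qed
  have qq: "Re (- ?c) = 0" "\<bar>Im (- ?c)\<bar> \<ge> 1" "Re ?c = 0" "\<bar>Im ?c\<bar> \<ge> 1" "norm (- ?c) = 2 * pi" "norm ?c = 2 * pi"
    using pi_gt3 by (auto simp: norm_mult)
  define K where "K = norm (stieltjes_kernel s 0 (- ?c)) + norm (stieltjes_kernel s 0 ?c)"
  define I where "I = (\<integral>x. C * (x powr (s - 1) / (1 + x) powr 1) \<partial>pos_measure)"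
  have K: "K \<ge> 0" by (simp add: K_def)
  have I_int: "integrable pos_measure (\<lambda>x. C * (x powr (s - 1) / (1 + x) powr 1))"
    using s by (intro integrable_mult_right pos_integrable_powr_weight) auto
  have I: "I \<ge> 0" unfolding I_def using C(1) by (intro Bochner_Integration.integral_nonneg) auto
  define D where "D = \<bar>rGamma s\<bar> * (I * (2 / (1 - s)) + K)"
  have D: "D \<ge> 0" using I K s by (simp add: D_def)
  have "norm (riemann_zeta (of_real (s - real j))) \<le> D * pochhammer (1 - s) j / (2 * pi) ^ j" for j
  proof -
    let ?P = "pochhammer (1 - s) j / (2 * pi) ^ j"
    let ?g = "\<lambda>x. complex_of_real x powr (of_real s - 1) * (deriv ^^ j) \<psi> (of_real x)"
    have cont_der: "continuous_on {0<..} (\<lambda>x. (deriv ^^ j) \<psi> (complex_of_real x))"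
      by (rule continuous_on_compose2[OF holomorphic_on_imp_continuous_on[OF holomorphic_higher_deriv[OF \<psi> openS]]])
        (auto intro!: continuous_intros)
    have gb: "norm (?g x) \<le> (fact j / (3 * pi) ^ j) * (C * (x powr (s - 1) / (1 + x) powr 1))" if "x > 0" for x
    proof -
      have "norm (?g x) \<le> x powr (s - 1) * (fact j * (C / (1 + x)) / (3 * pi) ^ j)"
        unfolding norm_mult powr_complex_of_real[OF that]
        using mult_left_mono[OF \<psi>_der[OF that, of j], of "x powr (s - 1)"] by simp
      then show ?thesis using that by (simp add: mult_ac)
    qed
    have g_int: "integrable pos_measure ?g"
    proof (rule pos_integrable_bound)
      show "integrable pos_measure (\<lambda>x. (fact j / (3 * pi) ^ j) * (C * (x powr (s - 1) / (1 + x) powr 1)))"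
        using I_int by (rule integrable_mult_right)
      show "continuous_on {0<..} ?g" by (intro continuous_intros cont_der) auto
    qed (rule gb)
    have g_le: "norm (\<integral>x. ?g x \<partial>pos_measure) \<le> (fact j / (3 * pi) ^ j) * I"
      unfolding I_def integral_mult_right_zero[symmetric]
    proof (rule Bochner_Integration.integral_norm_bound_integral[OF g_int integrable_mult_right[OF I_int]])
      show "norm (?g x) \<le> (fact j / (3 * pi) ^ j) * (C * (x powr (s - 1) / (1 + x) powr 1))" if "x \<in> space pos_measure" for x
        using that by (intro gb) (simp add: space_restrict_space)
    qed
    have "(\<integral>x. of_real (x powr (s - 1)) * (deriv ^^ j) phi (of_real x) \<partial>pos_measure) =
      (\<integral>x. ?g x + ((-1) ^ j * fact j * (of_real x powr (of_real s - 1) * (1 / (of_real x + (- ?c)) ^ Suc j)) +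
        (-1) ^ j * fact j * (of_real x powr (of_real s - 1) * (1 / (of_real x + ?c) ^ Suc j))) \<partial>pos_measure)"
    proof (rule Bochner_Integration.integral_cong[OF refl])
      fix x assume "x \<in> space pos_measure"
      then have x: "x > 0" by (simp add: space_restrict_space)
      have pw: "complex_of_real (x powr (s - 1)) = complex_of_real x powr (of_real s - 1)"
        using x powr_of_real[of x "s - 1"] by simp
      show "of_real (x powr (s - 1)) * (deriv ^^ j) phi (of_real x) =
        ?g x + ((-1) ^ j * fact j * (of_real x powr (of_real s - 1) * (1 / (of_real x + (- ?c)) ^ Suc j)) +
        (-1) ^ j * fact j * (of_real x powr (of_real s - 1) * (1 / (of_real x + ?c) ^ Suc j)))"
        unfolding phi_der[OF x] pw by (simp only: distrib_left mult_ac add.assoc)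
    qed
    also have "\<dots> = (\<integral>x. ?g x \<partial>pos_measure) + ((-1) ^ j * fact j * stieltjes_kernel s j (- ?c) + (-1) ^ j * fact j * stieltjes_kernel s j ?c)"
    proof -
      note iA = integrable_mult_right[OF stieltjes_kernel_integrable[OF qq(1,2) s, of j], of "(-1) ^ j * fact j"]
      note iB = integrable_mult_right[OF stieltjes_kernel_integrable[OF qq(3,4) s, of j], of "(-1) ^ j * fact j"]
      show ?thesis
        unfolding Bochner_Integration.integral_add[OF g_int Bochner_Integration.integrable_add[OF iA iB]]
          Bochner_Integration.integral_add[OF iA iB] stieltjes_kernel_def integral_mult_right_zero ..
    qed
    finally have eq: "(\<integral>x. of_real (x powr (s - 1)) * (deriv ^^ j) phi (of_real x) \<partial>pos_measure) =
      (\<integral>x. ?g x \<partial>pos_measure) + ((-1) ^ j * fact j * stieltjes_kernel s j (- ?c) + (-1) ^ j * fact j * stieltjes_kernel s j ?c)" .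
    have kk: "fact j * norm (stieltjes_kernel s j q) = ?P * norm (stieltjes_kernel s 0 q)"
      if "Re q = 0" "\<bar>Im q\<bar> \<ge> 1" "norm q = 2 * pi" for q
      using norm_stieltjes_kernel[OF that(1,2) s, of j] that(3) by (simp add: field_simps)
    have P0: "?P \<ge> 0" using s by (intro divide_nonneg_nonneg pochhammer_nonneg) auto
    have ge: "fact j / (3 * pi) ^ j \<le> ?P * (2 / (1 - s))"
    proof -
      have "1 + real j * (1 / 2) \<le> (1 + 1 / 2) ^ j" by (rule Bernoulli_inequality) simp
      then have "real (j + 1) \<le> 2 * (3 / 2) ^ j" by simp
      then have "real (j + 1) * (pochhammer (1 - s) j / (1 - s)) \<le> (2 * (3 / 2) ^ j) * (pochhammer (1 - s) j / (1 - s))"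
        using s by (intro mult_right_mono divide_nonneg_nonneg pochhammer_nonneg) auto
      with fact_le_pochhammer[OF s, of j]
      have "fact j \<le> (2 * (3 / 2) ^ j) * (pochhammer (1 - s) j / (1 - s))" by linarith
      then have "fact j / (3 * pi) ^ j \<le> (2 * (3 / 2) ^ j) * (pochhammer (1 - s) j / (1 - s)) / (3 * pi) ^ j"
        by (intro divide_right_mono) auto
      also have "\<dots> = ?P * (2 / (1 - s))"
        by (simp add: power_mult_distrib power_divide mult_ac)
      finally show ?thesis .
    qed
    have "norm (\<integral>x. of_real (x powr (s - 1)) * (deriv ^^ j) phi (of_real x) \<partial>pos_measure) \<le>
        norm (\<integral>x. ?g x \<partial>pos_measure) + (fact j * norm (stieltjes_kernel s j (- ?c)) + fact j * norm (stieltjes_kernel s j ?c))"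
      unfolding eq by (intro order_trans[OF norm_triangle_ineq] add_mono order_refl)
        (simp_all add: norm_mult norm_power)
    also have "\<dots> \<le> ?P * (2 / (1 - s)) * I + ?P * K"
      unfolding kk[OF qq(1,2,5)] kk[OF qq(3,4,6)] K_def distrib_left
      using order_trans[OF g_le mult_right_mono[OF ge I]] by simp
    also have "\<dots> = (I * (2 / (1 - s)) + K) * ?P"
      by (simp only: distrib_right mult_ac)
    finally have "norm (\<integral>x. of_real (x powr (s - 1)) * (deriv ^^ j) phi (of_real x) \<partial>pos_measure) \<le> (I * (2 / (1 - s)) + K) * ?P" .
    then have "norm (riemann_zeta (of_real (s - real j))) \<le> \<bar>rGamma s\<bar> * ((I * (2 / (1 - s)) + K) * ?P)"
      unfolding riemann_zeta_mellin[OF s] norm_mult norm_power norm_minus_cancel norm_one power_one mult_1_right norm_of_real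
      by (rule mult_left_mono) simp
    then show ?thesis by (simp add: D_def mult_ac)
  qed
  then show ?thesis using D by blast
qed

text \<open>
  Write \<open>s = t + N\<close> with \<open>0 < t < 1\<close>; then \<open>s - 2 m = t - j\<close> with \<open>j = 2 m - N\<close>, and the two Pochhammer
  symbols differ by a constant factor. The exponent \<open>- s\<close> of \<open>2 m + 1\<close> must be exact: it decides the
  convergence in the boundary case \<open>a + b = 2 \<pi>\<close>.
\<close>

theorem riemann_zeta_bound:
  assumes "s \<notin> \<int>"
  shows "\<exists>C\<ge>0. \<forall>m. norm (riemann_zeta (of_real (s - 2 * real m))) \<le>
    C * fact (2 * m) * real (2 * m + 1) powr (- s) / (2 * pi) ^ (2 * m)"
proof -
  define t where "t = frac s"
  define N where "N = \<lfloor>s\<rfloor>"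
  have t: "0 < t" "t < 1" using assms by (simp_all add: t_def frac_lt_1)
  have st: "s = t + of_int N" by (simp add: t_def N_def frac_def)
  obtain C1 where C1: "C1 \<ge> 0" "\<And>j. norm (riemann_zeta (of_real (t - real j))) \<le> C1 * pochhammer (1 - t) j / (2 * pi) ^ j"
    using riemann_zeta_bound_unit_shift[OF t] by blast
  obtain C2 where C2: "C2 \<ge> 0" "\<And>n. \<bar>pochhammer (1 - s) n\<bar> \<le> C2 * (fact n * real (n + 1) powr ((1 - s) - 1))"
    using pochhammer_upper_bound[of "1 - s"] by blast
  have ns: "1 - s \<notin> \<int>" "1 - t \<notin> \<int>"
    using assms Ints_diff[of 1 "1 - s"] Ints_diff[of 1 "1 - t"] frac_in_Ints_iff[of s] by (auto simp: t_def)
  define G where "G = \<bar>Gamma (1 - s) / Gamma (1 - t)\<bar> * (2 * pi) powi N"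
  have G0: "G \<ge> 0" by (simp add: G_def)
  define M where "M = nat N"
  let ?b = "\<lambda>m. fact (2 * m) * real (2 * m + 1) powr (- s) / (2 * pi) ^ (2 * m)"
  have b: "?b m > 0" for m by simp
  \<comment> \<open>The finite sum takes care of the indices with \<open>2 m < N\<close>, for which \<open>s - 2 m\<close> lies to the right of \<open>t\<close>.\<close>
  define C where "C = C1 * C2 * G + (\<Sum>m\<le>M. norm (riemann_zeta (of_real (s - 2 * real m))) / ?b m)"
  have Csum: "(\<Sum>m\<le>M. norm (riemann_zeta (of_real (s - 2 * real m))) / ?b m) \<ge> 0"
    by (intro sum_nonneg divide_nonneg_nonneg) auto
  have "norm (riemann_zeta (of_real (s - 2 * real m))) \<le> C * ?b m" for m
  proof (cases "m \<le> M")
    case True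
    have "norm (riemann_zeta (of_real (s - 2 * real m))) / ?b m \<le> (\<Sum>m\<le>M. norm (riemann_zeta (of_real (s - 2 * real m))) / ?b m)"
      using True by (intro member_le_sum divide_nonneg_nonneg) auto
    also have "\<dots> \<le> C" using C1(1) C2(1) G0 by (simp add: C_def)
    finally show ?thesis using b[of m] by (simp only: pos_divide_le_eq)
  next
    case False
    define j where "j = nat (2 * int m - N)"
    have j: "int j = 2 * int m - N" using False by (simp add: j_def M_def)
    then have jr: "real j = 2 * real m - of_int N" by linarith
    have "pochhammer (1 - t) j = Gamma (1 - t + real j) / Gamma (1 - t)"
      using ns nonpos_Ints_Int by (intro pochhammer_Gamma) blast
    moreover have "pochhammer (1 - s) (2 * m) = Gamma (1 - s + real (2 * m)) / Gamma (1 - s)"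
      using ns nonpos_Ints_Int by (intro pochhammer_Gamma) blast
    moreover have "1 - t + real j = 1 - s + real (2 * m)" using st jr by simp
    moreover have "Gamma (1 - s) \<noteq> 0"
      using ns nonpos_Ints_Int[of "1 - s"] by (auto simp: Gamma_eq_zero_iff)
    ultimately have P: "pochhammer (1 - t) j = Gamma (1 - s) / Gamma (1 - t) * pochhammer (1 - s) (2 * m)"
      by simp
    have pj: "(2 * pi) ^ j = (2 * pi) ^ (2 * m) / (2 * pi) powi N"
    proof -
      have "(2 * pi) ^ j = (2 * pi) powi (2 * int m - N)" by (simp add: j[symmetric])
      also have "\<dots> = (2 * pi) powi (int (2 * m)) / (2 * pi) powi N" by (subst power_int_diff) auto
      finally show ?thesis by (simp only: power_int_of_nat)
    qed
    have "norm (riemann_zeta (of_real (s - 2 * real m))) = norm (riemann_zeta (of_real (t - real j)))"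
    proof -
      have "s - 2 * real m = t - real j" using st jr by simp
      then show ?thesis by (simp only:)
    qed
    also have "\<dots> \<le> C1 * pochhammer (1 - t) j / (2 * pi) ^ j" by (rule C1(2))
    also have "\<dots> = C1 * \<bar>pochhammer (1 - t) j\<bar> / (2 * pi) ^ j"
      using t by (simp add: pochhammer_nonneg)
    also have "\<dots> = C1 * G * \<bar>pochhammer (1 - s) (2 * m)\<bar> / (2 * pi) ^ (2 * m)"
      unfolding P pj G_def abs_mult by simp
    also have "\<dots> \<le> C1 * G * (C2 * (fact (2 * m) * real (2 * m + 1) powr ((1 - s) - 1))) / (2 * pi) ^ (2 * m)"
      using C1(1) G0 by (intro divide_right_mono mult_left_mono C2(2)) auto
    also have "\<dots> = (C1 * C2 * G) * ?b m" by (simp add: mult_ac)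
    also have "\<dots> \<le> C * ?b m"
      using Csum b[of m] by (intro mult_right_mono) (auto simp: C_def)
    finally show ?thesis .
  qed
  moreover have "C \<ge> 0" using Csum C1(1) C2(1) G0 by (simp add: C_def)
  ultimately show ?thesis by (intro exI[of _ C]) (simp add: mult.assoc)
qed

section \<open>Bessel functions without their branch factor\<close>

text \<open>
  The power series coefficients, in \<open>y = x\<^sup>2\<close>, of \<open>J\<^sub>\<nu> (x)\<close> divided by \<open>(x / 2)^\<nu>\<close>.
\<close>

definition bessel_coeff :: "real \<Rightarrow> nat \<Rightarrow> real" where
  "bessel_coeff \<nu> k = (-1) ^ k * rGamma (\<nu> + real k + 1) / (fact k * 4 ^ k)"

lemma bessel_coeff_Suc:
  "\<nu> > -1 \<Longrightarrow> 4 * real (Suc k) * (\<nu> + real (Suc k)) * bessel_coeff \<nu> (Suc k) = - bessel_coeff \<nu> k"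
proof -
  have g: "rGamma (\<nu> + real k + 1) = (\<nu> + real (Suc k)) * rGamma (\<nu> + real (Suc k) + 1)"
    using rGamma_plus1[of "\<nu> + real (Suc k)"] by (simp add: add_ac)
  show ?thesis unfolding bessel_coeff_def g by (simp del: of_nat_Suc)
qed

text \<open>
  By the duplication formula \<open>4^k k!\<close> is \<open>(2 k)!\<close> divided by \<open>pochhammer (1 / 2) k\<close>. The power of \<open>k + 1\<close> is then the
  quotient of the two Pochhammer asymptotics.
\<close>

lemma bessel_coeff_bound:
  assumes "\<nu> \<ge> 0"
  shows "\<exists>C\<ge>0. \<forall>k. \<bar>bessel_coeff \<nu> k\<bar> \<le> C * real (k + 1) powr (- \<nu> - 1 / 2) / fact (2 * k)"
proof -
  obtain C1 where C1: "C1 \<ge> 0" "\<And>n. \<bar>pochhammer (1/2) n\<bar> \<le> C1 * (fact n * real (n + 1) powr (1/2 - 1))"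
    using pochhammer_upper_bound[of "1/2"] by blast
  obtain C2 where C2: "C2 \<ge> 0" "\<And>n. fact n * real (n + 1) powr (\<nu> + 1 - 1) \<le> C2 * pochhammer (\<nu> + 1) n"
    using pochhammer_lower_bound[of "\<nu> + 1"] assms by auto
  have "\<bar>bessel_coeff \<nu> k\<bar> \<le> (C1 * C2 * \<bar>rGamma (\<nu> + 1)\<bar>) * real (k + 1) powr (- \<nu> - 1 / 2) / fact (2 * k)" for k
  proof -
    let ?p = "pochhammer (\<nu> + 1) k" and ?r = "real (k + 1)"
    have p: "?p > 0" using assms by (intro pochhammer_pos) auto
    have r: "rGamma (\<nu> + real k + 1) = rGamma (\<nu> + 1) / ?p"
      using pochhammer_rGamma[of "\<nu> + 1" k] p by (simp add: field_simps)
    have d: "fact (2 * k) = (4 ^ k * pochhammer (1/2) k * fact k :: real)"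
      by (simp add: fact_double power_mult)
    have "\<bar>bessel_coeff \<nu> k\<bar> * fact (2 * k) = \<bar>pochhammer (1/2) k\<bar> * \<bar>rGamma (\<nu> + 1)\<bar> / ?p"
      unfolding bessel_coeff_def r d using p pochhammer_pos[of "1/2::real" k]
      by (simp add: abs_mult abs_divide)
    also have "\<dots> \<le> (C1 * (fact k * ?r powr (1/2 - 1))) * \<bar>rGamma (\<nu> + 1)\<bar> / ?p"
      using p by (intro divide_right_mono mult_right_mono C1(2)) auto
    also have "\<dots> = (C1 * \<bar>rGamma (\<nu> + 1)\<bar> * ?r powr (- \<nu> - 1/2)) * ((fact k * ?r powr (\<nu> + 1 - 1)) / ?p)"
      by (simp add: powr_add[symmetric] mult_ac del: of_nat_add)
    also have "\<dots> \<le> (C1 * \<bar>rGamma (\<nu> + 1)\<bar> * ?r powr (- \<nu> - 1/2)) * C2"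
      using C2(2)[of k] p C1(1) by (intro mult_left_mono) (auto simp: pos_divide_le_eq)
    finally show ?thesis by (simp add: field_simps)
  qed
  moreover have "C1 * C2 * \<bar>rGamma (\<nu> + 1)\<bar> \<ge> 0" using C1(1) C2(1) by simp
  ultimately show ?thesis by blast
qed

lemma bessel_coeff_bound_simple:
  assumes "\<nu> \<ge> 0"
  shows "\<exists>C\<ge>0. \<forall>k. \<bar>bessel_coeff \<nu> k\<bar> \<le> C / fact (2 * k)"
proof -
  obtain C where C: "C \<ge> 0" "\<And>k. \<bar>bessel_coeff \<nu> k\<bar> \<le> C * real (k + 1) powr (- \<nu> - 1 / 2) / fact (2 * k)"
    using bessel_coeff_bound[OF assms] by blast
  have "C * real (k + 1) powr (- \<nu> - 1 / 2) / fact (2 * k) \<le> C / fact (2 * k)" for k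
  proof -
    have "real (k + 1) powr (- \<nu> - 1 / 2) \<le> real (k + 1) powr 0" using assms by (intro powr_mono) auto
    then have "C * real (k + 1) powr (- \<nu> - 1 / 2) \<le> C * 1" using C(1) by (intro mult_left_mono) auto
    then show ?thesis by (simp add: divide_right_mono)
  qed
  then show ?thesis using C order_trans by blast
qed

lemma summable_even_exp: "summable (\<lambda>k. C * \<bar>x\<bar> ^ (2 * k) / fact (2 * k))" for x C :: real
proof -
  have "summable (\<lambda>n. \<bar>x\<bar> ^ n / fact n)" using summable_exp[of "\<bar>x\<bar>"] by (simp add: divide_inverse mult.commute)
  then have "summable ((\<lambda>n. \<bar>x\<bar> ^ n / fact n) \<circ> (\<lambda>k. 2 * k))"
    by (rule summable_reindex) (auto simp: inj_def)
  then show ?thesis using summable_mult[of "\<lambda>k. \<bar>x\<bar> ^ (2 * k) / fact (2 * k)" C] by (simp add: o_def)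
qed

definition bessel_entire :: "real \<Rightarrow> real \<Rightarrow> real" where
  "bessel_entire \<nu> y = (\<Sum>k. bessel_coeff \<nu> k * y ^ k)"

lemma bessel_coeff_summable:
  assumes "\<nu> \<ge> 0"
  shows "summable (\<lambda>k. \<bar>bessel_coeff \<nu> k * y ^ k\<bar>)"
proof -
  obtain C where C: "C \<ge> 0" "\<And>k. \<bar>bessel_coeff \<nu> k\<bar> \<le> C / fact (2 * k)"
    using bessel_coeff_bound_simple[OF assms] by blast
  show ?thesis
  proof (rule summable_comparison_test'[where N = 0])
    show "summable (\<lambda>k. C * \<bar>sqrt \<bar>y\<bar>\<bar> ^ (2 * k) / fact (2 * k))" by (rule summable_even_exp)
    fix k
    have "\<bar>bessel_coeff \<nu> k\<bar> * \<bar>y\<bar> ^ k \<le> C / fact (2 * k) * \<bar>y\<bar> ^ k" by (intro mult_right_mono C(2)) auto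
    then show "norm \<bar>bessel_coeff \<nu> k * y ^ k\<bar> \<le> C * \<bar>sqrt \<bar>y\<bar>\<bar> ^ (2 * k) / fact (2 * k)"
      by (simp add: abs_mult power_abs power_mult)
  qed
qed

lemma bessel_J_eq: "bessel_J \<nu> x = (x / 2) powr \<nu> * bessel_entire \<nu> (x\<^sup>2)"
proof -
  have "(x / 2) ^ (2 * k) = (x\<^sup>2) ^ k / 4 ^ k" for k
    by (simp add: power_mult power_divide)
  then show ?thesis
    unfolding bessel_J_def bessel_entire_def bessel_coeff_def by (simp add: mult_ac)
qed

text \<open>
  Bessel's differential equation in the variable \<open>y = x\<^sup>2\<close>.
\<close>

lemma bessel_entire_ode:
  assumes "\<nu> \<ge> 0"
  obtains g' g'' where "\<And>y. (bessel_entire \<nu> has_real_derivative g' y) (at y)"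
    and "\<And>y. (g' has_real_derivative g'' y) (at y)"
    and "\<And>y. 4 * y * g'' y + 4 * (\<nu> + 1) * g' y + bessel_entire \<nu> y = 0"
proof -
  let ?e = "bessel_coeff \<nu>"
  have s0: "summable (\<lambda>k. ?e k * y ^ k)" for y
    using bessel_coeff_summable[OF assms, of y] by (rule summable_rabs_cancel)
  have s1: "summable (\<lambda>k. diffs ?e k * y ^ k)" for y
    by (rule termdiff_converges_all) (rule s0)
  have s2: "summable (\<lambda>k. diffs (diffs ?e) k * y ^ k)" for y
    by (rule termdiff_converges_all) (rule s1)
  define g' where "g' = (\<lambda>y. \<Sum>k. diffs ?e k * y ^ k)"
  define g'' where "g'' = (\<lambda>y. \<Sum>k. diffs (diffs ?e) k * y ^ k)"
  have d1: "(bessel_entire \<nu> has_real_derivative g' y) (at y)" for y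
    unfolding bessel_entire_def g'_def by (rule termdiffs_strong_converges_everywhere) (rule s0)
  have d2: "(g' has_real_derivative g'' y) (at y)" for y
    unfolding g''_def g'_def by (rule termdiffs_strong_converges_everywhere) (rule s1)
  have ode: "4 * y * g'' y + 4 * (\<nu> + 1) * g' y + bessel_entire \<nu> y = 0" for y
  proof -
    have "(\<lambda>k. diffs (diffs ?e) k * y ^ k) sums g'' y" using s2 unfolding g''_def by (rule summable_sums)
    then have "(\<lambda>k. 4 * y * (diffs (diffs ?e) k * y ^ k)) sums (4 * y * g'' y)" by (rule sums_mult)
    moreover have "4 * y * (diffs (diffs ?e) k * y ^ k) = (4 * real (Suc k) * diffs ?e (Suc k)) * y ^ Suc k" for k
      by (simp add: diffs_def[of "diffs ?e"] mult_ac del: of_nat_Suc)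
    ultimately have "(\<lambda>k. (4 * real (Suc k) * diffs ?e (Suc k)) * y ^ Suc k) sums (4 * y * g'' y)"
      by simp
    then have "(\<lambda>k. (4 * real k * diffs ?e k) * y ^ k) sums (4 * y * g'' y)"
      by (subst (asm) sums_Suc_iff) simp
    moreover have "(\<lambda>k. (4 * (\<nu> + 1)) * (diffs ?e k * y ^ k)) sums ((4 * (\<nu> + 1)) * g' y)"
      using s1 unfolding g'_def by (intro sums_mult summable_sums)
    moreover have "(\<lambda>k. ?e k * y ^ k) sums bessel_entire \<nu> y"
      using s0 unfolding bessel_entire_def by (rule summable_sums)
    ultimately have "(\<lambda>k. (4 * real k * diffs ?e k) * y ^ k + (4 * (\<nu> + 1)) * (diffs ?e k * y ^ k) + ?e k * y ^ k)
        sums (4 * y * g'' y + 4 * (\<nu> + 1) * g' y + bessel_entire \<nu> y)"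
      by (intro sums_add)
    moreover have "(4 * real k * diffs ?e k) * y ^ k + (4 * (\<nu> + 1)) * (diffs ?e k * y ^ k) + ?e k * y ^ k = 0" for k
    proof -
      have "4 * real k * diffs ?e k + 4 * (\<nu> + 1) * diffs ?e k + ?e k = 0"
        using bessel_coeff_Suc[of \<nu> k] assms by (simp add: diffs_def algebra_simps)
      then have "(4 * real k * diffs ?e k + 4 * (\<nu> + 1) * diffs ?e k + ?e k) * y ^ k = 0" by simp
      then show ?thesis by (simp add: algebra_simps)
    qed
    ultimately have "(\<lambda>k. 0) sums (4 * y * g'' y + 4 * (\<nu> + 1) * g' y + bessel_entire \<nu> y)" by simp
    then show ?thesis using sums_zero by (rule sums_unique2)
  qed
  show thesis by (rule that[OF d1 d2 ode])
qed

lemma bessel_entire_isCont: "\<nu> \<ge> 0 \<Longrightarrow> isCont (bessel_entire \<nu>) y"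
  by (rule bessel_entire_ode[of \<nu>]) (auto intro: DERIV_isCont)

text \<open>
  After multiplication by \<open>x^(\<nu> + 1 / 2)\<close> the equation becomes \<open>u'' = (c / x\<^sup>2 - 1) u\<close>, an integrable perturbation of
  the harmonic oscillator, so that the energy \<open>u\<^sup>2 + u'\<^sup>2\<close> stays bounded for \<open>x \<ge> 1\<close>. Near \<open>0\<close> the bound holds because the
  function is continuous.
\<close>

theorem bessel_entire_decay:
  assumes \<nu>: "\<nu> \<ge> 0"
  shows "\<exists>C\<ge>0. \<forall>x>0. \<bar>bessel_entire \<nu> (x\<^sup>2)\<bar> \<le> C * x powr (- \<nu> - 1 / 2)"
proof -
  obtain g' g'' where d1: "\<And>y. (bessel_entire \<nu> has_real_derivative g' y) (at y)"
    and d2: "\<And>y. (g' has_real_derivative g'' y) (at y)"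
    and ode: "\<And>y. 4 * y * g'' y + 4 * (\<nu> + 1) * g' y + bessel_entire \<nu> y = 0"
    by (rule bessel_entire_ode[OF \<nu> that])
  let ?g = "bessel_entire \<nu>"
  define P where "P = (\<lambda>x::real. x powr (\<nu> + 1 / 2))"
  \<comment> \<open>\<open>v\<close> is the derivative of \<open>u\<close>.\<close>
  define u where "u = (\<lambda>x. P x * ?g (x\<^sup>2))"
  define v where "v = (\<lambda>x. P x * ((\<nu> + 1 / 2) / x * ?g (x\<^sup>2) + 2 * x * g' (x\<^sup>2)))"
  define c where "c = \<nu>\<^sup>2 - 1 / 4"
  define K where "K = \<bar>c\<bar>"
  have dP: "(P has_real_derivative (\<nu> + 1 / 2) / x * P x) (at x)" if "x > 0" for x
    unfolding P_def
    by (rule has_real_derivative_powr[OF that, THEN DERIV_cong], subst powr_diff) (use that in simp)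
  have dg: "((\<lambda>x. ?g (x\<^sup>2)) has_real_derivative 2 * x * g' (x\<^sup>2)) (at x)" for x
    by (rule DERIV_chain2[OF d1, THEN DERIV_cong]) (auto intro!: derivative_eq_intros)
  have dg': "((\<lambda>x. g' (x\<^sup>2)) has_real_derivative 2 * x * g'' (x\<^sup>2)) (at x)" for x
    by (rule DERIV_chain2[OF d2, THEN DERIV_cong]) (auto intro!: derivative_eq_intros)
  have du: "(u has_real_derivative v x) (at x)" if "x > 0" for x
    unfolding u_def v_def
    by (rule DERIV_mult[OF dP dg, THEN DERIV_cong]) (use that in \<open>auto simp: algebra_simps\<close>)
  have dv: "(v has_real_derivative (c / x\<^sup>2 - 1) * u x) (at x)" if x: "x > 0" for x
  proof -
    have "((\<lambda>x. (\<nu> + 1 / 2) / x * ?g (x\<^sup>2) + 2 * x * g' (x\<^sup>2)) has_real_derivative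
       (\<nu> + 1 / 2) / x * (2 * x * g' (x\<^sup>2)) - (\<nu> + 1 / 2) / x\<^sup>2 * ?g (x\<^sup>2) +
       (2 * x * (2 * x * g'' (x\<^sup>2)) + 2 * g' (x\<^sup>2))) (at x)"
    proof -
      have 1: "((\<lambda>x. (\<nu> + 1 / 2) / x) has_real_derivative - ((\<nu> + 1 / 2) / x\<^sup>2)) (at x)"
        using x by (auto intro!: derivative_eq_intros simp: power2_eq_square diff_divide_distrib add_divide_distrib)
      have 2: "((\<lambda>x. 2 * x) has_real_derivative 2) (at x)"
        by (auto intro!: derivative_eq_intros)
      show ?thesis
        by (rule DERIV_add[OF DERIV_mult[OF 1 dg] DERIV_mult[OF 2 dg'], THEN DERIV_cong]) (simp add: algebra_simps)
    qed
    note D = DERIV_mult[OF dP[OF x] this, folded v_def]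
    show ?thesis
    proof (rule DERIV_cong[OF D])
      let ?G = "?g (x\<^sup>2)" and ?G1 = "g' (x\<^sup>2)" and ?G2 = "g'' (x\<^sup>2)"
      have "4 * x\<^sup>2 * ?G2 = - 4 * (\<nu> + 1) * ?G1 - ?G" using ode[of "x\<^sup>2"] by linarith
      then have o: "2 * x * (2 * x * ?G2) = - 4 * (\<nu> + 1) * ?G1 - ?G" by (simp add: power2_eq_square)
      have "(\<nu> + 1 / 2) / x * ((\<nu> + 1 / 2) / x * ?G + 2 * x * ?G1) +
          ((\<nu> + 1 / 2) / x * (2 * x * ?G1) - (\<nu> + 1 / 2) / x\<^sup>2 * ?G + (2 * x * (2 * x * ?G2) + 2 * ?G1))
          = (c / x\<^sup>2 - 1) * ?G"
        unfolding o c_def using x by (simp add: field_simps power2_eq_square)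
      then have "P x * ((\<nu> + 1 / 2) / x * ((\<nu> + 1 / 2) / x * ?G + 2 * x * ?G1) +
          ((\<nu> + 1 / 2) / x * (2 * x * ?G1) - (\<nu> + 1 / 2) / x\<^sup>2 * ?G + (2 * x * (2 * x * ?G2) + 2 * ?G1)))
          = P x * ((c / x\<^sup>2 - 1) * ?G)" by simp
      then show "(\<nu> + 1 / 2) / x * P x * ((\<nu> + 1 / 2) / x * ?G + 2 * x * ?G1) +
          ((\<nu> + 1 / 2) / x * (2 * x * ?G1) - (\<nu> + 1 / 2) / x\<^sup>2 * ?G + (2 * x * (2 * x * ?G2) + 2 * ?G1)) * P x
          = (c / x\<^sup>2 - 1) * u x"
        by (simp add: u_def algebra_simps)
    qed
  qed
  \<comment> \<open>The perturbation changes \<open>E\<close> at a relative rate of at most \<open>K / x\<^sup>2\<close>, so that \<open>E x * exp (K / x)\<close> decreases.\<close>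
  define E where "E = (\<lambda>x. (u x)\<^sup>2 + (v x)\<^sup>2)"
  have dE: "(E has_real_derivative 2 * (c / x\<^sup>2) * (u x * v x)) (at x)" if "x > 0" for x
    unfolding E_def using du[OF that] dv[OF that]
    by (auto intro!: derivative_eq_intros simp: algebra_simps)
  have dH: "((\<lambda>x. E x * exp (K / x)) has_real_derivative
      (2 * (c / x\<^sup>2) * (u x * v x) - K / x\<^sup>2 * E x) * exp (K / x)) (at x)" if "x > 0" for x
    using that by (auto intro!: derivative_eq_intros dE simp: algebra_simps power2_eq_square)
  have neg: "(2 * (c / x\<^sup>2) * (u x * v x) - K / x\<^sup>2 * E x) * exp (K / x) \<le> 0" if "x > 0" for x
  proof -
    have "2 * (c * (u x * v x)) \<le> K * (2 * \<bar>u x * v x\<bar>)"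
      unfolding K_def using abs_ge_self[of "c * (u x * v x)"] by (simp add: abs_mult)
    also have "\<dots> \<le> K * E x"
    proof (rule mult_left_mono)
      have "2 * \<bar>u x\<bar> * \<bar>v x\<bar> \<le> \<bar>u x\<bar>\<^sup>2 + \<bar>v x\<bar>\<^sup>2" by (rule sum_squares_bound)
      then show "2 * \<bar>u x * v x\<bar> \<le> E x" by (simp add: E_def abs_mult)
    qed (simp add: K_def)
    finally have "(2 * (c * (u x * v x)) - K * E x) / x\<^sup>2 \<le> 0" by (intro divide_nonpos_nonneg) auto
    then have "2 * (c / x\<^sup>2) * (u x * v x) - K / x\<^sup>2 * E x \<le> 0" by (simp add: diff_divide_distrib)
    then show ?thesis by (intro mult_nonpos_nonneg) auto
  qed
  have mono: "E x * exp (K / x) \<le> E 1 * exp (K / 1)" if "x \<ge> 1" for x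
  proof (rule DERIV_nonpos_imp_nonincreasing[OF that])
    fix y :: real assume "1 \<le> y" "y \<le> x"
    then have "y > 0" by simp
    then show "\<exists>z. ((\<lambda>x. E x * exp (K / x)) has_real_derivative z) (at y) \<and> z \<le> 0"
      using dH[of y] neg[of y] by blast
  qed
  define M where "M = sqrt (E 1 * exp K)"
  have large: "\<bar>?g (x\<^sup>2)\<bar> \<le> M * x powr (- \<nu> - 1 / 2)" if x: "x \<ge> 1" for x
  proof -
    have "(u x)\<^sup>2 \<le> E x * 1" by (simp add: E_def)
    also have "\<dots> \<le> E x * exp (K / x)" using x by (intro mult_left_mono) (auto simp: E_def K_def)
    also have "\<dots> \<le> E 1 * exp K" using mono[OF x] by simp
    finally have "\<bar>u x\<bar> \<le> M" unfolding M_def by (rule real_le_rsqrt[of "\<bar>u x\<bar>", simplified])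
    then have "x powr (\<nu> + 1 / 2) * \<bar>?g (x\<^sup>2)\<bar> \<le> M" by (simp add: u_def P_def abs_mult)
    then have "x powr (- \<nu> - 1 / 2) * (x powr (\<nu> + 1 / 2) * \<bar>?g (x\<^sup>2)\<bar>) \<le> x powr (- \<nu> - 1 / 2) * M"
      by (intro mult_left_mono) auto
    moreover have "x powr (- \<nu> - 1 / 2) * x powr (\<nu> + 1 / 2) = 1" using x by (simp add: powr_add[symmetric])
    then have "x powr (- \<nu> - 1 / 2) * (x powr (\<nu> + 1 / 2) * \<bar>?g (x\<^sup>2)\<bar>) = \<bar>?g (x\<^sup>2)\<bar>"
      by (simp only: mult.assoc[symmetric] mult_1)
    ultimately show ?thesis by (simp only: mult.commute)
  qed
  have "continuous_on {0..1} (\<lambda>x. ?g (x\<^sup>2))"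
    by (intro continuous_at_imp_continuous_on ballI DERIV_isCont[OF dg])
  then have "bounded ((\<lambda>x. ?g (x\<^sup>2)) ` {0..1})"
    by (intro compact_imp_bounded compact_continuous_image) auto
  then obtain B where B: "\<And>x. x \<in> {0..1} \<Longrightarrow> norm (?g (x\<^sup>2)) \<le> B" unfolding bounded_iff by (metis imageI)
  have small: "\<bar>?g (x\<^sup>2)\<bar> \<le> \<bar>B\<bar> * x powr (- \<nu> - 1 / 2)" if x: "0 < x" "x \<le> 1" for x
  proof -
    have "\<bar>?g (x\<^sup>2)\<bar> \<le> \<bar>B\<bar> * 1" using B[of x] x by simp
    also have "\<dots> \<le> \<bar>B\<bar> * x powr (- \<nu> - 1 / 2)"
      using powr_mono'[of "- \<nu> - 1 / 2" 0 x] x \<nu> by (intro mult_left_mono) auto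
    finally show ?thesis .
  qed
  have M: "M \<ge> 0" by (simp add: M_def E_def)
  have "\<bar>?g (x\<^sup>2)\<bar> \<le> (M + \<bar>B\<bar>) * x powr (- \<nu> - 1 / 2)" if "x > 0" for x
  proof (cases "x \<ge> 1")
    case True
    have "M * x powr (- \<nu> - 1 / 2) \<le> (M + \<bar>B\<bar>) * x powr (- \<nu> - 1 / 2)" by (intro mult_right_mono) auto
    then show ?thesis using large[OF True] by linarith
  next
    case False
    have "\<bar>B\<bar> * x powr (- \<nu> - 1 / 2) \<le> (M + \<bar>B\<bar>) * x powr (- \<nu> - 1 / 2)" using M by (intro mult_right_mono) auto
    then show ?thesis using small[of x] False that by linarith
  qed
  then show ?thesis using M by (intro exI[of _ "M + \<bar>B\<bar>"]) auto
qed

section \<open>Taylor coefficients of a product of Bessel functions\<close>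

text \<open>
  Replacing \<open>N choose j\<close> by \<open>(N + R) choose (j + R)\<close> absorbs a factor \<open>((N + 1) / (j + 1))^R\<close>, up to a constant.
\<close>

lemma binomial_shift_bound:
  assumes "j \<le> N"
  shows "(real (N + 1) / real (j + 1)) ^ R * real (N choose j) \<le> fact R * real ((N + R) choose (j + R))"
proof (induction R)
  case (Suc R)
  have "real (N + 1) * real (j + R + 1) \<le> real (N + R + 1) * (real (R + 1) * real (j + 1))"
  proof (rule mult_mono)
    have "j + R + 1 \<le> (R + 1) * (j + 1)" by simp
    then show "real (j + R + 1) \<le> real (R + 1) * real (j + 1)" by (metis of_nat_le_iff of_nat_mult)
  qed auto
  then have y: "real (N + 1) / real (j + 1) \<le> real (R + 1) * (real (N + R + 1) / real (j + R + 1))"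
    by (simp add: field_simps)
  have "Suc (N + R) * (N + R choose (j + R)) = (Suc (N + R) choose Suc (j + R)) * Suc (j + R)"
    by (rule Suc_times_binomial_eq)
  then have "real (Suc (N + R)) * real (N + R choose (j + R)) = real (Suc (N + R) choose Suc (j + R)) * real (Suc (j + R))"
    by (metis of_nat_mult)
  then have c: "real (N + R + 1) / real (j + R + 1) * real (N + R choose (j + R)) = real (N + Suc R choose (j + Suc R))"
    by (simp add: field_simps)
  have "(real (N + 1) / real (j + 1)) ^ Suc R * real (N choose j) =
      (real (N + 1) / real (j + 1)) * ((real (N + 1) / real (j + 1)) ^ R * real (N choose j))" by simp
  also have "\<dots> \<le> (real (R + 1) * (real (N + R + 1) / real (j + R + 1))) * (fact R * real ((N + R) choose (j + R)))"
    by (intro mult_mono y Suc.IH) auto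
  also have "\<dots> = fact (Suc R) * real (N + Suc R choose (j + Suc R))"
    unfolding c[symmetric] by (simp add: mult_ac)
  finally show ?case .
qed simp

text \<open>
  Both weights are absorbed by enlarging the binomial coefficient, after which the sum is part of the
  expansion of \<open>(a + b)^(N + R + S)\<close>. So weights that blow up at the ends of the range do not change the order of the
  binomial sum: its mass sits where \<open>j\<close> and \<open>N - j\<close> are comparable to \<open>N\<close>.
\<close>

lemma binomial_weighted_sum_bound:
  fixes a b :: real
  assumes a: "a > 0" and b: "b > 0"
  shows "(\<Sum>j\<le>N. real (N choose j) * b ^ j * a ^ (N - j) * (real (N + 1) / real (j + 1)) ^ R *
      (real (N + 1) / real (N - j + 1)) ^ S) \<le> (fact R * fact S * (a + b) ^ (R + S) / (b ^ R * a ^ S)) * (a + b) ^ N"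
proof -
  let ?M = "N + R + S"
  have "real (N choose j) * b ^ j * a ^ (N - j) * (real (N + 1) / real (j + 1)) ^ R * (real (N + 1) / real (N - j + 1)) ^ S
      \<le> (fact R * fact S / (b ^ R * a ^ S)) * (real (?M choose (j + R)) * b ^ (j + R) * a ^ (?M - (j + R)))"
    if j: "j \<le> N" for j
  proof -
    have "(real (N + 1) / real (j + 1)) ^ R * real (N choose j) * (real (N + 1) / real (N - j + 1)) ^ S
       \<le> fact R * real ((N + R) choose (j + R)) * (real (N + R + 1) / real (N - j + 1)) ^ S"
      by (intro mult_mono binomial_shift_bound j power_mono divide_right_mono) auto
    also have "\<dots> = fact R * ((real (N + R + 1) / real (N - j + 1)) ^ S * real ((N + R) choose (N - j)))"
    proof -
      have "(N + R) choose (j + R) = (N + R) choose (N - j)"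
        using j by (subst binomial_symmetric) auto
      then show ?thesis by simp
    qed
    also have "\<dots> \<le> fact R * (fact S * real ((N + R + S) choose (N - j + S)))"
      by (intro mult_left_mono binomial_shift_bound) auto
    also have "(N + R + S) choose (N - j + S) = ?M choose (j + R)"
      using j by (subst binomial_symmetric) (auto simp: algebra_simps)
    finally have le: "(real (N + 1) / real (j + 1)) ^ R * real (N choose j) * (real (N + 1) / real (N - j + 1)) ^ S
        \<le> fact R * (fact S * real (?M choose (j + R)))" .
    have "?M - (j + R) = (N - j) + S" using j by simp
    then have ab: "b ^ j * a ^ (N - j) = b ^ (j + R) * a ^ (?M - (j + R)) / (b ^ R * a ^ S)"
      using a b by (simp add: power_add)
    have "(b ^ j * a ^ (N - j)) * ((real (N + 1) / real (j + 1)) ^ R * real (N choose j) * (real (N + 1) / real (N - j + 1)) ^ S)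
        \<le> (b ^ j * a ^ (N - j)) * (fact R * (fact S * real (?M choose (j + R))))"
      using a b by (intro mult_left_mono le) auto
    also have "\<dots> = (fact R * fact S / (b ^ R * a ^ S)) * (real (?M choose (j + R)) * b ^ (j + R) * a ^ (?M - (j + R)))"
      unfolding ab by (simp add: mult_ac)
    finally show ?thesis by (simp only: mult_ac)
  qed
  then have "(\<Sum>j\<le>N. real (N choose j) * b ^ j * a ^ (N - j) * (real (N + 1) / real (j + 1)) ^ R * (real (N + 1) / real (N - j + 1)) ^ S)
      \<le> (\<Sum>j\<le>N. (fact R * fact S / (b ^ R * a ^ S)) * (real (?M choose (j + R)) * b ^ (j + R) * a ^ (?M - (j + R))))"
    by (intro sum_mono) auto
  also have "\<dots> = (fact R * fact S / (b ^ R * a ^ S)) * (\<Sum>j\<le>N. real (?M choose (j + R)) * b ^ (j + R) * a ^ (?M - (j + R)))"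
    by (simp only: sum_distrib_left)
  also have "(\<Sum>j\<le>N. real (?M choose (j + R)) * b ^ (j + R) * a ^ (?M - (j + R))) =
      (\<Sum>i\<in>(\<lambda>j. j + R) ` {..N}. real (?M choose i) * b ^ i * a ^ (?M - i))"
    by (subst sum.reindex) (auto simp: inj_on_def)
  also have "\<dots> \<le> (\<Sum>i\<le>?M. real (?M choose i) * b ^ i * a ^ (?M - i))"
    using a b by (intro sum_mono2) auto
  also have "\<dots> = (b + a) ^ ?M" by (simp add: binomial_ring)
  finally show ?thesis using a b by (simp add: power_add add.commute mult_ac divide_right_mono mult_left_mono)
qed

text \<open>
  The Cauchy product of the two power series, that is, the coefficients \<open>c m\<close> of the introduction.
\<close>

definition product_coeff :: "real \<Rightarrow> real \<Rightarrow> real \<Rightarrow> real \<Rightarrow> nat \<Rightarrow> real" where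
  "product_coeff \<mu> \<nu> a b m = (\<Sum>k\<le>m. (bessel_coeff \<nu> k * b ^ (2 * k)) * (bessel_coeff \<mu> (m - k) * a ^ (2 * (m - k))))"

text \<open>
  Without the powers of \<open>k + 1\<close> from \<open>bessel_coeff_bound\<close>, the sum would be the even part of the binomial expansion of
  \<open>(a + b)^(2 m) / (2 m)!\<close>. The powers are evaluated at \<open>m + 1\<close> instead, and the quotients, raised to integer exponents
  for simplicity, are absorbed by \<open>binomial_weighted_sum_bound\<close>.
\<close>

theorem product_coeff_bound:
  assumes "\<mu> \<ge> 0" "\<nu> \<ge> 0" and a: "a > 0" and b: "b > 0"
  shows "\<exists>C\<ge>0. \<forall>m. (\<Sum>k\<le>m. \<bar>bessel_coeff \<nu> k * b ^ (2 * k)\<bar> * \<bar>bessel_coeff \<mu> (m - k) * a ^ (2 * (m - k))\<bar>)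
     \<le> C * (a + b) ^ (2 * m) / fact (2 * m) * real (m + 1) powr (- \<mu> - \<nu> - 1)"
proof -
  obtain C1 where C1: "C1 \<ge> 0" "\<And>k. \<bar>bessel_coeff \<nu> k\<bar> \<le> C1 * real (k + 1) powr (- \<nu> - 1 / 2) / fact (2 * k)"
    using bessel_coeff_bound[OF assms(2)] by blast
  obtain C2 where C2: "C2 \<ge> 0" "\<And>k. \<bar>bessel_coeff \<mu> k\<bar> \<le> C2 * real (k + 1) powr (- \<mu> - 1 / 2) / fact (2 * k)"
    using bessel_coeff_bound[OF assms(1)] by blast
  define R where "R = nat \<lceil>\<nu> + 1 / 2\<rceil>"
  define S where "S = nat \<lceil>\<mu> + 1 / 2\<rceil>"
  have RS: "\<nu> + 1 / 2 \<le> real R" "\<mu> + 1 / 2 \<le> real S" unfolding R_def S_def by linarith+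
  define K where "K = fact R * fact S * (a + b) ^ (R + S) / (b ^ R * a ^ S)"
  have K: "K \<ge> 0" using a b by (simp add: K_def)
  have pw: "real (k + 1) powr (- r) \<le> real (m + 1) powr (- r) * (real (2 * m + 1) / real (2 * k + 1)) ^ T"
    if "k \<le> m" "0 \<le> r" "r \<le> real T" for k m T :: nat and r :: real
  proof -
    let ?y = "real (m + 1) / real (k + 1)" and ?z = "real (2 * m + 1) / real (2 * k + 1)"
    have y: "1 \<le> ?y" using that by (simp add: field_simps)
    have yz: "?y \<le> ?z" using that by (simp add: field_simps)
    have "?y powr r \<le> ?z powr r" using y yz that by (intro powr_mono2) auto
    also have "\<dots> \<le> ?z powr real T" using y yz that by (intro powr_mono) auto
    also have "\<dots> = ?z ^ T" using y yz by (subst powr_realpow) auto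
    finally have "real (m + 1) powr (- r) * ?y powr r \<le> real (m + 1) powr (- r) * ?z ^ T"
      by (intro mult_left_mono) auto
    moreover have "real (m + 1) powr (- r) * ?y powr r = real (k + 1) powr (- r)"
      by (simp add: powr_divide powr_minus field_simps del: of_nat_add)
    ultimately show ?thesis by linarith
  qed
  have "(\<Sum>k\<le>m. \<bar>bessel_coeff \<nu> k * b ^ (2 * k)\<bar> * \<bar>bessel_coeff \<mu> (m - k) * a ^ (2 * (m - k))\<bar>)
     \<le> (C1 * C2 * K) * (a + b) ^ (2 * m) / fact (2 * m) * real (m + 1) powr (- \<mu> - \<nu> - 1)" for m
  proof -
    let ?N = "2 * m" and ?D = "C1 * C2 * real (m + 1) powr (- \<mu> - \<nu> - 1) / fact (2 * m)"
    let ?t = "\<lambda>j. real (?N choose j) * b ^ j * a ^ (?N - j) * (real (?N + 1) / real (j + 1)) ^ R *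
      (real (?N + 1) / real (?N - j + 1)) ^ S"
    have term_le: "\<bar>bessel_coeff \<nu> k * b ^ (2 * k)\<bar> * \<bar>bessel_coeff \<mu> (m - k) * a ^ (2 * (m - k))\<bar> \<le> ?D * ?t (2 * k)"
      if k: "k \<le> m" for k
    proof -
      have e1: "\<bar>bessel_coeff \<nu> k\<bar> \<le> C1 * (real (m + 1) powr (- \<nu> - 1 / 2) * (real (?N + 1) / real (2 * k + 1)) ^ R) / fact (2 * k)"
        using C1(1) pw[OF k _ RS(1)] assms
        by (intro order_trans[OF C1(2)] divide_right_mono mult_left_mono) auto
      have e2: "\<bar>bessel_coeff \<mu> (m - k)\<bar> \<le> C2 * (real (m + 1) powr (- \<mu> - 1 / 2) * (real (?N + 1) / real (2 * (m - k) + 1)) ^ S) / fact (2 * (m - k))"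
        using C2(1) pw[OF _ _ RS(2), of "m - k" m] assms
        by (intro order_trans[OF C2(2)] divide_right_mono mult_left_mono) auto
      have ch: "real (?N choose (2 * k)) = fact ?N / (fact (2 * k) * fact (2 * (m - k)))"
        using k by (subst binomial_fact) (auto simp: diff_mult_distrib2)
      have nk: "?N - 2 * k = 2 * (m - k)" by simp
      have p: "real (m + 1) powr (- \<mu> - \<nu> - 1) = real (m + 1) powr (- \<nu> - 1 / 2) * real (m + 1) powr (- \<mu> - 1 / 2)"
      proof -
        have "- \<mu> - \<nu> - 1 = (- \<nu> - 1 / 2) + (- \<mu> - 1 / 2)" by simp
        then show ?thesis by (simp only: powr_add)
      qed
      have "(\<bar>bessel_coeff \<nu> k\<bar> * b ^ (2 * k)) * (\<bar>bessel_coeff \<mu> (m - k)\<bar> * a ^ (2 * (m - k))) \<le>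
        (C1 * (real (m + 1) powr (- \<nu> - 1 / 2) * (real (?N + 1) / real (2 * k + 1)) ^ R) / fact (2 * k) * b ^ (2 * k)) *
        (C2 * (real (m + 1) powr (- \<mu> - 1 / 2) * (real (?N + 1) / real (2 * (m - k) + 1)) ^ S) / fact (2 * (m - k)) * a ^ (2 * (m - k)))"
        using a b C1(1) C2(1) by (intro mult_mono mult_right_mono e1 e2) (auto intro!: mult_nonneg_nonneg)
      also have "\<dots> = ?D * ?t (2 * k)"
        unfolding ch nk p by (simp add: mult_ac)
      finally show ?thesis using a b by (simp add: abs_mult)
    qed
    have "(\<Sum>k\<le>m. \<bar>bessel_coeff \<nu> k * b ^ (2 * k)\<bar> * \<bar>bessel_coeff \<mu> (m - k) * a ^ (2 * (m - k))\<bar>)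
        \<le> (\<Sum>k\<le>m. ?D * ?t (2 * k))"
      by (intro sum_mono term_le) auto
    also have "\<dots> = (\<Sum>j\<in>(\<lambda>k. 2 * k) ` {..m}. ?D * ?t j)"
      by (subst sum.reindex) (auto simp: inj_on_def)
    also have "\<dots> \<le> (\<Sum>j\<le>?N. ?D * ?t j)"
      using a b C1(1) C2(1) by (intro sum_mono2) auto
    also have "\<dots> = ?D * (\<Sum>j\<le>?N. ?t j)" by (simp only: sum_distrib_left)
    also have "\<dots> \<le> ?D * (K * (a + b) ^ ?N)"
      unfolding K_def using C1(1) C2(1) by (intro mult_left_mono binomial_weighted_sum_bound a b) auto
    finally show ?thesis by (simp add: mult_ac)
  qed
  moreover have "C1 * C2 * K \<ge> 0" using C1(1) C2(1) K by simp
  ultimately show ?thesis by blast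
qed

section \<open>A Poisson-type integral\<close>

abbreviation unit_measure :: "real measure" where
  "unit_measure \<equiv> restrict_space lborel {0<..<1}"

lemma unit_measurable: "continuous_on {0<..<1} f \<Longrightarrow> f \<in> borel_measurable unit_measure"
  for f :: "real \<Rightarrow> 'b::topological_space"
  using borel_measurable_continuous_on_restrict[of "{0<..<1}" f]
  by (simp cong: measurable_cong_sets add: sets_restrict_space)

lemma unit_integrable_bound:
  fixes f :: "real \<Rightarrow> complex"
  assumes "integrable unit_measure g" "continuous_on {0<..<1} f"
    and "\<And>x. 0 < x \<Longrightarrow> x < 1 \<Longrightarrow> norm (f x) \<le> g x"
  shows "integrable unit_measure f"
proof (rule Bochner_Integration.integrable_bound[OF assms(1) unit_measurable[OF assms(2)]])
  have "norm (f x) \<le> norm (g x)" if "0 < x" "x < 1" for x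
    using assms(3)[OF that] by simp
  then show "AE x in unit_measure. norm (f x) \<le> norm (g x)"
    by (intro AE_I2) (auto simp: space_restrict_space)
qed

lemma unit_Beta_integral:
  fixes a b :: real
  assumes "a > 0" "b > 0"
  shows "integrable unit_measure (\<lambda>u. u powr (a - 1) * (1 - u) powr (b - 1))"
    and "(\<integral>u. u powr (a - 1) * (1 - u) powr (b - 1) \<partial>unit_measure) = Beta a b"
proof -
  let ?f = "\<lambda>u. u powr (a - 1) * (1 - u) powr (b - 1)"
  have "set_integrable lborel {0<..<1} ?f"
    using integrable_Beta[OF assms] by (rule set_integrable_subset) auto
  then show int: "integrable unit_measure ?f"
    by (simp add: integrable_restrict_space set_integrable_def)
  have "integral\<^sup>L unit_measure ?f = (LINT u:{0<..<1}|lborel. ?f u)"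
    by (simp add: integral_restrict_space set_lebesgue_integral_def)
  also have "\<dots> = integral {0<..<1} ?f"
    using \<open>set_integrable lborel {0<..<1} ?f\<close> by (rule set_borel_integral_eq_integral)
  also have "\<dots> = Beta a b"
    using has_integral_Beta_real[OF assms] has_integral_open_interval[of ?f "Beta a b" 0 1]
    by (simp add: integral_unique)
  finally show "integral\<^sup>L unit_measure ?f = Beta a b" .
qed

definition poisson_weight :: "real \<Rightarrow> real \<Rightarrow> real" where
  "poisson_weight \<mu> u = u powr (- 1 / 2) * (1 - u) powr (\<mu> - 1 / 2)"

definition sym_power :: "real \<Rightarrow> complex \<Rightarrow> real \<Rightarrow> complex" where
  "sym_power z p u = (p + \<i> * of_real (sqrt u)) powr of_real z + (p - \<i> * of_real (sqrt u)) powr of_real z"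

text \<open>
  With \<open>u = t\<^sup>2\<close> this is the integral of \<open>(p + \<i> t)^z\<close> against \<open>(1 - t\<^sup>2)^(\<mu> - 1 / 2)\<close> over \<open>- 1 < t < 1\<close>, folded at
  \<open>t = 0\<close>. Poisson's integral for \<open>J\<^sub>\<mu>\<close> leads to it under the Laplace transform. It converges for every
  real \<open>z\<close>, while the Laplace integral does not.
\<close>

definition poisson_integral :: "real \<Rightarrow> real \<Rightarrow> complex \<Rightarrow> complex" where
  "poisson_integral \<mu> z p = (\<integral>u. of_real (poisson_weight \<mu> u) * sym_power z p u \<partial>unit_measure) / 2"

lemma poisson_weight_moment:
  assumes "\<mu> \<ge> 0" "z > -1"
  shows "integrable unit_measure (\<lambda>u. poisson_weight \<mu> u * u powr (z / 2))"
    and "(\<integral>u. poisson_weight \<mu> u * u powr (z / 2) \<partial>unit_measure) = Beta ((z + 1) / 2) (\<mu> + 1 / 2)"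
proof -
  have *: "poisson_weight \<mu> u * u powr (z / 2) = u powr ((z + 1) / 2 - 1) * (1 - u) powr (\<mu> + 1 / 2 - 1)" for u
  proof -
    have "(z + 1) / 2 - 1 = - 1 / 2 + z / 2" by (simp add: field_simps)
    then have "u powr ((z + 1) / 2 - 1) = u powr (- 1 / 2) * u powr (z / 2)" by (simp only: powr_add)
    then show ?thesis by (simp add: poisson_weight_def)
  qed
  show "integrable unit_measure (\<lambda>u. poisson_weight \<mu> u * u powr (z / 2))"
    and "(\<integral>u. poisson_weight \<mu> u * u powr (z / 2) \<partial>unit_measure) = Beta ((z + 1) / 2) (\<mu> + 1 / 2)"
    unfolding * using assms by (intro unit_Beta_integral; simp)+
qed

lemma poisson_weight_integrable: "\<mu> \<ge> 0 \<Longrightarrow> integrable unit_measure (poisson_weight \<mu>)"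
proof -
  assume "\<mu> \<ge> 0"
  then have "integrable unit_measure (\<lambda>u. poisson_weight \<mu> u * u powr (0 / 2))"
    by (intro poisson_weight_moment) auto
  then show ?thesis
    by (subst Bochner_Integration.integrable_cong[OF refl, of _ _ "\<lambda>u. poisson_weight \<mu> u * u powr (0 / 2)"])
      (auto simp: space_restrict_space)
qed

lemma continuous_poisson_weight: "continuous_on {0<..<1} (\<lambda>u. complex_of_real (poisson_weight \<mu> u))"
  unfolding poisson_weight_def by (intro continuous_intros) auto

lemma sym_power_base:
  assumes "Re p > 0 \<or> Re p \<ge> 0 \<and> Im p = 0 \<and> u > 0"
  shows "p + \<i> * of_real (sqrt u) \<notin> \<real>\<^sub>\<le>\<^sub>0" "p - \<i> * of_real (sqrt u) \<notin> \<real>\<^sub>\<le>\<^sub>0"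
  using assms by (auto simp: complex_nonpos_Reals_iff complex_eq_iff)

lemma continuous_on_powr_slit:
  fixes f :: "'a::topological_space \<Rightarrow> complex"
  assumes "continuous_on A f" "\<And>x. x \<in> A \<Longrightarrow> f x \<notin> \<real>\<^sub>\<le>\<^sub>0"
  shows "continuous_on A (\<lambda>x. f x powr c)"
proof (rule continuous_on_powr_complex)
  show "A \<subseteq> {x. 0 \<le> Re (f x) \<or> Im (f x) \<noteq> 0}"
    using assms(2) by (force simp: complex_nonpos_Reals_iff)
  show "0 < Re c" if "x \<in> A" "f x = 0" for x
    using assms(2)[OF that(1)] that(2) by simp
qed (use assms in auto)

lemma continuous_sym_power:
  assumes "Re p > 0 \<or> Re p \<ge> 0 \<and> Im p = 0"
  shows "continuous_on {0<..<1} (sym_power z p)"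
proof -
  have "continuous_on {0<..<1} (\<lambda>u. (p + \<i> * of_real (sqrt u)) powr of_real z + (p - \<i> * of_real (sqrt u)) powr of_real z)"
    by (intro continuous_on_add continuous_on_powr_slit continuous_intros sym_power_base) (use assms in auto)
  then show ?thesis by (simp add: sym_power_def[abs_def])
qed

lemma sym_power_has_derivative:
  assumes "Re p > 0 \<or> Re p \<ge> 0 \<and> Im p = 0 \<and> u > 0"
  shows "((\<lambda>p. sym_power z p u) has_field_derivative of_real z * sym_power (z - 1) p u) (at p)"
  unfolding sym_power_def using sym_power_base[OF assms]
  by (auto intro!: derivative_eq_intros simp: algebra_simps)

text \<open>
  Whatever the sign of \<open>z\<close>, one of the two powers dominates.
\<close>

lemma norm_sym_power_le:
  assumes "0 < r" "r \<le> Re p" "norm p \<le> R" "0 < u" "u < 1"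
  shows "norm (sym_power z p u) \<le> 2 * (r powr z + (R + 1) powr z)"
proof -
  have s: "0 \<le> sqrt u" "sqrt u \<le> 1" using assms by auto
  have *: "norm (q powr of_real z) \<le> r powr z + (R + 1) powr z" if "Re q = Re p" "norm q \<le> norm p + sqrt u" for q
  proof -
    have "r \<le> norm q" using complex_Re_le_cmod[of q] that assms by linarith
    moreover have "norm q \<le> R + 1" using that assms s by linarith
    ultimately have "norm q powr z \<le> r powr z + (R + 1) powr z"
    proof (cases "z \<ge> 0")
      case True
      then have "norm q powr z \<le> (R + 1) powr z" using \<open>norm q \<le> R + 1\<close> by (intro powr_mono2) auto
      then show ?thesis by (simp add: add_increasing)
    next
      case False
      then have "norm q powr z \<le> r powr z" using \<open>r \<le> norm q\<close> assms by (intro powr_mono2') auto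
      then show ?thesis by (simp add: add_increasing2)
    qed
    then show ?thesis by (simp add: norm_powr_real_powr')
  qed
  have "norm (sym_power z p u) \<le> norm ((p + \<i> * of_real (sqrt u)) powr of_real z) + norm ((p - \<i> * of_real (sqrt u)) powr of_real z)"
    unfolding sym_power_def by (rule norm_triangle_ineq)
  also have "\<dots> \<le> (r powr z + (R + 1) powr z) + (r powr z + (R + 1) powr z)"
  proof (intro add_mono *)
    show "norm (p + \<i> * of_real (sqrt u)) \<le> norm p + sqrt u"
      using norm_triangle_ineq[of p "\<i> * of_real (sqrt u)"] s by (simp add: norm_mult)
    show "norm (p - \<i> * of_real (sqrt u)) \<le> norm p + sqrt u"
      using norm_triangle_ineq4[of p "\<i> * of_real (sqrt u)"] s by (simp add: norm_mult)
  qed auto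
  finally show ?thesis by simp
qed

lemma sym_power_weight_integrable:
  assumes "\<mu> \<ge> 0" "Re p > 0"
  shows "integrable unit_measure (\<lambda>u. of_real (poisson_weight \<mu> u) * sym_power z p u)"
proof (rule unit_integrable_bound)
  let ?B = "2 * ((Re p) powr z + (norm p + 1) powr z)"
  show "integrable unit_measure (\<lambda>u. ?B * poisson_weight \<mu> u)"
    by (intro integrable_mult_right poisson_weight_integrable assms)
  show "continuous_on {0<..<1} (\<lambda>u. of_real (poisson_weight \<mu> u) * sym_power z p u)"
    using assms by (intro continuous_on_mult continuous_poisson_weight continuous_sym_power) auto
  fix u :: real assume u: "0 < u" "u < 1"
  have w: "poisson_weight \<mu> u \<ge> 0" by (simp add: poisson_weight_def)
  have "norm (sym_power z p u) \<le> ?B" using assms u by (intro norm_sym_power_le) auto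
  then have "poisson_weight \<mu> u * norm (sym_power z p u) \<le> poisson_weight \<mu> u * ?B"
    using w by (rule mult_left_mono)
  then show "norm (of_real (poisson_weight \<mu> u) * sym_power z p u) \<le> ?B * poisson_weight \<mu> u"
    using w by (simp add: norm_mult mult.commute)
qed

lemma poisson_integral_has_derivative:
  assumes \<mu>: "\<mu> \<ge> 0" and p0: "Re p0 > 0"
  shows "(poisson_integral \<mu> z has_field_derivative of_real z * poisson_integral \<mu> (z - 1) p0) (at p0)"
proof -
  let ?f = "\<lambda>u p. complex_of_real (poisson_weight \<mu> u) * sym_power z p u"
  let ?I = "\<lambda>p. \<integral>u. ?f u p \<partial>unit_measure"
  define r where "r = Re p0 / 2"
  have r: "r > 0" using p0 by (simp add: r_def)
  have near: "r \<le> Re p" "norm p \<le> norm p0 + r" if "p \<in> ball p0 r" for p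
  proof -
    have d: "norm (p0 - p) < r" using that by (simp add: dist_norm)
    have "Re p0 - Re p < r" using d complex_Re_le_cmod[of "p0 - p"] by simp
    then show "r \<le> Re p" by (simp add: r_def)
    show "norm p \<le> norm p0 + r" using d norm_triangle_ineq2[of p p0] by (simp add: norm_minus_commute)
  qed
  let ?B = "2 * (r powr z + (norm p0 + r + 1) powr z)"
  have meas: "(\<lambda>u. ?f u p) \<in> borel_measurable unit_measure" if "p \<in> ball p0 r" for p
    using near[OF that] r
    by (intro unit_measurable continuous_on_mult continuous_poisson_weight continuous_sym_power) auto
  have der: "(?f u has_field_derivative of_real (poisson_weight \<mu> u) * (of_real z * sym_power (z - 1) p u)) (at p)"
    if "u \<in> space unit_measure" "Re p > 0" for u p
    using that by (intro DERIV_cmult sym_power_has_derivative) (auto simp: space_restrict_space)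
  have hol: "?f u holomorphic_on ball p0 r" if "u \<in> space unit_measure" for u
    unfolding holomorphic_on_open[OF open_ball]
  proof
    fix p assume "p \<in> ball p0 r"
    then have "Re p > 0" using near(1)[of p] r by linarith
    then show "\<exists>f'. (?f u has_field_derivative f') (at p)" using der[OF that] by blast
  qed
  have bound: "norm (?f u p) \<le> ?B * poisson_weight \<mu> u" if "u \<in> space unit_measure" "p \<in> ball p0 r" for u p
  proof -
    have w: "poisson_weight \<mu> u \<ge> 0" by (simp add: poisson_weight_def)
    have "norm (sym_power z p u) \<le> 2 * (r powr z + ((norm p0 + r) + 1) powr z)"
      using that near[of p] r by (intro norm_sym_power_le) (auto simp: space_restrict_space)
    then have "poisson_weight \<mu> u * norm (sym_power z p u) \<le> poisson_weight \<mu> u * ?B"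
      using w by (rule mult_left_mono)
    then show ?thesis using w by (simp add: norm_mult mult.commute)
  qed
  have int: "integrable unit_measure (\<lambda>u. ?B * poisson_weight \<mu> u)"
    by (intro integrable_mult_right poisson_weight_integrable \<mu>)
  note pi = holomorphic_param_integral[OF r meas hol bound int]
  have "(?I has_field_derivative deriv ?I p0) (at p0)"
    using pi(1) r by (intro holomorphic_derivI[OF _ open_ball]) auto
  moreover have "deriv ?I p0 = (\<integral>u. deriv (?f u) p0 \<partial>unit_measure)"
    using pi(2)[of 1] by simp
  also have "\<dots> = (\<integral>u. of_real z * (of_real (poisson_weight \<mu> u) * sym_power (z - 1) p0 u) \<partial>unit_measure)"
    using der p0 by (intro Bochner_Integration.integral_cong refl) (simp add: DERIV_imp_deriv mult_ac)
  also have "\<dots> = of_real z * (\<integral>u. of_real (poisson_weight \<mu> u) * sym_power (z - 1) p0 u \<partial>unit_measure)"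
    by (rule integral_mult_right_zero)
  finally have "(?I has_field_derivative of_real z * (\<integral>u. of_real (poisson_weight \<mu> u) * sym_power (z - 1) p0 u \<partial>unit_measure)) (at p0)" .
  from DERIV_cdivide[OF this, of 2] show ?thesis
    by (simp add: poisson_integral_def[abs_def])
qed

text \<open>
  Exponents that differ by integers express the boundary terms of the integration by parts in
  \<open>poisson_integral_ode\<close> through the integrands themselves.
\<close>

lemma sym_power_Suc_relations:
  fixes z u :: real and p :: complex
  assumes "Re p > 0" "u \<ge> 0"
  defines "\<tau> \<equiv> sqrt u"
  defines "A \<equiv> (p + \<i> * of_real \<tau>) powr of_real (z - 1)" and "B \<equiv> (p - \<i> * of_real \<tau>) powr of_real (z - 1)"
  shows "\<i> * of_real \<tau> * (A - B) = sym_power z p u - p * sym_power (z - 1) p u"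
    and "(1 - of_real u) * sym_power (z - 2) p u =
      sym_power z p u - 2 * p * sym_power (z - 1) p u + (1 + p\<^sup>2) * sym_power (z - 2) p u"
proof -
  let ?q = "p + \<i> * of_real \<tau>" and ?r = "p - \<i> * of_real \<tau>"
  have ne: "?q \<noteq> 0" "?r \<noteq> 0" using assms by (auto simp: complex_eq_iff)
  have u: "complex_of_real u = of_real \<tau> * of_real \<tau>"
    using assms(2) by (simp add: \<tau>_def flip: of_real_mult)
  have step: "w powr of_real (y + 1) = w * w powr of_real y" if "w \<noteq> 0" for w :: complex and y :: real
    using that powr_add[of w 1 "of_real y"] by (simp add: add.commute)
  have z1: "w powr of_real (z - 1) = w * w powr of_real (z - 2)"
    and z0: "w powr of_real z = w * w * w powr of_real (z - 2)" if "w \<noteq> 0" for w :: complex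
    using step[OF that, of "z - 2"] step[OF that, of "z - 1"] by simp_all
  define C where "C = ?q powr of_real (z - 2)"
  define D where "D = ?r powr of_real (z - 2)"
  have S: "sym_power z p u = ?q * ?q * C + ?r * ?r * D" "sym_power (z - 1) p u = ?q * C + ?r * D"
    "sym_power (z - 2) p u = C + D"
    unfolding sym_power_def \<tau>_def[symmetric] z0[OF ne(1)] z0[OF ne(2)] z1[OF ne(1)] z1[OF ne(2)] C_def D_def by auto
  have AB: "A = ?q * C" "B = ?r * D"
    unfolding A_def B_def z1[OF ne(1)] z1[OF ne(2)] C_def D_def by auto
  show "\<i> * of_real \<tau> * (A - B) = sym_power z p u - p * sym_power (z - 1) p u"
    unfolding S AB by (simp add: algebra_simps)
  show "(1 - of_real u) * sym_power (z - 2) p u =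
      sym_power z p u - 2 * p * sym_power (z - 1) p u + (1 + p\<^sup>2) * sym_power (z - 2) p u"
    unfolding S u by (simp add: algebra_simps power2_eq_square)
qed

text \<open>
  The combination of the three integrands is, up to a factor, the derivative in \<open>u\<close> of
  \<open>(1 - u)^(\<mu> + 1 / 2) ((p + \<i> t)^(z - 1) - (p - \<i> t)^(z - 1))\<close> with \<open>t = sqrt u\<close>, which vanishes at both ends.
\<close>

lemma poisson_integral_ode:
  assumes \<mu>: "\<mu> \<ge> 0" and p: "Re p > 0"
  shows "of_real (2 * \<mu> + z) * poisson_integral \<mu> z p - of_real (2 * \<mu> + 2 * z - 1) * p * poisson_integral \<mu> (z - 1) p
     + of_real (z - 1) * (1 + p\<^sup>2) * poisson_integral \<mu> (z - 2) p = 0"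
proof -
  let ?w = "\<lambda>u. complex_of_real (poisson_weight \<mu> u)"
  let ?K = "\<lambda>z u. sym_power z p u"
  let ?A = "\<lambda>u. (p + \<i> * of_real (sqrt u)) powr of_real (z - 1)" and ?B = "\<lambda>u. (p - \<i> * of_real (sqrt u)) powr of_real (z - 1)"
  let ?F = "\<lambda>u. complex_of_real ((1 - u) powr (\<mu> + 1 / 2)) * (?A u - ?B u)"
  define f where "f = (\<lambda>u. of_real (2 * \<mu> + z) * (?w u * ?K z u) + (- of_real (2 * \<mu> + 2 * z - 1) * p) * (?w u * ?K (z - 1) u)
     + (of_real (z - 1) * (1 + p\<^sup>2)) * (?w u * ?K (z - 2) u))"
  have i: "integrable unit_measure (\<lambda>u. ?w u * ?K y u)" for y
    by (rule sym_power_weight_integrable[OF \<mu> p])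
  have f_int: "integrable unit_measure f"
    unfolding f_def by (intro Bochner_Integration.integrable_add integrable_mult_right i)
  have Ff: "(?F has_vector_derivative (\<i> / 2) * f u) (at u)" if u: "0 < u" "u < 1" for u
  proof -
    define t where "t = sqrt u"
    have t: "t > 0" "t * t = u" using u by (auto simp: t_def)
    define q where "q = p + \<i> * of_real t"
    define r where "r = p - \<i> * of_real t"
    have nq: "q \<notin> \<real>\<^sub>\<le>\<^sub>0" "r \<notin> \<real>\<^sub>\<le>\<^sub>0"
      using sym_power_base[of p u] p u by (auto simp: q_def r_def t_def)
    have dt: "(sqrt has_real_derivative 1 / (2 * t)) (at u)"
      using u by (auto intro!: derivative_eq_intros simp: t_def field_simps)
    have dtc: "((\<lambda>u. complex_of_real (sqrt u)) has_vector_derivative of_real (1 / (2 * t))) (at u)"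
      by (rule has_vector_derivative_of_real[OF dt])
    have dq: "((\<lambda>u. p + \<i> * of_real (sqrt u)) has_vector_derivative \<i> * of_real (1 / (2 * t))) (at u)"
      "((\<lambda>u. p - \<i> * of_real (sqrt u)) has_vector_derivative - (\<i> * of_real (1 / (2 * t)))) (at u)"
      using has_vector_derivative_add[OF has_vector_derivative_const[of p] has_vector_derivative_mult_right[OF dtc, of \<i>]]
        has_vector_derivative_diff[OF has_vector_derivative_const[of p] has_vector_derivative_mult_right[OF dtc, of \<i>]]
      by simp_all
    have pw: "((\<lambda>w. w powr of_real (z - 1)) has_field_derivative of_real (z - 1) * v powr of_real (z - 2)) (at v)"
      if "v \<notin> \<real>\<^sub>\<le>\<^sub>0" for v :: complex
      using has_field_derivative_powr[OF that, of "of_real (z - 1)"] by (simp add: algebra_simps)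
    have dA: "(?A has_vector_derivative \<i> * of_real (1 / (2 * t)) * (of_real (z - 1) * q powr of_real (z - 2))) (at u)"
      using field_vector_diff_chain_at[OF dq(1), of "\<lambda>w. w powr of_real (z - 1)"] pw[OF nq(1)]
      by (simp add: o_def q_def t_def)
    have dB: "(?B has_vector_derivative - (\<i> * of_real (1 / (2 * t))) * (of_real (z - 1) * r powr of_real (z - 2))) (at u)"
      using field_vector_diff_chain_at[OF dq(2), of "\<lambda>w. w powr of_real (z - 1)"] pw[OF nq(2)]
      by (simp add: o_def r_def t_def)
    have dW: "((\<lambda>u. complex_of_real ((1 - u) powr (\<mu> + 1 / 2))) has_vector_derivative
        of_real (- (\<mu> + 1 / 2) * (1 - u) powr (\<mu> - 1 / 2))) (at u)"
    proof (rule has_vector_derivative_of_real)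
      have 1: "((\<lambda>u. 1 - u) has_real_derivative -1) (at u)" by (auto intro!: derivative_eq_intros)
      have 2: "((\<lambda>x. x powr (\<mu> + 1 / 2)) has_real_derivative (\<mu> + 1 / 2) * (1 - u) powr (\<mu> + 1 / 2 - 1)) (at (1 - u))"
        by (rule has_real_derivative_powr) (use u in simp)
      show "((\<lambda>u. (1 - u) powr (\<mu> + 1 / 2)) has_real_derivative - (\<mu> + 1 / 2) * (1 - u) powr (\<mu> - 1 / 2)) (at u)"
        by (rule DERIV_chain2[OF 2 1, THEN DERIV_cong]) (simp add: algebra_simps)
    qed
    define V where "V = complex_of_real ((1 - u) powr (\<mu> - 1 / 2))"
    have V1: "complex_of_real ((1 - u) powr (\<mu> + 1 / 2)) = (1 - of_real u) * V"
    proof -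
      have "(1 - u) powr (\<mu> + 1 / 2) = (1 - u) * (1 - u) powr (\<mu> - 1 / 2)"
        using u powr_add[of "1 - u" 1 "\<mu> - 1 / 2"] by (simp add: add.commute)
      then show ?thesis by (simp add: V_def)
    qed
    have w: "?w u = V / of_real t"
    proof -
      have "u powr (- 1 / 2) = u powr (- (1 / 2))" by simp
      also have "\<dots> = 1 / t" unfolding powr_minus using u by (simp add: t_def powr_half_sqrt inverse_eq_divide)
      finally show ?thesis by (simp add: poisson_weight_def V_def)
    qed
    define S where "S = \<i> / (2 * of_real t)"
    have "(?F has_vector_derivative complex_of_real ((1 - u) powr (\<mu> + 1 / 2)) *
        (\<i> * of_real (1 / (2 * t)) * (of_real (z - 1) * q powr of_real (z - 2)) -
         - (\<i> * of_real (1 / (2 * t))) * (of_real (z - 1) * r powr of_real (z - 2))) +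
        of_real (- (\<mu> + 1 / 2) * (1 - u) powr (\<mu> - 1 / 2)) * (?A u - ?B u)) (at u)"
      by (rule has_vector_derivative_mult[OF dW has_vector_derivative_diff[OF dA dB]])
    moreover have "complex_of_real ((1 - u) powr (\<mu> + 1 / 2)) *
        (\<i> * of_real (1 / (2 * t)) * (of_real (z - 1) * q powr of_real (z - 2)) -
         - (\<i> * of_real (1 / (2 * t))) * (of_real (z - 1) * r powr of_real (z - 2))) +
        of_real (- (\<mu> + 1 / 2) * (1 - u) powr (\<mu> - 1 / 2)) * (?A u - ?B u) = (\<i> / 2) * f u"
    proof -
      have k2: "?K (z - 2) u = q powr of_real (z - 2) + r powr of_real (z - 2)"
        by (simp add: sym_power_def q_def r_def t_def)
      note rel = sym_power_Suc_relations[OF p less_imp_le[OF u(1)], of z]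
      have r1: "\<i> * of_real t * (?A u - ?B u) = ?K z u - p * ?K (z - 1) u" using rel(1) by (simp add: t_def)
      have r2: "(1 - of_real u) * ?K (z - 2) u = ?K z u - 2 * p * ?K (z - 1) u + (1 + p\<^sup>2) * ?K (z - 2) u" by (rule rel(2))
      have tc: "complex_of_real t \<noteq> 0" using t by simp
      define AB where "AB = ?A u - ?B u"
      define k0 where "k0 = ?K z u" define k1 where "k1 = ?K (z - 1) u" define k2' where "k2' = ?K (z - 2) u"
      have AB: "AB = - \<i> * (k0 - p * k1) / of_real t"
      proof -
        have "\<i> * (\<i> * of_real t * AB) = \<i> * (k0 - p * k1)" using r1 by (simp add: AB_def k0_def k1_def)
        then have "- (of_real t * AB) = \<i> * (k0 - p * k1)" by (simp add: mult.assoc[symmetric])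
        then have "- (- (of_real t * AB)) = - (\<i> * (k0 - p * k1))" by (rule arg_cong)
        then have "of_real t * AB = - \<i> * (k0 - p * k1)" by (simp only: minus_minus mult_minus_left)
        then show ?thesis using tc by (simp add: field_simps)
      qed
      have "complex_of_real ((1 - u) powr (\<mu> + 1 / 2)) *
        (\<i> * of_real (1 / (2 * t)) * (of_real (z - 1) * q powr of_real (z - 2)) -
         - (\<i> * of_real (1 / (2 * t))) * (of_real (z - 1) * r powr of_real (z - 2))) +
        of_real (- (\<mu> + 1 / 2) * (1 - u) powr (\<mu> - 1 / 2)) * (?A u - ?B u) =
        V * S * of_real (z - 1) * ((1 - of_real u) * k2') + of_real (- (\<mu> + 1 / 2)) * V * AB"
      proof -
        have Seq: "\<i> * complex_of_real (1 / (2 * t)) = S" by (simp add: S_def)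
        show ?thesis
          unfolding Seq V1 k2'_def k2 AB_def[symmetric] of_real_mult[of "- (\<mu> + 1 / 2)"] V_def[symmetric]
          by (simp add: algebra_simps)
      qed
      also have "\<dots> = V * S * of_real (z - 1) * (k0 - 2 * p * k1 + (1 + p\<^sup>2) * k2') + of_real (- (\<mu> + 1 / 2)) * V * AB"
        using r2 by (simp add: k0_def k1_def k2'_def)
      also have "\<dots> = (\<i> / 2) * f u"
        unfolding f_def w k0_def[symmetric] k1_def[symmetric] k2'_def[symmetric] AB S_def
        using tc by (simp add: field_simps)
      finally show ?thesis .
    qed
    ultimately show ?thesis by (simp only:)
  qed
  have "((\<lambda>u. (\<i> / 2) * f u) has_integral (?F 1 - ?F 0)) {0..1}"
  proof (rule fundamental_theorem_of_calculus_interior)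
    have "continuous_on {0..1} ?A" "continuous_on {0..1} ?B"
      by (intro continuous_on_powr_slit continuous_intros sym_power_base disjI1 p)+
    moreover have "continuous_on {0..1} (\<lambda>u. complex_of_real ((1 - u) powr (\<mu> + 1 / 2)))"
      using \<mu> by (intro continuous_on_of_real continuous_on_powr' continuous_intros) auto
    ultimately show "continuous_on {0..1} ?F" by (intro continuous_on_mult continuous_on_diff)
  qed (use Ff in auto)
  then have "((\<lambda>u. (\<i> / 2) * f u) has_integral 0) {0..1}" by simp
  then have "((\<lambda>u. (\<i> / 2) * f u) has_integral 0) {0<..<1}"
    using has_integral_open_interval[of "\<lambda>u. (\<i> / 2) * f u" 0 0 1] by simp
  then have "integral {0<..<1} (\<lambda>u. (\<i> / 2) * f u) = 0" by (rule integral_unique)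
  then have I0: "integral {0<..<1} f = 0" by simp
  have "set_integrable lborel {0<..<1} f"
    using f_int by (simp add: set_integrable_def integrable_restrict_space)
  then have "(LINT u:{0<..<1}|lborel. f u) = 0"
    using set_borel_integral_eq_integral(2)[of "{0<..<1}" f] I0 by simp
  then have I0': "integral\<^sup>L unit_measure f = 0"
    by (simp add: integral_restrict_space set_lebesgue_integral_def)
  have I: "integral\<^sup>L unit_measure f = of_real (2 * \<mu> + z) * (2 * poisson_integral \<mu> z p)
     + (- of_real (2 * \<mu> + 2 * z - 1) * p) * (2 * poisson_integral \<mu> (z - 1) p)
     + (of_real (z - 1) * (1 + p\<^sup>2)) * (2 * poisson_integral \<mu> (z - 2) p)"
    unfolding f_def poisson_integral_def
    using i[of z] i[of "z - 1"] i[of "z - 2"] by (simp add: Bochner_Integration.integral_add)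
  have "2 * (of_real (2 * \<mu> + z) * poisson_integral \<mu> z p - of_real (2 * \<mu> + 2 * z - 1) * p * poisson_integral \<mu> (z - 1) p
     + of_real (z - 1) * (1 + p\<^sup>2) * poisson_integral \<mu> (z - 2) p) = integral\<^sup>L unit_measure f"
    unfolding I by (simp add: algebra_simps)
  also note I0'
  finally show ?thesis by (rule mult_eq_0_iff[THEN iffD1, THEN disjE]) simp_all
qed

section \<open>The Laplace transform belonging to a Bessel function\<close>

text \<open>
  The termwise Laplace transform of \<open>x^(- z - 1)\<close> times the entire factor of \<open>J\<^sub>\<mu>\<close>; it converges for \<open>p > 1\<close>.
\<close>

definition laplace_series :: "real \<Rightarrow> real \<Rightarrow> real \<Rightarrow> real" where
  "laplace_series \<mu> z p = (\<Sum>l. bessel_coeff \<mu> l * Gamma (2 * real l - z) * p powr (z - 2 * real l))"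

text \<open>
  The value at \<open>p = 0\<close> of the same Laplace transform, that is, the Mellin transform of the entire factor of \<open>J\<^sub>\<mu>\<close>
  at \<open>- y\<close>, continued analytically in \<open>y\<close>.
\<close>

definition bessel_mellin :: "real \<Rightarrow> real \<Rightarrow> real" where
  "bessel_mellin \<mu> y = 2 powr (- y - 1) * Gamma (- y / 2) * rGamma (\<mu> + 1 + y / 2)"

definition bessel_laplace :: "real \<Rightarrow> real \<Rightarrow> complex \<Rightarrow> complex" where
  "bessel_laplace \<mu> z p = of_real (Gamma (- z) / (sqrt pi * Gamma (\<mu> + 1 / 2))) * poisson_integral \<mu> z p"

lemma not_Ints_minus: "z \<notin> \<int> \<Longrightarrow> - z \<notin> \<int>" for z :: real
  using Ints_minus[of "- z"] by auto

lemma Gamma_one_minus: "z \<notin> \<int> \<Longrightarrow> Gamma (1 - z) = - z * Gamma (- z)" for z :: real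
  using Gamma_plus1_real_notin_Ints[OF not_Ints_minus, of z] by (simp add: add.commute)

lemma bessel_laplace_has_derivative:
  assumes "\<mu> \<ge> 0" "Re p > 0" "z \<notin> \<int>"
  shows "(bessel_laplace \<mu> z has_field_derivative - bessel_laplace \<mu> (z - 1) p) (at p)"
proof -
  have "Gamma (- (z - 1)) = - z * Gamma (- z)" using Gamma_one_minus[OF assms(3)] by simp
  then have "- bessel_laplace \<mu> (z - 1) p =
      of_real (Gamma (- z) / (sqrt pi * Gamma (\<mu> + 1 / 2))) * (of_real z * poisson_integral \<mu> (z - 1) p)"
    unfolding bessel_laplace_def by simp
  then show ?thesis
    using DERIV_cmult[OF poisson_integral_has_derivative[OF assms(1,2), of z], of "of_real (Gamma (- z) / (sqrt pi * Gamma (\<mu> + 1 / 2)))"]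
    by (simp add: bessel_laplace_def[abs_def])
qed

lemma bessel_laplace_ode:
  assumes "\<mu> \<ge> 0" "Re p > 0" "z \<notin> \<int>"
  shows "(1 + p\<^sup>2) * bessel_laplace \<mu> (z - 2) p + of_real (2 * \<mu> + 2 * z - 1) * p * bessel_laplace \<mu> (z - 1) p
    + of_real (z * (2 * \<mu> + z)) * bessel_laplace \<mu> z p = 0"
proof -
  define c where "c = complex_of_real (Gamma (- z) / (sqrt pi * Gamma (\<mu> + 1 / 2)))"
  define P where "P = (\<lambda>y. poisson_integral \<mu> y p)"
  have g1: "Gamma (- (z - 1)) = - z * Gamma (- z)" using Gamma_one_minus[OF assms(3)] by simp
  have "z - 1 \<notin> \<int>" using not_Ints_shift(1)[OF assms(3), of 1] by simp
  then have g2: "Gamma (- (z - 2)) = z * (z - 1) * Gamma (- z)"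
    using Gamma_one_minus[of "z - 1"] g1 by (simp add: algebra_simps)
  have L: "bessel_laplace \<mu> z p = c * P z" "bessel_laplace \<mu> (z - 1) p = - of_real z * c * P (z - 1)"
    "bessel_laplace \<mu> (z - 2) p = of_real (z * (z - 1)) * c * P (z - 2)"
    unfolding bessel_laplace_def g1 g2 c_def P_def by simp_all
  have "(1 + p\<^sup>2) * bessel_laplace \<mu> (z - 2) p + of_real (2 * \<mu> + 2 * z - 1) * p * bessel_laplace \<mu> (z - 1) p
    + of_real (z * (2 * \<mu> + z)) * bessel_laplace \<mu> z p
    = of_real z * c * (of_real (2 * \<mu> + z) * P z - of_real (2 * \<mu> + 2 * z - 1) * p * P (z - 1) + of_real (z - 1) * (1 + p\<^sup>2) * P (z - 2))"
    unfolding L by (simp add: algebra_simps)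
  also have "\<dots> = 0" using poisson_integral_ode[OF assms(1,2), of z] by (simp add: P_def)
  finally show ?thesis .
qed

lemma bessel_laplace_coeff:
  assumes "\<mu> \<ge> 0" "z \<notin> \<int>"
  shows "Gamma (- z) / (sqrt pi * Gamma (\<mu> + 1 / 2)) * ((z gchoose (2 * l)) * (-1) ^ l * Beta (real l + 1 / 2) (\<mu> + 1 / 2))
    = bessel_coeff \<mu> l * Gamma (2 * real l - z)"
proof -
  have nz: "- z \<notin> \<int>\<^sub>\<le>\<^sub>0" using not_Ints_minus[OF assms(2)] nonpos_Ints_Int by blast
  have G0: "Gamma (- z) \<noteq> 0" using nz by (simp add: Gamma_eq_zero_iff)
  have "pochhammer (- z) (2 * l) = Gamma (- z + real (2 * l)) / Gamma (- z)" by (rule pochhammer_Gamma[OF nz])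
  then have 1: "z gchoose (2 * l) = Gamma (2 * real l - z) / (Gamma (- z) * fact (2 * l))"
    by (simp add: gbinomial_pochhammer power_mult)
  have "pochhammer (1/2) l = Gamma (1/2 + real l) / Gamma (1/2)" by (rule pochhammer_Gamma) (simp add: not_in_Ints_imp_not_in_nonpos_Ints)
  then have 2: "Gamma (real l + 1/2) = pochhammer (1/2) l * sqrt pi" by (simp add: Gamma_one_half_real add.commute)
  have 3: "fact (2 * l) = (4 ^ l * pochhammer (1/2) l * fact l :: real)" by (simp add: fact_double power_mult)
  have "Gamma (\<mu> + 1/2) > 0" by (rule Gamma_real_pos) (use assms in simp)
  then have M0: "Gamma (\<mu> + 1/2) \<noteq> 0" by linarith
  have P0: "pochhammer (1/2::real) l \<noteq> 0" using pochhammer_pos[of "1/2::real" l] by simp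
  have "real l + 1 / 2 + (\<mu> + 1 / 2) = \<mu> + real l + 1" by simp
  then have B: "Beta (real l + 1 / 2) (\<mu> + 1 / 2) = pochhammer (1/2) l * sqrt pi * Gamma (\<mu> + 1/2) * rGamma (\<mu> + real l + 1)"
    unfolding Beta_def 2 rGamma_inverse_Gamma by (simp only: divide_inverse)
  have alg: "g / (s * M) * (X / (g * (f * P * F)) * e * (P * s * M * W)) = e * W / (F * f) * X"
    if "g \<noteq> 0" "P \<noteq> 0" "M \<noteq> 0" "s \<noteq> 0" "F \<noteq> 0" "f \<noteq> 0" for g s M X f P F e W :: real
    using that by (simp add: field_simps)
  show ?thesis
    unfolding 1 3 B bessel_coeff_def by (rule alg) (use G0 P0 M0 in auto)
qed

text \<open>
  Expand \<open>(p \<plusminus> \<i> t)^z\<close> by the binomial series, which is possible for \<open>p > 1 > t\<close>. The odd terms cancel, and the even moments are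
  Beta integrals.
\<close>

lemma bessel_laplace_series:
  assumes \<mu>: "\<mu> \<ge> 0" and p: "p > 1" and z: "z \<notin> \<int>"
  shows "(\<lambda>l. complex_of_real (bessel_coeff \<mu> l * Gamma (2 * real l - z) * p powr (z - 2 * real l))) sums bessel_laplace \<mu> z (of_real p)"
proof -
  define b where "b = (\<lambda>n. complex_of_real z gchoose n)"
  define T where "T = (\<lambda>n u. b n * of_real (p powr z) * ((\<i> / of_real p) ^ n + (- (\<i> / of_real p)) ^ n) * of_real (sqrt u ^ n))"
  let ?w = "\<lambda>u. complex_of_real (poisson_weight \<mu> u)"
  define q where "q = (1 + 1 / p) / 2"
  have q: "1 / p < q" "q < 1" "0 < q" using p by (auto simp: q_def field_simps)
  have summ: "summable (\<lambda>n. norm (b n * of_real (1 / p) ^ n))"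
  proof (rule powser_insidea)
    show "summable (\<lambda>n. b n * complex_of_real q ^ n)"
      unfolding b_def using gen_binomial_complex[of "of_real q"] q by (simp add: sums_iff)
    show "norm (complex_of_real (1 / p)) < norm (complex_of_real q)" using q p by (simp only: norm_of_real) simp
  qed
  have pm: "complex_of_real (sqrt u ^ n) = of_real (u powr (real n / 2))" if "u > 0" for u n
  proof -
    have "sqrt u ^ n = sqrt u powr real n" using that by (simp add: powr_realpow)
    also have "\<dots> = u powr (real n / 2)" using that by (simp add: powr_half_sqrt[symmetric] powr_powr)
    finally show ?thesis by simp
  qed
  have int0: "integrable unit_measure (\<lambda>u. ?w u * of_real (sqrt u ^ n))" and I0: "(\<integral>u. ?w u * of_real (sqrt u ^ n) \<partial>unit_measure) = of_real (Beta ((real n + 1) / 2) (\<mu> + 1 / 2))" for n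
  proof -
    have i: "integrable unit_measure (\<lambda>u. complex_of_real (poisson_weight \<mu> u * u powr (real n / 2)))"
      using poisson_weight_moment(1)[OF \<mu>, of "real n"] by (intro integrable_of_real) auto
    show "integrable unit_measure (\<lambda>u. ?w u * of_real (sqrt u ^ n))"
      by (rule Bochner_Integration.integrable_cong[OF refl, THEN iffD1, OF _ i]) (auto simp: pm space_restrict_space simp del: of_real_power)
    have "(\<integral>u. ?w u * of_real (sqrt u ^ n) \<partial>unit_measure) = (\<integral>u. complex_of_real (poisson_weight \<mu> u * u powr (real n / 2)) \<partial>unit_measure)"
      by (rule Bochner_Integration.integral_cong[OF refl]) (auto simp: pm space_restrict_space simp del: of_real_power)
    also have "\<dots> = of_real (\<integral>u. poisson_weight \<mu> u * u powr (real n / 2) \<partial>unit_measure)" by (rule integral_complex_of_real)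
    also have "(\<integral>u. poisson_weight \<mu> u * u powr (real n / 2) \<partial>unit_measure) = Beta ((real n + 1) / 2) (\<mu> + 1 / 2)"
      using \<mu> by (intro poisson_weight_moment(2)) auto
    finally show "(\<integral>u. ?w u * of_real (sqrt u ^ n) \<partial>unit_measure) = of_real (Beta ((real n + 1) / 2) (\<mu> + 1 / 2))" .
  qed
  define d where "d = (\<lambda>n. b n * of_real (p powr z) * ((\<i> / of_real p) ^ n + (- (\<i> / of_real p)) ^ n))"
  have wT: "?w u * T n u = d n * (?w u * of_real (sqrt u ^ n))" for n u
    by (simp only: T_def d_def mult_ac)
  have d_le: "norm (d n) \<le> 2 * p powr z * norm (b n * of_real (1 / p) ^ n)" for n
  proof -
    have "norm ((\<i> / of_real p) ^ n + (- (\<i> / of_real p)) ^ n) \<le> (1 / p) ^ n + (1 / p) ^ n"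
      using p by (intro order_trans[OF norm_triangle_ineq]) (simp add: norm_power norm_divide)
    then have "norm (b n) * p powr z * norm ((\<i> / of_real p) ^ n + (- (\<i> / of_real p)) ^ n) \<le> norm (b n) * p powr z * ((1 / p) ^ n + (1 / p) ^ n)"
      by (intro mult_left_mono) auto
    then show ?thesis using p by (simp add: d_def norm_mult norm_power norm_divide mult_ac)
  qed
  have wint: "integrable unit_measure (\<lambda>u. ?w u * T n u)" for n
    unfolding wT by (intro integrable_mult_right int0)
  have "(\<lambda>n. \<integral>u. ?w u * T n u \<partial>unit_measure) sums (\<integral>u. (\<Sum>n. ?w u * T n u) \<partial>unit_measure)"
  proof (rule sums_integral[OF wint])
    have le: "norm (?w u * T n u) \<le> (2 * p powr z * norm (b n * of_real (1 / p) ^ n)) * poisson_weight \<mu> u"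
      if "u \<in> space unit_measure" for u n
    proof -
      have "0 < u" "u < 1" using that by (auto simp: space_restrict_space)
      then have s: "\<bar>sqrt u ^ n\<bar> \<le> 1" by (simp add: power_le_one)
      have w: "0 \<le> poisson_weight \<mu> u" by (simp add: poisson_weight_def)
      have "norm (?w u * of_real (sqrt u ^ n)) \<le> poisson_weight \<mu> u * 1"
        unfolding norm_mult norm_of_real using s w by (intro mult_mono) auto
      then show ?thesis unfolding wT norm_mult[of "d n"] using w by (intro mult_mono d_le) auto
    qed
    show "AE u in unit_measure. summable (\<lambda>n. norm (?w u * T n u))"
    proof (rule AE_I2)
      fix u assume u: "u \<in> space unit_measure"
      show "summable (\<lambda>n. norm (?w u * T n u))"
      proof (rule summable_comparison_test'[where N = 0])
        show "summable (\<lambda>n. (2 * p powr z * norm (b n * of_real (1 / p) ^ n)) * poisson_weight \<mu> u)"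
          by (intro summable_mult2 summable_mult summ)
      qed (use le[OF u] in simp)
    qed
    show "summable (\<lambda>n. \<integral>u. norm (?w u * T n u) \<partial>unit_measure)"
    proof (rule summable_comparison_test'[where N = 0])
      show "summable (\<lambda>n. (2 * p powr z * norm (b n * of_real (1 / p) ^ n)) * (\<integral>u. poisson_weight \<mu> u \<partial>unit_measure))"
        by (intro summable_mult2 summable_mult summ)
      fix n
      have "(\<integral>u. norm (?w u * T n u) \<partial>unit_measure) \<le> (\<integral>u. (2 * p powr z * norm (b n * of_real (1 / p) ^ n)) * poisson_weight \<mu> u \<partial>unit_measure)"
        by (intro integral_mono integrable_norm wint integrable_mult_right poisson_weight_integrable \<mu> le)
      moreover have "0 \<le> (\<integral>u. norm (?w u * T n u) \<partial>unit_measure)"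
        by (rule Bochner_Integration.integral_nonneg) (rule norm_ge_zero)
      ultimately show "norm (\<integral>u. norm (?w u * T n u) \<partial>unit_measure) \<le> (2 * p powr z * norm (b n * of_real (1 / p) ^ n)) * (\<integral>u. poisson_weight \<mu> u \<partial>unit_measure)"
        by (simp only: integral_mult_right_zero real_norm_def abs_of_nonneg)
    qed
  qed
  also have "(\<integral>u. (\<Sum>n. ?w u * T n u) \<partial>unit_measure) = (\<integral>u. ?w u * sym_power z (of_real p) u \<partial>unit_measure)"
  proof (rule Bochner_Integration.integral_cong[OF refl])
    fix u assume "u \<in> space unit_measure"
    then have u: "0 < u" "u < 1" by (auto simp: space_restrict_space)
    define v where "v = \<i> / of_real p * of_real (sqrt u)"
    have "sqrt u < 1" using u by simp
    then have "sqrt u < p" using p by linarith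
    then have nv: "norm v < 1" using p u by (simp add: v_def norm_mult norm_divide field_simps)
    have pp: "(complex_of_real p * y) powr of_real z = of_real (p powr z) * y powr of_real z" for y :: complex
      using p powr_times_real_left[of "of_real p" y "of_real z"] powr_of_real[of p z] by simp
    have "(\<lambda>n. of_real (p powr z) * (b n * v ^ n) + of_real (p powr z) * (b n * (- v) ^ n)) sums
        (of_real (p powr z) * (1 + v) powr of_real z + of_real (p powr z) * (1 + - v) powr of_real z)"
      unfolding b_def using nv by (intro sums_add sums_mult gen_binomial_complex) auto
    also have "of_real (p powr z) * (1 + v) powr of_real z + of_real (p powr z) * (1 + - v) powr of_real z = sym_power z (of_real p) u"
      unfolding pp[symmetric] sym_power_def v_def using p by (simp add: algebra_simps)
    also have "(\<lambda>n. of_real (p powr z) * (b n * v ^ n) + of_real (p powr z) * (b n * (- v) ^ n)) = (\<lambda>n. T n u)"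
    proof
      fix n
      have "(- v) ^ n = (- (\<i> / of_real p)) ^ n * of_real (sqrt u) ^ n"
        unfolding v_def by (simp only: power_mult_distrib[symmetric] mult_minus_left)
      then show "of_real (p powr z) * (b n * v ^ n) + of_real (p powr z) * (b n * (- v) ^ n) = T n u"
        unfolding T_def v_def by (simp only: power_mult_distrib of_real_power) (simp only: algebra_simps)
    qed
    finally have "(\<lambda>n. ?w u * T n u) sums (?w u * sym_power z (of_real p) u)" by (rule sums_mult)
    then show "(\<Sum>n. ?w u * T n u) = ?w u * sym_power z (of_real p) u" by (simp add: sums_iff)
  qed
  also have "\<dots> = 2 * poisson_integral \<mu> z (of_real p)" by (simp add: poisson_integral_def)
  finally have S: "(\<lambda>n. d n * of_real (Beta ((real n + 1) / 2) (\<mu> + 1 / 2))) sums (2 * poisson_integral \<mu> z (of_real p))"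
    unfolding wT integral_mult_right_zero I0 .
  have sm: "strict_mono (\<lambda>l::nat. 2 * l)" by (auto simp: strict_mono_def)
  have "d n = 0" if "n \<notin> range (\<lambda>l. 2 * l)" for n
  proof -
    have "odd n" using that by (auto elim!: evenE)
    then show ?thesis by (simp add: d_def)
  qed
  with S have "(\<lambda>l. d (2 * l) * of_real (Beta ((real (2 * l) + 1) / 2) (\<mu> + 1 / 2))) sums (2 * poisson_integral \<mu> z (of_real p))"
    by (subst sums_mono_reindex[OF sm, of "\<lambda>n. d n * of_real (Beta ((real n + 1) / 2) (\<mu> + 1 / 2))"]) auto
  then have "(\<lambda>l. of_real (Gamma (- z) / (sqrt pi * Gamma (\<mu> + 1 / 2))) / 2 * (d (2 * l) * of_real (Beta ((real (2 * l) + 1) / 2) (\<mu> + 1 / 2))))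
      sums (of_real (Gamma (- z) / (sqrt pi * Gamma (\<mu> + 1 / 2))) / 2 * (2 * poisson_integral \<mu> z (of_real p)))"
    by (rule sums_mult)
  moreover have "of_real (Gamma (- z) / (sqrt pi * Gamma (\<mu> + 1 / 2))) / 2 * (d (2 * l) * of_real (Beta ((real (2 * l) + 1) / 2) (\<mu> + 1 / 2)))
      = complex_of_real (bessel_coeff \<mu> l * Gamma (2 * real l - z) * p powr (z - 2 * real l))" for l
  proof -
    have "p powr (z - 2 * real l) = p powr z / p ^ (2 * l)"
      using p powr_realpow[of p "2 * l"] by (simp add: powr_diff)
    moreover have "(\<i> / of_real p) ^ (2 * l) = of_real ((-1) ^ l / p ^ (2 * l))"
      unfolding power_divide by (simp add: power_mult)
    moreover have be: "Beta ((real (2 * l) + 1) / 2) (\<mu> + 1 / 2) = Beta (real l + 1 / 2) (\<mu> + 1 / 2)"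
      by (simp add: add_divide_distrib)
    moreover have "b (2 * l) = of_real (z gchoose (2 * l))" by (simp add: b_def gbinomial_prod_rev)
    ultimately have "of_real (Gamma (- z) / (sqrt pi * Gamma (\<mu> + 1 / 2))) / 2 * (d (2 * l) * of_real (Beta ((real (2 * l) + 1) / 2) (\<mu> + 1 / 2)))
      = complex_of_real (Gamma (- z) / (sqrt pi * Gamma (\<mu> + 1 / 2)) * ((z gchoose (2 * l)) * (-1) ^ l * Beta (real l + 1 / 2) (\<mu> + 1 / 2)) * p powr (z - 2 * real l))"
      unfolding be by (simp add: d_def)
    then show ?thesis unfolding bessel_laplace_coeff[OF \<mu> z] .
  qed
  ultimately show ?thesis by (simp add: bessel_laplace_def)
qed

lemma Gamma_duplication_real:
  fixes x :: real
  assumes "2 * x \<notin> \<int>"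
  shows "Gamma x * Gamma (x + 1 / 2) = 2 powr (1 - 2 * x) * sqrt pi * Gamma (2 * x)"
proof -
  have "x \<notin> \<int>" "x + 1 / 2 \<notin> \<int>"
    using assms Ints_mult[of 2 x] Ints_diff[of "2 * (x + 1 / 2)" 1] Ints_mult[of 2 "x + 1 / 2"] by auto
  then have "complex_of_real x \<notin> \<int>\<^sub>\<le>\<^sub>0" "complex_of_real x + 1 / 2 \<notin> \<int>\<^sub>\<le>\<^sub>0"
    using nonpos_Ints_Int[of x] nonpos_Ints_Int[of "x + 1 / 2"] of_real_in_nonpos_Ints_iff[of "x + 1 / 2", where 'a = complex] by auto
  from Gamma_legendre_duplication[OF this]
  have "complex_of_real (Gamma x * Gamma (x + 1 / 2)) = of_real (exp ((1 - 2 * x) * ln 2) * sqrt pi * Gamma (2 * x))"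
    by (simp add: Gamma_complex_of_real[symmetric] exp_of_real[symmetric])
  then have "Gamma x * Gamma (x + 1 / 2) = exp ((1 - 2 * x) * ln 2) * sqrt pi * Gamma (2 * x)"
    by (simp only: of_real_eq_iff)
  then show ?thesis by (simp add: powr_def)
qed

lemma Gamma_reflection_cos:
  fixes z :: real
  assumes "z \<notin> \<int>"
  shows "Gamma ((1 + z) / 2) * Gamma ((1 - z) / 2) * cos (pi * z / 2) = pi"
proof -
  let ?y = "(1 + z) / 2"
  have y: "?y \<notin> \<int>"
  proof
    assume "?y \<in> \<int>"
    then have "2 * ?y - 1 \<in> \<int>" by (intro Ints_diff Ints_mult) auto
    moreover have "2 * ?y - 1 = z" by (simp add: field_simps)
    ultimately show False using assms by metis
  qed
  have s: "sin (pi * ?y) = cos (pi * z / 2)"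
  proof -
    have "pi * ?y = pi / 2 + pi * z / 2" by (simp add: field_simps)
    then have "sin (pi * ?y) = sin (pi / 2 + pi * z / 2)" by (rule arg_cong)
    then show ?thesis by (simp add: sin_add)
  qed
  have "sin (pi * ?y) \<noteq> 0" using y sin_times_pi_eq_0[of ?y] by (simp add: mult.commute)
  moreover have "complex_of_real (Gamma ?y * Gamma (1 - ?y)) = of_real (pi / sin (pi * ?y))"
    using Gamma_reflection_complex[of "of_real ?y"]
    by (simp add: Gamma_complex_of_real[symmetric] sin_of_real[symmetric])
  then have "Gamma ?y * Gamma (1 - ?y) = pi / sin (pi * ?y)" by (simp only: of_real_eq_iff)
  moreover have "1 - ?y = (1 - z) / 2" by (simp add: field_simps)
  ultimately show ?thesis unfolding s by (simp add: field_simps)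
qed

text \<open>
  The duplication formula splits \<open>\<Gamma> (- z)\<close>, and the reflection formula then removes the cosine.
\<close>

lemma bessel_mellin_eq_Beta:
  assumes "\<mu> \<ge> 0" "z \<notin> \<int>"
  shows "Gamma (- z) / (sqrt pi * Gamma (\<mu> + 1 / 2)) * (cos (pi * z / 2) * Beta ((z + 1) / 2) (\<mu> + 1 / 2)) = bessel_mellin \<mu> z"
proof -
  have d: "Gamma (- z / 2) * Gamma ((1 - z) / 2) = 2 powr (1 + z) * sqrt pi * Gamma (- z)"
    using Gamma_duplication_real[of "- z / 2"] not_Ints_minus[OF assms(2)] by (simp add: diff_divide_distrib)
  have p2: "(2::real) powr (- z - 1) * 2 powr (1 + z) = 1" by (simp flip: powr_add)
  have "2 powr (- z - 1) * (Gamma (- z / 2) * Gamma ((1 - z) / 2)) = (2 powr (- z - 1) * 2 powr (1 + z)) * (sqrt pi * Gamma (- z))"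
    unfolding d by (simp only: mult_ac)
  then have d': "sqrt pi * Gamma (- z) = 2 powr (- z - 1) * (Gamma (- z / 2) * Gamma ((1 - z) / 2))" unfolding p2 by simp
  have "Gamma (\<mu> + 1 / 2) > 0" by (rule Gamma_real_pos) (use assms in simp)
  then have G: "Gamma (\<mu> + 1 / 2) \<noteq> 0" by linarith
  have sp: "sqrt pi * sqrt pi = pi" by simp
  have "Gamma (- z) / (sqrt pi * Gamma (\<mu> + 1 / 2)) * (cos (pi * z / 2) * Beta ((z + 1) / 2) (\<mu> + 1 / 2))
     = (sqrt pi * Gamma (- z)) * (cos (pi * z / 2) * Gamma ((1 + z) / 2)) * rGamma (\<mu> + 1 + z / 2) / pi"
  proof -
    have "(z + 1) / 2 + (\<mu> + 1 / 2) = \<mu> + 1 + z / 2" by (simp add: field_simps)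
    then have "Beta ((z + 1) / 2) (\<mu> + 1 / 2) = Gamma ((1 + z) / 2) * Gamma (\<mu> + 1 / 2) * rGamma (\<mu> + 1 + z / 2)"
      by (simp only: Beta_def rGamma_inverse_Gamma divide_inverse add.commute[of z 1])
    moreover have "c / (s * M) * (co * (g * M * W)) = (s * c) * (co * g) * W / (s * s)"
      if "s \<noteq> 0" "M \<noteq> 0" for c s M co g W :: real
      using that by (simp add: field_simps)
    from this[of "sqrt pi", OF _ G] have "Gamma (- z) / (sqrt pi * Gamma (\<mu> + 1 / 2)) * (cos (pi * z / 2) * (Gamma ((1 + z) / 2) * Gamma (\<mu> + 1 / 2) * rGamma (\<mu> + 1 + z / 2)))
      = (sqrt pi * Gamma (- z)) * (cos (pi * z / 2) * Gamma ((1 + z) / 2)) * rGamma (\<mu> + 1 + z / 2) / (sqrt pi * sqrt pi)"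
      by simp
    ultimately show ?thesis unfolding sp by (simp only:)
  qed
  also have "\<dots> = 2 powr (- z - 1) * Gamma (- z / 2) * rGamma (\<mu> + 1 + z / 2) *
      (Gamma ((1 + z) / 2) * Gamma ((1 - z) / 2) * cos (pi * z / 2)) / pi"
    unfolding d' by (simp only: mult_ac)
  also have "\<dots> = bessel_mellin \<mu> z" unfolding Gamma_reflection_cos[OF assms(2)] by (simp add: bessel_mellin_def)
  finally show ?thesis .
qed

text \<open>
  At \<open>p = 0\<close> the two powers in the integrand add up to \<open>2 cos (\<pi> z / 2) u^(z / 2)\<close>, and the integral becomes a Beta
  integral. Dominated convergence applies because \<open>z > 0\<close> keeps the integrand bounded.
\<close>

lemma bessel_laplace_limit:
  assumes \<mu>: "\<mu> \<ge> 0" and z: "z > 0" "z \<notin> \<int>"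
  shows "((\<lambda>p. bessel_laplace \<mu> z (of_real p)) \<longlongrightarrow> of_real (bessel_mellin \<mu> z)) (at_right 0)"
proof -
  let ?w = "\<lambda>u. complex_of_real (poisson_weight \<mu> u)"
  let ?I = "\<lambda>p. \<integral>u. ?w u * sym_power z p u \<partial>unit_measure"
  have s0: "sym_power z 0 u = of_real (2 * cos (pi * z / 2) * u powr (z / 2))" if "u > 0" for u
  proof -
    have *: "(of_real (sqrt u) * y) powr of_real z = of_real (u powr (z / 2)) * y powr of_real z" for y :: complex
      using that powr_times_real_left[of "of_real (sqrt u)" y "of_real z"] powr_of_real[of "sqrt u" z]
      by (simp add: powr_half_sqrt[symmetric] powr_powr)
    have i: "\<i> powr of_real z = exp (\<i> * of_real (pi * z / 2))" "(- \<i>) powr of_real z = exp (- (\<i> * of_real (pi * z / 2)))"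
      by (simp_all add: powr_def mult_ac)
    have "sym_power z 0 u = of_real (u powr (z / 2)) * (\<i> powr of_real z + (- \<i>) powr of_real z)"
      using *[of "\<i>"] *[of "- \<i>"] by (simp add: sym_power_def mult.commute distrib_left)
    also have "\<i> powr of_real z + (- \<i>) powr of_real z = 2 * of_real (cos (pi * z / 2))"
      unfolding i cos_of_real[symmetric] cos_exp_eq by simp
    finally show ?thesis by (simp add: mult_ac)
  qed
  have lim: "((\<lambda>p. ?I (of_real p)) \<longlongrightarrow> ?I 0) (at_right (0::real))"
    unfolding tendsto_at_iff_sequentially
  proof (intro allI impI)
    fix X :: "nat \<Rightarrow> real" assume X: "\<forall>i. X i \<in> {0<..} - {0}" "X \<longlonglongrightarrow> 0"
    obtain R where R: "R \<ge> 0" "\<And>n. \<bar>X n\<bar> \<le> R" using convergent_bound[OF convergentI[OF X(2)]] by blast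
    have "(\<lambda>n. ?I (of_real (X n))) \<longlonglongrightarrow> ?I 0"
    proof (rule integral_dominated_convergence)
      show "integrable unit_measure (\<lambda>u. (2 * (R + 1) powr z) * poisson_weight \<mu> u)"
        by (intro integrable_mult_right poisson_weight_integrable \<mu>)
      show "(\<lambda>u. ?w u * sym_power z 0 u) \<in> borel_measurable unit_measure"
        by (intro unit_measurable continuous_on_mult continuous_poisson_weight continuous_sym_power) auto
      show "(\<lambda>u. ?w u * sym_power z (of_real (X n)) u) \<in> borel_measurable unit_measure" for n
        using X(1) by (intro unit_measurable continuous_on_mult continuous_poisson_weight continuous_sym_power) auto
      show "AE u in unit_measure. (\<lambda>n. ?w u * sym_power z (of_real (X n)) u) \<longlonglongrightarrow> ?w u * sym_power z 0 u"
      proof (rule AE_I2)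
        fix u assume "u \<in> space unit_measure"
        then have "((\<lambda>p. sym_power z p u) has_field_derivative of_real z * sym_power (z - 1) 0 u) (at 0)"
          by (intro sym_power_has_derivative) (auto simp: space_restrict_space)
        then have "isCont (\<lambda>p. sym_power z p u) 0" by (rule DERIV_isCont)
        moreover have "(\<lambda>n. complex_of_real (X n)) \<longlonglongrightarrow> 0" using tendsto_of_real[OF X(2)] by simp
        ultimately show "(\<lambda>n. ?w u * sym_power z (of_real (X n)) u) \<longlonglongrightarrow> ?w u * sym_power z 0 u"
          by (intro tendsto_mult tendsto_const isCont_tendsto_compose[of 0 "\<lambda>p. sym_power z p u"])
      qed
      show "AE u in unit_measure. norm (?w u * sym_power z (of_real (X n)) u) \<le> (2 * (R + 1) powr z) * poisson_weight \<mu> u" for n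
      proof (rule AE_I2)
        fix u assume "u \<in> space unit_measure"
        then have u: "0 < u" "u < 1" by (auto simp: space_restrict_space)
        have w: "0 \<le> poisson_weight \<mu> u" by (simp add: poisson_weight_def)
        have b: "norm (y powr of_real z) \<le> (R + 1) powr z" if "norm y \<le> norm (complex_of_real (X n)) + norm (\<i> * complex_of_real (sqrt u))" for y :: complex
        proof -
          have "norm (complex_of_real (X n)) + norm (\<i> * complex_of_real (sqrt u)) \<le> R + 1"
            using R(2)[of n] u by (intro add_mono) (auto simp: norm_mult)
          then have "norm y powr z \<le> (R + 1) powr z" using that z by (intro powr_mono2) auto
          then show ?thesis by (simp add: norm_powr_real_powr')
        qed
        have "norm (sym_power z (of_real (X n)) u) \<le> (R + 1) powr z + (R + 1) powr z"
          unfolding sym_power_def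
          by (intro order_trans[OF norm_triangle_ineq] add_mono b norm_triangle_ineq norm_triangle_ineq4)
        then have "poisson_weight \<mu> u * norm (sym_power z (of_real (X n)) u) \<le> poisson_weight \<mu> u * (2 * (R + 1) powr z)"
          using w by (intro mult_left_mono) auto
        then show "norm (?w u * sym_power z (of_real (X n)) u) \<le> (2 * (R + 1) powr z) * poisson_weight \<mu> u"
          using w by (simp add: norm_mult mult.commute)
      qed
    qed
    then show "((\<lambda>p. ?I (of_real p)) \<circ> X) \<longlonglongrightarrow> ?I 0" by (simp add: o_def)
  qed
  have "?I 0 = (\<integral>u. complex_of_real (2 * cos (pi * z / 2) * (poisson_weight \<mu> u * u powr (z / 2))) \<partial>unit_measure)"
    by (intro Bochner_Integration.integral_cong refl) (auto simp: s0 space_restrict_space mult_ac)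
  also have "\<dots> = of_real (2 * cos (pi * z / 2) * Beta ((z + 1) / 2) (\<mu> + 1 / 2))"
    unfolding integral_complex_of_real integral_mult_right_zero using poisson_weight_moment(2)[OF \<mu>, of z] z by simp
  finally have I0: "?I 0 = of_real (2 * cos (pi * z / 2) * Beta ((z + 1) / 2) (\<mu> + 1 / 2))" .
  have "((\<lambda>p. of_real (Gamma (- z) / (sqrt pi * Gamma (\<mu> + 1 / 2))) * (?I (of_real p) / 2)) \<longlongrightarrow>
      of_real (Gamma (- z) / (sqrt pi * Gamma (\<mu> + 1 / 2))) * (?I 0 / 2)) (at_right (0::real))"
    by (intro tendsto_mult tendsto_divide tendsto_const lim) auto
  also have "of_real (Gamma (- z) / (sqrt pi * Gamma (\<mu> + 1 / 2))) * (?I 0 / 2) = complex_of_real (bessel_mellin \<mu> z)"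
    unfolding I0 bessel_mellin_eq_Beta[OF \<mu> z(2), symmetric] by simp
  finally show ?thesis by (simp only: bessel_laplace_def poisson_integral_def)
qed

section \<open>Continuation of the Laplace transform to the origin\<close>

text \<open>
  This two-term recursion is the differential equation of the transform, read at \<open>p = 0\<close>.
\<close>

lemma bessel_mellin_shift:
  assumes "y \<notin> \<int>"
  shows "bessel_mellin \<mu> (y - 2) = - y * (y + 2 * \<mu>) * bessel_mellin \<mu> y"
proof -
  have "- y / 2 \<notin> \<int>"
  proof
    assume "- y / 2 \<in> \<int>"
    then have "- 2 * (- y / 2) \<in> \<int>" by (intro Ints_mult) auto
    then show False using assms by simp
  qed
  then have 1: "Gamma (- (y - 2) / 2) = - y / 2 * Gamma (- y / 2)"
    using Gamma_plus1_real_notin_Ints[of "- y / 2"] by (simp add: diff_divide_distrib add.commute)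
  have 2: "rGamma (\<mu> + 1 + (y - 2) / 2) = (\<mu> + y / 2) * rGamma (\<mu> + 1 + y / 2)"
    using rGamma_plus1[of "\<mu> + y / 2"] by (simp add: diff_divide_distrib add_ac)
  have "- (y - 2) - 1 = 2 + (- y - 1)" by simp
  then have 3: "2 powr (- (y - 2) - 1) = 4 * 2 powr (- y - 1)" by (simp only: powr_add) simp
  show ?thesis unfolding bessel_mellin_def 1 2 3 by (simp add: field_simps)
qed

definition taylor_coeff :: "real \<Rightarrow> real \<Rightarrow> nat \<Rightarrow> real" where
  "taylor_coeff \<mu> z j = (-1) ^ j * bessel_mellin \<mu> (z - real j) / fact j"

lemma taylor_coeff_rec:
  assumes "z \<notin> \<int>"
  shows "real (j + 1) * real (j + 2) * taylor_coeff \<mu> z (j + 2) = - (z - real j) * (z - real j + 2 * \<mu>) * taylor_coeff \<mu> z j"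
proof -
  have k: "bessel_mellin \<mu> (z - real (j + 2)) = - (z - real j) * (z - real j + 2 * \<mu>) * bessel_mellin \<mu> (z - real j)"
    using bessel_mellin_shift[OF not_Ints_shift(1)[OF assms, of j], of \<mu>] by (simp add: diff_diff_eq add.commute)
  have "real (j + 1) * real (j + 2) * (e * X / fact (j + 2)) = e * X / fact j" for e X :: real
  proof -
    have "(fact (j + 2) :: real) = real (j + 1) * real (j + 2) * fact j" by (simp add: algebra_simps)
    moreover have "real (j + 1) * real (j + 2) \<noteq> 0" by simp
    ultimately show ?thesis by (simp del: of_nat_add)
  qed
  then show ?thesis unfolding taylor_coeff_def k by (simp add: mult_ac)
qed

text \<open>
  By the recursion, the ratio of coefficients two apart tends to \<open>1\<close> in modulus, which corresponds to the
  singularities at \<open>\<plusminus> \<i>\<close>.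
\<close>

lemma taylor_coeff_summable:
  assumes z: "z \<notin> \<int>" and r: "0 < r" "r < 1"
  shows "summable (\<lambda>j. \<bar>taylor_coeff \<mu> z j\<bar> * r ^ j)"
proof -
  define s where "s = (1 + r) / 2"
  have s: "r < s" "s < 1" "0 < s" using r by (auto simp: s_def)
  have "(\<lambda>j::nat. \<bar>(z - real j) * (z - real j + 2 * \<mu>)\<bar> / (real (j + 1) * real (j + 2))) \<longlonglongrightarrow> 1"
    by real_asymp
  moreover have "1 < 1 / s\<^sup>2" using s by (simp add: power_less_one_iff)
  ultimately have "eventually (\<lambda>j. \<bar>(z - real j) * (z - real j + 2 * \<mu>)\<bar> / (real (j + 1) * real (j + 2)) < 1 / s\<^sup>2) sequentially"
    by (rule order_tendstoD(2))
  then obtain J where J: "\<And>j. j \<ge> J \<Longrightarrow> \<bar>(z - real j) * (z - real j + 2 * \<mu>)\<bar> / (real (j + 1) * real (j + 2)) < 1 / s\<^sup>2"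
    by (auto simp: eventually_sequentially)
  define a where "a = (\<lambda>j. \<bar>taylor_coeff \<mu> z j\<bar> * s ^ j)"
  have step: "a (j + 2) \<le> a j" if "j \<ge> J" for j
  proof -
    have pos: "real (j + 1) * real (j + 2) > 0" by simp
    have "(real (j + 1) * real (j + 2)) * \<bar>taylor_coeff \<mu> z (j + 2)\<bar> = \<bar>(z - real j) * (z - real j + 2 * \<mu>)\<bar> * \<bar>taylor_coeff \<mu> z j\<bar>"
      using arg_cong[OF taylor_coeff_rec[OF z, of j \<mu>], of abs] by (simp add: abs_mult abs_minus_commute[of "real j" z])
    then have "\<bar>taylor_coeff \<mu> z (j + 2)\<bar> = \<bar>(z - real j) * (z - real j + 2 * \<mu>)\<bar> / (real (j + 1) * real (j + 2)) * \<bar>taylor_coeff \<mu> z j\<bar>"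
      using pos by (simp add: field_simps)
    also have "\<dots> \<le> 1 / s\<^sup>2 * \<bar>taylor_coeff \<mu> z j\<bar>"
      using J[OF that] by (intro mult_right_mono) auto
    finally have "\<bar>taylor_coeff \<mu> z (j + 2)\<bar> * s ^ (j + 2) \<le> (1 / s\<^sup>2 * \<bar>taylor_coeff \<mu> z j\<bar>) * s ^ (j + 2)"
      using s by (intro mult_right_mono) auto
    also have "\<dots> = a j" using s by (simp add: a_def power_add power2_eq_square)
    finally show ?thesis by (simp add: a_def)
  qed
  define C where "C = (\<Sum>i\<le>J + 1. a i)"
  have a0: "a i \<ge> 0" for i using s by (simp add: a_def)
  have aC: "a j \<le> C" for j
  proof (induction j rule: less_induct)
    case (less j)
    show ?case
    proof (cases "j \<le> J + 1")
      case True
      then show ?thesis unfolding C_def using a0 by (intro member_le_sum) auto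
    next
      case False
      then have "j - 2 + 2 = j" "J \<le> j - 2" by simp_all
      then have "a j \<le> a (j - 2)" using step[of "j - 2"] by (simp only:)
      also have "\<dots> \<le> C" using False by (intro less.IH) simp
      finally show ?thesis .
    qed
  qed
  show ?thesis
  proof (rule summable_comparison_test'[where N = 0])
    show "summable (\<lambda>j. C * (r / s) ^ j)"
      using s r by (intro summable_mult summable_geometric) auto
    fix j
    have "\<bar>taylor_coeff \<mu> z j\<bar> * r ^ j = a j * (r / s) ^ j"
      using s by (simp add: a_def power_divide)
    also have "\<dots> \<le> C * (r / s) ^ j" using aC s r by (intro mult_right_mono) auto
    finally show "norm (\<bar>taylor_coeff \<mu> z j\<bar> * r ^ j) \<le> C * (r / s) ^ j" using r by simp
  qed
qed

definition taylor_sum :: "real \<Rightarrow> real \<Rightarrow> complex \<Rightarrow> complex" where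
  "taylor_sum \<mu> z p = (\<Sum>j. of_real (taylor_coeff \<mu> z j) * p ^ j)"

lemma taylor_sum_sums:
  assumes "z \<notin> \<int>" "norm p < 1"
  shows "(\<lambda>j. of_real (taylor_coeff \<mu> z j) * p ^ j) sums taylor_sum \<mu> z p"
proof -
  define r where "r = (1 + norm p) / 2"
  have r: "0 < r" "r < 1" "norm p < r" using assms norm_ge_zero[of p] by (auto simp: r_def add_pos_nonneg)
  have "summable (\<lambda>j. norm (of_real (taylor_coeff \<mu> z j) * p ^ j))"
  proof (rule summable_comparison_test'[where N = 0])
    show "summable (\<lambda>j. \<bar>taylor_coeff \<mu> z j\<bar> * r ^ j)" by (rule taylor_coeff_summable) (use assms r in auto)
    show "norm (norm (of_real (taylor_coeff \<mu> z j) * p ^ j)) \<le> \<bar>taylor_coeff \<mu> z j\<bar> * r ^ j" for j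
      using r by (auto simp: norm_mult norm_power intro!: mult_left_mono power_mono)
  qed
  then show ?thesis unfolding taylor_sum_def by (rule summable_sums[OF summable_norm_cancel])
qed

lemma taylor_sum_higher_deriv:
  assumes "z \<notin> \<int>"
  shows "taylor_sum \<mu> z holomorphic_on ball 0 1"
    and "(deriv ^^ k) (taylor_sum \<mu> z) 0 = of_real ((-1) ^ k * bessel_mellin \<mu> (z - real k))"
proof -
  have s: "(\<lambda>j. of_real (taylor_coeff \<mu> z j) * (p - 0) ^ j) sums taylor_sum \<mu> z p" if "p \<in> ball 0 1" for p
    using taylor_sum_sums[OF assms, of p] that by simp
  show "taylor_sum \<mu> z holomorphic_on ball 0 1"
    by (rule power_series_higher_deriv(1)[OF zero_less_one s])
  show "(deriv ^^ k) (taylor_sum \<mu> z) 0 = of_real ((-1) ^ k * bessel_mellin \<mu> (z - real k))"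
    using power_series_higher_deriv(2)[OF zero_less_one s, of k] by (simp add: taylor_coeff_def)
qed

lemma taylor_coeff_diffs: "real (Suc j) * taylor_coeff \<mu> z (Suc j) = - taylor_coeff \<mu> (z - 1) j"
proof -
  have idx: "z - real (Suc j) = z - 1 - real j" by simp
  show ?thesis unfolding taylor_coeff_def idx by (simp del: of_nat_Suc)
qed

lemma taylor_sum_has_derivative:
  assumes z: "z \<notin> \<int>" and p: "norm p < 1"
  shows "(taylor_sum \<mu> z has_field_derivative - taylor_sum \<mu> (z - 1) p) (at p)"
proof -
  obtain K where K: "norm p < K" "K < 1" using dense[OF p] by blast
  have "K > 0" using K norm_ge_zero[of p] by linarith
  have z1: "z - 1 \<notin> \<int>" using not_Ints_shift(1)[OF z, of 1] by simp
  have "((\<lambda>p. \<Sum>j. of_real (taylor_coeff \<mu> z j) * p ^ j) has_field_derivative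
      (\<Sum>j. diffs (\<lambda>j. complex_of_real (taylor_coeff \<mu> z j)) j * p ^ j)) (at p)"
  proof (rule termdiffs_strong)
    show "summable (\<lambda>j. complex_of_real (taylor_coeff \<mu> z j) * of_real K ^ j)"
      using taylor_sum_sums[OF z, of "of_real K" \<mu>] K \<open>K > 0\<close> by (simp add: sums_iff)
    show "norm p < norm (complex_of_real K)" using K \<open>K > 0\<close> by simp
  qed
  moreover have "diffs (\<lambda>j. complex_of_real (taylor_coeff \<mu> z j)) j = - of_real (taylor_coeff \<mu> (z - 1) j)" for j
    using arg_cong[OF taylor_coeff_diffs[of j \<mu> z], of complex_of_real] by (simp add: diffs_def)
  ultimately have "((\<lambda>p. \<Sum>j. of_real (taylor_coeff \<mu> z j) * p ^ j) has_field_derivative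
      (\<Sum>j. - (complex_of_real (taylor_coeff \<mu> (z - 1) j) * p ^ j))) (at p)" by simp
  moreover have "(\<Sum>j. - (complex_of_real (taylor_coeff \<mu> (z - 1) j) * p ^ j)) = - taylor_sum \<mu> (z - 1) p"
    using sums_minus[OF taylor_sum_sums[OF z1 p]] by (simp add: sums_iff)
  moreover have "taylor_sum \<mu> z = (\<lambda>p. \<Sum>j. of_real (taylor_coeff \<mu> z j) * p ^ j)"
    by (simp add: fun_eq_iff taylor_sum_def)
  ultimately show ?thesis by simp
qed

lemma taylor_sum_ode:
  assumes z: "z \<notin> \<int>" and p: "norm p < 1"
  shows "(1 + p\<^sup>2) * taylor_sum \<mu> (z - 2) p + of_real (2 * \<mu> + 2 * z - 1) * p * taylor_sum \<mu> (z - 1) p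
    + of_real (z * (2 * \<mu> + z)) * taylor_sum \<mu> z p = 0"
proof -
  let ?g = "\<lambda>z j. complex_of_real (taylor_coeff \<mu> z j)"
  have z1: "z - 1 \<notin> \<int>" and z2: "z - 2 \<notin> \<int>"
    using not_Ints_shift(1)[OF z, of 1] not_Ints_shift(1)[OF z, of 2] by simp_all
  have g1: "real j * taylor_coeff \<mu> z j = (case j of 0 \<Rightarrow> 0 | Suc i \<Rightarrow> - taylor_coeff \<mu> (z - 1) i)" for j z
    using taylor_coeff_diffs by (auto split: nat.splits)
  have s0: "(\<lambda>j. ?g z j * p ^ j) sums taylor_sum \<mu> z p" by (rule taylor_sum_sums[OF z p])
  have s1: "(\<lambda>j. - of_real (real j) * ?g z j * p ^ j) sums (p * taylor_sum \<mu> (z - 1) p)"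
  proof -
    have "(\<lambda>j. p * (?g (z - 1) j * p ^ j)) sums (p * taylor_sum \<mu> (z - 1) p)"
      by (intro sums_mult taylor_sum_sums z1 p)
    also have "(\<lambda>j. p * (?g (z - 1) j * p ^ j)) = (\<lambda>j. - of_real (real (Suc j)) * ?g z (Suc j) * p ^ Suc j)"
    proof
      fix j
      have "- of_real (real (Suc j)) * ?g z (Suc j) = ?g (z - 1) j"
        using arg_cong[OF taylor_coeff_diffs[of j \<mu> z], of complex_of_real] by (simp add: minus_equation_iff del: of_nat_Suc)
      then show "p * (?g (z - 1) j * p ^ j) = - of_real (real (Suc j)) * ?g z (Suc j) * p ^ Suc j"
        by (simp only: power_Suc mult_ac)
    qed
    finally show ?thesis by (subst (asm) sums_Suc_iff) simp
  qed
  have s2: "(\<lambda>j. ?g (z - 2) j * p ^ j) sums taylor_sum \<mu> (z - 2) p" by (rule taylor_sum_sums[OF z2 p])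
  have c2: "?g (z - 2) j = of_real (real (j + 1) * real (j + 2)) * ?g z (j + 2)" for j
  proof -
    have "taylor_coeff \<mu> (z - 2) j = - (real (Suc j) * taylor_coeff \<mu> (z - 1) (Suc j))"
      using taylor_coeff_diffs[of j \<mu> "z - 1"] by (simp add: algebra_simps)
    also have "taylor_coeff \<mu> (z - 1) (Suc j) = - (real (Suc (Suc j)) * taylor_coeff \<mu> z (Suc (Suc j)))"
      using taylor_coeff_diffs[of "Suc j" \<mu> z] by simp
    finally have "taylor_coeff \<mu> (z - 2) j = real (j + 1) * real (j + 2) * taylor_coeff \<mu> z (j + 2)" by simp
    then show ?thesis by (simp only: of_real_mult)
  qed
  have s3: "(\<lambda>j. of_real (real j * (real j - 1)) * ?g z j * p ^ j) sums (p\<^sup>2 * taylor_sum \<mu> (z - 2) p)"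
  proof -
    have "(\<lambda>j. p\<^sup>2 * (?g (z - 2) j * p ^ j)) sums (p\<^sup>2 * taylor_sum \<mu> (z - 2) p)" by (rule sums_mult[OF s2])
    also have "(\<lambda>j. p\<^sup>2 * (?g (z - 2) j * p ^ j)) = (\<lambda>j. of_real (real (j + 2) * (real (j + 2) - 1)) * ?g z (j + 2) * p ^ (j + 2))"
    proof
      fix j
      have "real (j + 2) - 1 = real (j + 1)" by simp
      then show "p\<^sup>2 * (?g (z - 2) j * p ^ j) = of_real (real (j + 2) * (real (j + 2) - 1)) * ?g z (j + 2) * p ^ (j + 2)"
        unfolding c2 power_add by (simp only: mult_ac)
    qed
    finally have h: "(\<lambda>j. of_real (real (j + 2) * (real (j + 2) - 1)) * ?g z (j + 2) * p ^ (j + 2)) sums (p\<^sup>2 * taylor_sum \<mu> (z - 2) p)" .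
    have "(\<Sum>i<2. of_real (real i * (real i - 1)) * ?g z i * p ^ i) = 0" by (simp add: numeral_2_eq_2)
    with h show ?thesis
      using sums_iff_shift[of "\<lambda>j. of_real (real j * (real j - 1)) * ?g z j * p ^ j" 2 "p\<^sup>2 * taylor_sum \<mu> (z - 2) p"] by simp
  qed
  let ?t = "\<lambda>j. ?g (z - 2) j * p ^ j + of_real (real j * (real j - 1)) * ?g z j * p ^ j
      + of_real (2 * \<mu> + 2 * z - 1) * (- of_real (real j) * ?g z j * p ^ j) + of_real (z * (2 * \<mu> + z)) * (?g z j * p ^ j)"
  have "?t sums (taylor_sum \<mu> (z - 2) p + p\<^sup>2 * taylor_sum \<mu> (z - 2) p + of_real (2 * \<mu> + 2 * z - 1) * (p * taylor_sum \<mu> (z - 1) p)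
      + of_real (z * (2 * \<mu> + z)) * taylor_sum \<mu> z p)"
    by (intro sums_add sums_mult s0 s1 s2 s3)
  moreover have "?t j = 0" for j
  proof -
    have "real (j + 1) * real (j + 2) * taylor_coeff \<mu> z (j + 2) + (real j * (real j - 1)) * taylor_coeff \<mu> z j
       + (2 * \<mu> + 2 * z - 1) * (- real j * taylor_coeff \<mu> z j) + z * (2 * \<mu> + z) * taylor_coeff \<mu> z j = 0"
      unfolding taylor_coeff_rec[OF z] by (simp add: algebra_simps)
    from arg_cong[OF this, of complex_of_real]
    have "(of_real (real (j + 1) * real (j + 2)) * ?g z (j + 2) + of_real (real j * (real j - 1)) * ?g z j
       + of_real (2 * \<mu> + 2 * z - 1) * (- of_real (real j) * ?g z j) + of_real (z * (2 * \<mu> + z)) * ?g z j) * p ^ j = 0"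
      by (simp only: of_real_add of_real_mult of_real_minus of_real_0 mult_zero_left)
    then show ?thesis unfolding c2 by (simp only: distrib_right mult.assoc)
  qed
  ultimately have "(\<lambda>j. 0) sums (taylor_sum \<mu> (z - 2) p + p\<^sup>2 * taylor_sum \<mu> (z - 2) p + of_real (2 * \<mu> + 2 * z - 1) * (p * taylor_sum \<mu> (z - 1) p)
      + of_real (z * (2 * \<mu> + z)) * taylor_sum \<mu> z p)" by simp
  from sums_unique2[OF sums_zero this] show ?thesis by (simp add: algebra_simps)
qed

text \<open>
  Uniqueness with initial values at the end of the interval, in Gronwall's form: \<open>(x\<^sup>2 + y\<^sup>2) exp (- K t)\<close> decreases and tends to \<open>0\<close>
  at the left end.
\<close>

lemma linear_ode_zero:
  fixes x y A B :: "real \<Rightarrow> real"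
  assumes dx: "\<And>t. 0 < t \<Longrightarrow> t < 1 \<Longrightarrow> (x has_real_derivative - y t) (at t)"
    and dy: "\<And>t. 0 < t \<Longrightarrow> t < 1 \<Longrightarrow> (y has_real_derivative A t * y t + B t * x t) (at t)"
    and AB: "\<And>t. 0 < t \<Longrightarrow> t < 1 \<Longrightarrow> \<bar>A t\<bar> \<le> M" "\<And>t. 0 < t \<Longrightarrow> t < 1 \<Longrightarrow> \<bar>B t\<bar> \<le> M"
    and lim: "(x \<longlongrightarrow> 0) (at_right 0)" "(y \<longlongrightarrow> 0) (at_right 0)"
    and t: "0 < t" "t < 1"
  shows "x t = 0"
proof -
  define K where "K = 1 + 3 * M"
  define E where "E = (\<lambda>t. ((x t)\<^sup>2 + (y t)\<^sup>2) * exp (- (K * t)))"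
  define E' where "E' = (\<lambda>t. (2 * x t * (- y t) + 2 * y t * (A t * y t + B t * x t) - K * ((x t)\<^sup>2 + (y t)\<^sup>2)) * exp (- (K * t)))"
  have dE: "(E has_real_derivative E' t) (at t)" if "0 < t" "t < 1" for t
    unfolding E_def E'_def using dx[OF that] dy[OF that]
    by (auto intro!: derivative_eq_intros simp: algebra_simps power2_eq_square)
  have neg: "E' s \<le> 0" if s: "0 < s" "s < 1" for s
  proof -
    have M: "M \<ge> 0" using AB(1)[OF s] by linarith
    have xy: "2 * \<bar>x s * y s\<bar> \<le> (x s)\<^sup>2 + (y s)\<^sup>2"
      using sum_squares_bound[of "\<bar>x s\<bar>" "\<bar>y s\<bar>"] by (simp add: abs_mult)
    have 1: "2 * x s * (- y s) \<le> 2 * \<bar>x s * y s\<bar>" using abs_ge_minus_self[of "x s * y s"] by (simp add: abs_mult)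
    have 2: "A s * (y s)\<^sup>2 \<le> M * (y s)\<^sup>2" using AB(1)[OF s] by (intro mult_right_mono) auto
    have 3: "B s * (x s * y s) \<le> M * \<bar>x s * y s\<bar>"
    proof -
      have "B s * (x s * y s) \<le> \<bar>B s\<bar> * \<bar>x s * y s\<bar>" unfolding abs_mult[symmetric] by (rule abs_ge_self)
      also have "\<dots> \<le> M * \<bar>x s * y s\<bar>" using AB(2)[OF s] by (rule mult_right_mono) simp
      finally show ?thesis .
    qed
    have 4: "M * (2 * \<bar>x s * y s\<bar>) \<le> M * ((x s)\<^sup>2 + (y s)\<^sup>2)" using M xy by (intro mult_left_mono)
    have 5: "2 * (M * (y s)\<^sup>2) \<le> 2 * (M * ((x s)\<^sup>2 + (y s)\<^sup>2))" using M by (intro mult_left_mono) auto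
    have "2 * x s * (- y s) + 2 * y s * (A s * y s + B s * x s) = 2 * x s * (- y s) + 2 * (A s * (y s)\<^sup>2) + 2 * (B s * (x s * y s))"
      by (simp add: algebra_simps power2_eq_square)
    also have "\<dots> \<le> ((x s)\<^sup>2 + (y s)\<^sup>2) + 3 * (M * ((x s)\<^sup>2 + (y s)\<^sup>2))"
      using 1 2 3 4 5 xy by linarith
    also have "\<dots> = K * ((x s)\<^sup>2 + (y s)\<^sup>2)" by (simp add: K_def algebra_simps)
    finally show ?thesis unfolding E'_def by (intro mult_nonpos_nonneg) auto
  qed
  have mono: "E t \<le> E s" if s: "0 < s" "s \<le> t" for s
  proof (rule DERIV_nonpos_imp_nonincreasing[OF s(2)])
    fix r assume "s \<le> r" "r \<le> t"
    then have "0 < r" "r < 1" using s t by auto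
    then show "\<exists>d. (E has_real_derivative d) (at r) \<and> d \<le> 0" using dE neg by blast
  qed
  have "(E \<longlongrightarrow> (0\<^sup>2 + 0\<^sup>2) * exp (- (K * 0))) (at_right 0)"
    unfolding E_def by (intro tendsto_intros lim)
  then have "(E \<longlongrightarrow> 0) (at_right 0)" by simp
  moreover have "eventually (\<lambda>s. E t \<le> E s) (at_right 0)"
    using eventually_at_right_less[of 0] eventually_at_right_field[of "\<lambda>s. s < t" 0] t
    by (auto simp: eventually_at_right_field intro!: exI[of _ t] mono)
  ultimately have "E t \<le> 0" by (rule tendsto_lowerbound) simp
  then have "(x t)\<^sup>2 + (y t)\<^sup>2 \<le> 0" by (simp add: E_def mult_le_0_iff)
  then show ?thesis by (simp add: sum_power2_le_zero_iff)
qed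

text \<open>
  Both sides satisfy the same second-order linear equation, and for \<open>z > 1\<close> their values and first derivatives have
  the same limits at \<open>0\<close>. So the transform continues holomorphically across \<open>0\<close>, although the powers in the integral
  defining it branch along the segment from \<open>- \<i>\<close> to \<open>\<i>\<close>.
\<close>

lemma bessel_laplace_eq_taylor:
  assumes \<mu>: "\<mu> \<ge> 0" and z: "z > 1" "z \<notin> \<int>" and p: "0 < p" "p < 1"
  shows "bessel_laplace \<mu> z (of_real p) = taylor_sum \<mu> z (of_real p)"
proof -
  have z1: "z - 1 \<notin> \<int>" and z1': "z - 1 > 0" using not_Ints_shift(1)[OF z(2), of 1] z by simp_all
  define D where "D = (\<lambda>y t. bessel_laplace \<mu> y (complex_of_real t) - taylor_sum \<mu> y (of_real t))"
  have lim: "(D y \<longlongrightarrow> 0) (at_right 0)" if "y > 0" "y \<notin> \<int>" for y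
  proof -
    have "isCont (taylor_sum \<mu> y) 0"
      using taylor_sum_has_derivative[OF that(2), of 0 \<mu>] by (intro DERIV_isCont) auto
    moreover have "((\<lambda>t. complex_of_real t) \<longlongrightarrow> 0) (at_right 0)"
      by (rule tendsto_eq_intros | simp)+
    ultimately have "((\<lambda>t. taylor_sum \<mu> y (of_real t)) \<longlongrightarrow> taylor_sum \<mu> y 0) (at_right (0::real))"
      by (intro isCont_tendsto_compose[of 0 "taylor_sum \<mu> y"])
    moreover have "taylor_sum \<mu> y 0 = of_real (bessel_mellin \<mu> y)"
      using taylor_sum_higher_deriv(2)[OF that(2), of 0 \<mu>] by simp
    ultimately show ?thesis unfolding D_def using tendsto_diff[OF bessel_laplace_limit[OF \<mu> that]] by fastforce
  qed
  have der: "((\<lambda>t. D y t) has_vector_derivative - D (y - 1) t) (at t)" if "y \<notin> \<int>" "0 < t" "t < 1" for y t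
  proof -
    have "((\<lambda>q. bessel_laplace \<mu> y q - taylor_sum \<mu> y q) has_field_derivative
        - bessel_laplace \<mu> (y - 1) (of_real t) - - taylor_sum \<mu> (y - 1) (of_real t)) (at (of_real t))"
      using that \<mu> by (intro DERIV_diff bessel_laplace_has_derivative taylor_sum_has_derivative) auto
    then show ?thesis unfolding D_def
      using has_vector_derivative_real_field[of "\<lambda>q. bessel_laplace \<mu> y q - taylor_sum \<mu> y q" _ t] by (simp add: has_field_derivative_at_within)
  qed
  define A where "A = (\<lambda>t::real. (2 * \<mu> + 2 * z - 1) * t / (1 + t\<^sup>2))"
  define B where "B = (\<lambda>t::real. z * (2 * \<mu> + z) / (1 + t\<^sup>2))"
  have ode: "- D (z - 1 - 1) t = of_real (A t) * D (z - 1) t + of_real (B t) * D z t" if t: "0 < t" "t < 1" for t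
  proof -
    have "(1 + (complex_of_real t)\<^sup>2) * D (z - 2) t + of_real (2 * \<mu> + 2 * z - 1) * of_real t * D (z - 1) t + of_real (z * (2 * \<mu> + z)) * D z t = 0"
    proof -
      have lin: "(1 + q\<^sup>2) * (a2 - b2) + c1 * q * (a1 - b1) + c0 * (a0 - b0) = 0"
        if "(1 + q\<^sup>2) * a2 + c1 * q * a1 + c0 * a0 = 0" "(1 + q\<^sup>2) * b2 + c1 * q * b1 + c0 * b0 = 0"
        for q a0 a1 a2 b0 b1 b2 c0 c1 :: complex
      proof -
        have "(1 + q\<^sup>2) * (a2 - b2) + c1 * q * (a1 - b1) + c0 * (a0 - b0) =
          ((1 + q\<^sup>2) * a2 + c1 * q * a1 + c0 * a0) - ((1 + q\<^sup>2) * b2 + c1 * q * b1 + c0 * b0)"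
          by (simp add: algebra_simps)
        then show ?thesis unfolding that by simp
      qed
      show ?thesis
        unfolding D_def by (rule lin[OF bessel_laplace_ode[OF \<mu> _ z(2)] taylor_sum_ode[OF z(2)]]) (use t in auto)
    qed
    moreover have e: "1 + (complex_of_real t)\<^sup>2 = of_real (1 + t\<^sup>2)" "1 + t\<^sup>2 \<noteq> 0"
      using zero_le_power2[of t] by (simp, linarith)
    ultimately have "of_real (1 + t\<^sup>2) * D (z - 2) t = - (of_real (2 * \<mu> + 2 * z - 1) * of_real t * D (z - 1) t + of_real (z * (2 * \<mu> + z)) * D z t)"
      by (simp only: add.assoc eq_neg_iff_add_eq_0)
    moreover have "complex_of_real (1 + t\<^sup>2) \<noteq> 0" using e(2) by (simp only: of_real_eq_0_iff not_False_eq_True)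
    ultimately have "- D (z - 2) t = (of_real (2 * \<mu> + 2 * z - 1) * of_real t * D (z - 1) t + of_real (z * (2 * \<mu> + z)) * D z t) / of_real (1 + t\<^sup>2)"
      by (metis minus_minus nonzero_mult_div_cancel_left minus_divide_left)
    then show ?thesis by (simp add: A_def B_def add_divide_distrib diff_diff_eq)
  qed
  define M where "M = \<bar>2 * \<mu> + 2 * z - 1\<bar> + \<bar>z * (2 * \<mu> + z)\<bar>"
  have frac_le: "\<bar>c * s / (1 + t\<^sup>2)\<bar> \<le> \<bar>c\<bar>" if "\<bar>s\<bar> \<le> 1" for c s t :: real
  proof -
    have pos: "1 + t\<^sup>2 > 0" by (rule add_pos_nonneg) simp_all
    have "\<bar>c * s\<bar> \<le> \<bar>c\<bar> * 1" unfolding abs_mult using that by (intro mult_left_mono) auto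
    moreover have "\<bar>c * s\<bar> / (1 + t\<^sup>2) \<le> \<bar>c * s\<bar> / 1" using pos by (intro divide_left_mono) auto
    moreover have "\<bar>c * s / (1 + t\<^sup>2)\<bar> = \<bar>c * s\<bar> / (1 + t\<^sup>2)" unfolding abs_divide using pos by (simp only: abs_of_pos)
    ultimately show ?thesis by linarith
  qed
  have AB: "\<bar>A t\<bar> \<le> M" "\<bar>B t\<bar> \<le> M" if "0 < t" "t < 1" for t
    using frac_le[of t "2 * \<mu> + 2 * z - 1" t] frac_le[of 1 "z * (2 * \<mu> + z)" t] that
    unfolding A_def B_def M_def by auto
  have dRe: "((\<lambda>t. Re (D y t)) has_real_derivative Re (- D (y - 1) t)) (at t)"
    and dIm: "((\<lambda>t. Im (D y t)) has_real_derivative Im (- D (y - 1) t)) (at t)" if "y \<notin> \<int>" "0 < t" "t < 1" for y t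
    using bounded_linear.has_vector_derivative[OF bounded_linear_Re der[OF that]]
      bounded_linear.has_vector_derivative[OF bounded_linear_Im der[OF that]]
    by (simp_all only: has_real_derivative_iff_has_vector_derivative)
  have "Re (D z p) = 0"
  proof (rule linear_ode_zero[of "\<lambda>t. Re (D z t)" "\<lambda>t. Re (D (z - 1) t)" A B M])
    show "((\<lambda>t. Re (D z t)) has_real_derivative - Re (D (z - 1) t)) (at t)" if "0 < t" "t < 1" for t
      using dRe[OF z(2) that] by simp
    show "((\<lambda>t. Re (D (z - 1) t)) has_real_derivative A t * Re (D (z - 1) t) + B t * Re (D z t)) (at t)" if "0 < t" "t < 1" for t
      using dRe[OF z1 that] unfolding ode[OF that] by simp
    show "((\<lambda>t. Re (D z t)) \<longlongrightarrow> 0) (at_right 0)" "((\<lambda>t. Re (D (z - 1) t)) \<longlongrightarrow> 0) (at_right 0)"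
      using tendsto_Re[OF lim[of z]] tendsto_Re[OF lim[of "z - 1"]] z z1 z1' by auto
  qed (use AB p in auto)
  moreover have "Im (D z p) = 0"
  proof (rule linear_ode_zero[of "\<lambda>t. Im (D z t)" "\<lambda>t. Im (D (z - 1) t)" A B M])
    show "((\<lambda>t. Im (D z t)) has_real_derivative - Im (D (z - 1) t)) (at t)" if "0 < t" "t < 1" for t
      using dIm[OF z(2) that] by simp
    show "((\<lambda>t. Im (D (z - 1) t)) has_real_derivative A t * Im (D (z - 1) t) + B t * Im (D z t)) (at t)" if "0 < t" "t < 1" for t
      using dIm[OF z1 that] unfolding ode[OF that] by simp
    show "((\<lambda>t. Im (D z t)) \<longlongrightarrow> 0) (at_right 0)" "((\<lambda>t. Im (D (z - 1) t)) \<longlongrightarrow> 0) (at_right 0)"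
      using tendsto_Im[OF lim[of z]] tendsto_Im[OF lim[of "z - 1"]] z z1 z1' by auto
  qed (use AB p in auto)
  ultimately have "D z p = 0" by (simp add: complex_eq_iff)
  then show ?thesis by (simp add: D_def)
qed

definition laplace_domain :: "complex set" where
  "laplace_domain = {p. Re p > 0} \<union> ball 0 1"

text \<open>
  As for \<open>polylog_extension\<close>, all derivatives are prescribed, so that differentiation lowers \<open>z\<close> by one.
\<close>

definition laplace_extension :: "real \<Rightarrow> real \<Rightarrow> (complex \<Rightarrow> complex) \<Rightarrow> bool" where
  "laplace_extension \<mu> z L \<longleftrightarrow> L holomorphic_on laplace_domain \<and>
     (\<forall>k. \<forall>p>1. (deriv ^^ k) L (of_real p) = of_real ((-1) ^ k * laplace_series \<mu> (z - real k) p)) \<and>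
     (\<forall>k. (deriv ^^ k) L 0 = of_real ((-1) ^ k * bessel_mellin \<mu> (z - real k)))"

lemma open_laplace_domain: "open laplace_domain"
  unfolding laplace_domain_def by (intro open_Un open_ball open_Collect_less continuous_intros)

lemma laplace_extension_base:
  assumes \<mu>: "\<mu> \<ge> 0" and z: "z > 1" "z \<notin> \<int>"
  shows "laplace_extension \<mu> z (\<lambda>p. if Re p > 0 then bessel_laplace \<mu> z p else taylor_sum \<mu> z p)" (is "laplace_extension \<mu> z ?L")
proof -
  let ?H = "{p. Re p > 0}"
  have H: "open ?H" by (intro open_Collect_less continuous_intros)
  have holH: "bessel_laplace \<mu> z holomorphic_on ?H"
    unfolding holomorphic_on_open[OF H] using bessel_laplace_has_derivative[OF \<mu> _ z(2)] by auto
  note holB = taylor_sum_higher_deriv(1)[OF z(2), of \<mu>]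
  have eq: "bessel_laplace \<mu> z p = taylor_sum \<mu> z p" if "p \<in> ?H \<inter> ball 0 1" for p
  proof -
    let ?S = "?H \<inter> ball 0 1"
    have S: "open ?S" "connected ?S"
      using H by (auto intro!: convex_connected convex_Int convex_halfspace_Re_gt)
    have "bessel_laplace \<mu> z p - taylor_sum \<mu> z p = 0"
    proof (rule analytic_continuation[of "\<lambda>p. bessel_laplace \<mu> z p - taylor_sum \<mu> z p" ?S "of_real ` {0<..<1}" "of_real (1/2)"])
      show "(\<lambda>p. bessel_laplace \<mu> z p - taylor_sum \<mu> z p) holomorphic_on ?S"
        using holH holB by (intro holomorphic_on_diff) (auto intro: holomorphic_on_subset)
      show "complex_of_real ` {0<..<1} \<subseteq> ?S" by auto
      show "complex_of_real (1 / 2) islimpt of_real ` {0<..<1}"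
      proof (rule islimptI)
        fix T assume T: "complex_of_real (1 / 2) \<in> T" "open T"
        then obtain e where e: "e > 0" "ball (complex_of_real (1 / 2)) e \<subseteq> T"
          using open_contains_ball by blast
        define x where "x = 1 / 2 + min (e / 2) (1 / 4)"
        have x: "0 < x" "x < 1" "x \<noteq> 1 / 2" "\<bar>1 / 2 - x\<bar> < e" using e(1) by (auto simp: x_def min_def)
        then have "complex_of_real x \<in> T"
          using e(2) by (intro subsetD[OF e(2)]) (simp only: mem_ball dist_of_real dist_real_def)
        then show "\<exists>y\<in>of_real ` {0<..<1}. y \<in> T \<and> y \<noteq> complex_of_real (1 / 2)"
          using x by (intro bexI[of _ "of_real x"]) (auto simp del: of_real_divide)
      qed
    qed (use S that bessel_laplace_eq_taylor[OF \<mu> z] in auto)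
    then show ?thesis by simp
  qed
  have LH: "?L holomorphic_on ?H" using holH by (rule holomorphic_transform) auto
  have LB: "?L holomorphic_on ball 0 1" using holB by (rule holomorphic_transform) (use eq in auto)
  have "(deriv ^^ k) ?L (of_real p) = of_real ((-1) ^ k * laplace_series \<mu> (z - real k) p)" if "p > 1" for k p
  proof -
    have "(deriv ^^ k) ?L (of_real p) = (deriv ^^ k) (bessel_laplace \<mu> (z - real 0)) (of_real p)"
      by (rule higher_deriv_transform_within_open[OF LH _ H]) (use holH that in auto)
    also have "\<dots> = (-1) ^ k * bessel_laplace \<mu> (z - real k) (of_real p)"
    proof (rule higher_deriv_ladder[OF H])
      show "(bessel_laplace \<mu> (z - real k) has_field_derivative - bessel_laplace \<mu> (z - real (Suc k)) p) (at p)" if "p \<in> ?H" for k p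
        using bessel_laplace_has_derivative[OF \<mu> _ not_Ints_shift(1)[OF z(2), of k], of p] that by (simp add: diff_diff_eq add.commute)
    qed (use that in auto)
    also have "bessel_laplace \<mu> (z - real k) (of_real p) = of_real (laplace_series \<mu> (z - real k) p)"
    proof -
      have "(\<lambda>l. complex_of_real (bessel_coeff \<mu> l * Gamma (2 * real l - (z - real k)) * p powr ((z - real k) - 2 * real l))) sums bessel_laplace \<mu> (z - real k) (of_real p)"
        by (rule bessel_laplace_series[OF \<mu> that not_Ints_shift(1)[OF z(2)]])
      moreover from sums_summable[OF this]
      have "summable (\<lambda>l. bessel_coeff \<mu> l * Gamma (2 * real l - (z - real k)) * p powr ((z - real k) - 2 * real l))"
        by (simp only: summable_of_real_iff)
      then have "(\<lambda>l. complex_of_real (bessel_coeff \<mu> l * Gamma (2 * real l - (z - real k)) * p powr ((z - real k) - 2 * real l))) sums of_real (laplace_series \<mu> (z - real k) p)"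
        unfolding laplace_series_def by (intro sums_of_real summable_sums)
      ultimately show ?thesis by (rule sums_unique2)
    qed
    finally show ?thesis by simp
  qed
  moreover have "(deriv ^^ k) ?L 0 = of_real ((-1) ^ k * bessel_mellin \<mu> (z - real k))" for k
  proof -
    have "(deriv ^^ k) ?L 0 = (deriv ^^ k) (taylor_sum \<mu> z) 0"
      by (rule higher_deriv_transform_within_open[OF LB holB open_ball]) (use eq in auto)
    then show ?thesis using taylor_sum_higher_deriv(2)[OF z(2)] by simp
  qed
  moreover have "?L holomorphic_on laplace_domain"
    unfolding laplace_domain_def by (rule holomorphic_on_Un[OF LH LB H open_ball])
  ultimately show ?thesis unfolding laplace_extension_def by blast
qed

lemma laplace_extension_step_down:
  assumes "laplace_extension \<mu> z L"
  shows "laplace_extension \<mu> (z - 1) (\<lambda>p. - deriv L p)"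
proof -
  have hol: "L holomorphic_on laplace_domain" using assms by (simp add: laplace_extension_def)
  have hold: "deriv L holomorphic_on laplace_domain" by (rule holomorphic_deriv[OF hol open_laplace_domain])
  have der: "(deriv ^^ k) (\<lambda>p. - deriv L p) p = - (deriv ^^ Suc k) L p" if "p \<in> laplace_domain" for k p
    using higher_deriv_uminus[OF hold open_laplace_domain that, of k] by (simp add: funpow_Suc_right del: funpow.simps)
  have dom: "of_real p \<in> laplace_domain" if "p > 1" for p using that by (simp add: laplace_domain_def)
  have dom0: "0 \<in> laplace_domain" by (simp add: laplace_domain_def)
  have idx: "z - 1 - real k = z - real (Suc k)" for k by simp
  show ?thesis unfolding laplace_extension_def idx
  proof (intro conjI allI impI)
    show "(\<lambda>p. - deriv L p) holomorphic_on laplace_domain" using hold by (rule holomorphic_on_minus)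
    fix k
    show "(deriv ^^ k) (\<lambda>p. - deriv L p) (of_real p) = of_real ((-1) ^ k * laplace_series \<mu> (z - real (Suc k)) p)" if "p > 1" for p
    proof -
      have "(deriv ^^ Suc k) L (of_real p) = of_real ((-1) ^ Suc k * laplace_series \<mu> (z - real (Suc k)) p)"
        using assms that unfolding laplace_extension_def by blast
      then show ?thesis unfolding der[OF dom[OF that]] by (simp del: of_nat_Suc funpow.simps)
    qed
    have "(deriv ^^ Suc k) L 0 = of_real ((-1) ^ Suc k * bessel_mellin \<mu> (z - real (Suc k)))"
      using assms unfolding laplace_extension_def by blast
    then show "(deriv ^^ k) (\<lambda>p. - deriv L p) 0 = of_real ((-1) ^ k * bessel_mellin \<mu> (z - real (Suc k)))"
      unfolding der[OF dom0] by (simp del: of_nat_Suc funpow.simps)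
  qed
qed

text \<open>
  For \<open>z > 1\<close> the transform has been continued directly. Differentiation then reaches every \<open>z\<close> in the same class modulo integers.
\<close>

theorem laplace_extension_exists:
  assumes "\<mu> \<ge> 0" "z \<notin> \<int>"
  shows "\<exists>L. laplace_extension \<mu> z L"
proof -
  obtain n :: nat where n: "1 - z < real n" using reals_Archimedean2 by blast
  have "\<exists>L. laplace_extension \<mu> (z + real n - real k) L" for k
  proof (induction k)
    case 0
    show ?case using laplace_extension_base[of \<mu> "z + real n"] assms not_Ints_shift(2)[OF assms(2), of n] n by auto
  next
    case (Suc k)
    then obtain L where "laplace_extension \<mu> (z + real n - real k) L" by blast
    from laplace_extension_step_down[OF this] show ?case by (auto simp: algebra_simps)
  qed
  from this[of n] show ?thesis by simp
qed

section \<open>Rearrangements for large parameter\<close>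

lemma suminf_swap:
  fixes g :: "nat \<Rightarrow> nat \<Rightarrow> complex"
  assumes S1: "\<And>n. summable (\<lambda>m. norm (g n m))" and S2: "summable (\<lambda>n. \<Sum>m. norm (g n m))"
  shows "(\<Sum>n. \<Sum>m. g n m) = (\<Sum>m. \<Sum>n. g n m)" and "summable (\<lambda>m. \<Sum>n. g n m)"
    and "\<And>m. summable (\<lambda>n. g n m)"
proof -
  have abs: "summable (\<lambda>n. norm (h n))" and eq: "infsum h UNIV = suminf h" if "(\<lambda>x. norm (h x)) summable_on UNIV" for h :: "nat \<Rightarrow> complex"
  proof -
    show *: "summable (\<lambda>n. norm (h n))" using that by (subst (asm) summable_on_UNIV_nonneg_real_iff) auto
    show "infsum h UNIV = suminf h"
      by (rule infsumI[OF norm_summable_imp_has_sum[OF * summable_sums[OF summable_norm_cancel[OF *]]]])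
  qed
  have row: "infsum (\<lambda>m. norm (g n m)) UNIV = (\<Sum>m. norm (g n m))" for n
    by (rule infsumI[OF sums_nonneg_imp_has_sum[OF summable_sums[OF S1]]]) simp
  have A: "(\<lambda>x. norm (case x of (n, m) \<Rightarrow> g n m)) summable_on UNIV \<times> UNIV"
    unfolding Infinite_Sum.abs_summable_on_Sigma_iff split_conv row
  proof (intro conjI ballI)
    show "(\<lambda>m. norm (g n m)) summable_on UNIV" for n
      by (rule summable_nonneg_imp_summable_on[OF S1]) simp
    have "0 \<le> (\<Sum>m. norm (g n m))" for n by (intro suminf_nonneg S1) auto
    then show "(\<lambda>n. norm (\<Sum>m. norm (g n m))) summable_on UNIV"
      by (intro summable_nonneg_imp_summable_on) (use S2 in auto)
  qed
  have "(\<lambda>x. norm (case prod.swap x of (n, m) \<Rightarrow> g n m)) summable_on UNIV"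
    using A summable_on_reindex_bij_betw[OF bij_swap, of "\<lambda>x. norm (case x of (n, m) \<Rightarrow> g n m)"] by simp
  then have "(\<lambda>x. norm (case x of (m, n) \<Rightarrow> g n m)) summable_on UNIV \<times> UNIV"
    by (simp add: case_prod_beta)
  then have col: "\<And>m. (\<lambda>n. norm (g n m)) summable_on UNIV" and cols: "(\<lambda>m. norm (infsum (\<lambda>n. norm (g n m)) UNIV)) summable_on UNIV"
    unfolding Infinite_Sum.abs_summable_on_Sigma_iff by auto
  show cs: "\<And>m. summable (\<lambda>n. g n m)" using abs[OF col] by (rule summable_norm_cancel)
  have "(\<Sum>n. \<Sum>m. g n m) = infsum (\<lambda>n. infsum (\<lambda>m. g n m) UNIV) UNIV"
  proof -
    have r: "(\<lambda>m. norm (g n m)) summable_on UNIV" for n by (rule summable_nonneg_imp_summable_on[OF S1]) simp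
    have "(\<lambda>n. norm (\<Sum>m. g n m)) summable_on UNIV"
    proof (rule summable_nonneg_imp_summable_on)
      show "summable (\<lambda>n. norm (\<Sum>m. g n m))"
        by (rule summable_comparison_test'[OF S2, of 0]) (use summable_norm[OF S1] in auto)
    qed simp
    then show ?thesis using eq[OF r] eq by simp
  qed
  also have "\<dots> = infsum (\<lambda>m. infsum (\<lambda>n. g n m) UNIV) UNIV"
    by (rule infsum_swap_banach[OF Infinite_Sum.abs_summable_summable[OF A]])
  finally have sw: "(\<Sum>n. \<Sum>m. g n m) = infsum (\<lambda>m. infsum (\<lambda>n. g n m) UNIV) UNIV" .
  have nn: "infsum (\<lambda>n. norm (g n m)) UNIV = (\<Sum>n. norm (g n m))" for m
    by (rule infsumI[OF sums_nonneg_imp_has_sum[OF summable_sums[OF abs[OF col]]]]) simp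
  have sc: "summable (\<lambda>m. \<Sum>n. norm (g n m))"
  proof -
    have "0 \<le> (\<Sum>n. norm (g n m))" for m by (intro suminf_nonneg abs col) auto
    then show ?thesis using cols unfolding nn by (subst (asm) summable_on_UNIV_nonneg_real_iff) auto
  qed
  have sc': "summable (\<lambda>m. norm (\<Sum>n. g n m))"
    by (rule summable_comparison_test'[OF sc, of 0]) (use summable_norm[OF abs[OF col]] in auto)
  then show "summable (\<lambda>m. \<Sum>n. g n m)" by (rule summable_norm_cancel)
  have "(\<lambda>m. norm (\<Sum>n. g n m)) summable_on UNIV"
    by (rule summable_nonneg_imp_summable_on[OF sc']) simp
  then show "(\<Sum>n. \<Sum>m. g n m) = (\<Sum>m. \<Sum>n. g n m)"
    unfolding sw using eq[OF col] eq by simp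
qed

lemma suminf_triangle:
  fixes g :: "nat \<Rightarrow> nat \<Rightarrow> complex"
  assumes "summable (\<lambda>m. \<Sum>k\<le>m. norm (g k (m - k)))"
  shows "(\<Sum>m. \<Sum>k\<le>m. g k (m - k)) = (\<Sum>k. \<Sum>l. g k l)"
proof -
  let ?G = "\<lambda>m k. if k \<le> m then g k (m - k) else 0"
  have fin: "(\<Sum>k. ?G m k) = (\<Sum>k\<le>m. g k (m - k))" for m
    by (subst suminf_finite[of "{..m}"]) auto
  have finn: "(\<Sum>k. norm (?G m k)) = (\<Sum>k\<le>m. norm (g k (m - k)))" for m
    by (subst suminf_finite[of "{..m}"]) auto
  have S1: "summable (\<lambda>k. norm (?G m k))" for m by (rule summable_finite[of "{..m}"]) auto
  have S2: "summable (\<lambda>m. \<Sum>k. norm (?G m k))" unfolding finn by (rule assms)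
  have "(\<Sum>m. ?G m k) = (\<Sum>l. g k l)" for k
  proof -
    have "(\<Sum>m. ?G m k) = (\<Sum>m. ?G (m + k) k) + (\<Sum>m<k. ?G m k)"
      by (rule suminf_split_initial_segment[OF suminf_swap(3)[of ?G, OF S1 S2]])
    then show ?thesis by simp
  qed
  then show ?thesis using suminf_swap(1)[of ?G, OF S1 S2] unfolding fin by simp
qed

definition bessel_product :: "real \<Rightarrow> real \<Rightarrow> real \<Rightarrow> real \<Rightarrow> real \<Rightarrow> real" where
  "bessel_product \<mu> \<nu> a b x = bessel_entire \<mu> ((a * x)\<^sup>2) * bessel_entire \<nu> ((b * x)\<^sup>2)"

lemma bessel_product_decay:
  assumes "\<mu> \<ge> 0" "\<nu> \<ge> 0" "a > 0" "b > 0"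
  shows "\<exists>C\<ge>0. \<forall>x>0. \<bar>bessel_product \<mu> \<nu> a b x\<bar> \<le> C * x powr (- \<mu> - \<nu> - 1)"
proof -
  obtain C1 where C1: "C1 \<ge> 0" "\<And>x. x > 0 \<Longrightarrow> \<bar>bessel_entire \<mu> (x\<^sup>2)\<bar> \<le> C1 * x powr (- \<mu> - 1 / 2)"
    using bessel_entire_decay[OF assms(1)] by blast
  obtain C2 where C2: "C2 \<ge> 0" "\<And>x. x > 0 \<Longrightarrow> \<bar>bessel_entire \<nu> (x\<^sup>2)\<bar> \<le> C2 * x powr (- \<nu> - 1 / 2)"
    using bessel_entire_decay[OF assms(2)] by blast
  have "\<bar>bessel_product \<mu> \<nu> a b x\<bar> \<le> (C1 * C2 * a powr (- \<mu> - 1 / 2) * b powr (- \<nu> - 1 / 2)) * x powr (- \<mu> - \<nu> - 1)" if "x > 0" for x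
  proof -
    have "\<bar>bessel_product \<mu> \<nu> a b x\<bar> \<le> (C1 * (a * x) powr (- \<mu> - 1 / 2)) * (C2 * (b * x) powr (- \<nu> - 1 / 2))"
      unfolding bessel_product_def abs_mult using that assms C1 C2 by (intro mult_mono C1(2) C2(2)) auto
    also have "\<dots> = (C1 * C2 * a powr (- \<mu> - 1 / 2) * b powr (- \<nu> - 1 / 2)) * (x powr (- \<mu> - 1 / 2) * x powr (- \<nu> - 1 / 2))"
      using that assms by (simp add: powr_mult mult_ac)
    also have "x powr (- \<mu> - 1 / 2) * x powr (- \<nu> - 1 / 2) = x powr (- \<mu> - \<nu> - 1)"
      by (simp add: powr_add[symmetric] algebra_simps)
    finally show ?thesis .
  qed
  moreover have "C1 * C2 * a powr (- \<mu> - 1 / 2) * b powr (- \<nu> - 1 / 2) \<ge> 0" using C1(1) C2(1) by simp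
  ultimately show ?thesis by blast
qed

lemma bessel_product_sums:
  assumes "\<mu> \<ge> 0" "\<nu> \<ge> 0"
  shows "(\<lambda>m. product_coeff \<mu> \<nu> a b m * x ^ (2 * m)) sums bessel_product \<mu> \<nu> a b x"
proof -
  have "(\<lambda>m. \<Sum>i\<le>m. (bessel_coeff \<nu> i * ((b * x)\<^sup>2) ^ i) * (bessel_coeff \<mu> (m - i) * ((a * x)\<^sup>2) ^ (m - i))) sums
      ((\<Sum>k. bessel_coeff \<nu> k * ((b * x)\<^sup>2) ^ k) * (\<Sum>k. bessel_coeff \<mu> k * ((a * x)\<^sup>2) ^ k))"
    by (rule Cauchy_product_sums) (use bessel_coeff_summable[OF assms(1)] bessel_coeff_summable[OF assms(2)] in simp_all)
  moreover have "(\<Sum>i\<le>m. (bessel_coeff \<nu> i * ((b * x)\<^sup>2) ^ i) * (bessel_coeff \<mu> (m - i) * ((a * x)\<^sup>2) ^ (m - i))) =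
      product_coeff \<mu> \<nu> a b m * x ^ (2 * m)" for m
    unfolding product_coeff_def sum_distrib_right
  proof (rule sum.cong[OF refl])
    fix k assume "k \<in> {..m}"
    then have "2 * m = 2 * k + 2 * (m - k)" by simp
    then have "x ^ (2 * m) = x ^ (2 * k) * x ^ (2 * (m - k))" by (simp only: power_add[symmetric])
    then show "(bessel_coeff \<nu> k * ((b * x)\<^sup>2) ^ k) * (bessel_coeff \<mu> (m - k) * ((a * x)\<^sup>2) ^ (m - k)) =
        (bessel_coeff \<nu> k * b ^ (2 * k)) * (bessel_coeff \<mu> (m - k) * a ^ (2 * (m - k))) * x ^ (2 * m)"
      by (simp add: power_mult[symmetric] power_mult_distrib mult_ac)
  qed
  ultimately show ?thesis by (simp add: bessel_product_def bessel_entire_def mult.commute)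
qed

lemma even_exp_le:
  fixes y :: real
  assumes "y \<ge> 0"
  shows "summable (\<lambda>m. y ^ (2 * m) / fact (2 * m))" and "(\<Sum>m. y ^ (2 * m) / fact (2 * m)) \<le> exp y"
proof -
  show s: "summable (\<lambda>m. y ^ (2 * m) / fact (2 * m))"
    using summable_even_exp[of 1 y] assms by simp
  have e: "(\<lambda>n. y ^ n / fact n) sums exp y" using exp_converges[of y] by (simp add: divide_inverse mult.commute)
  show "(\<Sum>m. y ^ (2 * m) / fact (2 * m)) \<le> exp y"
  proof (rule suminf_le_const[OF s])
    fix n
    have "(\<Sum>m<n. y ^ (2 * m) / fact (2 * m)) = (\<Sum>i\<in>(\<lambda>m. 2 * m) ` {..<n}. y ^ i / fact i)"
      by (subst sum.reindex) (auto simp: inj_on_def)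
    also have "\<dots> \<le> (\<Sum>i. y ^ i / fact i)"
      using e assms by (intro sum_le_suminf) (auto simp: sums_iff)
    also have "\<dots> = exp y" using e by (simp add: sums_iff)
    finally show "(\<Sum>m<n. y ^ (2 * m) / fact (2 * m)) \<le> exp y" .
  qed
qed

definition abs_product_coeff :: "real \<Rightarrow> real \<Rightarrow> real \<Rightarrow> real \<Rightarrow> nat \<Rightarrow> real" where
  "abs_product_coeff \<mu> \<nu> a b m = (\<Sum>k\<le>m. \<bar>bessel_coeff \<nu> k * b ^ (2 * k)\<bar> * \<bar>bessel_coeff \<mu> (m - k) * a ^ (2 * (m - k))\<bar>)"

lemma abs_product_coeff_ge: "\<bar>product_coeff \<mu> \<nu> a b m\<bar> \<le> abs_product_coeff \<mu> \<nu> a b m"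
  unfolding product_coeff_def abs_product_coeff_def
  by (rule order_trans[OF sum_abs]) (simp add: abs_mult)

lemma abs_product_coeff_bound:
  assumes "\<mu> \<ge> 0" "\<nu> \<ge> 0" "a > 0" "b > 0"
  shows "\<exists>C\<ge>0. \<forall>m. abs_product_coeff \<mu> \<nu> a b m \<le> C * (a + b) ^ (2 * m) / fact (2 * m)"
proof -
  obtain C where C: "C \<ge> 0" "\<And>m. abs_product_coeff \<mu> \<nu> a b m \<le> C * (a + b) ^ (2 * m) / fact (2 * m) * real (m + 1) powr (- \<mu> - \<nu> - 1)"
    using product_coeff_bound[OF assms] unfolding abs_product_coeff_def by blast
  have "C * (a + b) ^ (2 * m) / fact (2 * m) * real (m + 1) powr (- \<mu> - \<nu> - 1) \<le> C * (a + b) ^ (2 * m) / fact (2 * m) * 1" for m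
  proof (rule mult_left_mono)
    have "real (m + 1) powr (- \<mu> - \<nu> - 1) \<le> real (m + 1) powr 0" using assms by (intro powr_mono) auto
    then show "real (m + 1) powr (- \<mu> - \<nu> - 1) \<le> 1" by simp
  qed (use C(1) assms in auto)
  then show ?thesis using C by (intro exI[of _ C]) (auto intro: order_trans)
qed

text \<open>
  For \<open>p > a + b\<close> the factor \<open>exp (- n p)\<close> beats the majorant \<open>exp (n (a + b))\<close> of the power series, and the double
  series converges absolutely.
\<close>

lemma exp_dirichlet_product:
  assumes "\<mu> \<ge> 0" "\<nu> \<ge> 0" "a > 0" "b > 0" and p: "p > a + b"
  shows "(\<Sum>n. complex_of_real (real (Suc n) powr (- s) * bessel_product \<mu> \<nu> a b (real (Suc n))) * exp (- (of_nat (Suc n) * of_real p)))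
    = (\<Sum>m. of_real (product_coeff \<mu> \<nu> a b m) * exp_dirichlet (s - real (2 * m)) (of_real p))" (is "?lhs = ?rhs")
    and "summable (\<lambda>m. of_real (product_coeff \<mu> \<nu> a b m) * exp_dirichlet (s - real (2 * m)) (of_real p))"
proof -
  let ?c = "product_coeff \<mu> \<nu> a b"
  define W where "W = (\<lambda>n. real (Suc n) powr (- s) * exp (- (real (Suc n) * p)))"
  define g where "g = (\<lambda>n m. complex_of_real (W n * (?c m * real (Suc n) ^ (2 * m))))"
  have W0: "W n \<ge> 0" for n by (simp add: W_def)
  obtain C where C: "C \<ge> 0" "\<And>m. abs_product_coeff \<mu> \<nu> a b m \<le> C * (a + b) ^ (2 * m) / fact (2 * m)"
    using abs_product_coeff_bound[OF assms(1-4)] by blast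
  have gle: "norm (g n m) \<le> (W n * C) * (((a + b) * real (Suc n)) ^ (2 * m) / fact (2 * m))" for n m
  proof -
    have "norm (g n m) = W n * \<bar>?c m\<bar> * real (Suc n) ^ (2 * m)"
      unfolding g_def norm_of_real using W0[of n] by (simp add: abs_mult)
    also have "\<dots> \<le> W n * (C * (a + b) ^ (2 * m) / fact (2 * m)) * real (Suc n) ^ (2 * m)"
      by (intro mult_right_mono mult_left_mono order_trans[OF abs_product_coeff_ge C(2)] W0) auto
    finally show ?thesis by (simp add: power_mult_distrib mult_ac)
  qed
  have S1: "summable (\<lambda>m. norm (g n m))" for n
  proof (rule summable_comparison_test'[where N = 0])
    show "summable (\<lambda>m. (W n * C) * (((a + b) * real (Suc n)) ^ (2 * m) / fact (2 * m)))"
      by (intro summable_mult even_exp_le(1)) (use assms in auto)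
  qed (use gle in simp)
  have sle: "(\<Sum>m. norm (g n m)) \<le> C * (real (Suc n) powr (- s) * exp (- (real (Suc n) * (p - (a + b)))))" for n
  proof -
    have "(\<Sum>m. norm (g n m)) \<le> (\<Sum>m. (W n * C) * (((a + b) * real (Suc n)) ^ (2 * m) / fact (2 * m)))"
      by (intro suminf_le gle S1 summable_mult even_exp_le(1)) (use assms in auto)
    also have "\<dots> = (W n * C) * (\<Sum>m. ((a + b) * real (Suc n)) ^ (2 * m) / fact (2 * m))"
      by (intro suminf_mult even_exp_le(1)) (use assms in auto)
    also have "\<dots> \<le> (W n * C) * exp ((a + b) * real (Suc n))"
      by (intro mult_left_mono even_exp_le(2) mult_nonneg_nonneg W0 C(1)) (use assms in auto)
    also have "\<dots> = C * (real (Suc n) powr (- s) * (exp (- (real (Suc n) * p)) * exp ((a + b) * real (Suc n))))"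
      by (simp only: W_def mult_ac)
    also have "exp (- (real (Suc n) * p)) * exp ((a + b) * real (Suc n)) = exp (- (real (Suc n) * (p - (a + b))))"
      by (simp add: exp_add[symmetric] algebra_simps)
    finally show ?thesis .
  qed
  have S2: "summable (\<lambda>n. \<Sum>m. norm (g n m))"
  proof (rule summable_comparison_test'[where N = 0])
    show "summable (\<lambda>n. C * (real (Suc n) powr (- s) * exp (- (real (Suc n) * (p - (a + b))))))"
      using summable_Suc_iff[of "\<lambda>n. real n powr (- s) * exp (- (real n * (p - (a + b))))"]
        summable_powr_exp[of "p - (a + b)" s] p
      by (intro summable_mult) simp
    show "norm (\<Sum>m. norm (g n m)) \<le> C * (real (Suc n) powr (- s) * exp (- (real (Suc n) * (p - (a + b)))))" for n
      using sle[of n] suminf_nonneg[OF S1[of n]] by simp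
  qed
  have row: "(\<Sum>m. g n m) = complex_of_real (real (Suc n) powr (- s) * bessel_product \<mu> \<nu> a b (real (Suc n))) * exp (- (of_nat (Suc n) * of_real p))" for n
  proof -
    have "(\<lambda>m. W n * (?c m * real (Suc n) ^ (2 * m))) sums (W n * bessel_product \<mu> \<nu> a b (real (Suc n)))"
      by (intro sums_mult bessel_product_sums assms)
    then have "(\<lambda>m. g n m) sums complex_of_real (W n * bessel_product \<mu> \<nu> a b (real (Suc n)))"
      unfolding g_def by (rule sums_of_real)
    then show ?thesis by (simp add: sums_iff W_def exp_of_real[symmetric] mult_ac del: of_nat_Suc)
  qed
  have colterm: "g n m = of_real (?c m) * (complex_of_real (real (Suc n) powr (- (s - real (2 * m)))) * exp (- (of_nat (Suc n) * of_real p)))" for n m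
  proof -
    have "- (s - real (2 * m)) = - s + real (2 * m)" by simp
    then have "real (Suc n) powr (- (s - real (2 * m))) = real (Suc n) powr (- s) * real (Suc n) ^ (2 * m)"
      by (simp only: powr_add powr_realpow of_nat_0_less_iff zero_less_Suc)
    then show ?thesis by (simp add: g_def W_def exp_of_real[symmetric] mult_ac del: of_nat_Suc)
  qed
  have col: "(\<Sum>n. g n m) = of_real (?c m) * exp_dirichlet (s - real (2 * m)) (of_real p)" for m
    unfolding colterm exp_dirichlet_def
    by (rule suminf_mult[OF summable_norm_cancel[OF summable_exp_dirichlet]]) (use p assms in auto)
  show "?lhs = ?rhs" using suminf_swap(1)[OF S1 S2] unfolding row col .
  show "summable (\<lambda>m. of_real (product_coeff \<mu> \<nu> a b m) * exp_dirichlet (s - real (2 * m)) (of_real p))"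
    using suminf_swap(2)[OF S1 S2] unfolding col .
qed

text \<open>
  Summing the double series over the factor with parameter \<open>a\<close> first collects, for each power \<open>k\<close> of the other factor, one Laplace
  transform with \<open>z\<close> lowered by \<open>2 k\<close>. Absolute convergence for \<open>p > a + b\<close> follows from the size \<open>(2 m)!\<close> of the Gamma
  factor against \<open>(a + b)^(2 m) / (2 m)!\<close>.
\<close>

lemma Gamma_series_rearrange:
  assumes "\<mu> \<ge> 0" "\<nu> \<ge> 0" "a > 0" "b > 0" and p: "p > a + b" and z: "z \<notin> \<int>"
  shows "(\<Sum>m. complex_of_real (product_coeff \<mu> \<nu> a b m * Gamma (2 * real m - z) * p powr (z - 2 * real m)))
    = (\<Sum>k. of_real (bessel_coeff \<nu> k * b ^ (2 * k)) * of_real (a powr (z - real (2 * k)) * laplace_series \<mu> (z - real (2 * k)) (p / a)))"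
    and "summable (\<lambda>m. complex_of_real (product_coeff \<mu> \<nu> a b m * Gamma (2 * real m - z) * p powr (z - 2 * real m)))"
proof -
  have p0: "p > 0" using p assms by simp
  define h where "h = (\<lambda>m. Gamma (2 * real m - z) * p powr (z - 2 * real m))"
  define g where "g = (\<lambda>k l. complex_of_real ((bessel_coeff \<nu> k * b ^ (2 * k)) * (bessel_coeff \<mu> l * a ^ (2 * l)) * h (k + l)))"
  obtain C where C: "C \<ge> 0" "\<And>m. abs_product_coeff \<mu> \<nu> a b m \<le> C * (a + b) ^ (2 * m) / fact (2 * m)"
    using abs_product_coeff_bound[OF assms(1-4)] by blast
  obtain C' where C': "C' \<ge> 0" "\<And>n. \<bar>pochhammer (- z) n\<bar> \<le> C' * (fact n * real (n + 1) powr (- z - 1))"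
    using pochhammer_upper_bound[of "- z"] by blast
  define D where "D = C * C' * \<bar>Gamma (- z)\<bar> * p powr z"
  define q where "q = ln (p / (a + b))"
  have q: "q > 0" using p assms by (simp add: q_def)
  have eq: "(a + b) ^ n / p ^ n = exp (- (real n * q))" for n
  proof -
    have "exp (real n * q) = (p / (a + b)) ^ n"
      using p0 assms by (simp add: q_def exp_of_nat_mult)
    then show ?thesis using p0 assms by (simp add: exp_minus power_divide)
  qed
  have nz: "- z \<notin> \<int>\<^sub>\<le>\<^sub>0" using not_Ints_minus[OF z] nonpos_Ints_Int by blast
  have hle: "abs_product_coeff \<mu> \<nu> a b m * \<bar>h m\<bar> \<le> D * (real (2 * m + 1) powr (- z - 1) * exp (- (real (2 * m) * q)))" for m
  proof -
    have "Gamma (2 * real m - z) = Gamma (- z) * pochhammer (- z) (2 * m)"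
      using pochhammer_Gamma[OF nz, of "2 * m"] nz by (simp add: Gamma_eq_zero_iff)
    moreover have "p powr (z - 2 * real m) = p powr z / p ^ (2 * m)"
      using p0 powr_realpow[of p "2 * m"] by (simp add: powr_diff)
    ultimately have "\<bar>h m\<bar> = \<bar>Gamma (- z)\<bar> * \<bar>pochhammer (- z) (2 * m)\<bar> * (p powr z / p ^ (2 * m))"
      using p0 by (simp add: h_def abs_mult)
    also have "\<dots> \<le> \<bar>Gamma (- z)\<bar> * (C' * (fact (2 * m) * real (2 * m + 1) powr (- z - 1))) * (p powr z / p ^ (2 * m))"
      using p0 by (intro mult_right_mono mult_left_mono C'(2)) auto
    finally have "abs_product_coeff \<mu> \<nu> a b m * \<bar>h m\<bar> \<le> (C * (a + b) ^ (2 * m) / fact (2 * m)) *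
        (\<bar>Gamma (- z)\<bar> * (C' * (fact (2 * m) * real (2 * m + 1) powr (- z - 1))) * (p powr z / p ^ (2 * m)))"
      using C(1) assms by (intro mult_mono C(2)) auto
    also have "\<dots> = D * (real (2 * m + 1) powr (- z - 1) * ((a + b) ^ (2 * m) / p ^ (2 * m)))"
      by (simp add: D_def mult_ac)
    finally show ?thesis unfolding eq .
  qed
  have summ: "summable (\<lambda>m. D * (real (2 * m + 1) powr (- z - 1) * exp (- (real (2 * m) * q))))"
  proof -
    have "summable (\<lambda>n. real n powr (- (z + 1)) * exp (- (real n * q)))" by (rule summable_powr_exp[OF q])
    then have "summable ((\<lambda>n. real n powr (- (z + 1)) * exp (- (real n * q))) \<circ> (\<lambda>m. 2 * m + 1))"
      by (rule summable_reindex) (auto simp: inj_def)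
    then have "summable (\<lambda>m. (D * exp q) * (real (2 * m + 1) powr (- (z + 1)) * exp (- (real (2 * m + 1) * q))))"
      unfolding o_def by (rule summable_mult)
    moreover have "(D * exp q) * (real (2 * m + 1) powr (- (z + 1)) * exp (- (real (2 * m + 1) * q))) =
        D * (real (2 * m + 1) powr (- z - 1) * exp (- (real (2 * m) * q)))" for m
    proof -
      have "exp q * exp (- (real (2 * m + 1) * q)) = exp (- (real (2 * m) * q))"
        by (simp add: exp_add[symmetric] algebra_simps)
      moreover have "- (z + 1) = - z - 1" by simp
      moreover have "(D * x) * (v * y) = D * (v * (x * y))" for v x y :: real by (simp only: mult_ac)
      ultimately show ?thesis by (simp only:)
    qed
    ultimately show ?thesis by (simp only:)
  qed
  have gnorm: "(\<Sum>k\<le>m. norm (g k (m - k))) = abs_product_coeff \<mu> \<nu> a b m * \<bar>h m\<bar>" for m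
    unfolding abs_product_coeff_def sum_distrib_right
    by (rule sum.cong[OF refl]) (simp only: g_def norm_of_real abs_mult atMost_iff le_add_diff_inverse mult.assoc)
  have apc0: "abs_product_coeff \<mu> \<nu> a b m \<ge> 0" for m unfolding abs_product_coeff_def by (intro sum_nonneg) auto
  have S: "summable (\<lambda>m. \<Sum>k\<le>m. norm (g k (m - k)))"
    unfolding gnorm by (rule summable_comparison_test'[OF summ, of 0]) (use hle apc0 in auto)
  have row: "(\<Sum>k\<le>m. g k (m - k)) = complex_of_real (product_coeff \<mu> \<nu> a b m * Gamma (2 * real m - z) * p powr (z - 2 * real m))" for m
    unfolding product_coeff_def sum_distrib_right of_real_sum
    by (rule sum.cong[OF refl]) (simp add: g_def h_def)
  have "summable (\<lambda>m. norm (\<Sum>k\<le>m. g k (m - k)))"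
    by (rule summable_comparison_test'[OF S, of 0]) (use norm_sum in auto)
  then show "summable (\<lambda>m. complex_of_real (product_coeff \<mu> \<nu> a b m * Gamma (2 * real m - z) * p powr (z - 2 * real m)))"
    unfolding row by (rule summable_norm_cancel)
  have col: "(\<Sum>l. g k l) = of_real (bessel_coeff \<nu> k * b ^ (2 * k)) * of_real (a powr (z - real (2 * k)) * laplace_series \<mu> (z - real (2 * k)) (p / a))" for k
  proof -
    let ?y = "z - real (2 * k)"
    have y: "?y \<notin> \<int>" by (rule not_Ints_shift(1)[OF z])
    have "p / a > 1" using p assms by simp
    from sums_summable[OF bessel_laplace_series[OF assms(1) this y]]
    have "summable (\<lambda>l. bessel_coeff \<mu> l * Gamma (2 * real l - ?y) * (p / a) powr (?y - 2 * real l))"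
      by (simp only: summable_of_real_iff)
    then have "(\<lambda>l. bessel_coeff \<mu> l * Gamma (2 * real l - ?y) * (p / a) powr (?y - 2 * real l)) sums laplace_series \<mu> ?y (p / a)"
      unfolding laplace_series_def by (rule summable_sums)
    then have "(\<lambda>l. (bessel_coeff \<nu> k * b ^ (2 * k)) * (a powr ?y * (bessel_coeff \<mu> l * Gamma (2 * real l - ?y) * (p / a) powr (?y - 2 * real l)))) sums
        ((bessel_coeff \<nu> k * b ^ (2 * k)) * (a powr ?y * laplace_series \<mu> ?y (p / a)))"
      by (intro sums_mult)
    moreover have "(bessel_coeff \<nu> k * b ^ (2 * k)) * (a powr ?y * (bessel_coeff \<mu> l * Gamma (2 * real l - ?y) * (p / a) powr (?y - 2 * real l))) =
        (bessel_coeff \<nu> k * b ^ (2 * k)) * (bessel_coeff \<mu> l * a ^ (2 * l)) * h (k + l)" for l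
    proof -
      have e1: "2 * real l - ?y = 2 * real (k + l) - z" and e2: "?y - 2 * real l = z - 2 * real (k + l)" by simp_all
      have "a powr ?y * (p / a) powr (?y - 2 * real l) = a ^ (2 * l) * p powr (z - 2 * real (k + l))"
      proof -
        have "a powr ?y = a powr (?y - 2 * real l) * a powr (real (2 * l))" by (simp add: powr_add[symmetric])
        moreover have "(u * v) * w = v * (u * w)" for u v w :: real by (simp only: mult_ac)
        moreover have "a powr (real (2 * l)) = a ^ (2 * l)" using assms by (simp only: powr_realpow)
        moreover have "a powr (?y - 2 * real l) * (p / a) powr (?y - 2 * real l) = p powr (?y - 2 * real l)"
          using assms p0 by (simp add: powr_mult[symmetric])
        ultimately show ?thesis unfolding e2[symmetric] by (simp only:)
      qed
      moreover have "N * (A * (B * G * P)) = N * B * G * (A * P)" and "N * (B * Q) * (G * R) = N * B * G * (Q * R)"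
        for N A B G P Q R :: real by (simp_all only: mult_ac)
      ultimately show ?thesis unfolding h_def e1 by (simp only:)
    qed
    ultimately have "(\<lambda>l. (bessel_coeff \<nu> k * b ^ (2 * k)) * (bessel_coeff \<mu> l * a ^ (2 * l)) * h (k + l)) sums
        ((bessel_coeff \<nu> k * b ^ (2 * k)) * (a powr ?y * laplace_series \<mu> ?y (p / a)))" by (simp only:)
    then have "(\<lambda>l. g k l) sums of_real ((bessel_coeff \<nu> k * b ^ (2 * k)) * (a powr ?y * laplace_series \<mu> ?y (p / a)))"
      unfolding g_def by (rule sums_of_real)
    then show ?thesis by (simp add: sums_iff)
  qed
  show "(\<Sum>m. complex_of_real (product_coeff \<mu> \<nu> a b m * Gamma (2 * real m - z) * p powr (z - 2 * real m)))
    = (\<Sum>k. of_real (bessel_coeff \<nu> k * b ^ (2 * k)) * of_real (a powr (z - real (2 * k)) * laplace_series \<mu> (z - real (2 * k)) (p / a)))"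
    using suminf_triangle[OF S] unfolding row col .
qed

section \<open>Letting the parameter tend to zero\<close>

text \<open>
  The series with weights \<open>exp (- n p)\<close> converges uniformly on the closed half-plane \<open>Re p \<ge> 0\<close>.
\<close>

lemma abel_sum:
  fixes w :: "nat \<Rightarrow> real"
  assumes w: "summable (\<lambda>n. \<bar>w n\<bar>)"
  shows "(\<lambda>p. \<Sum>n. complex_of_real (w n) * exp (- (of_nat (Suc n) * p))) holomorphic_on {p. Re p > 0}"
    and "((\<lambda>t. \<Sum>n. complex_of_real (w n) * exp (- (of_nat (Suc n) * of_real t))) \<longlongrightarrow> of_real (\<Sum>n. w n)) (at_right 0)"
proof -
  let ?t = "\<lambda>n p. complex_of_real (w n) * exp (- (of_nat (Suc n) * p))"
  have ul: "uniform_limit {p. Re p \<ge> 0} (\<lambda>N p. \<Sum>n<N. ?t n p) (\<lambda>p. \<Sum>n. ?t n p) sequentially"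
  proof (rule Weierstrass_m_test[OF _ w])
    fix n p assume "p \<in> {p. Re p \<ge> 0}"
    then have "\<bar>w n\<bar> * exp (- (real (Suc n) * Re p)) \<le> \<bar>w n\<bar> * 1"
      by (intro mult_left_mono) auto
    then show "norm (?t n p) \<le> \<bar>w n\<bar>" by (simp add: norm_mult del: of_nat_Suc)
  qed
  have H: "open {p. Re p > 0}" by (intro open_Collect_less continuous_intros)
  show "(\<lambda>p. \<Sum>n. ?t n p) holomorphic_on {p. Re p > 0}"
  proof (rule holomorphic_uniform_sequence[OF H])
    show "(\<lambda>p. \<Sum>n<N. ?t n p) holomorphic_on {p. Re p > 0}" for N by (intro holomorphic_intros)
    fix x :: complex assume "x \<in> {p. Re p > 0}"
    then obtain d where d: "d > 0" "cball x d \<subseteq> {p. Re p > 0}" using H open_contains_cball by blast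
    then have "uniform_limit (cball x d) (\<lambda>N p. \<Sum>n<N. ?t n p) (\<lambda>p. \<Sum>n. ?t n p) sequentially"
      by (intro uniform_limit_on_subset[OF ul]) auto
    then show "\<exists>d>0. cball x d \<subseteq> {p. Re p > 0} \<and> uniform_limit (cball x d) (\<lambda>N p. \<Sum>n<N. ?t n p) (\<lambda>p. \<Sum>n. ?t n p) sequentially"
      using d by blast
  qed
  have "continuous_on {p. Re p \<ge> 0} (\<lambda>p. \<Sum>n. ?t n p)"
    by (rule uniform_limit_theorem[OF _ ul]) (auto intro!: always_eventually continuous_intros)
  then have "continuous_on {0..} (\<lambda>t. \<Sum>n. ?t n (complex_of_real t))"
    by (rule continuous_on_compose2) (auto intro!: continuous_intros)
  then have "((\<lambda>t. \<Sum>n. ?t n (complex_of_real t)) \<longlongrightarrow> (\<Sum>n. ?t n (complex_of_real 0))) (at 0 within {0..})"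
    unfolding continuous_on_def by (rule bspec) simp
  then have "((\<lambda>t. \<Sum>n. ?t n (complex_of_real t)) \<longlongrightarrow> (\<Sum>n. ?t n (complex_of_real 0))) (at_right 0)"
    by (rule tendsto_within_subset) auto
  moreover have "(\<Sum>n. ?t n (complex_of_real 0)) = of_real (\<Sum>n. w n)"
    using suminf_of_real[OF summable_rabs_cancel[OF w], where 'a = complex] by simp
  ultimately show "((\<lambda>t. \<Sum>n. ?t n (complex_of_real t)) \<longlongrightarrow> of_real (\<Sum>n. w n)) (at_right 0)" by simp
qed

text \<open>
  The transform for parameter \<open>a\<close>: replacing \<open>x\<close> by \<open>a x\<close> multiplies \<open>p\<close> by \<open>1 / a\<close>, and the unit disc becomes the disc of radius \<open>a\<close>.
\<close>

lemma scaled_laplace_extension: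
  assumes L: "laplace_extension \<mu> z L" and a: "a > 0"
  defines "La \<equiv> (\<lambda>p. of_real (a powr z) * L (of_real (1 / a) * p))"
  shows "La holomorphic_on ({p. Re p > 0} \<union> ball 0 a)"
    and "p > a \<Longrightarrow> (deriv ^^ k) La (of_real p) =
           of_real ((-1) ^ k * (a powr (z - real k) * laplace_series \<mu> (z - real k) (p / a)))"
    and "(deriv ^^ k) La 0 = of_real ((-1) ^ k * (a powr (z - real k) * bessel_mellin \<mu> (z - real k)))"
proof -
  let ?D = "{p. Re p > 0} \<union> ball 0 a"
  have D: "open ?D" by (intro open_Un open_ball open_Collect_less continuous_intros)
  have Lh: "L holomorphic_on laplace_domain" using L by (simp add: laplace_extension_def)
  have m: "of_real (1 / a) * p \<in> laplace_domain" if "p \<in> ?D" for p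
    using that a by (auto simp: laplace_domain_def norm_divide)
  have Lc: "(\<lambda>p. L (of_real (1 / a) * p)) holomorphic_on ?D"
    by (rule holomorphic_on_compose_gen[OF _ Lh, unfolded o_def]) (use m in \<open>auto intro!: holomorphic_intros\<close>)
  then show "La holomorphic_on ?D" unfolding La_def by (rule holomorphic_on_mult[OF holomorphic_on_const])
  have d: "(deriv ^^ k) La q = of_real (a powr (z - real k)) * (deriv ^^ k) L (of_real (1 / a) * q)" if "q \<in> ?D" for q
  proof -
    have "(deriv ^^ k) La q = of_real (a powr z) * (of_real (1 / a) ^ k * (deriv ^^ k) L (of_real (1 / a) * q))"
      unfolding La_def higher_deriv_cmult[OF Lc that D]
      by (subst higher_deriv_compose_linear[OF Lh D open_laplace_domain that]) (use m in auto)
    moreover have "a powr (z - real k) = a powr z * (1 / a) ^ k"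
      using a by (simp add: powr_diff powr_realpow power_divide)
    ultimately show ?thesis by (simp del: of_real_power of_real_divide add: of_real_power[symmetric])
  qed
  show "(deriv ^^ k) La (of_real p) =
      of_real ((-1) ^ k * (a powr (z - real k) * laplace_series \<mu> (z - real k) (p / a)))" if "p > a"
  proof -
    have "(deriv ^^ k) L (of_real (p / a)) = of_real ((-1) ^ k * laplace_series \<mu> (z - real k) (p / a))"
    proof -
      have "p / a > 1" using that a by simp
      then show ?thesis using L unfolding laplace_extension_def by blast
    qed
    moreover have "of_real (1 / a) * complex_of_real p = of_real (p / a)" by simp
    ultimately show ?thesis using d[of "of_real p"] that a by (simp only:) (simp add: mult_ac)
  qed
  show "(deriv ^^ k) La 0 = of_real ((-1) ^ k * (a powr (z - real k) * bessel_mellin \<mu> (z - real k)))"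
    using d[of 0] a L by (simp add: laplace_extension_def mult_ac)
qed

text \<open>
  A disc about a point close to the right half-plane reaches into the left half-plane only within a slightly larger
  disc about \<open>0\<close>. So \<open>holomorphic_sum_derivs\<close> applies on a whole neighbourhood of the positive axis, including \<open>0\<close>,
  although the domain of the transform narrows to a disc at \<open>0\<close>.
\<close>

lemma norm_less_of_left_half_plane:
  assumes "- \<epsilon> < Re p" "\<bar>Im p\<bar> < \<epsilon>" "norm (q - p) \<le> r" "Re q \<le> 0"
  shows "norm q < r + 2 * \<epsilon>"
proof -
  define p' where "p' = Complex (min (Re p) 0) (Im p)"
  have "norm (q - p') \<le> norm (q - p)"
    unfolding cmod_def p'_def using assms(4)
    by (intro real_sqrt_le_mono add_mono) (auto simp: abs_le_square_iff[symmetric] min_def)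
  moreover have "norm p' < 2 * \<epsilon>"
    using cmod_le[of p'] assms(1,2) by (auto simp: p'_def min_def split: if_splits)
  ultimately show ?thesis using norm_triangle_ineq[of "q - p'" p'] assms(3) by simp
qed

lemma weighted_product_bound:
  assumes "\<mu> \<ge> 0" "\<nu> \<ge> 0" "a > 0" "b > 0"
  shows "\<exists>C\<ge>0. \<forall>x>0. \<bar>x powr (- (\<alpha> - \<mu> - \<nu>)) * bessel_product \<mu> \<nu> a b x\<bar> \<le> C * x powr (- \<alpha> - 1)"
proof -
  obtain C where C: "C \<ge> 0" "\<And>x. x > 0 \<Longrightarrow> \<bar>bessel_product \<mu> \<nu> a b x\<bar> \<le> C * x powr (- \<mu> - \<nu> - 1)"
    using bessel_product_decay[OF assms] by blast
  have "\<bar>x powr (- (\<alpha> - \<mu> - \<nu>)) * bessel_product \<mu> \<nu> a b x\<bar> \<le> C * x powr (- \<alpha> - 1)" if "x > 0" for x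
  proof -
    have "\<bar>x powr (- (\<alpha> - \<mu> - \<nu>)) * bessel_product \<mu> \<nu> a b x\<bar> \<le> x powr (- (\<alpha> - \<mu> - \<nu>)) * (C * x powr (- \<mu> - \<nu> - 1))"
      unfolding abs_mult using C(2)[OF that] by (intro mult_mono) auto
    also have "\<dots> = C * (x powr (- (\<alpha> - \<mu> - \<nu>)) * x powr (- \<mu> - \<nu> - 1))" by (simp only: mult_ac)
    also have "x powr (- (\<alpha> - \<mu> - \<nu>)) * x powr (- \<mu> - \<nu> - 1) = x powr (- \<alpha> - 1)"
    proof -
      have "- (\<alpha> - \<mu> - \<nu>) + (- \<mu> - \<nu> - 1) = - \<alpha> - 1" by simp
      then show ?thesis by (simp only: powr_add[symmetric])
    qed
    finally show ?thesis .
  qed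
  then show ?thesis using C(1) by blast
qed

lemma summable_Suc_powr: "\<alpha> > 0 \<Longrightarrow> summable (\<lambda>n. real (Suc n) powr (- \<alpha> - 1))"
  by (subst summable_Suc_iff) (simp add: summable_real_powr_iff)

lemma weighted_product_summable:
  assumes "\<mu> \<ge> 0" "\<nu> \<ge> 0" "a > 0" "b > 0" "\<alpha> > 0"
  shows "summable (\<lambda>n. \<bar>real (Suc n) powr (- (\<alpha> - \<mu> - \<nu>)) * bessel_product \<mu> \<nu> a b (real (Suc n))\<bar>)"
proof -
  obtain C where C: "C \<ge> 0" "\<And>x. x > 0 \<Longrightarrow> \<bar>x powr (- (\<alpha> - \<mu> - \<nu>)) * bessel_product \<mu> \<nu> a b x\<bar> \<le> C * x powr (- \<alpha> - 1)"
    using weighted_product_bound[OF assms(1-4)] by blast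
  show ?thesis
    by (rule summable_comparison_test'[OF summable_mult[OF summable_Suc_powr[OF assms(5)], of C], of 0])
      (use C(2)[of "real (Suc _)"] in \<open>simp del: of_nat_Suc\<close>)
qed

text \<open>
  On the real ray \<open>p > a + b\<close> the regularised sum is \<open>A + B\<close> by the rearrangements. Both sides are holomorphic on a
  thin strip about the positive axis, and \<open>A + B\<close> is so even about \<open>0\<close>. The identity theorem carries the equation to small \<open>p\<close>, and
  continuity to \<open>p = 0\<close>.
\<close>

theorem interior_identity:
  assumes "\<mu> \<ge> 0" "\<nu> \<ge> 0" "\<alpha> > 0" and "\<alpha> - \<mu> - \<nu> \<notin> \<int>" and "b > 0" "a > b" "a + b < 2 * pi"
  defines "\<theta> \<equiv> \<alpha> - \<mu> - \<nu>" and "z \<equiv> \<alpha> - \<mu> - \<nu> - 1"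
  shows "complex_of_real (\<Sum>n. real (Suc n) powr (- \<theta>) * bessel_product \<mu> \<nu> a b (real (Suc n))) =
      (\<Sum>k. of_real (bessel_coeff \<nu> k * b ^ (2 * k) * (a powr (z - real (2 * k)) * bessel_mellin \<mu> (z - real (2 * k))))) +
      (\<Sum>m. of_real (product_coeff \<mu> \<nu> a b m) * riemann_zeta (of_real (\<theta> - real (2 * m))))"
    and "summable (\<lambda>k. bessel_coeff \<nu> k * b ^ (2 * k) * (a powr (z - real (2 * k)) * bessel_mellin \<mu> (z - real (2 * k))))"
proof -
  have a: "a > 0" using assms by simp
  have \<theta>: "\<theta> \<notin> \<int>" and z: "z \<notin> \<int>" using assms(4) not_Ints_shift(1)[of \<theta> 1] by (simp_all add: \<theta>_def z_def)
  define w where "w = (\<lambda>n. real (Suc n) powr (- \<theta>) * bessel_product \<mu> \<nu> a b (real (Suc n)))"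
  define F where "F = (\<lambda>p. \<Sum>n. complex_of_real (w n) * exp (- (of_nat (Suc n) * p)))"
  have w: "summable (\<lambda>n. \<bar>w n\<bar>)" using weighted_product_summable[OF assms(1,2) a assms(5,3)] by (simp add: w_def \<theta>_def)
  obtain R where R: "polylog_extension \<theta> R" using polylog_extension_exists[OF \<theta>] by blast
  obtain L where L: "laplace_extension \<mu> z L" using laplace_extension_exists[OF assms(1) z] by blast
  define La where "La = (\<lambda>p. complex_of_real (a powr z) * L (of_real (1 / a) * p))"
  note La = scaled_laplace_extension[OF L a, folded La_def]
  define d where "d = (\<lambda>k. complex_of_real (bessel_coeff \<nu> k * b ^ (2 * k)))"
  define c where "c = (\<lambda>m. complex_of_real (product_coeff \<mu> \<nu> a b m))"
  define A where "A = (\<lambda>p. \<Sum>k. d k * (deriv ^^ (2 * k)) La p)"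
  define B where "B = (\<lambda>p. \<Sum>m. c m * (deriv ^^ (2 * m)) R p)"
  obtain Cd where Cd: "Cd \<ge> 0" "\<And>k. \<bar>bessel_coeff \<nu> k\<bar> \<le> Cd / fact (2 * k)"
    using bessel_coeff_bound_simple[OF assms(2)] by blast
  obtain Cc where Cc: "Cc \<ge> 0" "\<And>m. abs_product_coeff \<mu> \<nu> a b m \<le> Cc * (a + b) ^ (2 * m) / fact (2 * m)"
    using abs_product_coeff_bound[OF assms(1,2) a assms(5)] by blast
  have dle: "norm (d k) \<le> Cd * b ^ (2 * k) / fact (2 * k)" for k
  proof -
    have "norm (d k) = \<bar>bessel_coeff \<nu> k\<bar> * b ^ (2 * k)"
      unfolding d_def norm_of_real using assms(5) by (simp add: abs_mult)
    also have "\<dots> \<le> (Cd / fact (2 * k)) * b ^ (2 * k)" using assms(5) by (intro mult_right_mono Cd(2)) auto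
    finally show ?thesis by simp
  qed
  have cle: "norm (c m) \<le> Cc * (a + b) ^ (2 * m) / fact (2 * m)" for m
    unfolding c_def norm_of_real by (rule order_trans[OF abs_product_coeff_ge Cc(2)])
  \<comment> \<open>Both discs below have a radius halfway between the type of the coefficients and the distance of the
    singularities. The gap left over has to exceed \<open>2 \<epsilon>\<close>.\<close>
  define \<epsilon> where "\<epsilon> = min ((a - b) / 8) ((2 * pi - a - b) / 8)"
  have \<epsilon>: "\<epsilon> > 0" "8 * \<epsilon> \<le> a - b" "8 * \<epsilon> \<le> 2 * pi - a - b" using assms by (auto simp: \<epsilon>_def min_def)
  define U where "U = {p. - \<epsilon> < Re p \<and> \<bar>Im p\<bar> < \<epsilon>}"
  have U: "open U" unfolding U_def by (intro open_Collect_conj open_Collect_less continuous_intros)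
  let ?DA = "{p. Re p > 0} \<union> ball 0 a"
  have DA: "open ?DA" by (intro open_Un open_ball open_Collect_less continuous_intros)
  have subA: "cball p (b + (a - b) / 2) \<subseteq> ?DA" if "p \<in> U" for p
  proof
    fix q assume "q \<in> cball p (b + (a - b) / 2)"
    then have "norm (q - p) \<le> b + (a - b) / 2" by (simp add: dist_norm norm_minus_commute)
    then have "norm q < b + (a - b) / 2 + 2 * \<epsilon>" if "Re q \<le> 0"
      using norm_less_of_left_half_plane[of \<epsilon> p q] that \<open>p \<in> U\<close> by (auto simp: U_def)
    then show "q \<in> ?DA" using \<epsilon> by (cases "Re q \<le> 0") (auto simp: field_simps)
  qed
  have subB: "cball p (a + b + (2 * pi - a - b) / 2) \<subseteq> polylog_strip" if "p \<in> U" for p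
  proof
    fix q assume "q \<in> cball p (a + b + (2 * pi - a - b) / 2)"
    then have *: "norm (q - p) \<le> a + b + (2 * pi - a - b) / 2" by (simp add: dist_norm norm_minus_commute)
    have "\<bar>Re q - Re p\<bar> \<le> norm (q - p)" "\<bar>Im q - Im p\<bar> \<le> norm (q - p)"
      using abs_Re_le_cmod[of "q - p"] abs_Im_le_cmod[of "q - p"] by simp_all
    then have "\<bar>Re q - Re p\<bar> \<le> a + b + (2 * pi - a - b) / 2" "\<bar>Im q - Im p\<bar> \<le> a + b + (2 * pi - a - b) / 2"
      using * by linarith+
    moreover have "a + b + (2 * pi - a - b) / 2 \<le> 2 * pi - 4 * \<epsilon>" using \<epsilon> by (simp add: field_simps)
    moreover have "- \<epsilon> < Re p" "\<bar>Im p\<bar> < \<epsilon>" using that by (auto simp: U_def)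
    ultimately have "Re q > - 8" "\<bar>Im q\<bar> < 2 * pi" using \<epsilon>(1) pi_less_4 by linarith+
    then show "q \<in> polylog_strip" by (simp add: polylog_strip_def)
  qed
  have Rh: "R holomorphic_on polylog_strip" using R by (simp add: polylog_extension_def)
  have T: "0 \<le> b" "b < b + (a - b) / 2" "0 \<le> a + b" "a + b < a + b + (2 * pi - a - b) / 2" using assms by auto
  have A: "A holomorphic_on U" unfolding A_def by (rule holomorphic_sum_derivs(1)[OF La(1) DA U T(1,2) subA dle])
  have Asum: "summable (\<lambda>k. d k * (deriv ^^ (2 * k)) La p)" if "p \<in> U" for p
    by (rule holomorphic_sum_derivs(2)[OF La(1) DA U T(1,2) subA dle that])
  have B: "B holomorphic_on U" unfolding B_def by (rule holomorphic_sum_derivs(1)[OF Rh polylog_strip(1) U T(3,4) subB cle])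
  let ?S = "{p. Re p > 0} \<inter> {p. Im p < \<epsilon>} \<inter> {p. Im p > - \<epsilon>}"
  have SU: "?S \<subseteq> U" using \<epsilon> by (auto simp: U_def)
  have S: "open ?S" "connected ?S"
    by (intro open_Int open_Collect_less continuous_intros)
      (intro convex_connected convex_Int convex_halfspace_Re_gt convex_halfspace_Im_lt convex_halfspace_Im_gt)
  have large: "F (of_real p) = A (of_real p) + B (of_real p)" if p: "p > a + b" for p
  proof -
    have "p > 0" "p > a" using p assms a by auto
    have pS: "complex_of_real p \<in> polylog_strip" "Re (complex_of_real p) > 0" using \<open>p > 0\<close> by (auto simp: polylog_strip_def)
    let ?E = "\<lambda>m. c m * exp_dirichlet (\<theta> - real (2 * m)) (of_real p)"
    let ?G = "\<lambda>m. complex_of_real (product_coeff \<mu> \<nu> a b m * Gamma (2 * real m - z) * p powr (z - 2 * real m))"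
    note E = exp_dirichlet_product[OF assms(1,2) a assms(5) p, of \<theta>]
    note G = Gamma_series_rearrange[OF assms(1,2) a assms(5) p z]
    have "c m * (deriv ^^ (2 * m)) R (of_real p) = ?E m - ?G m" for m
    proof -
      have e: "1 - (\<theta> - real (2 * m)) = 2 * real m - z" "\<theta> - real (2 * m) - 1 = z - 2 * real m"
        by (simp_all add: \<theta>_def z_def)
      have "(deriv ^^ (2 * m)) R (of_real p) = exp_dirichlet (\<theta> - real (2 * m)) (of_real p)
          - of_real (Gamma (2 * real m - z)) * (of_real p powr of_real (z - 2 * real m))"
        using polylog_extension_eq(2)[OF R \<theta> pS, of "2 * m"] unfolding polylog_regular_def e by simp
      also have "of_real p powr of_real (z - 2 * real m) = complex_of_real (p powr (z - 2 * real m))"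
        using \<open>p > 0\<close> by (intro powr_of_real) simp
      finally have f: "(deriv ^^ (2 * m)) R (of_real p) = exp_dirichlet (\<theta> - real (2 * m)) (of_real p)
          - of_real (Gamma (2 * real m - z)) * complex_of_real (p powr (z - 2 * real m))" .
      show ?thesis unfolding f c_def by (simp only: right_diff_distrib of_real_mult mult.assoc)
    qed
    then have "B (of_real p) = (\<Sum>m. ?E m) - (\<Sum>m. ?G m)"
      unfolding B_def using suminf_diff[OF E(2) G(2), symmetric]
      by (simp only: c_def)
    also have "(\<Sum>m. ?E m) = F (of_real p)" unfolding F_def c_def w_def
      using E(1) by simp
    also have "(\<Sum>m. ?G m) = A (of_real p)"
      unfolding G(1) A_def d_def La(2)[OF \<open>p > a\<close>] by simp
    finally show ?thesis by simp
  qed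
  have eq: "F p = A p + B p" if "p \<in> ?S" for p
  proof (rule holomorphic_eq_from_real_ray[of F ?S "\<lambda>p. A p + B p" "a + b", OF _ _ S])
    show "F holomorphic_on ?S" unfolding F_def by (rule holomorphic_on_subset[OF abel_sum(1)[OF w]]) auto
    show "(\<lambda>p. A p + B p) holomorphic_on ?S"
      using A B SU by (intro holomorphic_on_add) (auto intro: holomorphic_on_subset)
  qed (use large that a assms(5) \<epsilon> in auto)
  have U0: "0 \<in> U" using \<epsilon> by (simp add: U_def)
  have "continuous_on U (\<lambda>p. A p + B p)" using A B by (intro holomorphic_on_imp_continuous_on holomorphic_on_add)
  then have "isCont (\<lambda>p. A p + B p) (complex_of_real 0)" using continuous_on_eq_continuous_at[OF U, of "\<lambda>p. A p + B p"] U0 by auto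
  then have "((\<lambda>t. A (complex_of_real t) + B (complex_of_real t)) \<longlongrightarrow> A (of_real 0) + B (of_real 0)) (at_right 0)"
    by (rule isCont_tendsto_compose) (auto intro!: tendsto_eq_intros)
  moreover have "\<forall>\<^sub>F t in at_right 0. A (complex_of_real t) + B (complex_of_real t) = F (of_real t)"
    using eventually_at_right_less[of "0::real"] by eventually_elim (use eq \<epsilon> in auto)
  ultimately have "((\<lambda>t. F (complex_of_real t)) \<longlongrightarrow> A 0 + B 0) (at_right 0)"
    by (simp add: Lim_transform_eventually)
  moreover have "((\<lambda>t. F (complex_of_real t)) \<longlongrightarrow> of_real (\<Sum>n. w n)) (at_right 0)"
    unfolding F_def by (rule abel_sum(2)[OF w])
  ultimately have "A 0 + B 0 = of_real (\<Sum>n. w n)"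
    by (intro tendsto_unique[of "at_right (0::real)"]) simp_all
  then have *: "of_real (\<Sum>n. w n) = A 0 + B 0" ..
  have A0: "d k * (deriv ^^ (2 * k)) La 0 =
      of_real (bessel_coeff \<nu> k * b ^ (2 * k) * (a powr (z - real (2 * k)) * bessel_mellin \<mu> (z - real (2 * k))))" for k
    unfolding La(3) d_def by simp
  have B0: "(deriv ^^ (2 * m)) R 0 = riemann_zeta (of_real (\<theta> - real (2 * m)))" for m
    using R by (simp add: polylog_extension_def)
  show "complex_of_real (\<Sum>n. real (Suc n) powr (- \<theta>) * bessel_product \<mu> \<nu> a b (real (Suc n))) =
      (\<Sum>k. of_real (bessel_coeff \<nu> k * b ^ (2 * k) * (a powr (z - real (2 * k)) * bessel_mellin \<mu> (z - real (2 * k))))) +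
      (\<Sum>m. of_real (product_coeff \<mu> \<nu> a b m) * riemann_zeta (of_real (\<theta> - real (2 * m))))"
    using * unfolding A_def B_def A0 B0 c_def w_def .
  show "summable (\<lambda>k. bessel_coeff \<nu> k * b ^ (2 * k) * (a powr (z - real (2 * k)) * bessel_mellin \<mu> (z - real (2 * k))))"
    using Asum[OF U0] unfolding A0 by (simp only: summable_of_real_iff)
qed

section \<open>Closed forms and the boundary case\<close>

lemma rGamma_shift_pochhammer:
  fixes x :: real
  assumes "x > 0"
  shows "rGamma (x + real k) = rGamma x / pochhammer x k"
proof -
  have "pochhammer x k > 0" using assms by (rule pochhammer_pos)
  then show ?thesis using pochhammer_rGamma[of x k] by simp
qed

lemma rGamma_shift_down:
  fixes x :: real
  shows "rGamma (x + 1 - real k) = (-1) ^ k * pochhammer (- x) k * rGamma (x + 1)"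
proof -
  have e: "x + 1 - real k = x - real k + 1" "x - real k + 1 + real k = x + 1" by simp_all
  show ?thesis using pochhammer_rGamma[of "x - real k + 1" k] unfolding e pochhammer_minus' .
qed

text \<open>
  Shifting \<open>z\<close> by \<open>2 k\<close> shifts the arguments of the Gamma functions in \<open>bessel_mellin\<close> by \<open>k\<close> in opposite directions,
  which produces the two Pochhammer symbols of the hypergeometric term.
\<close>

lemma bessel_mellin_term:
  assumes a: "a > 0" and \<nu>: "\<nu> \<ge> 0" and z: "z \<notin> \<int>"
  shows "bessel_coeff \<nu> k * b ^ (2 * k) * (a powr (z - real (2 * k)) * bessel_mellin \<mu> (z - real (2 * k))) =
    ((a / 2) powr z * Gamma (- z / 2) / 2 * rGamma (1 + \<nu>) * rGamma (\<mu> + z / 2 + 1)) *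
    (pochhammer (- z / 2) k * pochhammer (- (\<mu> + z / 2)) k / (pochhammer (1 + \<nu>) k * fact k) * (b\<^sup>2 / a\<^sup>2) ^ k)"
proof -
  have nz: "- z / 2 \<notin> \<int>\<^sub>\<le>\<^sub>0"
  proof
    assume "- z / 2 \<in> \<int>\<^sub>\<le>\<^sub>0"
    then have "- z / 2 \<in> \<int>" using nonpos_Ints_Int by blast
    then have "2 * (- z / 2) \<in> \<int>" by (intro Ints_mult) auto
    then show False using not_Ints_minus[OF z] by simp
  qed
  have G: "Gamma (- z / 2 + real k) = pochhammer (- z / 2) k * Gamma (- z / 2)"
    using pochhammer_Gamma[OF nz, of k] nz by (simp add: Gamma_eq_zero_iff)
  have e: "- (z - real (2 * k)) / 2 = - z / 2 + real k" "\<mu> + 1 + (z - real (2 * k)) / 2 = (\<mu> + z / 2) + 1 - real k"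
    by (simp_all add: field_simps)
  have two: "2 powr (- (z - real (2 * k)) - 1) = 4 ^ k * (1 / 2 powr z) / (2 :: real)"
  proof -
    have "- (z - real (2 * k)) - 1 = real (2 * k) + (- z) + (- 1)" by simp
    then have "(2 :: real) powr (- (z - real (2 * k)) - 1) = 2 powr real (2 * k) * 2 powr (- z) * 2 powr (- 1)"
      by (simp only: powr_add)
    also have "(2 :: real) powr real (2 * k) = 4 ^ k" by (subst powr_realpow) (simp_all add: power_mult)
    also have "2 powr (- z) = 1 / 2 powr z" by (simp add: powr_minus divide_inverse)
    also have "2 powr (- 1) = (1 / 2 :: real)" by (simp add: powr_minus)
    finally show ?thesis by (simp only: times_divide_eq_right mult_1_right)
  qed
  have K: "bessel_mellin \<mu> (z - real (2 * k)) = 4 ^ k * (1 / 2 powr z) / 2 * (pochhammer (- z / 2) k * Gamma (- z / 2)) *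
      ((-1) ^ k * pochhammer (- (\<mu> + z / 2)) k * rGamma ((\<mu> + z / 2) + 1))"
    unfolding bessel_mellin_def e two G rGamma_shift_down ..
  have r: "rGamma (\<nu> + real k + 1) = rGamma (1 + \<nu>) / pochhammer (1 + \<nu>) k"
    using rGamma_shift_pochhammer[of "1 + \<nu>" k] \<nu> by (simp add: add_ac)
  have ap: "a powr (z - real (2 * k)) = a powr z / (a\<^sup>2) ^ k"
    using a powr_realpow[of a "2 * k"] by (simp add: powr_diff power_mult)
  have bp: "b ^ (2 * k) = (b\<^sup>2) ^ k" by (simp add: power_mult)
  have s: "(-1) ^ k * (-1) ^ k = (1 :: real)" by (simp flip: power_mult_distrib)
  have alg: "s * (rg / P) / (f * q) * B * (A / A2 * (q * (1 / w) / 2 * (p1 * Ga) * (s * p2 * rm))) =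
      (A / w * Ga / 2 * rg * rm) * (p1 * p2 / (P * f) * (B / A2))"
    if "s * s = 1" "q \<noteq> 0" for s rg P f q B A A2 w p1 Ga p2 rm :: real
  proof -
    have "s * (rg / P) / (f * q) * B * (A / A2 * (q * (1 / w) / 2 * (p1 * Ga) * (s * p2 * rm))) =
      (s * s) * (q / q) * ((A / w * Ga / 2 * rg * rm) * (p1 * p2 / (P * f) * (B / A2)))"
      by (simp only: divide_inverse inverse_mult_distrib mult_ac mult_1_left)
    then show ?thesis using that by simp
  qed
  have a2: "(a / 2) powr z = a powr z / 2 powr z" using a by (simp add: powr_divide)
  show ?thesis
    unfolding bessel_coeff_def r ap bp K a2 power_divide[of "b\<^sup>2" "a\<^sup>2"] by (rule alg[OF s]) simp
qed

lemma bessel_mellin_sum: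
  assumes "a > 0" "\<nu> \<ge> 0" "\<alpha> - \<mu> - \<nu> \<notin> \<int>"
  defines "z \<equiv> \<alpha> - \<mu> - \<nu> - 1"
  assumes S: "summable (\<lambda>k. bessel_coeff \<nu> k * b ^ (2 * k) * (a powr (z - real (2 * k)) * bessel_mellin \<mu> (z - real (2 * k))))"
  shows "(\<Sum>k. complex_of_real (bessel_coeff \<nu> k * b ^ (2 * k) * (a powr (z - real (2 * k)) * bessel_mellin \<mu> (z - real (2 * k))))) =
    of_real (F_hat_1 \<alpha> \<mu> \<nu> a b)"
proof -
  have z: "z \<notin> \<int>" using assms(3) not_Ints_shift(1)[of "\<alpha> - \<mu> - \<nu>" 1] by (simp add: z_def)
  define K where "K = (a / 2) powr z * Gamma (- z / 2) / 2 * rGamma (1 + \<nu>) * rGamma (\<mu> + z / 2 + 1)"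
  define h where "h = (\<lambda>k. pochhammer (- z / 2) k * pochhammer (- (\<mu> + z / 2)) k / (pochhammer (1 + \<nu>) k * fact k) * (b\<^sup>2 / a\<^sup>2) ^ k)"
  have h: "h k = pochhammer (- z / 2) k * pochhammer (- (\<mu> + z / 2)) k / (pochhammer (1 + \<nu>) k * fact k) * (b\<^sup>2 / a\<^sup>2) ^ k" for k
    by (simp add: h_def)
  have t: "bessel_coeff \<nu> k * b ^ (2 * k) * (a powr (z - real (2 * k)) * bessel_mellin \<mu> (z - real (2 * k))) = K * h k" for k
    unfolding h K_def by (rule bessel_mellin_term[OF assms(1,2) z])
  have "(\<Sum>k. K * h k) = K * suminf h"
  \<comment> \<open>If the constant vanishes, convergence of the hypergeometric series is unknown, but both sides are \<open>0\<close>.\<close>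
  proof (cases "K = 0")
    case False
    have "summable (\<lambda>k. K * h k)" using S unfolding t .
    then have "summable h" using False by simp
    then show ?thesis by (rule suminf_mult)
  qed simp
  also have "\<dots> = F_hat_1 \<alpha> \<mu> \<nu> a b"
  proof -
    have e: "- z / 2 = (\<mu> + \<nu> + 1 - \<alpha>) / 2" "- (\<mu> + z / 2) = (\<nu> - \<mu> + 1 - \<alpha>) / 2"
      "(\<mu> + \<nu> + 1 - \<alpha>) / 2 = \<mu> / 2 + \<nu> / 2 + 1 / 2 - \<alpha> / 2" "\<mu> + z / 2 + 1 = \<mu> / 2 - \<nu> / 2 + \<alpha> / 2 + 1 / 2"
      by (simp_all add: z_def field_simps)
    show ?thesis
      unfolding F_hat_1_def hyp2F1_altdef K_def h_def e(4) by (simp only: e(1,2)) (simp only: e(3) z_def)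
  qed
  finally have "(\<Sum>k. K * h k) = F_hat_1 \<alpha> \<mu> \<nu> a b" .
  moreover have "(\<Sum>k. complex_of_real (K * h k)) = of_real (\<Sum>k. K * h k)"
    using S unfolding t by (rule suminf_of_real[symmetric])
  ultimately show ?thesis unfolding t by (simp only:)
qed

text \<open>
  Reversing the Gamma factor and the factorial of index \<open>m - k\<close> into Pochhammer symbols of negative arguments makes the finite
  convolution a terminating hypergeometric series.
\<close>

lemma product_coeff_hyp2F1:
  assumes \<mu>: "\<mu> \<ge> 0" and \<nu>: "\<nu> \<ge> 0" and a: "a > 0"
  shows "product_coeff \<mu> \<nu> a b m = rGamma (1 + \<nu>) * ((-1) ^ m / fact m * rGamma (1 + \<mu> + real m) *
    hyp2F1 (- real m) (- real m - \<mu>) (1 + \<nu>) (b\<^sup>2 / a\<^sup>2) * (a / 2) ^ (2 * m))"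
proof -
  define h where "h = (\<lambda>k. pochhammer (- real m) k * pochhammer (- real m - \<mu>) k / (pochhammer (1 + \<nu>) k * fact k) * (b\<^sup>2 / a\<^sup>2) ^ k)"
  define K where "K = rGamma (1 + \<nu>) * ((-1) ^ m / fact m * rGamma (1 + \<mu> + real m)) * (a / 2) ^ (2 * m)"
  have "hyp2F1 (- real m) (- real m - \<mu>) (1 + \<nu>) (b\<^sup>2 / a\<^sup>2) = (\<Sum>k\<le>m. h k)"
    unfolding hyp2F1_altdef h_def
    by (rule suminf_finite) (auto simp: pochhammer_of_nat_eq_0_lemma)
  moreover have "(bessel_coeff \<nu> k * b ^ (2 * k)) * (bessel_coeff \<mu> (m - k) * a ^ (2 * (m - k))) = K * h k" if k: "k \<le> m" for k
  proof -
    have p1: "pochhammer (- real m) k = (-1) ^ k * (fact m / fact (m - k))"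
    proof -
      have "fact m = (fact (m - k) :: real) * pochhammer (real m - real k + 1) k"
        using pochhammer_product[of "m - k" m "1 :: real"] k by (simp add: pochhammer_fact of_nat_diff add_ac)
      then have "pochhammer (real m - real k + 1) k = fact m / fact (m - k)" by simp
      then have "(-1) ^ k * pochhammer (- real m) k = (fact m / fact (m - k) :: real)"
        using pochhammer_minus'[of "real m" k] by simp
      then have "(-1) ^ k * ((-1) ^ k * pochhammer (- real m) k) = (-1) ^ k * (fact m / fact (m - k) :: real)" by simp
      then show ?thesis by (simp add: mult.assoc[symmetric] flip: power_mult_distrib)
    qed
    have r: "rGamma (\<nu> + real k + 1) = rGamma (1 + \<nu>) / pochhammer (1 + \<nu>) k"
      using rGamma_shift_pochhammer[of "1 + \<nu>" k] \<nu> by (simp add: add_ac)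
    have q: "rGamma (\<mu> + real (m - k) + 1) = (-1) ^ k * pochhammer (- real m - \<mu>) k * rGamma (1 + \<mu> + real m)"
    proof -
      have "real m + \<mu> + 1 - real k = \<mu> + real (m - k) + 1" "- (real m + \<mu>) = - real m - \<mu>" "real m + \<mu> + 1 = 1 + \<mu> + real m"
        using k by (simp_all add: of_nat_diff)
      then show ?thesis using rGamma_shift_down[of "real m + \<mu>" k] by (simp only:)
    qed
    have f4: "(4 :: real) ^ m = 4 ^ k * 4 ^ (m - k)" using k by (simp flip: power_add)
    have ms: "(-1 :: real) ^ m = (-1) ^ k * (-1) ^ (m - k)" using k by (simp flip: power_add)
    have am: "(a / 2) ^ (2 * m) = (a\<^sup>2) ^ k * a ^ (2 * (m - k)) / 4 ^ m"
      using k by (simp add: power_divide power_mult flip: power_add)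
    have bk: "b ^ (2 * k) = (b\<^sup>2) ^ k" by (simp add: power_mult)
    have alg: "(s * (rg / P) / (f * q) * B) * (t * (s * p2 * rm) / (g * q') * A') =
        rg * (s * t / F * rm) * (A * A' / (q * q')) * (s * (F / g) * p2 / (P * f) * (B / A))"
      if "A \<noteq> 0" "F \<noteq> 0" for s t rg P f q B p2 rm g q' A' F A :: real
    proof -
      have "rg * (s * t / F * rm) * (A * A' / (q * q')) * (s * (F / g) * p2 / (P * f) * (B / A)) =
          (A / A) * (F / F) * ((s * (rg / P) / (f * q) * B) * (t * (s * p2 * rm) / (g * q') * A'))"
        by (simp only: divide_inverse inverse_mult_distrib mult_ac)
      then show ?thesis using that by simp
    qed
    show ?thesis
      unfolding bessel_coeff_def K_def h_def p1 r q am bk ms f4 power_divide[of "b\<^sup>2" "a\<^sup>2"]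
      by (rule alg) (use a in auto)
  qed
  then have "product_coeff \<mu> \<nu> a b m = K * (\<Sum>k\<le>m. h k)"
    unfolding product_coeff_def sum_distrib_left by (intro sum.cong) auto
  ultimately show ?thesis by (simp only: K_def mult_ac)
qed

lemma B_coeff_product_coeff:
  assumes "\<mu> \<ge> 0" "\<nu> \<ge> 0" "a > 0"
  shows "of_real (rGamma (1 + \<nu>)) * (B_coeff \<alpha> \<mu> \<nu> a b m * of_real ((a / 2) ^ (2 * m))) =
    of_real (product_coeff \<mu> \<nu> a b m) * riemann_zeta (of_real (\<alpha> - \<mu> - \<nu> - real (2 * m)))"
  unfolding product_coeff_hyp2F1[OF assms] B_coeff_def by (simp add: mult_ac)

text \<open>
  The factorials cancel, \<open>((a + b) / (2 \<pi>))^(2 m)\<close> is at most \<open>1\<close>, and the remaining powers of \<open>m\<close> combine to \<open>- \<mu> - \<nu> - 1 - \<theta> = - \<alpha> - 1\<close>.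
  Since \<open>\<alpha> > 0\<close>, this is summable even if \<open>a + b = 2 \<pi>\<close>.
\<close>

lemma zeta_series_bound:
  assumes "\<mu> \<ge> 0" "\<nu> \<ge> 0" "a > 0" "b > 0" and ab: "a + b \<le> 2 * pi" and \<theta>: "\<alpha> - \<mu> - \<nu> \<notin> \<int>"
  shows "\<exists>K. \<forall>m. norm (of_real (product_coeff \<mu> \<nu> a b m) * riemann_zeta (of_real (\<alpha> - \<mu> - \<nu> - real (2 * m)))) \<le>
    K * real (Suc m) powr (- \<alpha> - 1)"
proof -
  let ?\<theta> = "\<alpha> - \<mu> - \<nu>"
  obtain C where C: "C \<ge> 0" "\<And>m. abs_product_coeff \<mu> \<nu> a b m \<le> C * (a + b) ^ (2 * m) / fact (2 * m) * real (m + 1) powr (- \<mu> - \<nu> - 1)"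
    using product_coeff_bound[OF assms(1-4)] unfolding abs_product_coeff_def by blast
  obtain Z where Z: "Z \<ge> 0" "\<And>m. norm (riemann_zeta (of_real (?\<theta> - 2 * real m))) \<le> Z * fact (2 * m) * real (2 * m + 1) powr (- ?\<theta>) / (2 * pi) ^ (2 * m)"
    using riemann_zeta_bound[OF \<theta>] by blast
  \<comment> \<open>Compares powers of \<open>2 m + 1\<close> and \<open>m + 1\<close> for either sign of the exponent.\<close>
  define M where "M = max 1 (2 powr (- ?\<theta>))"
  have pw: "real (2 * m + 1) powr (- ?\<theta>) \<le> M * real (m + 1) powr (- ?\<theta>)" for m
  proof (cases "?\<theta> \<ge> 0")
    case True
    then have "real (2 * m + 1) powr (- ?\<theta>) \<le> 1 * real (m + 1) powr (- ?\<theta>)"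
      by (simp add: powr_mono2')
    also have "\<dots> \<le> M * real (m + 1) powr (- ?\<theta>)" by (intro mult_right_mono) (auto simp: M_def)
    finally show ?thesis .
  next
    case False
    then have "real (2 * m + 1) powr (- ?\<theta>) \<le> (2 * real (m + 1)) powr (- ?\<theta>)"
      by (intro powr_mono2) auto
    also have "\<dots> = 2 powr (- ?\<theta>) * real (m + 1) powr (- ?\<theta>)" by (rule powr_mult)
    also have "\<dots> \<le> M * real (m + 1) powr (- ?\<theta>)" by (intro mult_right_mono) (auto simp: M_def)
    finally show ?thesis .
  qed
  have "norm (of_real (product_coeff \<mu> \<nu> a b m) * riemann_zeta (of_real (?\<theta> - real (2 * m)))) \<le>
      (C * Z * M) * real (Suc m) powr (- \<alpha> - 1)" for m
  proof -
    let ?x = "real (m + 1)"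
    have q: "(a + b) ^ (2 * m) / (2 * pi) ^ (2 * m) \<le> 1"
      using power_mono[OF ab, of "2 * m"] assms(3,4) by simp
    have "norm (of_real (product_coeff \<mu> \<nu> a b m) * riemann_zeta (of_real (?\<theta> - real (2 * m)))) \<le>
        (C * (a + b) ^ (2 * m) / fact (2 * m) * ?x powr (- \<mu> - \<nu> - 1)) *
        (Z * fact (2 * m) * real (2 * m + 1) powr (- ?\<theta>) / (2 * pi) ^ (2 * m))"
      unfolding norm_mult norm_of_real
      using C Z(2)[of m] assms(3,4) by (intro mult_mono order_trans[OF abs_product_coeff_ge C(2)]) auto
    also have "\<dots> = (C * Z) * ((a + b) ^ (2 * m) / (2 * pi) ^ (2 * m)) * (?x powr (- \<mu> - \<nu> - 1) * real (2 * m + 1) powr (- ?\<theta>))"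
      by (simp add: mult_ac)
    also have "\<dots> \<le> (C * Z) * 1 * (?x powr (- \<mu> - \<nu> - 1) * (M * ?x powr (- ?\<theta>)))"
      using C(1) Z(1) assms(3,4) by (intro mult_mono mult_left_mono q pw) auto
    also have "\<dots> = (C * Z * M) * (?x powr (- \<mu> - \<nu> - 1) * ?x powr (- ?\<theta>))" by (simp add: mult_ac)
    also have "?x powr (- \<mu> - \<nu> - 1) * ?x powr (- ?\<theta>) = real (Suc m) powr (- \<alpha> - 1)"
    proof -
      have "- \<mu> - \<nu> - 1 + - ?\<theta> = - \<alpha> - 1" by simp
      then show ?thesis by (simp only: powr_add[symmetric] Suc_eq_plus1)
    qed
    finally show ?thesis .
  qed
  then show ?thesis by blast
qed

lemma product_coeff_scale: "product_coeff \<mu> \<nu> (t * a) (t * b) m = product_coeff \<mu> \<nu> a b m * t ^ (2 * m)"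
  unfolding product_coeff_def sum_distrib_right
proof (rule sum.cong[OF refl])
  fix k assume "k \<in> {..m}"
  then have "2 * m = 2 * k + 2 * (m - k)" by simp
  then have "t ^ (2 * m) = t ^ (2 * k) * t ^ (2 * (m - k))" by (simp only: power_add[symmetric])
  then show "bessel_coeff \<nu> k * (t * b) ^ (2 * k) * (bessel_coeff \<mu> (m - k) * (t * a) ^ (2 * (m - k))) =
      bessel_coeff \<nu> k * b ^ (2 * k) * (bessel_coeff \<mu> (m - k) * a ^ (2 * (m - k))) * t ^ (2 * m)"
    by (simp only: power_mult_distrib mult_ac)
qed

lemma bessel_product_scale: "bessel_product \<mu> \<nu> (t * a) (t * b) x = bessel_product \<mu> \<nu> a b (t * x)"
  by (simp add: bessel_product_def mult_ac)

lemma F_hat_1_scale: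
  assumes "t > 0" "a > 0"
  shows "F_hat_1 \<alpha> \<mu> \<nu> (t * a) (t * b) = t powr (\<alpha> - \<mu> - \<nu> - 1) * F_hat_1 \<alpha> \<mu> \<nu> a b"
proof -
  have "(t * a / 2) powr (\<alpha> - \<mu> - \<nu> - 1) = t powr (\<alpha> - \<mu> - \<nu> - 1) * (a / 2) powr (\<alpha> - \<mu> - \<nu> - 1)"
    using assms powr_mult[of t "a / 2"] by simp
  moreover have "(t * b)\<^sup>2 / (t * a)\<^sup>2 = b\<^sup>2 / a\<^sup>2" using assms by (simp add: power_mult_distrib)
  ultimately show ?thesis unfolding F_hat_1_def by (simp only: mult_ac times_divide_eq_right times_divide_eq_left)
qed

text \<open>
  Scaling \<open>(a, b)\<close> by \<open>t < 1\<close> leads to the interior case and leaves \<open>b / a\<close> unchanged. Both sides are uniformly convergent in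
  \<open>t\<close> on \<open>[1 / 2, 1]\<close>, and \<open>t\<close> may tend to \<open>1\<close>.
\<close>

theorem closed_identity:
  assumes "\<mu> \<ge> 0" "\<nu> \<ge> 0" "\<alpha> > 0" and \<theta>: "\<alpha> - \<mu> - \<nu> \<notin> \<int>" and "b > 0" "a > b" and ab: "a + b \<le> 2 * pi"
  shows "complex_of_real (\<Sum>n. real (Suc n) powr (- (\<alpha> - \<mu> - \<nu>)) * bessel_product \<mu> \<nu> a b (real (Suc n))) =
    of_real (F_hat_1 \<alpha> \<mu> \<nu> a b) +
    (\<Sum>m. of_real (product_coeff \<mu> \<nu> a b m) * riemann_zeta (of_real (\<alpha> - \<mu> - \<nu> - real (2 * m))))"
proof -
  let ?\<theta> = "\<alpha> - \<mu> - \<nu>"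
  have a: "a > 0" using assms by simp
  define w where "w = (\<lambda>n t. real (Suc n) powr (- ?\<theta>) * bessel_product \<mu> \<nu> a b (t * real (Suc n)))"
  define c where "c = (\<lambda>m. of_real (product_coeff \<mu> \<nu> a b m) * riemann_zeta (of_real (?\<theta> - real (2 * m))))"
  let ?l = "\<lambda>t. complex_of_real (\<Sum>n. w n t)"
  let ?r = "\<lambda>t. of_real (t powr (?\<theta> - 1) * F_hat_1 \<alpha> \<mu> \<nu> a b) + (\<Sum>m. c m * of_real (t ^ (2 * m)))"
  have eq: "?l t = ?r t" if t: "1 / 2 < t" "t < 1" for t
  proof -
    have "t * a + t * b < 1 * (2 * pi)"
    proof -
      have "t * (a + b) < 1 * (a + b)" using t a assms(5) by (intro mult_strict_right_mono) auto
      then show ?thesis using ab by (simp add: distrib_left)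
    qed
    then have i: "t * b > 0" "t * a > t * b" "t * a + t * b < 2 * pi" "t * a > 0" using t a assms by simp_all
    note I = interior_identity[OF assms(1-4) i(1-3)]
    have "?l t = of_real (F_hat_1 \<alpha> \<mu> \<nu> (t * a) (t * b)) +
        (\<Sum>m. of_real (product_coeff \<mu> \<nu> (t * a) (t * b) m) * riemann_zeta (of_real (?\<theta> - real (2 * m))))"
      using I(1) unfolding bessel_mellin_sum[OF i(4) assms(2) \<theta> I(2)] by (simp only: w_def bessel_product_scale)
    also have "\<dots> = ?r t"
    proof -
      have "t > 0" using t by simp
      show ?thesis unfolding F_hat_1_scale[OF \<open>t > 0\<close> a] product_coeff_scale c_def by (simp only: of_real_mult mult_ac)
    qed
    finally show ?thesis .
  qed
  have "continuous_on {1/2..1} ?l"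
  proof -
    obtain C where C: "C \<ge> 0" "\<And>x. x > 0 \<Longrightarrow> \<bar>bessel_product \<mu> \<nu> a b x\<bar> \<le> C * x powr (- \<mu> - \<nu> - 1)"
      using bessel_product_decay[OF assms(1,2) a assms(5)] by blast
    define M where "M = C * (1 / 2) powr (- \<mu> - \<nu> - 1)"
    have "uniform_limit {1/2..1} (\<lambda>N t. \<Sum>n<N. w n t) (\<lambda>t. \<Sum>n. w n t) sequentially"
    proof (rule Weierstrass_m_test)
      show "summable (\<lambda>n. M * real (Suc n) powr (- \<alpha> - 1))"
        by (intro summable_mult summable_Suc_powr assms)
      fix n :: nat and t :: real assume t: "t \<in> {1/2..1}"
      let ?x = "real (Suc n)"
      have tx: "t * ?x > 0" using t by simp
      have "norm (w n t) \<le> ?x powr (- ?\<theta>) * (C * (t * ?x) powr (- \<mu> - \<nu> - 1))"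
        unfolding w_def real_norm_def abs_mult using C(2)[OF tx] by (intro mult_mono) auto
      also have "(t * ?x) powr (- \<mu> - \<nu> - 1) = t powr (- \<mu> - \<nu> - 1) * ?x powr (- \<mu> - \<nu> - 1)"
        by (rule powr_mult)
      also have "?x powr (- ?\<theta>) * (C * (t powr (- \<mu> - \<nu> - 1) * ?x powr (- \<mu> - \<nu> - 1))) =
          C * t powr (- \<mu> - \<nu> - 1) * (?x powr (- ?\<theta>) * ?x powr (- \<mu> - \<nu> - 1))" by (simp only: mult_ac)
      also have "?x powr (- ?\<theta>) * ?x powr (- \<mu> - \<nu> - 1) = ?x powr (- \<alpha> - 1)"
      proof -
        have "- ?\<theta> + (- \<mu> - \<nu> - 1) = - \<alpha> - 1" by simp
        then show ?thesis by (simp only: powr_add[symmetric])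
      qed
      also have "C * t powr (- \<mu> - \<nu> - 1) * ?x powr (- \<alpha> - 1) \<le> M * ?x powr (- \<alpha> - 1)"
        unfolding M_def using C(1) t assms(1,2) by (intro mult_right_mono mult_left_mono powr_mono2') auto
      finally show "norm (w n t) \<le> M * ?x powr (- \<alpha> - 1)" .
    qed
    moreover have "continuous_on {1/2..1} (w n)" for n
    proof -
      have e: "continuous_on UNIV (bessel_entire \<sigma>)" if "\<sigma> \<ge> 0" for \<sigma>
        using bessel_entire_isCont[OF that] by (simp add: continuous_on_eq_continuous_at)
      show ?thesis unfolding w_def bessel_product_def
        by (intro continuous_intros continuous_on_compose2[OF e[OF assms(1)]] continuous_on_compose2[OF e[OF assms(2)]]) auto
    qed
    ultimately have "continuous_on {1/2..1} (\<lambda>t. \<Sum>n. w n t)"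
      by (intro uniform_limit_theorem[rotated]) (auto intro!: always_eventually continuous_on_sum)
    then show ?thesis by (intro continuous_on_of_real)
  qed
  moreover have "continuous_on {1/2..1} ?r"
  proof -
    obtain K where K: "\<And>m. norm (c m) \<le> K * real (Suc m) powr (- \<alpha> - 1)"
      using zeta_series_bound[OF assms(1,2) a assms(5) ab \<theta>] unfolding c_def by blast
    have "uniform_limit {1/2..1} (\<lambda>N t. \<Sum>m<N. c m * of_real (t ^ (2 * m))) (\<lambda>t. \<Sum>m. c m * of_real (t ^ (2 * m))) sequentially"
    proof (rule Weierstrass_m_test)
      show "summable (\<lambda>m. K * real (Suc m) powr (- \<alpha> - 1))"
        by (intro summable_mult summable_Suc_powr assms)
      fix m :: nat and t :: real assume t: "t \<in> {1/2..1}"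
      have "norm (c m * of_real (t ^ (2 * m))) = norm (c m) * t ^ (2 * m)"
        unfolding norm_mult norm_of_real using t by simp
      also have "\<dots> \<le> norm (c m) * 1" using t by (intro mult_left_mono power_le_one) auto
      finally show "norm (c m * of_real (t ^ (2 * m))) \<le> K * real (Suc m) powr (- \<alpha> - 1)" using K[of m] by simp
    qed
    then have "continuous_on {1/2..1} (\<lambda>t. \<Sum>m. c m * of_real (t ^ (2 * m)))"
      by (rule uniform_limit_theorem[rotated]) (auto intro!: always_eventually continuous_intros)
    then show ?thesis by (intro continuous_intros) auto
  qed
  moreover have "(f \<longlongrightarrow> f 1) (at_left 1)" if "continuous_on {1/2..1} f" for f :: "real \<Rightarrow> complex"
    using that at_within_Icc_at_left[of "1/2" "1::real"] by (auto simp: continuous_on_def dest: bspec[of _ _ 1])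
  ultimately have l: "(?l \<longlongrightarrow> ?l 1) (at_left 1)" and r: "(?r \<longlongrightarrow> ?r 1) (at_left 1)" by blast+
  have "\<forall>\<^sub>F t in at_left 1. ?l t = ?r t"
    using eventually_at_left_real[of "1/2" "1::real"] by (rule eventually_mono) (use eq in auto)
  with l have "(?r \<longlongrightarrow> ?l 1) (at_left 1)" by (rule Lim_transform_eventually)
  from tendsto_unique[OF _ this r] have "?l 1 = ?r 1" by simp
  then show ?thesis by (simp add: w_def c_def del: of_nat_Suc)
qed

lemma schloemilch_term_eq:
  assumes "a > 0" "b > 0"
  shows "schloemilch_term \<alpha> \<mu> \<nu> a b n = (a powr \<mu> * b powr \<nu> / 2 powr (\<mu> + \<nu>)) *
    (real (Suc n) powr (- (\<alpha> - \<mu> - \<nu>)) * bessel_product \<mu> \<nu> a b (real (Suc n)))"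
proof -
  let ?x = "real (Suc n)"
  have x: "?x > 0" by simp
  have p: "(?x * y / 2) powr \<sigma> = ?x powr \<sigma> * y powr \<sigma> / 2 powr \<sigma>" if "y > 0" for y \<sigma>
    using that by (simp add: powr_divide powr_mult del: of_nat_Suc)
  have "?x powr (- (\<alpha> - \<mu> - \<nu>)) = ?x powr \<mu> * ?x powr \<nu> / ?x powr \<alpha>"
  proof -
    have "- (\<alpha> - \<mu> - \<nu>) = \<mu> + \<nu> - \<alpha>" by simp
    then show ?thesis by (simp only: powr_add powr_diff)
  qed
  moreover have "2 powr (\<mu> + \<nu>) = 2 powr \<mu> * (2 powr \<nu> :: real)" by (rule powr_add)
  ultimately show ?thesis
    unfolding schloemilch_term_def bessel_J_eq p[OF assms(1)] p[OF assms(2)] bessel_product_def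
    by (simp add: mult_ac del: of_nat_Suc)
qed

theorem theorem3:
  fixes \<alpha> \<mu> \<nu> a b :: real
  assumes "\<mu> \<ge> 0" and "\<nu> \<ge> 0" and "\<alpha> > 0"
    and "\<alpha> - \<mu> - \<nu> \<notin> \<int>"
    and "b > 0" and "a > b"
    and "0 < a + b" and "a + b \<le> 2 * pi"
  shows "summable (schloemilch_term \<alpha> \<mu> \<nu> a b) \<and>
    summable (\<lambda>m. B_coeff \<alpha> \<mu> \<nu> a b m * of_real ((a / 2) ^ (2 * m))) \<and>
    complex_of_real (schloemilch_sum \<alpha> \<mu> \<nu> a b) =
      of_real (F_hat_1 \<alpha> \<mu> \<nu> a b) +
      of_real (rGamma (1 + \<nu>)) * (\<Sum>m. B_coeff \<alpha> \<mu> \<nu> a b m * of_real ((a / 2) ^ (2 * m)))"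
proof -
  have a: "a > 0" using assms by simp
  define w where "w = (\<lambda>n. real (Suc n) powr (- (\<alpha> - \<mu> - \<nu>)) * bessel_product \<mu> \<nu> a b (real (Suc n)))"
  define K where "K = a powr \<mu> * b powr \<nu> / 2 powr (\<mu> + \<nu>)"
  define t where "t = (\<lambda>m. B_coeff \<alpha> \<mu> \<nu> a b m * of_real ((a / 2) ^ (2 * m)))"
  define g where "g = complex_of_real (rGamma (1 + \<nu>))"
  have terms: "schloemilch_term \<alpha> \<mu> \<nu> a b = (\<lambda>n. K * w n)"
    unfolding K_def w_def by (rule ext) (rule schloemilch_term_eq[OF a assms(5)])
  have w: "summable w"
    using weighted_product_summable[OF assms(1,2) a assms(5,3)] unfolding w_def by (rule summable_rabs_cancel)
  have sum: "schloemilch_sum \<alpha> \<mu> \<nu> a b = suminf w"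
    unfolding schloemilch_sum_def terms suminf_mult[OF w] using a assms(5) by (simp add: K_def)
  have gt: "g * t m = of_real (product_coeff \<mu> \<nu> a b m) * riemann_zeta (of_real (\<alpha> - \<mu> - \<nu> - real (2 * m)))" for m
    unfolding g_def t_def by (rule B_coeff_product_coeff[OF assms(1,2) a])
  have "Gamma (1 + \<nu>) > 0" by (rule Gamma_real_pos) (use assms in simp)
  then have g: "g \<noteq> 0" by (simp add: g_def rGamma_inverse_Gamma)
  obtain C where C: "\<And>m. norm (g * t m) \<le> C * real (Suc m) powr (- \<alpha> - 1)"
    using zeta_series_bound[OF assms(1,2) a assms(5,8,4)] unfolding gt by blast
  have "summable (\<lambda>m. g * t m)"
    by (rule summable_comparison_test'[OF summable_mult[OF summable_Suc_powr[OF assms(3)]], of 0]) (rule C)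
  then have t: "summable t" using g by simp
  have "complex_of_real (schloemilch_sum \<alpha> \<mu> \<nu> a b) = of_real (F_hat_1 \<alpha> \<mu> \<nu> a b) + g * suminf t"
    unfolding sum suminf_mult[OF t, symmetric] gt w_def by (rule closed_identity[OF assms(1-6,8)])
  then show ?thesis using t summable_mult[OF w, of K] unfolding terms t_def g_def by blast
qed

end
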